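(* Let $(s_{0,0},\ldots,s_{0,m})=\mathcal N(\sigma_0,\ldots,\sigma_m)$ be a Nikishin system and let $\Lambda\subset\mathbb Z_+^{m+1}$ be an infinite sequence of distinct multi-indices. Assume that there exist constants $c>0$, $\kappa<1$, such that for all $\mathbf n=(n_0,\ldots,n_m)\in\Lambda$ $$n_j\ge\frac{|\mathbf n|}{m+1}-c|\mathbf n|^\kappa,\qquad j=0,\ldots,m.$$ Then, for each $k=0,\ldots,m$, $$\lim_{\mathbf n\in\Lambda}\frac{P_{\mathbf n,k}}{Q_{\mathbf n}}=\widehat s_{0,k}$$ uniformly on each compact subset $\mathcal K$ of $\overline{\mathbb C}\setminus\mathrm{Co}(\mathrm{supp}\,\sigma_0)$. Moreover, for each such compact set $\mathcal K$, $$\limsup_{\mathbf n\in\Lambda}\Bigl\|\widehat s_{0,k}-\frac{P_{\mathbf n,k}}{Q_{\mathbf n}}\Bigr\|_{\mathcal K}^{1/(2|\mathbf n|)}\le\delta_{\mathcal K}<1,\qquad k=0,\ldots,m,$$ where $\|\cdot\|_{\mathcal K}$ denotes the uniform norm on $\mathcal K$, $$\delta_{\mathcal K}=\max\{|\varphi_t(z)|:z\in\mathcal K,\ t\in\mathrm{Co}(\mathrm{supp}\,\sigma_1)\cup\{\infty\}\},$$ and $\varphi_t$ is the conformal representation of $\overline{\mathbb C}\setminus\mathrm{Co}(\mathrm{supp}\,\sigma_0)$ onto the open unit disk with $\varphi_t(t)=0$, $\varphi_t'(t)>0$.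
   Context: For a bounded interval $\Delta\subset\mathbb R$, $\mathcal M(\Delta)$ is the class of finite Borel measures $s$ of constant sign on $\mathbb R$ whose support is compact and infinite and such that $\Delta=\mathrm{Co}(\mathrm{supp}\,s)$ (convex hull). $\widehat s(z)=\int\frac{ds(x)}{z-x}$. If $\Delta_\alpha\cap\Delta_\beta=\emptyset$, $\sigma_\alpha\in\mathcal M(\Delta_\alpha)$, $\sigma_\beta\in\mathcal M(\Delta_\beta)$, then $d\langle\sigma_\alpha,\sigma_\beta\rangle(x)=\widehat\sigma_\beta(x)\,d\sigma_\alpha(x)$. Nikishin system: given $\sigma_j\in\mathcal M(\Delta_j)$, $j=0,\ldots,m$, with $\Delta_j\cap\Delta_{j+1}=\emptyset$, put $s_{j,j}=\sigma_j$, $s_{j,k}=\langle\sigma_j,\langle\sigma_{j+1},\ldots,\sigma_k\rangle\rangle$ for $j<k$; $\mathcal N(\sigma_0,\ldots,\sigma_m)=(s_{0,0},\ldots,s_{0,m})$. Type II approximation: for $\mathbf n\in\mathbb Z_+^{m+1}$, $|\mathbf n|=n_0+\cdots+n_m$, $Q_{\mathbf n}$ is a polynomial, not identically zero, $\deg Q_{\mathbf n}\le|\mathbf n|$, such that for some polynomials $P_{\mathbf n,k}$, $Q_{\mathbf n}(z)\widehat s_{0,k}(z)-P_{\mathbf n,k}(z)=\mathcal O(1/z^{n_k+1})$, $z\to\infty$, $k=0,\ldots,m$. ($Q_{\mathbf n}$ is unique up to a constant factor, so the fractions $P_{\mathbf n,k}/Q_{\mathbf n}$ are well defined.) For $t=\infty$,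 $\varphi_\infty'(\infty)>0$ is understood as usual, $\lim_{z\to\infty}z\varphi_\infty(z)>0$. If $m=0$, $\mathrm{Co}(\mathrm{supp}\,\sigma_1)$ is read as $\emptyset$. *)

theory Defs
  imports "HOL-Complex_Analysis.Complex_Analysis" "HOL-Library.Landau_Symbols"
begin

section \<open>Finite Borel measures of constant sign\<close>

text \<open>A signed measure is encoded by its set function \<open>s :: real set \<Rightarrow> real\<close>; only the values
  of \<open>s\<close> on Borel sets matter.\<close>

definition const_sign_measure :: "(real set \<Rightarrow> real) \<Rightarrow> bool" where
  "const_sign_measure s \<longleftrightarrow>
     (\<exists>\<mu> e. finite_measure \<mu> \<and> sets \<mu> = sets borel \<and> e \<in> {1, - 1 :: real} \<and>
            (\<forall>A \<in> sets borel. s A = e * measure \<mu> A))"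

definition variation :: "(real set \<Rightarrow> real) \<Rightarrow> real measure" where
  "variation s = measure_of UNIV (sets borel) (\<lambda>A. ennreal \<bar>s A\<bar>)"

text \<open>The integral \<open>\<integral>f ds\<close>. As \<open>s\<close> has constant sign, that sign is the sign of its total mass.\<close>

definition sint :: "(real set \<Rightarrow> real) \<Rightarrow> (real \<Rightarrow> 'a::{banach, second_countable_topology}) \<Rightarrow> 'a" where
  "sint s f = sgn (s UNIV) *\<^sub>R integral\<^sup>L (variation s) f"

definition supp :: "(real set \<Rightarrow> real) \<Rightarrow> real set" where
  "supp s = {x. \<forall>U. open U \<and> x \<in> U \<longrightarrow> s U \<noteq> 0}"

definition meas_class :: "real set \<Rightarrow> (real set \<Rightarrow> real) set" where
  "meas_class \<Delta> = {s. const_sign_measure s \<and> compact (supp s) \<and> infinite (supp s) \<and>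
                       \<Delta> = convex hull (supp s)}"

section \<open>Nikishin systems\<close>

text \<open>Polymorphic, so that the transform can be evaluated at real points (as the density of a product)
  as well as at complex ones.\<close>

definition cauchy_transform ::
    "(real set \<Rightarrow> real) \<Rightarrow> 'a \<Rightarrow> 'a::{banach, real_normed_field, second_countable_topology}" where
  "cauchy_transform s z = sint s (\<lambda>x. 1 / (z - of_real x))"

definition meas_prod :: "(real set \<Rightarrow> real) \<Rightarrow> (real set \<Rightarrow> real) \<Rightarrow> real set \<Rightarrow> real" where
  "meas_prod \<sigma>\<^sub>a \<sigma>\<^sub>b = (\<lambda>A. sint \<sigma>\<^sub>a (\<lambda>x. indicator A x * cauchy_transform \<sigma>\<^sub>b x))"

text \<open>\<open>nikishin \<sigma> j k\<close> is the measure $s_{j,k}$, for $j \le k$.\<close>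

function nikishin :: "(nat \<Rightarrow> real set \<Rightarrow> real) \<Rightarrow> nat \<Rightarrow> nat \<Rightarrow> real set \<Rightarrow> real" where
  "nikishin \<sigma> j k = (if j < k then meas_prod (\<sigma> j) (nikishin \<sigma> (Suc j) k) else \<sigma> j)"
  by pat_completeness auto
termination
  by (relation "Wellfounded.measure (\<lambda>(\<sigma>, j, k). k - j)") auto

declare nikishin.simps [simp del]

definition nikishin_generators :: "nat \<Rightarrow> (nat \<Rightarrow> real set) \<Rightarrow> (nat \<Rightarrow> real set \<Rightarrow> real) \<Rightarrow> bool" where
  "nikishin_generators m \<Delta> \<sigma> \<longleftrightarrow>
     (\<forall>j\<le>m. \<sigma> j \<in> meas_class (\<Delta> j)) \<and> (\<forall>j<m. \<Delta> j \<inter> \<Delta> (Suc j) = {})"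

section \<open>Type II approximation\<close>

text \<open>A multi-index in $\mathbb{Z}_+^{m+1}$ is a list of length $m+1$; \<open>s k\<close> is the \<open>k\<close>-th
  measure of the system, \<open>P k\<close> the numerator belonging to it.\<close>

definition type_II_approximant ::
    "nat \<Rightarrow> (nat \<Rightarrow> real set \<Rightarrow> real) \<Rightarrow> nat list \<Rightarrow> complex poly \<Rightarrow> (nat \<Rightarrow> complex poly) \<Rightarrow> bool" where
  "type_II_approximant m s n Q P \<longleftrightarrow>
     Q \<noteq> 0 \<and> degree Q \<le> sum_list n \<and>
     (\<forall>k\<le>m. (\<lambda>z. poly Q z * cauchy_transform (s k) z - poly (P k) z)
               \<in> O[at_infinity](\<lambda>z. 1 / z ^ (n ! k + 1)))"

section \<open>The Riemann sphere\<close>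

text \<open>\<open>None\<close> is the point at infinity.\<close>

definition riemann_sphere :: "complex option topology" where
  "riemann_sphere = Alexandroff_compactification euclidean"

definition real_embed :: "real set \<Rightarrow> complex option set" where
  "real_embed A = (\<lambda>x. Some (complex_of_real x)) ` A"

text \<open>Extension to infinity by the limit there.\<close>

definition sphere_ext :: "(complex \<Rightarrow> complex) \<Rightarrow> complex option \<Rightarrow> complex" where
  "sphere_ext f p = (case p of None \<Rightarrow> Lim at_infinity f | Some z \<Rightarrow> f z)"

definition unif_norm :: "complex option set \<Rightarrow> (complex option \<Rightarrow> complex) \<Rightarrow> real" where
  "unif_norm K f = (SUP p\<in>K. norm (f p))"

definition chart_at_infinity :: "complex \<Rightarrow> complex option" where
  "chart_at_infinity w = (if w = 0 then None else Some (1 / w))"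

text \<open>Meant for \<open>D\<close> open in the sphere; the two charts cover the sphere.\<close>

definition sphere_holomorphic_on :: "(complex option \<Rightarrow> complex) \<Rightarrow> complex option set \<Rightarrow> bool" where
  "sphere_holomorphic_on f D \<longleftrightarrow>
     (f \<circ> Some) holomorphic_on (Some -` D) \<and>
     (f \<circ> chart_at_infinity) holomorphic_on (chart_at_infinity -` D)"

text \<open>Positivity of the derivative at infinity means $\lim_{z\to\infty} z\,\varphi(z) > 0$.\<close>

definition conformal_representation ::
    "complex option set \<Rightarrow> complex option \<Rightarrow> (complex option \<Rightarrow> complex) \<Rightarrow> bool" where
  "conformal_representation D t \<phi> \<longleftrightarrow>
     sphere_holomorphic_on \<phi> D \<and> bij_betw \<phi> D (ball 0 1) \<and> \<phi> t = 0 \<and>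
     (\<exists>r>0. case t of
        None \<Rightarrow> ((\<lambda>z. z * \<phi> (Some z)) \<longlongrightarrow> complex_of_real r) at_infinity
      | Some a \<Rightarrow> ((\<lambda>z. \<phi> (Some z)) has_field_derivative complex_of_real r) (at a))"

text \<open>The normalization points \<open>t\<close>: for \<open>m = 0\<close> there is no \<open>\<Delta> 1\<close> and only infinity remains.\<close>

definition norm_points :: "nat \<Rightarrow> (nat \<Rightarrow> real set) \<Rightarrow> complex option set" where
  "norm_points m \<Delta> = (if m = 0 then {} else real_embed (\<Delta> 1)) \<union> {None}"

end

theory Submission
  imports Defs "HOL-Probability.Probability"
begin

text \<open>Ratios of minors of the triangular matrix of the Cauchy transforms form a family that is closed under
  passing from $\mathcal N(\sigma_{r+1},\dots,\sigma_m)$ to $\mathcal N(\sigma_r,\dots,\sigma_m)$: in each column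
  the ratios are Cauchy transforms of one measure on the next interval up to linear terms, because the
  reciprocal of a Markov function is again of this kind. By induction, linear forms in these functions with
  polynomial coefficients form Chebyshev systems for arbitrary multi-indices. Hence $Q_{\mathbf n}$ has
  $|\mathbf n|$ simple zeros in $\mathrm{Co}(\mathrm{supp}\,\sigma_0)$, and the remainder
  $Q_{\mathbf n}\widehat s_{0,k}-P_{\mathbf n,k}$ vanishes at almost $|\mathbf n|-n_k$ points of
  $\mathrm{Co}(\mathrm{supp}\,\sigma_1)$. The approximation is thus a multipoint Pad\'e approximation with a
  deficiency $s = o(|\mathbf n|)$ in the number of interpolation conditions; quadrature formulas with at most
  $s/2$ weights of the wrong sign bound the error off the support by $C D^s$. Pulled back to the disc by
  the Joukowski map and divided by its $2|\mathbf n| - s$ zeros, the error obeys the maximum principle,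
  which gives the rate.\<close>

text \<open>The obstacle is the arbitrary order of the components of a multi-index. For
  nonincreasing components, elimination can start with the first function and stays within Nikishin
  systems. In general the divisor has to be the function whose coefficient has the largest degree,
  quotients outside the given system appear, and repeated elimination produces exactly the ratios of
  minors. They are therefore studied together, for all column sets at once. Ratios are handled in
  the upper half-plane; their real values off the cuts enter as limits from above, which avoids
  keeping track of domains. The deficiency has the same origin: a ratio may carry a term linear in
  z, so that the remainder with index k is tested on the second interval only by polynomials of
  degree below \<open>min (n ! j) (n ! k - 1)\<close>. The balance hypothesis bounds the loss by a
  multiple of |n|^\<kappa> plus a constant. The exponent 2|n| counts a zero of order |n| + n_k + 1
  at infinity and |n| - n_k - s zeros on the second interval.\<close>

lemma poly_of_real_add: "poly (map_poly of_real (p + q)) z = poly (map_poly of_real p) z + poly (map_poly of_real q) (z :: 'a :: real_field)"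
  by (induction p q rule: poly_induct2) (simp_all add: map_poly_pCons algebra_simps)

lemma poly_of_real_smult: "poly (map_poly of_real (smult a p)) z = of_real a * poly (map_poly of_real p) (z :: 'a :: real_field)"
  by (induction p) (simp_all add: map_poly_pCons algebra_simps)

lemma poly_of_real_mult: "poly (map_poly of_real (p * q)) z = poly (map_poly of_real p) z * poly (map_poly of_real q) (z :: 'a :: real_field)"
  by (induction p) (simp_all add: map_poly_pCons poly_of_real_add poly_of_real_smult algebra_simps)

lemma poly_of_real_eq: "poly (map_poly of_real p) (of_real x) = (of_real (poly p x) :: 'a :: real_field)"
  by (induction p) (simp_all add: map_poly_pCons)

lemmas poly_of_real_simps = poly_of_real_add poly_of_real_smult poly_of_real_mult poly_of_real_eq

lemma map_poly_of_real_eq_0_iff: "map_poly of_real p = (0 :: 'a :: real_field poly) \<longleftrightarrow> p = 0"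
  by (rule map_poly_eq_0_iff) auto

section \<open>Measures on a compact set, densities and Cauchy transforms\<close>

definition measure_on :: "real set \<Rightarrow> real measure \<Rightarrow> bool" where
  "measure_on D M \<longleftrightarrow> finite_measure M \<and> sets M = sets borel \<and> (AE x in M. x \<in> D)"

text \<open>The measure-theoretic form of an infinite support: it is what makes integrals of
  nonnegative functions with finitely many zeros strictly positive.\<close>

definition nondegenerate_on :: "real set \<Rightarrow> real measure \<Rightarrow> bool" where
  "nondegenerate_on D M \<longleftrightarrow> measure_on D M \<and> (\<forall>F. finite F \<longrightarrow> \<not> (AE x in M. x \<in> F))"

lemma nondegenerate_onD: "nondegenerate_on D M \<Longrightarrow> measure_on D M"
  by (simp add: nondegenerate_on_def)

text \<open>Measurability is global, so that densities can be divided by polynomials and multiplied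
  by Cauchy transforms under total division. Continuity, and with it boundedness, is asked only on
  the set that carries the measure.\<close>

definition density_on :: "real set \<Rightarrow> (real \<Rightarrow> real) \<Rightarrow> bool" where
  "density_on D \<rho> \<longleftrightarrow> \<rho> \<in> borel_measurable borel \<and> continuous_on D \<rho>"

text \<open>Measure and density are kept apart because the functions of one column share the measure
  and are compared through quotients of their densities. Arguments may be real or complex: real
  values serve as factors of new densities.\<close>

definition ct :: "real measure \<Rightarrow> (real \<Rightarrow> real) \<Rightarrow> 'a \<Rightarrow> 'a::{banach, real_normed_field, second_countable_topology}" where
  "ct M \<rho> z = (\<integral>x. of_real (\<rho> x) / (z - of_real x) \<partial>M)"

lemma density_on_intros [intro]:
  "density_on D (\<lambda>_. c)"
  "density_on D (\<lambda>x. x)"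
  "density_on D f \<Longrightarrow> density_on D g \<Longrightarrow> density_on D (\<lambda>x. f x + g x)"
  "density_on D f \<Longrightarrow> density_on D g \<Longrightarrow> density_on D (\<lambda>x. f x - g x)"
  "density_on D f \<Longrightarrow> density_on D g \<Longrightarrow> density_on D (\<lambda>x. f x * g x)"
  "density_on D f \<Longrightarrow> density_on D (\<lambda>x. - f x)"
  unfolding density_on_def by (auto intro!: continuous_intros)

lemma density_on_cmult: "density_on D f \<Longrightarrow> density_on D (\<lambda>x. c * f x)"
  by (rule density_on_intros(5)[OF density_on_intros(1)])

lemma density_on_poly [intro]: "density_on D (poly p)"
  unfolding density_on_def by (auto intro!: continuous_intros borel_measurable_continuous_onI)

context
  fixes D :: "real set" and M :: "real measure"
  assumes M: "measure_on D M" and D: "compact D"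
begin

lemma nd_sets [measurable_cong]: "sets M = sets borel"
  using M by (simp add: measure_on_def)

lemma nd_space: "space M = UNIV"
  using sets_eq_imp_space_eq[OF nd_sets] by simp

lemma nd_finite: "finite_measure M"
  using M by (simp add: measure_on_def)

lemma nd_AE: "AE x in M. x \<in> D"
  using M by (simp add: measure_on_def)

lemma nd_integrable:
  fixes f :: "real \<Rightarrow> 'b::{banach, second_countable_topology}"
  assumes f: "f \<in> borel_measurable borel" and c: "continuous_on D f"
  shows "integrable M f"
proof -
  interpret finite_measure M by (rule nd_finite)
  obtain B where B: "\<And>x. x \<in> D \<Longrightarrow> norm (f x) \<le> B"
    using compact_imp_bounded[OF compact_continuous_image[OF c D]] unfolding bounded_iff by auto
  show ?thesis
    using f B nd_AE by (intro integrable_const_bound[where B=B]) (auto cong: measurable_cong_sets simp: nd_sets)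
qed

lemma nd_integral_bound:
  fixes f :: "real \<Rightarrow> 'b::{banach, second_countable_topology}"
  assumes B: "\<And>x. x \<in> D \<Longrightarrow> norm (f x) \<le> B" and B0: "0 \<le> B"
  shows "norm (integral\<^sup>L M f) \<le> B * measure M UNIV"
proof (cases "integrable M f")
  case True
  interpret finite_measure M by (rule nd_finite)
  have "norm (integral\<^sup>L M f) \<le> (\<integral>x. norm (f x) \<partial>M)" by simp
  also have "\<dots> \<le> (\<integral>x. B \<partial>M)"
    using True B nd_AE by (intro integral_mono_AE) auto
  finally show ?thesis by (simp add: nd_space mult.commute)
next
  case False
  then show ?thesis using B0 by (simp add: not_integrable_integral_eq)
qed

lemma nd_integral_cong:
  fixes f g :: "real \<Rightarrow> 'b::{banach, second_countable_topology}"
  assumes "\<And>x. x \<in> D \<Longrightarrow> f x = g x" "f \<in> borel_measurable borel" "g \<in> borel_measurable borel"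
  shows "integral\<^sup>L M f = integral\<^sup>L M g"
  using assms nd_AE by (intro integral_cong_AE) (auto cong: measurable_cong_sets simp: nd_sets)

text \<open>A vanishing integral would concentrate the measure on the finite zero set. This strict
  positivity is the source of the contradictions in the sign arguments below.\<close>

lemma nd_integral_pos:
  fixes f :: "real \<Rightarrow> real"
  assumes nd: "nondegenerate_on D M" and f: "f \<in> borel_measurable borel" and c: "continuous_on D f"
    and nn: "\<And>x. x \<in> D \<Longrightarrow> 0 \<le> f x" and fin: "finite {x \<in> D. f x = 0}"
  shows "0 < integral\<^sup>L M f"
proof -
  have i: "integrable M f" by (rule nd_integrable[OF f c])
  have nn': "AE x in M. 0 \<le> f x" using nd_AE by eventually_elim (use nn in auto)
  have "integral\<^sup>L M f \<ge> 0" by (rule integral_nonneg_AE[OF nn'])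
  moreover have "integral\<^sup>L M f \<noteq> 0"
  proof
    assume "integral\<^sup>L M f = 0"
    then have "AE x in M. f x = 0" using integral_nonneg_eq_0_iff_AE[OF i nn'] by simp
    with nd_AE have "AE x in M. x \<in> {x \<in> D. f x = 0}" by eventually_elim auto
    with fin nd show False unfolding nondegenerate_on_def by blast
  qed
  ultimately show ?thesis by simp
qed

lemma borel_measurable_ct_integrand:
  fixes z :: "'a::{banach, real_normed_field, second_countable_topology}"
  assumes "density_on D \<rho>"
  shows "(\<lambda>x. of_real (\<rho> x) / (z - of_real x)) \<in> borel_measurable borel"
proof -
  have [measurable]: "\<rho> \<in> borel_measurable borel" using assms by (simp add: density_on_def)
  show ?thesis by measurable
qed

lemma continuous_ct_integrand:
  fixes z :: "'a::{banach, real_normed_field, second_countable_topology}"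
  assumes "density_on D \<rho>" "z \<notin> of_real ` D"
  shows "continuous_on D (\<lambda>x. of_real (\<rho> x) / (z - of_real x))"
  using assms unfolding density_on_def by (auto intro!: continuous_intros)

lemma integrable_ct_integrand:
  fixes z :: "'a::{banach, real_normed_field, second_countable_topology}"
  assumes "density_on D \<rho>" "z \<notin> of_real ` D"
  shows "integrable M (\<lambda>x. of_real (\<rho> x) / (z - of_real x))"
  using borel_measurable_ct_integrand[OF assms(1)] continuous_ct_integrand[OF assms] by (rule nd_integrable)

lemma ct_add:
  fixes z :: "'a::{banach, real_normed_field, second_countable_topology}"
  assumes "density_on D f" "density_on D g" "z \<notin> of_real ` D"
  shows "ct M (\<lambda>x. f x + g x) z = ct M f z + ct M g z"
  using integrable_ct_integrand[OF assms(1,3)] integrable_ct_integrand[OF assms(2,3)]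
  unfolding ct_def by (simp add: add_divide_distrib)

lemma ct_cmult:
  fixes z :: "'a::{banach, real_normed_field, second_countable_topology}"
  shows "ct M (\<lambda>x. c * f x) z = of_real c * ct M f z"
  unfolding ct_def by (simp flip: integral_mult_right_zero)

lemma ct_minus:
  fixes z :: "'a::{banach, real_normed_field, second_countable_topology}"
  shows "ct M (\<lambda>x. - f x) z = - ct M f z"
  unfolding ct_def by simp

lemma ct_sum:
  fixes z :: "'a::{banach, real_normed_field, second_countable_topology}"
  assumes "finite I" "\<And>i. i \<in> I \<Longrightarrow> density_on D (f i)" "z \<notin> of_real ` D"
  shows "ct M (\<lambda>x. \<Sum>i\<in>I. f i x) z = (\<Sum>i\<in>I. ct M (f i) z)"
  unfolding ct_def of_real_sum sum_divide_distrib
  by (rule Bochner_Integration.integral_sum) (use assms integrable_ct_integrand in blast)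

lemma ct_cong:
  fixes z :: "'a::{banach, real_normed_field, second_countable_topology}"
  assumes "density_on D f" "density_on D g" "\<And>x. x \<in> D \<Longrightarrow> f x = g x"
  shows "ct M f z = ct M g z"
  unfolding ct_def using assms borel_measurable_ct_integrand
  by (intro nd_integral_cong) auto

lemma dist_pos:
  fixes w :: "'a::{banach, real_normed_field, second_countable_topology}"
  assumes "w \<notin> of_real ` D"
  obtains \<eta> where "\<eta> > 0" "\<And>x. x \<in> D \<Longrightarrow> \<eta> \<le> norm (w - of_real x)"
proof -
  have "open (- (of_real ` D) :: 'a set)"
    by (intro open_Compl compact_imp_closed compact_continuous_image D continuous_intros)
  then obtain \<eta> where "\<eta> > 0" "ball w \<eta> \<subseteq> - (of_real ` D)" using assms open_contains_ball by blast
  then show thesis by (intro that[of \<eta>]) (auto simp: subset_iff dist_norm not_less[symmetric])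
qed

lemma density_bound:
  assumes "density_on D f" obtains B where "B > 0" "\<And>x. x \<in> D \<Longrightarrow> \<bar>f x\<bar> \<le> B"
proof -
  obtain B where B: "\<And>x. x \<in> D \<Longrightarrow> norm (f x) \<le> B"
    using compact_imp_bounded[OF compact_continuous_image[OF _ D, of f]] assms
    unfolding bounded_iff density_on_def by auto
  show thesis by (rule that[of "\<bar>B\<bar> + 1"]) (use B in force)+
qed

text \<open>The difference quotient minus the candidate is z - w times the integral of f(x) / ((z -
  x) (w - x)^2), hence O(|z - w|). The same proof serves real and complex arguments.\<close>

lemma ct_has_field_derivative:
  fixes w :: "'a::{banach, real_normed_field, second_countable_topology}"
  assumes f: "density_on D f" and w: "w \<notin> of_real ` D"
  shows "(ct M f has_field_derivative (- (\<integral>x. of_real (f x) / (w - of_real x)\<^sup>2 \<partial>M))) (at w)"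
proof -
  obtain \<eta> where \<eta>: "\<eta> > 0" "\<And>x. x \<in> D \<Longrightarrow> \<eta> \<le> norm (w - of_real x)" using dist_pos[OF w] by blast
  obtain B where B: "B > 0" "\<And>x. x \<in> D \<Longrightarrow> \<bar>f x\<bar> \<le> B" using density_bound[OF f] by blast
  let ?d = "- (\<integral>x. of_real (f x) / (w - of_real x)\<^sup>2 \<partial>M)"
  \<comment> \<open>For |z - w| < \<eta> / 2 the factor z - x is at least \<eta> / 2 in modulus and
    w - x at least \<eta>, which gives the constant.\<close>
  let ?C = "2 * B / \<eta>^3 * measure M UNIV"
  have m: "f \<in> borel_measurable borel" and cf: "continuous_on D f" using f by (auto simp: density_on_def)
  have i2: "integrable M (\<lambda>x. of_real (f x) / (w - of_real x)\<^sup>2)"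
    using m cf w by (intro nd_integrable) (auto simp: divide_inverse intro!: continuous_intros)
  have key: "norm ((ct M f z - ct M f w) / (z - w) - ?d) \<le> ?C * norm (z - w)"
    if z: "z \<noteq> w" "norm (z - w) < \<eta> / 2" for z
  proof -
    have zx: "\<eta> / 2 \<le> norm (z - of_real x)" if "x \<in> D" for x
      using \<eta>(2)[OF that] z norm_triangle_ineq4[of "w - z" "of_real x - z"]
      by (simp add: norm_minus_commute)
    have zD: "z \<notin> of_real ` D" using zx \<eta>(1) by force
    have e: "(of_real (f x) / (z - of_real x) - of_real (f x) / (w - of_real x)) / (z - w)
         + of_real (f x) / (w - of_real x)\<^sup>2
         = (z - w) * (of_real (f x) / ((z - of_real x) * (w - of_real x)\<^sup>2))" if "x \<in> D" for x
    proof -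
      have 1: "z - of_real x \<noteq> 0" "w - of_real x \<noteq> 0" "z - w \<noteq> 0" using zx[OF that] \<eta>(2)[OF that] \<eta>(1) z by auto
      define p q where "p = z - of_real x" and "q = w - of_real x"
      have "z - w = p - q" by (simp add: p_def q_def)
      with 1 show ?thesis unfolding p_def[symmetric] q_def[symmetric]
        by (simp add: divide_simps) (simp add: algebra_simps power2_eq_square)
    qed
    have "(ct M f z - ct M f w) / (z - w) - ?d
        = (\<integral>x. (of_real (f x) / (z - of_real x) - of_real (f x) / (w - of_real x)) / (z - w)
           + of_real (f x) / (w - of_real x)\<^sup>2 \<partial>M)"
      unfolding ct_def using integrable_ct_integrand[OF f zD] integrable_ct_integrand[OF f w] i2 by simp
    also have "\<dots> = (\<integral>x. (z - w) * (of_real (f x) / ((z - of_real x) * (w - of_real x)\<^sup>2)) \<partial>M)"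
          proof (rule nd_integral_cong)
      have [measurable]: "f \<in> borel_measurable borel" by (rule m)
      show "(\<lambda>x. (of_real (f x) / (z - of_real x) - of_real (f x) / (w - of_real x)) / (z - w) + of_real (f x) / (w - of_real x)\<^sup>2) \<in> borel_measurable borel"
        "(\<lambda>x. (z - w) * (of_real (f x) / ((z - of_real x) * (w - of_real x)\<^sup>2))) \<in> borel_measurable borel"
        by measurable
    qed (use e in blast)
    finally have "norm ((ct M f z - ct M f w) / (z - w) - ?d)
       = norm (\<integral>x. (z - w) * (of_real (f x) / ((z - of_real x) * (w - of_real x)\<^sup>2)) \<partial>M)" by simp
    also have "\<dots> \<le> (norm (z - w) * (B / (\<eta> / 2 * \<eta>\<^sup>2))) * measure M UNIV"
    proof (rule nd_integral_bound)
      fix x assume x: "x \<in> D"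
      have "\<bar>f x\<bar> / (norm (z - of_real x) * (norm (w - of_real x))\<^sup>2) \<le> B / (\<eta> / 2 * \<eta>\<^sup>2)"
        using B(1) B(2)[OF x] zx[OF x] \<eta>(2)[OF x] \<eta>(1) by (intro frac_le mult_mono power_mono) auto
      then show "norm ((z - w) * (of_real (f x) / ((z - of_real x) * (w - of_real x)\<^sup>2)))
          \<le> norm (z - w) * (B / (\<eta> / 2 * \<eta>\<^sup>2))"
        unfolding norm_mult norm_divide norm_power norm_of_real by (rule mult_left_mono) simp
    qed (use B \<eta> in auto)
    also have "\<dots> = ?C * norm (z - w)" using \<eta>(1) by (simp add: field_simps power2_eq_square power3_eq_cube)
    finally show ?thesis .
  qed
  have "((\<lambda>z. (ct M f z - ct M f w) / (z - w) - ?d) \<longlongrightarrow> 0) (at w)"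
  proof (rule Lim_null_comparison)
    show "\<forall>\<^sub>F z in at w. norm ((ct M f z - ct M f w) / (z - w) - ?d) \<le> ?C * norm (z - w)"
      unfolding eventually_at using key \<eta>(1) by (intro exI[of _ "\<eta>/2"]) (auto simp: dist_norm)
    show "((\<lambda>z. ?C * norm (z - w)) \<longlongrightarrow> 0) (at w)" using \<eta>(1) by (auto intro!: tendsto_eq_intros)
  qed
  then show ?thesis unfolding has_field_derivative_iff using Lim_null by blast
qed

lemma closed_of_real_image: "closed (of_real ` D :: 'a::{banach, real_normed_field, second_countable_topology} set)"
  by (intro compact_imp_closed compact_continuous_image D continuous_intros)

lemma holomorphic_on_ct: "density_on D f \<Longrightarrow> ct M f holomorphic_on - (of_real ` D)"
  using ct_has_field_derivative by (subst holomorphic_on_open) (auto simp: closed_of_real_image open_Compl)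

lemma isCont_ct:
  fixes w :: "'a::{banach, real_normed_field, second_countable_topology}"
  shows "density_on D f \<Longrightarrow> w \<notin> of_real ` D \<Longrightarrow> isCont (ct M f) w"
  using ct_has_field_derivative DERIV_isCont by blast

lemma ct_cnj: "ct M f (cnj z) = cnj (ct M f z)"
proof -
  have "cnj (ct M f z) = (\<integral>x. cnj (of_real (f x) / (z - of_real x)) \<partial>M)"
    unfolding ct_def by (rule Bochner_Integration.integral_cnj[symmetric])
  then show ?thesis unfolding ct_def by simp
qed

lemma ct_of_real:
  fixes x :: real
  assumes "density_on D f" "x \<notin> D"
  shows "ct M f (of_real x :: complex) = of_real (ct M f x)"
  unfolding ct_def by (simp flip: integral_complex_of_real of_real_diff of_real_divide)

lemma ct_Complex_tendsto:
  assumes "density_on D f" "x \<notin> D"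
  shows "((\<lambda>\<epsilon>. ct M f (Complex x \<epsilon>)) \<longlongrightarrow> of_real (ct M f x)) (at_right 0)"
proof -
  have "isCont (ct M f) (of_real x :: complex)" using assms by (intro isCont_ct) auto
  moreover have "((\<lambda>\<epsilon>. Complex x \<epsilon>) \<longlongrightarrow> of_real x) (at_right 0)"
    unfolding complex_of_real_def by (intro tendsto_intros)
  ultimately show ?thesis using isCont_tendsto_compose ct_of_real[OF assms] by metis
qed

lemma borel_measurable_ct:
  assumes "density_on D f" shows "(ct M f :: real \<Rightarrow> real) \<in> borel_measurable borel"
proof -
  interpret finite_measure M by (rule nd_finite)
  have [measurable]: "f \<in> borel_measurable borel" using assms by (simp add: density_on_def)
  show ?thesis unfolding ct_def by measurable
qed

lemma density_on_ct:
  assumes "density_on D f" "D \<inter> E = {}" shows "density_on E (ct M f)"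
proof -
  have "isCont (ct M f) x" if "x \<in> E" for x :: real
    using that assms by (intro isCont_ct) auto
  then show ?thesis
    unfolding density_on_def using borel_measurable_ct[OF assms(1)] by (auto intro!: continuous_at_imp_continuous_on)
qed

text \<open>For real x the imaginary part of 1 / (z - x) is -Im z / |z - x|^2. The finitely many
  zeros of the density do not affect strictness.\<close>

lemma Im_ct_neg:
  assumes nd: "nondegenerate_on D M" and f: "density_on D f" and pos: "\<And>x. x \<in> D \<Longrightarrow> 0 \<le> f x"
    and fin: "finite {x \<in> D. f x = 0}" and z: "Im z > 0"
  shows "Im (ct M f z) < 0"
proof -
  have zD: "z \<notin> of_real ` D" using z by auto
  have "Im (ct M f z) = (\<integral>x. Im (of_real (f x) / (z - of_real x)) \<partial>M)"
    unfolding ct_def using integrable_ct_integrand[OF f zD] by simp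
  also have "\<dots> = - (\<integral>x. f x * Im z / (cmod (z - of_real x))\<^sup>2 \<partial>M)"
    by (simp flip: integral_minus add: Im_divide cmod_power2 Complex.Im_complex_div_eq_0)
  finally have e: "Im (ct M f z) = - (\<integral>x. f x * Im z / (cmod (z - of_real x))\<^sup>2 \<partial>M)" .
  have ne: "cmod (z - of_real x) \<noteq> 0" for x using z by auto
  have "0 < (\<integral>x. f x * Im z / (cmod (z - of_real x))\<^sup>2 \<partial>M)"
  proof (rule nd_integral_pos[OF nd])
    show "(\<lambda>x. f x * Im z / (cmod (z - complex_of_real x))\<^sup>2) \<in> borel_measurable borel"
    proof -
      have [measurable]: "f \<in> borel_measurable borel" using f by (simp add: density_on_def)
      show ?thesis by measurable
    qed
    show "continuous_on D (\<lambda>x. f x * Im z / (cmod (z - complex_of_real x))\<^sup>2)"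
      using f ne unfolding density_on_def by (auto intro!: continuous_intros)
    show "0 \<le> f x * Im z / (cmod (z - complex_of_real x))\<^sup>2" if "x \<in> D" for x
      using pos[OF that] z by (simp add: zero_le_mult_iff)
    have "{x \<in> D. f x * Im z / (cmod (z - complex_of_real x))\<^sup>2 = 0} \<subseteq> {x \<in> D. f x = 0}" using z ne by auto
    then show "finite {x \<in> D. f x * Im z / (cmod (z - complex_of_real x))\<^sup>2 = 0}" using fin by (rule finite_subset)
  qed
  with e show ?thesis by simp
qed

text \<open>The identity z / (z - x) = x / (z - x) + 1 under the integral. Iterating it moves
  polynomial factors into the density, and it also gives the first coefficient of the expansion at
  infinity.\<close>

lemma z_ct:
  fixes z :: "'a::{banach, real_normed_field, second_countable_topology}"
  assumes f: "density_on D f" and z: "z \<notin> of_real ` D"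
  shows "z * ct M f z = ct M (\<lambda>x. x * f x) z + of_real (integral\<^sup>L M f)"
proof -
  have fi: "integrable M f" using f by (intro nd_integrable) (auto simp: density_on_def)
  have xf: "density_on D (\<lambda>x. x * f x)" using f by auto
  have "z * ct M f z = (\<integral>x. z * (of_real (f x) / (z - of_real x)) \<partial>M)"
    unfolding ct_def by (rule integral_mult_right_zero[symmetric])
  also have "\<dots> = (\<integral>x. of_real (x * f x) / (z - of_real x) + of_real (f x) \<partial>M)"
  proof (rule nd_integral_cong)
    show "z * (of_real (f x) / (z - of_real x)) = of_real (x * f x) / (z - of_real x) + of_real (f x)" if "x \<in> D" for x
    proof -
      have "z - of_real x \<noteq> 0" using that z by auto
      then show ?thesis by (simp add: field_simps)
    qed
    have [measurable]: "f \<in> borel_measurable borel" using f by (simp add: density_on_def)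
    show "(\<lambda>x. z * (of_real (f x) / (z - of_real x))) \<in> borel_measurable borel"
      "(\<lambda>x. of_real (x * f x) / (z - of_real x) + of_real (f x)) \<in> borel_measurable borel"
      by measurable
  qed
  also have "\<dots> = ct M (\<lambda>x. x * f x) z + of_real (integral\<^sup>L M f)"
    unfolding ct_def using integrable_ct_integrand[OF xf z] fi by simp
  finally show ?thesis .
qed

lemma tendsto_ct_at_infinity:
  fixes f :: "real \<Rightarrow> real"
  assumes f: "density_on D f"
  shows "((ct M f :: 'a::{banach, real_normed_field, second_countable_topology} \<Rightarrow> 'a) \<longlongrightarrow> 0) at_infinity"
proof -
  obtain B where B: "B > 0" "\<And>x. x \<in> D \<Longrightarrow> \<bar>f x\<bar> \<le> B" using density_bound[OF f] by blast
  obtain L where L: "L > 0" "\<And>x. x \<in> D \<Longrightarrow> \<bar>x\<bar> \<le> L" using density_bound[of "\<lambda>x. x"] by blast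
  have b: "norm (ct M f z) \<le> B / (norm z - L) * measure M UNIV" if z: "norm z > L" for z :: 'a
    unfolding ct_def
  proof (rule nd_integral_bound)
    fix x assume x: "x \<in> D"
    have "norm z - L \<le> norm (z - of_real x)" using L(2)[OF x] norm_triangle_ineq2[of z "of_real x"] by simp
    then show "norm (of_real (f x) / (z - of_real x)) \<le> B / (norm z - L)"
      using B(2)[OF x] z B(1) unfolding norm_divide by (intro frac_le) auto
  qed (use B z in auto)
  show ?thesis
  proof (rule Lim_null_comparison)
    show "\<forall>\<^sub>F z in at_infinity. norm (ct M f z) \<le> B / (norm (z::'a) - L) * measure M UNIV"
      unfolding eventually_at_infinity using b by (intro exI[of _ "L + 1"]) auto
    have "((\<lambda>r. B / (r - L) * measure M UNIV) \<longlongrightarrow> 0) at_top" by real_asymp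
    then show "((\<lambda>z. B / (norm (z::'a) - L) * measure M UNIV) \<longlongrightarrow> 0) at_infinity"
      by (rule filterlim_compose) (rule filterlim_norm_at_top)
  qed
qed

lemma tendsto_z_ct_at_infinity:
  fixes f :: "real \<Rightarrow> real"
  assumes f: "density_on D f"
  shows "((\<lambda>z::'a::{banach, real_normed_field, second_countable_topology}. z * ct M f z) \<longlongrightarrow> of_real (integral\<^sup>L M f)) at_infinity"
proof -
  obtain L where L: "L > 0" "\<And>x. x \<in> D \<Longrightarrow> \<bar>x\<bar> \<le> L" using density_bound[of "\<lambda>x. x"] by blast
  have "((\<lambda>z::'a. ct M (\<lambda>x. x * f x) z + of_real (integral\<^sup>L M f)) \<longlongrightarrow> 0 + of_real (integral\<^sup>L M f)) at_infinity"
    using f by (intro tendsto_intros tendsto_ct_at_infinity) auto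
  moreover have "\<forall>\<^sub>F z::'a in at_infinity. ct M (\<lambda>x. x * f x) z + of_real (integral\<^sup>L M f) = z * ct M f z"
    unfolding eventually_at_infinity
  proof (intro exI[of _ "L + 1"] allI impI)
    fix z :: 'a assume "L + 1 \<le> norm z"
    then have "z \<notin> of_real ` D" using L by force
    then show "ct M (\<lambda>x. x * f x) z + of_real (integral\<^sup>L M f) = z * ct M f z" by (rule z_ct[OF f, symmetric])
  qed
  ultimately show ?thesis using Lim_transform_eventually by fastforce
qed

text \<open>Horner induction with \<open>z_ct\<close>. The degree bound on the polynomial correction
  is what later allows it to be absorbed into a coefficient without raising degrees.\<close>

lemma poly_ct:
  assumes f: "density_on D f"
  shows "\<exists>c. (degree c < degree p \<or> c = 0) \<and> (\<forall>z::'a::{banach, real_normed_field, second_countable_topology}. z \<notin> of_real ` D \<longrightarrow>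
     poly (map_poly of_real p) z * ct M f z = ct M (\<lambda>x. poly p x * f x) z + poly (map_poly of_real c) z)"
proof (induction p)
  case 0
  then show ?case by (intro exI[of _ 0]) (simp add: ct_def)
next
  case (pCons a p)
  then obtain c where c: "degree c < degree p \<or> c = 0"
    "\<And>z::'a. z \<notin> of_real ` D \<Longrightarrow> poly (map_poly of_real p) z * ct M f z = ct M (\<lambda>x. poly p x * f x) z + poly (map_poly of_real c) z" by blast
  have pf: "density_on D (\<lambda>x. poly p x * f x)" using f by auto
  have af: "density_on D (\<lambda>x. a * f x)" using f by auto
  have xpf: "density_on D (\<lambda>x. x * (poly p x * f x))" using pf by auto
  show ?case
  proof (intro exI[of _ "pCons (\<integral>x. poly p x * f x \<partial>M) c"] conjI allI impI)
    show "degree (pCons (\<integral>x. poly p x * f x \<partial>M) c) < degree (pCons a p) \<or> pCons (\<integral>x. poly p x * f x \<partial>M) c = 0"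
    proof (cases "p = 0")
      case True then show ?thesis using c by auto
    next
      case False then show ?thesis using c by (auto simp: degree_pCons_eq_if)
    qed
    fix z :: 'a assume z: "z \<notin> of_real ` D"
    have "poly (map_poly of_real (pCons a p)) z * ct M f z = of_real a * ct M f z + z * (poly (map_poly of_real p) z * ct M f z)"
      by (simp add: map_poly_pCons algebra_simps)
    also have "\<dots> = ct M (\<lambda>x. a * f x) z + (z * ct M (\<lambda>x. poly p x * f x) z + z * poly (map_poly of_real c) z)"
      unfolding c(2)[OF z] by (simp add: ct_cmult algebra_simps)
    also have "\<dots> = ct M (\<lambda>x. a * f x + x * (poly p x * f x)) z + poly (map_poly of_real (pCons (\<integral>x. poly p x * f x \<partial>M) c)) z"
      unfolding z_ct[OF pf z] ct_add[OF af xpf z] by (simp add: map_poly_pCons algebra_simps)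
    also have "(\<lambda>x. a * f x + x * (poly p x * f x)) = (\<lambda>x. poly (pCons a p) x * f x)" by (auto simp: algebra_simps)
    finally show "poly (map_poly of_real (pCons a p)) z * ct M f z =
       ct M (\<lambda>x. poly (pCons a p) x * f x) z + poly (map_poly of_real (pCons (\<integral>x. poly p x * f x \<partial>M) c)) z" .
  qed
qed

end

text \<open>Partial fractions under the double integral.\<close>

lemma ct_mult_ct:
  assumes M: "measure_on D M" "compact D" and N: "measure_on E N" "compact E"
    and DE: "D \<inter> E = {}" and f: "density_on D f" and g: "density_on E g"
    and z: "z \<notin> complex_of_real ` D" "z \<notin> complex_of_real ` E"
  shows "ct M f z * ct N g z = ct M (\<lambda>x. f x * ct N g x) z + ct N (\<lambda>y. g y * ct M f y) z"
proof -
  interpret M: finite_measure M using M by (simp add: measure_on_def)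
  interpret N: finite_measure N using N by (simp add: measure_on_def)
  interpret pair_sigma_finite M N ..
  note [measurable_cong] = nd_sets[OF M] nd_sets[OF N]
  have [measurable]: "f \<in> borel_measurable borel" "g \<in> borel_measurable borel" using f g by (auto simp: density_on_def)
  \<comment> \<open>Since 1 / ((z - x) (z - y)) = 1 / ((z - x) (x - y)) - 1 / ((z - y) (x - y)), the
    first term suffices: integrated over y first it gives one summand of the claim, over x first the
    product minus the other summand.\<close>
  let ?F = "\<lambda>x y. of_real (f x) / (z - of_real x) * (of_real (g y) / (of_real x - of_real y)) :: complex"
  have compDE: "compact (D \<times> E)" using M N by (simp add: compact_Times)
  have "continuous_on (D \<times> E) (\<lambda>(x, y). ?F x y)"
    unfolding split_beta using f g z DE
    by (auto intro!: continuous_intros continuous_on_compose2[of D f _ fst] continuous_on_compose2[of E g _ snd]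
        simp: density_on_def)
  from compact_imp_bounded[OF compact_continuous_image[OF this compDE]]
  obtain B0 where B0: "\<forall>w\<in>(\<lambda>(x, y). ?F x y) ` (D \<times> E). norm w \<le> B0" unfolding bounded_iff by blast
  define B where "B = \<bar>B0\<bar>"
  have B: "norm (?F x y) \<le> B" if "x \<in> D" "y \<in> E" for x y
  proof -
    have "norm (case (x, y) of (x, y) \<Rightarrow> ?F x y) \<le> B0" using B0 that by blast
    then show ?thesis unfolding B_def by simp
  qed
  have mF: "(\<lambda>(x, y). ?F x y) \<in> borel_measurable (M \<Otimes>\<^sub>M N)"
  proof -
    have [measurable]: "fst \<in> M \<Otimes>\<^sub>M N \<rightarrow>\<^sub>M borel" "snd \<in> M \<Otimes>\<^sub>M N \<rightarrow>\<^sub>M borel"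
      using measurable_fst[of M N] measurable_snd[of M N] nd_sets[OF M] nd_sets[OF N]
      by (auto cong: measurable_cong_sets)
    show ?thesis unfolding split_beta by measurable
  qed
  have mF1: "?F x \<in> borel_measurable N" for x
  proof -
    have "?F x \<in> borel_measurable borel" by measurable
    then show ?thesis using nd_sets[OF N] by (simp cong: measurable_cong_sets)
  qed
  have int: "integrable (M \<Otimes>\<^sub>M N) (\<lambda>(x, y). ?F x y)"
  proof (rule Fubini_integrable[OF mF])
    show "AE x in M. integrable N (\<lambda>y. case (x, y) of (x, y) \<Rightarrow> ?F x y)"
      using nd_AE[OF M]
    proof eventually_elim
      case (elim x)
      have "AE y in N. norm (?F x y) \<le> B" using nd_AE[OF N] by eventually_elim (use B[OF elim] in blast)
      then show ?case using mF1[of x] by (simp only: prod.case) (rule N.integrable_const_bound)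
    qed
    have b2: "AE x in M. norm (\<integral>y. norm (?F x y) \<partial>N) \<le> B * measure N UNIV"
      using nd_AE[OF M]
    proof eventually_elim
      case (elim x)
      show ?case by (rule nd_integral_bound[OF N]) (use B[OF elim] in \<open>auto simp: B_def\<close>)
    qed
    show "integrable M (\<lambda>x. \<integral>y. norm (case (x, y) of (x, y) \<Rightarrow> ?F x y) \<partial>N)"
      unfolding prod.case
    proof (rule M.integrable_const_bound)
      show "AE x in M. norm (\<integral>y. norm (?F x y) \<partial>N) \<le> B * measure N UNIV" by (rule b2)
      have "(\<lambda>(x, y). norm (?F x y)) \<in> borel_measurable (M \<Otimes>\<^sub>M N)"
        using measurable_compose[OF mF, of norm borel] by (simp add: split_beta)
      then show "(\<lambda>x. \<integral>y. norm (?F x y) \<partial>N) \<in> borel_measurable M"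
        by (rule N.borel_measurable_lebesgue_integral)
    qed
  qed
  have F: "(\<integral>y. (\<integral>x. ?F x y \<partial>M) \<partial>N) = (\<integral>x. (\<integral>y. ?F x y \<partial>N) \<partial>M)"
    by (rule Fubini_integral[OF int])
  have ne: "z - of_real x \<noteq> 0" if "x \<in> D" for x using that z by auto
  have ne2: "z - of_real y \<noteq> 0" if "y \<in> E" for y using that z by auto
  have c1: "(\<integral>x. ?F x y \<partial>M) = of_real (g y) / (z - of_real y) * (ct M f z - of_real (ct M f y))" if y: "y \<in> E" for y
  proof -
    have yD: "y \<notin> D" using y DE by auto
    then have yD': "complex_of_real y \<notin> of_real ` D" by auto
    have "(\<integral>x. ?F x y \<partial>M) = (\<integral>x. of_real (g y) / (z - of_real y) * (of_real (f x) / (z - of_real x) - of_real (f x) / (of_real y - of_real x)) \<partial>M)"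
    proof (rule nd_integral_cong[OF M])
      fix x assume x: "x \<in> D"
      have n: "complex_of_real x - of_real y \<noteq> 0" using x yD by auto
      define p q where "p = z - of_real x" and "q = z - complex_of_real y"
      have e: "complex_of_real x - of_real y = q - p" "complex_of_real y - of_real x = p - q" by (auto simp: p_def q_def)
      show "?F x y = of_real (g y) / (z - of_real y) * (of_real (f x) / (z - of_real x) - of_real (f x) / (of_real y - of_real x))"
        using ne[OF x] ne2[OF y] n unfolding e p_def[symmetric] q_def[symmetric]
        by (simp add: divide_simps) (simp add: algebra_simps)
    qed measurable
    also have "\<dots> = of_real (g y) / (z - of_real y) * (ct M f z - ct M f (of_real y))"
      using integrable_ct_integrand[OF M f z(1)] integrable_ct_integrand[OF M f yD']
      unfolding ct_def by simp
    also have "ct M f (complex_of_real y) = of_real (ct M f y)" using ct_of_real[OF M f yD] .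
    finally show ?thesis .
  qed
  have c2: "(\<integral>y. ?F x y \<partial>N) = of_real (f x) / (z - of_real x) * of_real (ct N g x)" if x: "x \<in> D" for x
  proof -
    have xE: "x \<notin> E" using x DE by auto
    have "(\<integral>y. ?F x y \<partial>N) = of_real (f x) / (z - of_real x) * ct N g (of_real x)"
      unfolding ct_def by (rule integral_mult_right_zero)
    then show ?thesis using ct_of_real[OF N g xE] by simp
  qed
  have mM: "h \<in> borel_measurable borel \<Longrightarrow> h \<in> borel_measurable M" for h :: "real \<Rightarrow> complex"
    using nd_sets[OF M] by (simp cong: measurable_cong_sets)
  have mN: "h \<in> borel_measurable borel \<Longrightarrow> h \<in> borel_measurable N" for h :: "real \<Rightarrow> complex"
    using nd_sets[OF N] by (simp cong: measurable_cong_sets)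
  have dfg: "density_on D (\<lambda>x. f x * ct N g x)" "density_on E (\<lambda>y. g y * ct M f y)"
    using f g density_on_ct[OF N g] density_on_ct[OF M f] DE by auto
  have [measurable]: "(ct N g :: real \<Rightarrow> real) \<in> borel_measurable borel" "(ct M f :: real \<Rightarrow> real) \<in> borel_measurable borel"
    using borel_measurable_ct[OF N g] borel_measurable_ct[OF M f] by auto
  have "(\<integral>x. (\<integral>y. ?F x y \<partial>N) \<partial>M) = ct M (\<lambda>x. f x * ct N g x) z"
    unfolding ct_def[of M]
  proof (rule integral_cong_AE)
    show "AE x in M. (\<integral>y. ?F x y \<partial>N) = of_real (f x * ct N g x) / (z - of_real x)"
      using nd_AE[OF M] by eventually_elim (simp only: c2, simp)
    show "(\<lambda>x. (\<integral>y. ?F x y \<partial>N)) \<in> borel_measurable M" by (rule N.borel_measurable_lebesgue_integral[OF mF])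
    show "(\<lambda>x. of_real (f x * ct N g x) / (z - of_real x)) \<in> borel_measurable M" by (rule mM) measurable
  qed
  moreover have "(\<integral>y. (\<integral>x. ?F x y \<partial>M) \<partial>N) = ct M f z * ct N g z - ct N (\<lambda>y. g y * ct M f y) z"
  proof -
    have "(\<integral>y. (\<integral>x. ?F x y \<partial>M) \<partial>N) = (\<integral>y. ct M f z * (of_real (g y) / (z - of_real y)) - of_real (g y * ct M f y) / (z - of_real y) \<partial>N)"
    proof (rule integral_cong_AE)
      show "AE y in N. (\<integral>x. ?F x y \<partial>M) = ct M f z * (of_real (g y) / (z - of_real y)) - of_real (g y * ct M f y) / (z - of_real y)"
        using nd_AE[OF N] by eventually_elim (simp only: c1, simp add: algebra_simps diff_divide_distrib)
      show "(\<lambda>y. (\<integral>x. ?F x y \<partial>M)) \<in> borel_measurable N"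
        using measurable_pair_swap[OF mF] by (intro M.borel_measurable_lebesgue_integral) simp
      show "(\<lambda>y. ct M f z * (of_real (g y) / (z - of_real y)) - of_real (g y * ct M f y) / (z - of_real y)) \<in> borel_measurable N"
        by (rule mN) measurable
    qed
    also have "\<dots> = ct M f z * ct N g z - ct N (\<lambda>y. g y * ct M f y) z"
      using Bochner_Integration.integral_diff[OF integrable_mult_right[OF integrable_ct_integrand[OF N g z(2)], of "ct M f z"]
          integrable_ct_integrand[OF N dfg(2) z(2)]]
      unfolding ct_def[of N] integral_mult_right_zero .
    finally show ?thesis .
  qed
  ultimately show ?thesis using F by (simp add: algebra_simps)
qed

section \<open>Sign changes of continuous functions\<close>

lemma connected_const_sign:
  fixes f :: "real \<Rightarrow> real"
  assumes "connected S" "continuous_on S f" "\<And>x. x \<in> S \<Longrightarrow> f x \<noteq> 0"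
  obtains e where "e \<in> {1, -1 :: real}" "\<And>x. x \<in> S \<Longrightarrow> 0 < e * f x"
proof (cases "\<exists>x\<in>S. f x > 0")
  case True
  then obtain x where x: "x \<in> S" "f x > 0" by blast
  have "f y > 0" if y: "y \<in> S" for y
  proof (rule ccontr)
    assume "\<not> f y > 0"
    then have "f y < 0" using assms(3)[OF y] by simp
    have "connected (f ` S)" by (rule connected_continuous_image[OF assms(2,1)])
    then have "0 \<in> f ` S" using connectedD_interval[of "f ` S" "f y" "f x" 0] x y \<open>f y < 0\<close> by auto
    with assms(3) show False by auto
  qed
  then show thesis by (intro that[of 1]) auto
next
  case False
  then have "f y < 0" if "y \<in> S" for y using assms(3)[OF that] that by (meson linorder_neqE_linordered_idom)
  then show thesis by (intro that[of "-1"]) auto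
qed

text \<open>The set Z collects the zeros at which the sign changes. Induction on the number of
  zeros: the largest zero is split off, and it joins Z exactly if the sign on its right disagrees
  with the sign that the induction hypothesis supplies on its left.\<close>

lemma sign_pattern:
  fixes f :: "real \<Rightarrow> real"
  assumes "is_interval I" "continuous_on I f" "finite {x \<in> I. f x = 0}"
  shows "\<exists>Z. Z \<subseteq> {x \<in> I. f x = 0} \<and> (\<exists>e\<in>{1, -1}. \<forall>x\<in>I. 0 \<le> e * f x * (\<Prod>y\<in>Z. x - y))"
  using assms
proof (induction "card {x \<in> I. f x = 0}" arbitrary: I)
  case 0
  then have "{x \<in> I. f x = 0} = {}" by simp
  then have "\<And>x. x \<in> I \<Longrightarrow> f x \<noteq> 0" by blast
  then obtain e where "e \<in> {1, -1 :: real}" "\<And>x. x \<in> I \<Longrightarrow> 0 < e * f x"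
    using connected_const_sign[of I f] 0 is_interval_connected by blast
  then show ?case by (intro exI[of _ "{}"]) (auto intro: less_imp_le)
next
  case (Suc n)
  let ?S = "{x \<in> I. f x = 0}"
  have ne: "?S \<noteq> {}" using Suc(2) by (metis card.empty nat.distinct(1))
  define z where "z = Max ?S"
  have z: "z \<in> I" "f z = 0" using Max_in[OF Suc(5) ne] by (auto simp: z_def)
  have zmax: "x \<le> z" if "x \<in> I" "f x = 0" for x using that Suc(5) by (auto simp: z_def)
  define I1 I2 where "I1 = I \<inter> {..<z}" and "I2 = I \<inter> {z<..}"
  have S1: "{x \<in> I1. f x = 0} = ?S - {z}" unfolding I1_def using zmax by (auto simp: less_le)
  have int: "is_interval I1" "is_interval I2" using Suc(3) unfolding I1_def I2_def by (auto intro!: is_interval_Int is_interval_io is_interval_oi)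
  have c: "continuous_on I1 f" "continuous_on I2 f" using Suc(4) unfolding I1_def I2_def by (auto intro: continuous_on_subset)
  have "n = card {x \<in> I1. f x = 0}" unfolding S1 using Suc(2) z Suc(5) by (simp add: card_Diff_singleton)
  moreover have "finite {x \<in> I1. f x = 0}" unfolding S1 using Suc(5) by simp
  ultimately obtain Z e where Z: "Z \<subseteq> ?S - {z}" "e \<in> {1, -1}" "\<And>x. x \<in> I1 \<Longrightarrow> 0 \<le> e * f x * (\<Prod>y\<in>Z. x - y)"
    using Suc(1)[OF _ int(1) c(1)] unfolding S1 by blast
  have fZ: "finite Z" "z \<notin> Z" using Z(1) Suc(5) by (auto intro: finite_subset)
  have "f x \<noteq> 0" if "x \<in> I2" for x using that zmax[of x] unfolding I2_def by auto
  then obtain e2 where e2: "e2 \<in> {1, -1 :: real}" "\<And>x. x \<in> I2 \<Longrightarrow> 0 < e2 * f x"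
    using connected_const_sign[of I2 f] int c is_interval_connected by blast
  have P2: "0 < (\<Prod>y\<in>Z. x - y)" if "x \<in> I2" for x
  proof (intro prod_pos)
    fix y assume "y \<in> Z"
    then have "y \<le> z" using Z(1) zmax by auto
    then show "0 < x - y" using that by (auto simp: I2_def)
  qed
  have cases: "x \<in> I1 \<or> x = z \<or> x \<in> I2" if "x \<in> I" for x using that unfolding I1_def I2_def by auto
  show ?case
  proof (cases "e2 = e")
    case True
    have "0 \<le> e * f x * (\<Prod>y\<in>Z. x - y)" if "x \<in> I" for x
      using cases[OF that]
    proof (elim disjE)
      assume "x \<in> I2"
      from mult_pos_pos[OF e2(2)[OF this] P2[OF this]] show ?thesis using True by simp
    qed (use Z(3) z in auto)
    then show ?thesis using Z by blast
  next
    case False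
    then have e2e: "e2 = - e" using e2 Z by auto
    have "0 \<le> (- e) * f x * (\<Prod>y\<in>insert z Z. x - y)" if "x \<in> I" for x
      using cases[OF that]
    proof (elim disjE)
      assume x: "x \<in> I1"
      have "x - z \<le> 0" using x by (auto simp: I1_def)
      have "0 \<le> (e * f x * (\<Prod>y\<in>Z. x - y)) * (z - x)" by (rule mult_nonneg_nonneg[OF Z(3)[OF x]]) (use \<open>x - z \<le> 0\<close> in simp)
      then show ?thesis using fZ by (simp add: algebra_simps)
    next
      assume x: "x \<in> I2"
      then have "0 < (x - z) * (\<Prod>y\<in>Z. x - y)" using P2[OF x] by (auto simp: I2_def)
      with e2(2)[OF x] have "0 < (e2 * f x) * ((x - z) * (\<Prod>y\<in>Z. x - y))" by (rule mult_pos_pos)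
      then show ?thesis using fZ e2e by (simp add: mult.assoc)
    qed (use z in simp)
    then show ?thesis using Z z Suc(5) by (intro exI[of _ "insert z Z"]) auto
  qed
qed

section \<open>The Joukowski map\<close>

text \<open>The map \<zeta> + 1 / \<zeta> sends the unit circle onto [-2, 2]; centre and scale carry
  this segment to [c, d]. The punctured disc then parametrizes the plane without the segment, with
  the origin standing for infinity.\<close>

definition joukowski :: "real \<Rightarrow> real \<Rightarrow> complex \<Rightarrow> complex" where
  "joukowski c d \<zeta> = of_real ((c + d) / 2) + of_real ((d - c) / 4) * (\<zeta> + 1 / \<zeta>)"

text \<open>Inside the unit disc the last factor is negative, so the map interchanges the two
  half-planes. This decides the sign of the densities in the representation theorem below.\<close>

lemma Im_joukowski: "Im (joukowski c d \<zeta>) = (d - c) / 4 * (Im \<zeta> * (1 - 1 / (cmod \<zeta>)\<^sup>2))"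
proof -
  have "Im (1 / \<zeta>) = - Im \<zeta> / (cmod \<zeta>)\<^sup>2" by (simp add: Im_divide cmod_power2)
  moreover have "Im (of_real r * w) = r * Im w" for r w by simp
  ultimately have "Im (joukowski c d \<zeta>) = (d - c) / 4 * (Im \<zeta> + - Im \<zeta> / (cmod \<zeta>)\<^sup>2)"
    unfolding joukowski_def plus_complex.sel Im_complex_of_real by (simp only: add_0_left plus_complex.sel)
  then show ?thesis by (simp add: right_diff_distrib)
qed

lemma joukowski_cnj: "joukowski c d (cnj \<zeta>) = cnj (joukowski c d \<zeta>)"
  by (simp add: joukowski_def)

lemma joukowski_notin:
  assumes cd: "c < d" and z: "\<zeta> \<noteq> 0" "cmod \<zeta> < 1"
  shows "joukowski c d \<zeta> \<notin> of_real ` {c..d}"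
proof
  assume "joukowski c d \<zeta> \<in> of_real ` {c..d}"
  then obtain t where t: "c \<le> t" "t \<le> d" "joukowski c d \<zeta> = of_real t" by auto
  have "cmod \<zeta> > 0" using z by simp
  moreover have "(cmod \<zeta>)\<^sup>2 < 1" using power_strict_mono[OF z(2) norm_ge_zero, of 2] by simp
  ultimately have n: "1 - 1 / (cmod \<zeta>)\<^sup>2 \<noteq> 0" by (simp add: field_simps)
  have "Im (joukowski c d \<zeta>) = 0" using t by simp
  then have "Im \<zeta> = 0" unfolding Im_joukowski using n cd by auto
  then obtain r where r: "\<zeta> = of_real r" by (metis complex_is_Real_iff Reals_cases)
  then have r1: "r \<noteq> 0" "\<bar>r\<bar> < 1" using z by auto
  have "of_real ((c + d) / 2 + (d - c) / 4 * (r + 1 / r)) = complex_of_real t"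
    using t(3) unfolding r joukowski_def by simp
  then have e: "(d - c) / 4 * (r + 1 / r) = t - (c + d) / 2" unfolding of_real_eq_iff by linarith
  have "\<bar>(d - c) / 4 * (r + 1 / r)\<bar> \<le> (d - c) / 2" unfolding e using t by (simp add: abs_le_iff field_simps)
  then have "(d - c) / 4 * \<bar>r + 1 / r\<bar> \<le> (d - c) / 4 * 2" using cd by (simp add: abs_mult)
  then have "\<bar>r + 1 / r\<bar> \<le> 2" by (rule mult_left_le_imp_le) (use cd in simp)
  then have "\<bar>r\<bar> * \<bar>r + 1 / r\<bar> \<le> \<bar>r\<bar> * 2" by (intro mult_left_mono) auto
  then have "\<bar>r * r + 1\<bar> \<le> \<bar>r\<bar> * 2" using r1 by (simp flip: abs_mult add: distrib_left)
  then have "(1 - \<bar>r\<bar>)\<^sup>2 \<le> 0" by (simp add: power2_eq_square algebra_simps)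
  then show False using r1 by simp
qed

text \<open>Both preimages solve \<zeta>^2 - u \<zeta> + 1 = 0 and have product 1, so one of them
  lies in the open disc unless both are on the circle. In that case they are conjugate, and u is
  real in [-2, 2].\<close>

lemma joukowski_surj:
  assumes cd: "c < d" and z: "z \<notin> of_real ` {c..d}"
  obtains \<zeta> where "\<zeta> \<noteq> 0" "cmod \<zeta> < 1" "joukowski c d \<zeta> = z"
proof -
  define u where "u = (z - of_real ((c + d) / 2)) / of_real ((d - c) / 4)"
  have dc: "complex_of_real ((d - c) / 4) \<noteq> 0" unfolding of_real_eq_0_iff using cd by simp
  have zu: "z = of_real ((c + d) / 2) + of_real ((d - c) / 4) * u"
    unfolding u_def times_divide_eq_right nonzero_mult_div_cancel_left[OF dc] by simp
  define s where "s = csqrt (u\<^sup>2 - 4)"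
  define r1 r2 where "r1 = (u + s) / 2" and "r2 = (u - s) / 2"
  have ss: "s\<^sup>2 = u\<^sup>2 - 4" by (simp add: s_def)
  have pr: "r1 * r2 = 1" using ss by (simp add: r1_def r2_def field_simps power2_eq_square)
  have su: "r1 + r2 = u" by (simp add: r1_def r2_def field_simps)
  have nz: "r1 \<noteq> 0" "r2 \<noteq> 0" using pr by auto
  have inv: "1 / r1 = r2" "1 / r2 = r1" using pr nz by (auto simp: field_simps)
  have j: "joukowski c d r1 = z" "joukowski c d r2 = z"
    unfolding joukowski_def inv zu using su by (auto simp: add.commute)
  have nm: "cmod r1 * cmod r2 = 1" using pr by (metis norm_mult norm_one)
  have "cmod r1 \<noteq> 1"
  proof
    assume 1: "cmod r1 = 1"
    then have "r2 = cnj r1" using inv(1) by (metis complex_div_cnj div_by_1 mult_1 norm_one of_real_1 one_power2)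
    then have "u = of_real (2 * Re r1)" using su by (simp add: complex_add_cnj)
    then have "z = of_real ((c + d) / 2 + (d - c) / 4 * (2 * Re r1))" using zu by simp
    moreover have "(c + d) / 2 + (d - c) / 4 * (2 * Re r1) \<in> {c..d}"
    proof -
      have "\<bar>Re r1\<bar> \<le> 1" using abs_Re_le_cmod[of r1] 1 by simp
      then have "\<bar>(d - c) / 2 * Re r1\<bar> \<le> (d - c) / 2 * 1" unfolding abs_mult using cd by (intro mult_mono) auto
      then show ?thesis by (auto simp: abs_le_iff field_simps)
    qed
    ultimately show False using z by blast
  qed
  then consider "cmod r1 < 1" | "cmod r1 > 1" by linarith
  then show thesis
  proof cases
    case 1 then show ?thesis using that[of r1] nz j by blast
  next
    case 2
    have "cmod r2 = 1 / cmod r1" using nm nz by (simp add: field_simps)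
    then have "cmod r2 < 1" using 2 by (simp add: divide_less_eq)
    then show ?thesis using that[of r2] nz j by blast
  qed
qed

lemma joukowski_inj:
  assumes cd: "c < d" and "\<zeta> \<noteq> 0" "cmod \<zeta> < 1" "\<xi> \<noteq> 0" "cmod \<xi> < 1" and e: "joukowski c d \<zeta> = joukowski c d \<xi>"
  shows "\<zeta> = \<xi>"
proof -
  have dc: "complex_of_real ((d - c) / 4) \<noteq> 0" using cd by (simp flip: of_real_diff)
  have "\<zeta> + 1 / \<zeta> = \<xi> + 1 / \<xi>" using e dc unfolding joukowski_def by (simp only: add_left_cancel mult_cancel_left) auto
  then have "(\<zeta> - \<xi>) * (\<zeta> * \<xi> - 1) = 0" using assms by (simp add: field_simps)
  moreover have "cmod (\<zeta> * \<xi>) < 1" unfolding norm_mult using mult_strict_mono[of "cmod \<zeta>" 1 "cmod \<xi>" 1] assms by simp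
  then have "\<zeta> * \<xi> \<noteq> 1" by auto
  ultimately show ?thesis by auto
qed

lemma holomorphic_on_joukowski [holomorphic_intros]:
  "f holomorphic_on S \<Longrightarrow> (\<And>x. x \<in> S \<Longrightarrow> f x \<noteq> 0) \<Longrightarrow> (\<lambda>x. joukowski c d (f x)) holomorphic_on S"
  unfolding joukowski_def by (intro holomorphic_intros) auto

lemma filterlim_joukowski:
  assumes "c < d" shows "filterlim (joukowski c d) at_infinity (at 0)"
proof -
  have "filterlim (\<lambda>\<zeta>::complex. 1 / \<zeta>) at_infinity (at 0)"
    using filterlim_inverse_at_infinity by (simp add: divide_inverse)
  then have "filterlim (\<lambda>\<zeta>::complex. of_real ((d - c) / 4) * (1 / \<zeta>)) at_infinity (at 0)"
    using assms by (intro tendsto_mult_filterlim_at_infinity[OF tendsto_const]) (auto simp flip: of_real_diff)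
  from tendsto_add_filterlim_at_infinity[OF _ this, of "\<lambda>\<zeta>. of_real ((c + d) / 2) + of_real ((d - c) / 4) * \<zeta>" "of_real ((c + d) / 2) + of_real ((d - c) / 4) * 0"]
  have "filterlim (\<lambda>\<zeta>::complex. of_real ((c + d) / 2) + of_real ((d - c) / 4) * \<zeta> + of_real ((d - c) / 4) * (1 / \<zeta>)) at_infinity (at 0)"
    by (rule meta_mp[rotated]) (intro tendsto_intros)
  then show ?thesis unfolding joukowski_def distrib_left add.assoc .
qed

section \<open>A Schwarz formula on circles\<close>

text \<open>The real and imaginary symmetric parts of the two Cauchy integrals, for \<open>\<rho> \<zeta>\<close> and for \<open>0\<close>,
  recombine so that only the imaginary part of \<open>f\<close> on the circle survives.\<close>

lemma schwarz_circle_formula: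
  assumes f: "f holomorphic_on ball 0 1" and cnj: "\<And>u. cmod u < 1 \<Longrightarrow> f (cnj u) = cnj (f u)"
    and \<rho>: "0 < \<rho>" "\<rho> < 1" and z: "z \<noteq> 0" "cmod z < 1"
  shows "((\<lambda>t. of_real (2 * Im (f (of_real \<rho> * exp (2 * of_real pi * \<i> * of_real t))) * sin (2 * pi * t))
            / (z + 1 / z - of_real (2 * cos (2 * pi * t)))) has_integral (f (of_real \<rho> * z) - f 0)) {0..1}"
proof -
  define E where "E t = exp (2 * of_real pi * \<i> * of_real t)" for t :: real
  have E1: "cmod (E t) = 1" for t unfolding E_def by simp
  have E0: "E t \<noteq> 0" for t unfolding E_def by simp
  have Ecs: "E t = of_real (cos (2 * pi * t)) + \<i> * of_real (sin (2 * pi * t))" for t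
    unfolding E_def using cis_conv_exp[of "2 * pi * t"] by (simp add: cis.ctr complex_eq_iff mult_ac)
  have Ecnj: "E (1 - t) = cnj (E t)" for t
  proof -
    have "2 * pi * (1 - t) = 2 * pi - 2 * pi * t" by (simp add: algebra_simps)
    then show ?thesis unfolding Ecs by (simp add: cos_diff sin_diff)
  qed
  have Einv: "cnj (E t) * E t = 1" for t using complex_norm_square[of "E t"] E1[of t] by (simp add: mult.commute)
  have rE: "cmod (of_real \<rho> * E t) = \<rho>" for t using \<rho> by (simp add: norm_mult E1)
  have hol: "f holomorphic_on ball 0 \<rho>" "continuous_on (cball 0 \<rho>) f"
    using f \<rho> by (auto intro: holomorphic_on_subset holomorphic_on_imp_continuous_on
      continuous_on_subset[OF holomorphic_on_imp_continuous_on[OF f]] subset_ball)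
  have A: "((\<lambda>t. f (of_real \<rho> * E t) * (1 / (1 - z * cnj (E t)))) has_integral f (of_real \<rho> * z)) {0..1}"
  proof -
    have "((\<lambda>u. f u / (u - of_real \<rho> * z)) has_contour_integral (2 * of_real pi * \<i> * f (of_real \<rho> * z))) (circlepath 0 \<rho>)"
      using z \<rho> by (intro Cauchy_integral_circlepath hol) (simp add: norm_mult)
    then have "((\<lambda>t. f (of_real \<rho> * E t) / (of_real \<rho> * E t - of_real \<rho> * z) * (2 * of_real pi * \<i> * of_real \<rho> * E t)) has_integral (2 * of_real pi * \<i> * f (of_real \<rho> * z))) {0..1}"
      unfolding has_contour_integral vector_derivative_circlepath by (simp add: circlepath E_def)
    then have "((\<lambda>t. (f (of_real \<rho> * E t) / (of_real \<rho> * E t - of_real \<rho> * z) * (2 * of_real pi * \<i> * of_real \<rho> * E t)) / (2 * of_real pi * \<i>))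
        has_integral (2 * of_real pi * \<i> * f (of_real \<rho> * z)) / (2 * of_real pi * \<i>)) {0..1}"
      by (rule has_integral_divide)
    moreover have "(f (of_real \<rho> * E t) / (of_real \<rho> * E t - of_real \<rho> * z) * (2 * of_real pi * \<i> * of_real \<rho> * E t)) / (2 * of_real pi * \<i>)
        = f (of_real \<rho> * E t) * (1 / (1 - z * cnj (E t)))" for t
    proof -
      have n: "E t - z \<noteq> 0" using E1[of t] z by auto
      have e: "1 - z * cnj (E t) = (E t - z) * cnj (E t)" using Einv[of t] by (simp add: algebra_simps)
      have "cnj (E t) = 1 / E t" using Einv[of t] E0[of t] by (simp add: field_simps)
      then have "1 / (1 - z * cnj (E t)) = E t / (E t - z)"
        unfolding e using n E0[of t] by (simp only: times_divide_eq_right mult_1_right divide_divide_eq_right mult_1_left)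
      moreover have "of_real \<rho> * E t - of_real \<rho> * z = of_real \<rho> * (E t - z)" by (simp add: algebra_simps)
      ultimately show ?thesis using \<rho> n by simp
    qed
    ultimately show ?thesis by simp
  qed
  \<comment> \<open>Cauchy's formula at the centre for the function f(u) / (1 - z u / \<rho>), which
    is holomorphic because |z| < 1 and has the value f(0) there.\<close>
  have B: "((\<lambda>t. f (of_real \<rho> * E t) * (1 / (1 - z * E t))) has_integral f 0) {0..1}"
  proof -
    define F where "F u = f u / (1 - z * u / of_real \<rho>)" for u
    have nz: "1 - z * u / of_real \<rho> \<noteq> 0" if "cmod u \<le> \<rho>" for u
    proof
      assume "1 - z * u / of_real \<rho> = 0"
      then have "cmod (z * u / of_real \<rho>) = 1" by simp
      moreover have "cmod (z * u / of_real \<rho>) \<le> cmod z * 1" using that \<rho> unfolding norm_divide norm_mult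
        by (simp add: divide_le_eq mult_left_mono)
      ultimately show False using z by simp
    qed
    have F: "F holomorphic_on ball 0 \<rho>" "continuous_on (cball 0 \<rho>) F"
      unfolding F_def using nz \<rho> by (auto intro!: holomorphic_intros hol continuous_intros)
    have "((\<lambda>u. F u / (u - 0)) has_contour_integral (2 * of_real pi * \<i> * F 0)) (circlepath 0 \<rho>)"
      using \<rho> by (intro Cauchy_integral_circlepath F) simp
    then have "((\<lambda>t. F (of_real \<rho> * E t) / (of_real \<rho> * E t) * (2 * of_real pi * \<i> * of_real \<rho> * E t)) has_integral (2 * of_real pi * \<i> * F 0)) {0..1}"
      unfolding has_contour_integral vector_derivative_circlepath by (simp add: circlepath E_def)
    then have "((\<lambda>t. (F (of_real \<rho> * E t) / (of_real \<rho> * E t) * (2 * of_real pi * \<i> * of_real \<rho> * E t)) / (2 * of_real pi * \<i>))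
        has_integral (2 * of_real pi * \<i> * F 0) / (2 * of_real pi * \<i>)) {0..1}"
      by (rule has_integral_divide)
    then show ?thesis using \<rho> E0 by (simp add: F_def)
  qed
  define S where "S t = of_real (sin (2 * pi * t)) / (z + 1 / z - of_real (2 * cos (2 * pi * t)))" for t
  \<comment> \<open>The difference of the two kernels changes sign under conjugation of
    \<open>E t\<close>, which is what the reflection of t to 1 - t exploits.\<close>
  have kd: "1 / (1 - z * cnj (E t)) - 1 / (1 - z * E t) = - 2 * \<i> * S t" for t
  proof -
    have n1: "1 - z * E t \<noteq> 0" "1 - z * cnj (E t) \<noteq> 0"
    proof -
      have "cmod (z * E t) < 1" "cmod (z * cnj (E t)) < 1" using E1[of t] z by (simp_all add: norm_mult)
      then show "1 - z * E t \<noteq> 0" "1 - z * cnj (E t) \<noteq> 0" by auto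
    qed
    have e: "(1 - z * E t) * (1 - z * cnj (E t)) = z * (z + 1 / z - of_real (2 * cos (2 * pi * t)))"
    proof -
      have "(1 - z * E t) * (1 - z * cnj (E t)) = 1 - z * (E t + cnj (E t)) + z * z * (cnj (E t) * E t)" by (simp add: algebra_simps)
      also have "\<dots> = 1 - z * of_real (2 * cos (2 * pi * t)) + z * z" unfolding Einv by (simp add: Ecs)
      also have "\<dots> = z * (z + 1 / z - of_real (2 * cos (2 * pi * t)))" using z by (simp add: distrib_left right_diff_distrib)
      finally show ?thesis .
    qed
    have "1 / (1 - z * cnj (E t)) - 1 / (1 - z * E t) = z * (cnj (E t) - E t) / ((1 - z * E t) * (1 - z * cnj (E t)))"
      using n1 by (simp add: field_simps)
    also have "cnj (E t) - E t = - 2 * \<i> * of_real (sin (2 * pi * t))" by (simp add: Ecs)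
    finally show ?thesis unfolding e S_def using z by simp
  qed
  have C: "((\<lambda>t. f (of_real \<rho> * E t) * (- 2 * \<i> * S t)) has_integral (f (of_real \<rho> * z) - f 0)) {0..1}"
    using has_integral_diff[OF A B] unfolding kd[symmetric] right_diff_distrib .
  have S1: "S (1 - t) = - S t" for t
  proof -
    have "2 * pi * (1 - t) = 2 * pi - 2 * pi * t" by (simp add: algebra_simps)
    then show ?thesis unfolding S_def by (simp add: cos_diff sin_diff)
  qed
  have "((\<lambda>t. f (of_real \<rho> * E (1 - t)) * (- 2 * \<i> * S (1 - t))) has_integral (f (of_real \<rho> * z) - f 0)) {0..1}"
    using has_integral_affinity01[of "\<lambda>t. f (of_real \<rho> * E t) * (- 2 * \<i> * S t)" _ "-1" 1] C by simp
  moreover have "f (of_real \<rho> * E (1 - t)) * (- 2 * \<i> * S (1 - t)) = cnj (f (of_real \<rho> * E t)) * (2 * \<i> * S t)" for t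
  proof -
    have "cmod (of_real \<rho> * E t) < 1" unfolding rE by (rule \<rho>)
    from cnj[OF this] have "f (of_real \<rho> * cnj (E t)) = cnj (f (of_real \<rho> * E t))"
      unfolding complex_cnj_mult complex_cnj_complex_of_real .
    then show ?thesis unfolding Ecnj S1 by simp
  qed
  ultimately have C': "((\<lambda>t. cnj (f (of_real \<rho> * E t)) * (2 * \<i> * S t)) has_integral (f (of_real \<rho> * z) - f 0)) {0..1}" by (simp only:)
  have "((\<lambda>t. (f (of_real \<rho> * E t) * (- 2 * \<i> * S t) + cnj (f (of_real \<rho> * E t)) * (2 * \<i> * S t)) / 2) has_integral
      (f (of_real \<rho> * z) - f 0)) {0..1}"
    using has_integral_divide[OF has_integral_add[OF C C'], of 2] by (simp only: mult_2[symmetric] nonzero_mult_div_cancel_left[OF zero_neq_numeral[symmetric]])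
  moreover have "(f (of_real \<rho> * E t) * (- 2 * \<i> * S t) + cnj (f (of_real \<rho> * E t)) * (2 * \<i> * S t)) / 2
     = of_real (2 * Im (f (of_real \<rho> * E t))) * S t" for t
  proof -
    have "(f (of_real \<rho> * E t) * (- 2 * \<i> * S t) + cnj (f (of_real \<rho> * E t)) * (2 * \<i> * S t)) / 2
       = - \<i> * S t * (f (of_real \<rho> * E t) - cnj (f (of_real \<rho> * E t)))" by (simp add: field_simps)
    also have "f (of_real \<rho> * E t) - cnj (f (of_real \<rho> * E t)) = \<i> * of_real (2 * Im (f (of_real \<rho> * E t)))"
      by (simp add: complex_diff_cnj)
    finally show ?thesis by simp
  qed
  ultimately have "((\<lambda>t. of_real (2 * Im (f (of_real \<rho> * E t))) * S t) has_integral (f (of_real \<rho> * z) - f 0)) {0..1}"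
    by (simp only:)
  then show ?thesis unfolding S_def E_def by (simp only: times_divide_eq_right of_real_mult)
qed

section \<open>Nevanlinna functions with compactly supported measure\<close>

text \<open>The push-forward of a density on the interval of angles under a continuous map. It turns
  a circle integral into an integral against a measure on the line, to which weak compactness
  applies.\<close>

lemma measure_density_distr:
  fixes q x :: "real \<Rightarrow> real"
  assumes q: "continuous_on {0..1} q" "\<And>t. t \<in> {0..1} \<Longrightarrow> 0 \<le> q t" and x: "continuous_on UNIV x"
  defines "P \<equiv> distr (density lborel (\<lambda>t. ennreal (indicator {0..1} t * q t))) borel x"
  shows "\<And>f :: real \<Rightarrow> 'b::euclidean_space. continuous_on UNIV f \<Longrightarrow> integral\<^sup>L P f = integral {0..1} (\<lambda>t. q t *\<^sub>R f (x t))"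
    and "emeasure P (space P) = ennreal (integral {0..1} q)" and "sets P = sets borel" and "space P = UNIV"
    and "\<And>A. A \<in> sets borel \<Longrightarrow> (\<And>t. t \<in> {0..1} \<Longrightarrow> x t \<in> A) \<Longrightarrow> AE y in P. y \<in> A"
proof -
  have [measurable]: "x \<in> borel_measurable borel" using x by (rule borel_measurable_continuous_onI)
  have m[measurable]: "(\<lambda>t. indicator {0..1} t * q t) \<in> borel_measurable borel"
    using borel_measurable_continuous_on_indicator[OF _ q(1)] by simp
  have nn: "0 \<le> indicator {0..1} t * q t" for t :: real using q(2) by (auto simp: indicator_def)
  show "integral\<^sup>L P f = integral {0..1} (\<lambda>t. q t *\<^sub>R f (x t))" if f: "continuous_on UNIV f" for f :: "real \<Rightarrow> 'b"
  proof -
    have [measurable]: "f \<in> borel_measurable borel" using f by (rule borel_measurable_continuous_onI)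
    have "integral\<^sup>L P f = (\<integral>t. f (x t) \<partial>(density lborel (\<lambda>t. ennreal (indicator {0..1} t * q t))))"
      unfolding P_def by (rule integral_distr) auto
    also have "\<dots> = (\<integral>t. (indicator {0..1} t * q t) *\<^sub>R f (x t) \<partial>lborel)"
      by (rule integral_density) (use nn in auto)
    also have "\<dots> = (LINT t:{0..1}|lborel. q t *\<^sub>R f (x t))"
      unfolding set_lebesgue_integral_def by (intro Bochner_Integration.integral_cong refl) (simp add: mult.commute)
    also have "\<dots> = integral {0..1} (\<lambda>t. q t *\<^sub>R f (x t))"
    proof (rule set_borel_integral_eq_integral(2))
      have "continuous_on {0..1} (\<lambda>t. q t *\<^sub>R f (x t))"
        using q(1) x f by (auto intro!: continuous_intros continuous_on_compose2[OF f] intro: continuous_on_subset)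
      then show "set_integrable lborel {0..1} (\<lambda>t. q t *\<^sub>R f (x t))"
        unfolding set_integrable_def by (intro borel_integrable_compact) auto
    qed
    finally show ?thesis .
  qed
  show "sets P = sets borel" "space P = UNIV" by (simp_all add: P_def)
  have "emeasure P (space P) = (\<integral>\<^sup>+t. ennreal (indicator {0..1} t * q t) \<partial>lborel)"
    unfolding P_def by (subst emeasure_distr) (auto simp: emeasure_density)
  also have "\<dots> = ennreal (integral {0..1} q)"
  proof -
    have i: "integrable lborel (\<lambda>t. indicator {0..1} t *\<^sub>R q t)"
      using borel_integrable_compact[of "{0..1}" q] q(1) by simp
    have "(\<integral>t. indicator {0..1} t *\<^sub>R q t \<partial>lborel) = integral {0..1} q"
      using set_borel_integral_eq_integral(2)[of "{0..1}" q] i unfolding set_integrable_def set_lebesgue_integral_def by simp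
    then show ?thesis using nn_integral_eq_integral[of lborel "\<lambda>t. indicator {0..1} t *\<^sub>R q t"] i nn by simp
  qed
  finally show "emeasure P (space P) = ennreal (integral {0..1} q)" .
  show "AE y in P. y \<in> A" if A: "A \<in> sets borel" "\<And>t. t \<in> {0..1} \<Longrightarrow> x t \<in> A" for A
  proof -
    have [measurable]: "A \<in> sets borel" by (rule A)
    have "AE t in density lborel (\<lambda>t. ennreal (indicator {0..1} t * q t)). x t \<in> A"
    proof (subst AE_density)
      show "(\<lambda>t. ennreal (indicator {0..1} t * q t)) \<in> borel_measurable lborel"
        using measurable_compose[OF m measurable_ennreal] by simp
      show "AE t in lborel. 0 < ennreal (indicator {0..1} t * q t) \<longrightarrow> x t \<in> A" by (rule AE_I2) (use A in \<open>auto simp: indicator_def\<close>)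
    qed
    then show ?thesis unfolding P_def by (subst AE_distr_iff) auto
  qed
qed

text \<open>Pulled back by the Joukowski map, the Schwarz formula on the circle of radius \<open>\<rho>\<close> represents the
  dilated function with a positive measure on \<open>{c..d}\<close>; Helly's theorem supplies the limit as \<open>\<rho> \<rightarrow> 1\<close>.\<close>

theorem nevanlinna_compact_representation:
  fixes \<Psi> :: "complex \<Rightarrow> complex"
  assumes cd: "c < d" and hol: "\<Psi> holomorphic_on - (of_real ` {c..d})"
    and cnj: "\<And>z. z \<notin> of_real ` {c..d} \<Longrightarrow> \<Psi> (cnj z) = cnj (\<Psi> z)"
    and pos: "\<And>z. Im z > 0 \<Longrightarrow> Im (\<Psi> z) \<ge> 0"
    and lim: "((\<lambda>z. \<Psi> z / z) \<longlongrightarrow> of_real \<alpha>) at_infinity"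
  obtains N \<beta> where "measure_on {c..d} N"
    "\<And>z. Im z > 0 \<Longrightarrow> \<Psi> z = of_real \<alpha> * z + of_real \<beta> - ct N (\<lambda>_. 1) z"
proof -
  define h where "h = (d - c) / 4"
  have h0: "h > 0" using cd by (simp add: h_def)
  let ?J = "joukowski c d"
  \<comment> \<open>Near the origin \<Psi> composed with the Joukowski map behaves like \<alpha> h /
    \<zeta>, whence the value that removes the singularity.\<close>
  define k where "k \<zeta> = (if \<zeta> = 0 then of_real (\<alpha> * h) else \<zeta> * \<Psi> (?J \<zeta>))" for \<zeta>
  have kh: "k holomorphic_on ball 0 1" unfolding k_def
  proof (rule removable_singularity)
    have "(\<lambda>\<zeta>. \<Psi> (?J \<zeta>)) holomorphic_on ball 0 1 - {0}"
      by (rule holomorphic_on_compose_gen[OF _ hol, unfolded o_def])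
        (auto intro!: holomorphic_intros dest: joukowski_notin[OF cd])
    then show "(\<lambda>\<zeta>. \<zeta> * \<Psi> (?J \<zeta>)) holomorphic_on ball 0 1 - {0}" by (intro holomorphic_intros)
    have "((\<lambda>\<zeta>. \<Psi> (?J \<zeta>) / ?J \<zeta>) \<longlongrightarrow> of_real \<alpha>) (at 0)"
      by (rule filterlim_compose[OF lim filterlim_joukowski[OF cd]])
    moreover have "((\<lambda>\<zeta>::complex. of_real ((c + d) / 2) * \<zeta> + of_real h * (\<zeta>\<^sup>2 + 1)) \<longlongrightarrow> of_real h) (at 0)"
      by (auto intro!: tendsto_eq_intros)
    ultimately have "((\<lambda>\<zeta>. \<Psi> (?J \<zeta>) / ?J \<zeta> * (of_real ((c + d) / 2) * \<zeta> + of_real h * (\<zeta>\<^sup>2 + 1))) \<longlongrightarrow> of_real \<alpha> * of_real h) (at 0)"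
      by (rule tendsto_mult)
    moreover have "\<forall>\<^sub>F \<zeta> in at 0. \<Psi> (?J \<zeta>) / ?J \<zeta> * (of_real ((c + d) / 2) * \<zeta> + of_real h * (\<zeta>\<^sup>2 + 1)) = \<zeta> * \<Psi> (?J \<zeta>)"
    proof -
      have "\<forall>\<^sub>F \<zeta> in at 0. ?J \<zeta> \<noteq> 0"
        using filterlim_joukowski[OF cd] by (metis (no_types, lifting) eventually_mono filterlim_at_infinity_imp_eventually_ne)
      moreover have "\<forall>\<^sub>F \<zeta>::complex in at 0. \<zeta> \<noteq> 0" by (simp add: eventually_at_filter)
      ultimately show ?thesis
      proof eventually_elim
        case (elim \<zeta>)
        have "of_real ((c + d) / 2) * \<zeta> + of_real h * (\<zeta>\<^sup>2 + 1) = \<zeta> * ?J \<zeta>"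
          using elim(2) unfolding joukowski_def h_def by (simp add: distrib_left power2_eq_square mult_ac del: of_real_divide of_real_add of_real_diff)
        then show ?case using elim by simp
      qed
    qed
    ultimately show "((\<lambda>\<zeta>. \<zeta> * \<Psi> (?J \<zeta>)) \<longlongrightarrow> of_real (\<alpha> * h)) (at 0)"
      using Lim_transform_eventually by fastforce
  qed simp
  define g where "g \<zeta> = (if \<zeta> = 0 then deriv k 0 else (k \<zeta> - k 0) / (\<zeta> - 0))" for \<zeta>
  have gh: "g holomorphic_on ball 0 1" unfolding g_def by (rule pole_lemma_open[OF kh]) simp
  have G: "\<Psi> (?J \<zeta>) = of_real (\<alpha> * h) / \<zeta> + g \<zeta>" if "\<zeta> \<noteq> 0" for \<zeta>
    using that by (simp add: g_def k_def field_simps)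
  have gc0: "g (cnj \<zeta>) = cnj (g \<zeta>)" if "\<zeta> \<noteq> 0" "cmod \<zeta> < 1" for \<zeta>
    using that joukowski_notin[OF cd that] by (simp add: g_def k_def joukowski_cnj cnj)
  \<comment> \<open>The symmetry under conjugation is inherited from \<Psi> only away from the
    origin; at the origin it follows by continuity along the real axis.\<close>
  have g0: "Im (g 0) = 0"
  proof -
    have "isCont g 0"
      using holomorphic_on_imp_continuous_on[OF gh] by (simp add: continuous_on_eq_continuous_at)
    then have "((\<lambda>n. g (of_real (inverse (real (Suc (Suc n)))))) \<longlongrightarrow> g 0) sequentially"
    proof (rule isCont_tendsto_compose)
      have "(\<lambda>n. inverse (real (Suc (Suc n)))) \<longlonglongrightarrow> 0" using LIMSEQ_Suc[OF LIMSEQ_inverse_real_of_nat] .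
      from tendsto_of_real[OF this, where 'a=complex]
      show "(\<lambda>n. complex_of_real (inverse (real (Suc (Suc n))))) \<longlonglongrightarrow> 0" unfolding of_real_0 .
    qed
    then have "(\<lambda>n. Im (g (of_real (inverse (real (Suc (Suc n))))))) \<longlonglongrightarrow> Im (g 0)" by (rule tendsto_Im)
    moreover have "Im (g (of_real s)) = 0" if "s \<noteq> 0" "\<bar>s\<bar> < 1" for s
    proof -
      have "g (of_real s) = cnj (g (of_real s))" using gc0[of "of_real s"] that by simp
      then show ?thesis by (metis Reals_cnj_iff complex_is_Real_iff)
    qed
    from this[of "inverse (real (Suc (Suc n)))" for n] have "Im (g (of_real (inverse (real (Suc (Suc n)))))) = 0" for n
      by (simp add: field_simps)
    ultimately show ?thesis by (simp add: LIMSEQ_const_iff)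
  qed
  have gc: "g (cnj \<zeta>) = cnj (g \<zeta>)" if "cmod \<zeta> < 1" for \<zeta>
  proof (cases "\<zeta> = 0")
    case True
    have "cnj (g 0) = g 0" using g0 by (simp add: complex_eq_iff)
    with True show ?thesis by simp
  qed (use gc0 that in auto)
  \<comment> \<open>The image of the point exp(2 pi i t) of the unit circle under the Joukowski
    map.\<close>
  define x where "x t = (c + d) / 2 + 2 * h * cos (2 * pi * t)" for t :: real
  have xc: "continuous_on UNIV x" unfolding x_def by (intro continuous_intros)
  have xI: "x t \<in> {c..d}" for t
  proof -
    have "\<bar>2 * h * cos (2 * pi * t)\<bar> \<le> 2 * h * 1" unfolding abs_mult using h0 by (intro mult_mono) auto
    then show ?thesis unfolding x_def h_def by (auto simp: abs_le_iff field_simps)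
  qed
  define \<rho> where "\<rho> n = 1 - inverse (real (Suc (Suc n)))" for n
  have \<rho>: "0 < \<rho> n" "\<rho> n < 1" for n unfolding \<rho>_def by (auto simp: field_simps)
  have \<rho>1: "\<rho> \<longlonglongrightarrow> 1" unfolding \<rho>_def
    using tendsto_diff[OF tendsto_const LIMSEQ_Suc[OF LIMSEQ_inverse_real_of_nat], of 1] by simp
  \<comment> \<open>On the circle of radius \<rho> the number \<alpha> h / \<zeta> is the conjugate
    of \<alpha> h \<zeta> / \<rho>^2, so their sum is real. Subtracting the latter from
    \<open>g\<close> makes the imaginary part of \<open>Gr\<close> equal to that of \<Psi> composed
    with the Joukowski map on this circle, while \<open>Gr\<close> stays holomorphic.\<close>
  define Gr where "Gr n \<zeta> = g \<zeta> - of_real (\<alpha> * h / (\<rho> n)\<^sup>2) * \<zeta>" for n \<zeta>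
  have Grh: "Gr n holomorphic_on ball 0 1" for n unfolding Gr_def by (intro holomorphic_intros gh)
  have Grc: "Gr n (cnj u) = cnj (Gr n u)" if "cmod u < 1" for n u unfolding Gr_def using gc[OF that] by simp
  define E where "E t = exp (2 * of_real pi * \<i> * of_real t)" for t :: real
  have E1: "cmod (E t) = 1" for t unfolding E_def by simp
  have Ecs: "E t = of_real (cos (2 * pi * t)) + \<i> * of_real (sin (2 * pi * t))" for t
    unfolding E_def using cis_conv_exp[of "2 * pi * t"] by (simp add: cis.ctr complex_eq_iff mult_ac)
  define q0 where "q0 n t = - 2 * h * Im (Gr n (of_real (\<rho> n) * E t)) * sin (2 * pi * t)" for n t
  have q0nn: "0 \<le> q0 n t" for n t
  proof -
    let ?u = "of_real (\<rho> n) * E t"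
    have cu: "cmod ?u = \<rho> n" using \<rho>[of n] by (simp add: norm_mult E1)
    have u0: "?u \<noteq> 0" using cu \<rho>[of n] by auto
    have "Im (\<Psi> (?J ?u)) = Im (Gr n ?u)"
    proof -
      have "of_real (\<alpha> * h) / ?u = cnj (of_real (\<alpha> * h / (\<rho> n)\<^sup>2) * ?u)"
      proof -
        have "cnj ?u * ?u = of_real ((\<rho> n)\<^sup>2)" using complex_norm_square[of ?u] cu by (simp add: mult.commute)
        then show ?thesis using u0 \<rho>[of n] by (simp add: field_simps)
      qed
      then have "\<Psi> (?J ?u) = Gr n ?u + (of_real (\<alpha> * h / (\<rho> n)\<^sup>2) * ?u + cnj (of_real (\<alpha> * h / (\<rho> n)\<^sup>2) * ?u))"
        unfolding G[OF u0] Gr_def by simp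
      then show ?thesis by (simp add: complex_add_cnj)
    qed
    moreover have iJ: "Im (?J ?u) = h * \<rho> n * (1 - 1 / (\<rho> n)\<^sup>2) * sin (2 * pi * t)"
      unfolding Im_joukowski cu h_def by (simp add: Ecs)
    have neg: "h * \<rho> n * (1 - 1 / (\<rho> n)\<^sup>2) < 0"
    proof -
      have "(\<rho> n)\<^sup>2 < 1" using \<rho>[of n] power_strict_mono[of "\<rho> n" 1 2] by simp
      then show ?thesis using \<rho>[of n] h0 by (intro mult_pos_neg) (auto simp: field_simps)
    qed
    have "Im (\<Psi> (?J ?u)) * sin (2 * pi * t) \<le> 0"
    proof (cases "sin (2 * pi * t)" "0::real" rule: linorder_cases)
      case less
      then have "Im (?J ?u) > 0" unfolding iJ using neg by (intro mult_neg_neg)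
      then show ?thesis using pos less by (intro mult_nonneg_nonpos) auto
    next
      case greater
      then have "Im (cnj (?J ?u)) > 0" using mult_neg_pos[OF neg greater] iJ by simp
      then have "Im (\<Psi> (cnj (?J ?u))) \<ge> 0" by (rule pos)
      moreover have "\<Psi> (cnj (?J ?u)) = cnj (\<Psi> (?J ?u))" using cu \<rho>[of n] u0 by (intro cnj joukowski_notin[OF cd]) auto
      ultimately have "Im (\<Psi> (?J ?u)) \<le> 0" by simp
      then show ?thesis using greater by (intro mult_nonpos_nonneg) auto
    qed simp
    then have "Im (Gr n ?u) * sin (2 * pi * t) \<le> 0" using calculation by simp
    then have "2 * h * (Im (Gr n ?u) * sin (2 * pi * t)) \<le> 0" by (rule mult_nonneg_nonpos[rotated]) (use h0 in simp)
    then show ?thesis unfolding q0_def by (simp add: mult.assoc)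
  qed
  have q0c: "continuous_on {0..1} (q0 n)" for n
  proof -
    have "continuous_on UNIV (\<lambda>t. Gr n (of_real (\<rho> n) * E t))"
    proof (rule continuous_on_compose2[OF holomorphic_on_imp_continuous_on[OF Grh]])
      show "continuous_on UNIV (\<lambda>t. of_real (\<rho> n) * E t)" unfolding E_def by (intro continuous_intros)
      show "range (\<lambda>t. of_real (\<rho> n) * E t) \<subseteq> ball 0 1" using \<rho>[of n] by (auto simp: norm_mult E1)
    qed
    then show ?thesis unfolding q0_def by (auto intro!: continuous_intros intro: continuous_on_subset)
  qed
  text \<open>Adding a vanishing constant keeps every mass positive, so that it can be normalized.\<close>
  define q where "q n t = q0 n t + inverse (real (Suc n))" for n t
  have qc: "continuous_on {0..1} (q n)" for n unfolding q_def by (intro continuous_intros q0c)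
  have qnn: "0 \<le> q n t" "0 < q n t" for n t
    unfolding q_def using q0nn[of n t] by (auto intro!: add_nonneg_pos add_nonneg_nonneg)
  define m where "m n = integral {0..1} (q n)" for n
  have mpos: "m n > 0" for n
  proof -
    have "0 < inverse (real (Suc n))" by simp
    also have "inverse (real (Suc n)) = integral {0..1} (\<lambda>t::real. inverse (real (Suc n)))" by simp
    also have "\<dots> \<le> integral {0..1} (q n)"
      by (rule integral_le) (auto intro!: integrable_continuous_real qc continuous_intros simp: q_def q0nn)
    finally show ?thesis by (simp add: m_def)
  qed
  define P where "P n = distr (density lborel (\<lambda>t. ennreal (indicator {0..1} t * (q n t / m n)))) borel x" for n
  have qmc: "continuous_on {0..1} (\<lambda>t. q n t / m n)" "0 \<le> q n t / m n" for n t
    using mpos[of n] qnn by (auto intro!: continuous_intros qc divide_nonneg_pos)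
  note Pf = measure_density_distr[OF qmc(1) qmc(2) xc, folded P_def]
  have Pd: "real_distribution (P n)" for n
  proof -
    have "integral {0..1} (\<lambda>t. q n t / m n) = integral {0..1} (q n) / m n" by (rule integral_divide)
    then have "emeasure (P n) (space (P n)) = 1" unfolding Pf(2) using mpos[of n] by (simp flip: m_def)
    then have "prob_space (P n)" by (rule prob_spaceI)
    then show ?thesis unfolding real_distribution_def real_distribution_axioms_def using Pf(3,4) by auto
  qed
  have PA: "AE y in P n. y \<in> {c..d}" for n by (rule Pf(5)) (use xI in auto)
  have "tight P" unfolding tight_def
  proof (intro conjI allI impI Pd)
    fix \<epsilon> :: real assume e: "\<epsilon> > 0"
    have "measure (P n) {c - 1<..d} > 1 - \<epsilon>" for n
    proof -
      interpret real_distribution "P n" by (rule Pd)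
      have "AE y in P n. y \<in> {c - 1<..d}" using PA by eventually_elim auto
      then have "prob {c - 1<..d} = 1" by (subst prob_eq_1) auto
      then show ?thesis using e by simp
    qed
    moreover have "c - 1 < d" using cd by simp
    ultimately show "\<exists>a b. a < b \<and> (\<forall>n. 1 - \<epsilon> < measure (P n) {a<..b})" by blast
  qed
  from tight_imp_convergent_subsubsequence[OF this, of id] obtain r Q where
    r: "strict_mono r" and Q: "real_distribution Q" and w: "weak_conv_m (P \<circ> r) Q"
    by (auto simp: strict_mono_def o_def id_def)
  interpret Q: real_distribution Q by (rule Q)
  have Pdr: "real_distribution ((P \<circ> r) n)" for n using Pd by simp
  note wl = weak_conv_imp_integral_bdd_continuous_conv[OF Pdr Q w, unfolded o_def]
  \<comment> \<open>Weak convergence controls integrals of bounded continuous functions only, so the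
    carrier of the limit is tested with the truncated distance to the segment.\<close>
  have QA: "AE y in Q. y \<in> {c..d}"
  proof -
    define f where "f y = min 1 (infdist y {c..d})" for y :: real
    have fc: "isCont f y" for y unfolding f_def by (intro continuous_intros)
    have fb: "norm (f y) \<le> 1" for y unfolding f_def by (simp add: infdist_nonneg)
    have z: "integral\<^sup>L (P n) f = 0" for n
    proof -
      have "AE y in P n. f y = 0" using PA by eventually_elim (simp add: f_def)
      then show ?thesis by (rule integral_eq_zero_AE)
    qed
    have "integral\<^sup>L Q f = 0" using wl[OF fc fb] unfolding z by (simp add: LIMSEQ_const_iff)
    moreover have "integrable Q f"
    proof (rule Q.integrable_const_bound[of _ 1])
      have "f \<in> borel_measurable borel"
        using fc by (intro borel_measurable_continuous_onI continuous_at_imp_continuous_on) blast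
      then show "f \<in> borel_measurable Q" by (simp cong: measurable_cong_sets)
    qed (use fb in simp)
    moreover have "AE y in Q. 0 \<le> f y" by (auto simp: f_def infdist_nonneg)
    ultimately have "AE y in Q. f y = 0" using integral_nonneg_eq_0_iff_AE by blast
    then show ?thesis
    proof eventually_elim
      case (elim y)
      then have "infdist y {c..d} = 0" by (auto simp: f_def min_def split: if_splits)
      then show ?case using in_closed_iff_infdist_zero[of "{c..d}" y] cd by auto
    qed
  qed
  \<comment> \<open>The limit, as \<rho> tends to 1, of the Cauchy transforms of the measures before
    normalization.\<close>
  define L where "L z = g 0 - (\<Psi> z - of_real \<alpha> * (z - of_real ((c + d) / 2)))" for z
  have key: "(\<lambda>n. of_real (m n) * (\<integral>y. 1 / (z - of_real y) \<partial>P n)) \<longlonglongrightarrow> L z" if z: "Im z > 0" for z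
  proof -
    have zD: "z \<notin> of_real ` {c..d}" using z by auto
    from joukowski_surj[OF cd this] obtain \<zeta> where \<zeta>: "\<zeta> \<noteq> 0" "cmod \<zeta> < 1" "?J \<zeta> = z" by blast
    have zx: "z - of_real (x t) = of_real h * (\<zeta> + 1 / \<zeta> - of_real (2 * cos (2 * pi * t)))" for t
      unfolding \<zeta>(3)[symmetric] joukowski_def x_def h_def by (simp add: algebra_simps)
    have zx0: "z - of_real (x t) \<noteq> 0" for t using z by (auto simp: complex_eq_iff)
    have kc: "continuous_on UNIV (\<lambda>y. 1 / (z - complex_of_real y))"
      using z by (auto intro!: continuous_intros simp: complex_eq_iff)
    have kxc: "continuous_on {0..1} (\<lambda>t. 1 / (z - complex_of_real (x t)))"
      using zx0 xc by (auto intro!: continuous_intros intro: continuous_on_subset)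
    have I0: "integral {0..1} (\<lambda>t. of_real (q0 n t) * (1 / (z - of_real (x t)))) = g 0 - Gr n (of_real (\<rho> n) * \<zeta>)" for n
    proof -
      from schwarz_circle_formula[OF Grh Grc \<rho> \<zeta>(1,2), of n n]
      have "((\<lambda>t. of_real (2 * Im (Gr n (of_real (\<rho> n) * E t)) * sin (2 * pi * t)) / (\<zeta> + 1 / \<zeta> - of_real (2 * cos (2 * pi * t))))
         has_integral (Gr n (of_real (\<rho> n) * \<zeta>) - Gr n 0)) {0..1}" unfolding E_def by blast
      then have "((\<lambda>t. - (of_real (2 * Im (Gr n (of_real (\<rho> n) * E t)) * sin (2 * pi * t)) / (\<zeta> + 1 / \<zeta> - of_real (2 * cos (2 * pi * t)))))
         has_integral - (Gr n (of_real (\<rho> n) * \<zeta>) - Gr n 0)) {0..1}" by (rule has_integral_neg)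
      moreover have "- (of_real (2 * Im (Gr n (of_real (\<rho> n) * E t)) * sin (2 * pi * t)) / (\<zeta> + 1 / \<zeta> - of_real (2 * cos (2 * pi * t))))
          = of_real (q0 n t) * (1 / (z - of_real (x t)))" for t
      proof -
        have "of_real (q0 n t) * (1 / (z - of_real (x t))) = of_real h * (- of_real (2 * Im (Gr n (of_real (\<rho> n) * E t)) * sin (2 * pi * t))) / (of_real h * (\<zeta> + 1 / \<zeta> - of_real (2 * cos (2 * pi * t))))"
          unfolding zx q0_def by (simp add: mult_ac)
        then show ?thesis using h0 by (simp only: mult_divide_mult_cancel_left of_real_eq_0_iff) simp
      qed
      ultimately show ?thesis by (simp only: integral_unique) (simp add: Gr_def)
    qed
    have "of_real (m n) * (\<integral>y. 1 / (z - of_real y) \<partial>P n) = g 0 - Gr n (of_real (\<rho> n) * \<zeta>)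
        + of_real (inverse (real (Suc n))) * integral {0..1} (\<lambda>t. 1 / (z - of_real (x t)))" for n
    proof -
      have "of_real (m n) * (\<integral>y. 1 / (z - of_real y) \<partial>P n) = of_real (m n) * integral {0..1} (\<lambda>t. (q n t / m n) *\<^sub>R (1 / (z - of_real (x t))))"
        by (subst Pf(1)[OF kc]) simp
      also have "\<dots> = integral {0..1} (\<lambda>t. of_real (m n) * ((q n t / m n) *\<^sub>R (1 / (z - of_real (x t)))))"
        by (rule integral_mult_right[symmetric])
      also have "\<dots> = integral {0..1} (\<lambda>t. of_real (q0 n t) * (1 / (z - of_real (x t))) + of_real (inverse (real (Suc n))) * (1 / (z - of_real (x t))))"
      proof (rule Henstock_Kurzweil_Integration.integral_cong)
        fix t
        have "of_real (m n) * ((q n t / m n) *\<^sub>R (1 / (z - of_real (x t)))) = of_real (m n * (q n t / m n)) * (1 / (z - of_real (x t)))"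
          by (simp only: scaleR_conv_of_real of_real_mult mult.assoc)
        also have "m n * (q n t / m n) = q0 n t + inverse (real (Suc n))" using mpos[of n] by (simp add: q_def)
        finally show "of_real (m n) * ((q n t / m n) *\<^sub>R (1 / (z - of_real (x t)))) =
          of_real (q0 n t) * (1 / (z - of_real (x t))) + of_real (inverse (real (Suc n))) * (1 / (z - of_real (x t)))"
          by (simp only: of_real_add distrib_right)
      qed
      also have "\<dots> = integral {0..1} (\<lambda>t. of_real (q0 n t) * (1 / (z - of_real (x t)))) + integral {0..1} (\<lambda>t. of_real (inverse (real (Suc n))) * (1 / (z - of_real (x t))))"
        by (intro Henstock_Kurzweil_Integration.integral_add integrable_continuous_real continuous_on_mult continuous_on_of_real q0c kxc continuous_on_const)
      finally show ?thesis unfolding I0 by (simp only: integral_mult_right)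
    qed
    moreover have "(\<lambda>n. g 0 - Gr n (of_real (\<rho> n) * \<zeta>) + of_real (inverse (real (Suc n))) * integral {0..1} (\<lambda>t. 1 / (z - of_real (x t))))
       \<longlonglongrightarrow> g 0 - (g (of_real 1 * \<zeta>) - of_real (\<alpha> * h / 1\<^sup>2) * (of_real 1 * \<zeta>)) + of_real 0 * integral {0..1} (\<lambda>t. 1 / (z - of_real (x t)))"
      unfolding Gr_def
    proof (intro tendsto_intros \<rho>1 LIMSEQ_inverse_real_of_nat)
      have "isCont g (of_real 1 * \<zeta>)" using holomorphic_on_imp_continuous_on[OF gh] \<zeta>(2) by (simp add: continuous_on_eq_continuous_at)
      then show "(\<lambda>n. g (of_real (\<rho> n) * \<zeta>)) \<longlonglongrightarrow> g (of_real 1 * \<zeta>)"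
        by (rule isCont_tendsto_compose) (intro tendsto_intros \<rho>1)
    qed simp
    moreover have "g 0 - (g (of_real 1 * \<zeta>) - of_real (\<alpha> * h / 1\<^sup>2) * (of_real 1 * \<zeta>)) + of_real 0 * integral {0..1} (\<lambda>t. 1 / (z - of_real (x t))) = L z"
    proof -
      have "z - of_real ((c + d) / 2) = of_real h * (\<zeta> + 1 / \<zeta>)" unfolding \<zeta>(3)[symmetric] joukowski_def h_def by simp
      then show ?thesis unfolding L_def \<zeta>(3)[symmetric] G[OF \<zeta>(1)] by (simp add: algebra_simps \<zeta>(3))
    qed
    ultimately show ?thesis by simp
  qed
  have pl: "(\<lambda>n. \<integral>y. 1 / (z - of_real y) \<partial>P (r n)) \<longlonglongrightarrow> (\<integral>y. 1 / (z - of_real y) \<partial>Q)" if z: "Im z > 0" for z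
  proof (rule wl[where B="1 / Im z"])
    show "isCont (\<lambda>y. 1 / (z - complex_of_real y)) y" for y using z by (auto intro!: continuous_intros simp: complex_eq_iff)
    show "norm (1 / (z - complex_of_real y)) \<le> 1 / Im z" for y
      using abs_Im_le_cmod[of "z - of_real y"] z unfolding norm_divide by (intro frac_le) auto
  qed
  have pp: "(\<integral>y. 1 / (z - of_real y) \<partial>Q) = ct Q (\<lambda>_. 1) z" for z :: complex by (simp add: ct_def)
  have Qm: "measure_on {c..d} Q" unfolding measure_on_def using QA Q.finite_measure_axioms by simp
  \<comment> \<open>The total masses are recovered as quotients of two convergent sequences of
    transforms at the point i, so the limit of the denominators must not vanish.\<close>
  have Qn0: "ct Q (\<lambda>_. 1) \<i> \<noteq> 0"
  proof
    assume z: "ct Q (\<lambda>_. 1) \<i> = 0"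
    have "Im (ct Q (\<lambda>_. 1) \<i>) = (\<integral>y. Im (1 / (\<i> - of_real y)) \<partial>Q)"
    proof -
      have "\<i> \<notin> complex_of_real ` {c..d}" by (auto simp: complex_eq_iff)
      from integrable_ct_integrand[OF Qm compact_Icc _ this, of "\<lambda>_. 1"]
      have "integrable Q (\<lambda>y. 1 / (\<i> - complex_of_real y))" by auto
      from integral_Im[OF this] show ?thesis unfolding ct_def by simp
    qed
    also have "\<dots> = (\<integral>y. - (1 / (1 + y\<^sup>2)) \<partial>Q)"
      by (intro Bochner_Integration.integral_cong refl) (simp add: Im_divide power2_eq_square add.commute)
    finally have "(\<integral>y. 1 / (1 + y\<^sup>2) \<partial>Q) = 0" using z by simp
    moreover have "integrable Q (\<lambda>y. 1 / (1 + y\<^sup>2))"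
      by (rule nd_integrable[OF Qm]) (auto intro!: continuous_intros simp: add_nonneg_eq_0_iff)
    ultimately have "AE y in Q. 1 / (1 + y\<^sup>2) = 0" by (subst (asm) integral_nonneg_eq_0_iff_AE) auto
    then have "AE y in Q. False" by eventually_elim (simp add: add_nonneg_eq_0_iff)
    then show False using Q.AE_False by simp
  qed
  have mr: "(\<lambda>n. of_real (m (r n)) * (\<integral>y. 1 / (z - of_real y) \<partial>P (r n))) \<longlonglongrightarrow> L z" if "Im z > 0" for z
    using LIMSEQ_subseq_LIMSEQ[OF key[OF that] r] by (simp add: o_def)
  have ml: "(\<lambda>n. complex_of_real (m (r n))) \<longlonglongrightarrow> L \<i> / ct Q (\<lambda>_. 1) \<i>"
  proof -
    have p0: "(\<lambda>n. \<integral>y. 1 / (\<i> - of_real y) \<partial>P (r n)) \<longlonglongrightarrow> ct Q (\<lambda>_. 1) \<i>" using pl[of \<i>] unfolding pp by simp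
    have "(\<lambda>n. of_real (m (r n)) * (\<integral>y. 1 / (\<i> - of_real y) \<partial>P (r n)) / (\<integral>y. 1 / (\<i> - of_real y) \<partial>P (r n))) \<longlonglongrightarrow> L \<i> / ct Q (\<lambda>_. 1) \<i>"
      by (intro tendsto_divide mr p0 Qn0) simp
    moreover have "\<forall>\<^sub>F n in sequentially. (\<integral>y. 1 / (\<i> - of_real y) \<partial>P (r n)) \<noteq> 0"
      using tendsto_imp_eventually_ne[OF p0 Qn0] .
    then have "\<forall>\<^sub>F n in sequentially. of_real (m (r n)) * (\<integral>y. 1 / (\<i> - of_real y) \<partial>P (r n)) / (\<integral>y. 1 / (\<i> - of_real y) \<partial>P (r n)) = of_real (m (r n))"
      by eventually_elim simp
    ultimately show ?thesis by (rule Lim_transform_eventually)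
  qed
  define \<mu> where "\<mu> = Re (L \<i> / ct Q (\<lambda>_. 1) \<i>)"
  have \<mu>l: "(\<lambda>n. m (r n)) \<longlonglongrightarrow> \<mu>" using tendsto_Re[OF ml] by (simp add: \<mu>_def)
  have \<mu>0: "\<mu> \<ge> 0" by (rule LIMSEQ_le_const[OF \<mu>l]) (use mpos in \<open>auto intro: less_imp_le\<close>)
  have Lz: "L z = of_real \<mu> * ct Q (\<lambda>_. 1) z" if "Im z > 0" for z
  proof (rule LIMSEQ_unique[OF mr[OF that]])
    show "(\<lambda>n. of_real (m (r n)) * (\<integral>y. 1 / (z - of_real y) \<partial>P (r n))) \<longlonglongrightarrow> of_real \<mu> * ct Q (\<lambda>_. 1) z"
      unfolding pp[symmetric] by (intro tendsto_intros \<mu>l pl that)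
  qed
  define N where "N = density Q (\<lambda>_. ennreal \<mu>)"
  have NA: "measure_on {c..d} N" unfolding measure_on_def
  proof (intro conjI)
    show "finite_measure N" 
    proof (rule finite_measureI)
      have "emeasure Q UNIV = 1" using Q.emeasure_space_1 by simp
      then show "emeasure N (space N) \<noteq> \<infinity>" by (simp add: N_def emeasure_density_const)
    qed
    show "sets N = sets borel" by (simp add: N_def)
    show "AE x in N. x \<in> {c..d}" unfolding N_def by (subst AE_density) (use QA in auto)
  qed
  have Nct: "ct N (\<lambda>_. 1) z = of_real \<mu> * ct Q (\<lambda>_. 1) z" for z :: complex
  proof -
    have "ct N (\<lambda>_. 1) z = (\<integral>y. \<mu> *\<^sub>R (of_real 1 / (z - of_real y)) \<partial>Q)"
      unfolding ct_def N_def by (rule integral_density) (use \<mu>0 in auto)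
    then show ?thesis unfolding ct_def of_real_1 scaleR_conv_of_real integral_mult_right_zero .
  qed
  show thesis
  proof (rule that[OF NA, of "Re (g 0) - \<alpha> * ((c + d) / 2)"])
    fix z :: complex assume z: "Im z > 0"
    have gR: "g 0 = of_real (Re (g 0))" using g0 by (simp add: complex_eq_iff)
    have "\<Psi> z = g 0 + of_real \<alpha> * (z - of_real ((c + d) / 2)) - L z" by (simp add: L_def)
    also have "\<dots> = of_real \<alpha> * z + of_real (Re (g 0) - \<alpha> * ((c + d) / 2)) - ct N (\<lambda>_. 1) z"
      unfolding Lz[OF z] Nct by (subst gR) (simp add: algebra_simps)
    finally show "\<Psi> z = of_real \<alpha> * z + of_real (Re (g 0) - \<alpha> * ((c + d) / 2)) - ct N (\<lambda>_. 1) z" .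
  qed
qed

lemma poly_tendsto_zero_on_imaginary_axis:
  fixes p :: "complex poly"
  assumes "((\<lambda>y. poly p (\<i> * of_real y)) \<longlongrightarrow> 0) at_top"
  shows "p = 0"
proof (cases "degree p = 0")
  case True
  then obtain a where "p = [:a:]" using degree_eq_zeroE by blast
  then show ?thesis using assms by (simp add: tendsto_const_iff)
next
  case False
  then have "filterlim (poly p) at_infinity at_infinity" by (intro filterlim_poly_at_infinity) simp
  moreover have "filterlim (\<lambda>y. \<i> * complex_of_real y) at_infinity at_top"
    by (simp add: filterlim_at_infinity_conv_norm_at_top norm_mult filterlim_abs_real)
  ultimately have "filterlim (\<lambda>y. poly p (\<i> * of_real y)) at_infinity at_top" by (rule filterlim_compose)
  then show ?thesis
    using not_tendsto_and_filterlim_at_infinity[OF _ assms] trivial_limit_at_top_linorder by blast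
qed

lemma ct_eq_poly_imp_zero:
  assumes M: "measure_on D M" "compact D" and f: "density_on D f"
    and e: "\<And>z. Im z > 0 \<Longrightarrow> ct M f z = poly p z"
  shows "p = 0"
proof (rule poly_tendsto_zero_on_imaginary_axis)
  have "filterlim (\<lambda>y. \<i> * complex_of_real y) at_infinity at_top"
    by (simp add: filterlim_at_infinity_conv_norm_at_top norm_mult filterlim_abs_real)
  then have "((\<lambda>y. ct M f (\<i> * complex_of_real y)) \<longlongrightarrow> 0) at_top"
    by (rule filterlim_compose[OF tendsto_ct_at_infinity[OF M f]])
  moreover have "\<forall>\<^sub>F y in at_top. ct M f (\<i> * complex_of_real y) = poly p (\<i> * of_real y)"
    using eventually_gt_at_top[of 0] by eventually_elim (rule e, simp)
  ultimately show "((\<lambda>y. poly p (\<i> * of_real y)) \<longlongrightarrow> 0) at_top"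
    by (rule Lim_transform_eventually)
qed

section \<open>Reciprocals of Cauchy transforms with densities of constant sign\<close>

definition nonvanishing_density :: "real set \<Rightarrow> (real \<Rightarrow> real) \<Rightarrow> bool" where
  "nonvanishing_density D \<rho> \<longleftrightarrow> density_on D \<rho> \<and> (\<forall>x\<in>D. \<rho> x \<noteq> 0)"

lemma nonvanishing_densityD:
  "nonvanishing_density D \<rho> \<Longrightarrow> density_on D \<rho>" "nonvanishing_density D \<rho> \<Longrightarrow> x \<in> D \<Longrightarrow> \<rho> x \<noteq> 0"
  by (auto simp: nonvanishing_density_def)

lemma nonvanishing_density_sign:
  assumes "nonvanishing_density {c..d} \<rho>"
  obtains e where "e \<in> {1, -1 :: real}" "\<And>x. x \<in> {c..d} \<Longrightarrow> 0 < e * \<rho> x"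
  using connected_const_sign[of "{c..d}" \<rho>] assms unfolding nonvanishing_density_def density_on_def by auto

lemma integral_nonvanishing_density:
  assumes M: "nondegenerate_on {c..d} M" and \<rho>: "nonvanishing_density {c..d} \<rho>"
  shows "integral\<^sup>L M \<rho> \<noteq> 0"
proof -
  note M' = nondegenerate_onD[OF M] compact_Icc[of c d]
  from nonvanishing_density_sign[OF \<rho>] obtain e where e: "e \<in> {1, -1}" "\<And>x. x \<in> {c..d} \<Longrightarrow> 0 < e * \<rho> x" by blast
  have "0 < (\<integral>x. e * \<rho> x \<partial>M)"
  proof (rule nd_integral_pos[OF M' M])
    have "{x \<in> {c..d}. e * \<rho> x = 0} = {}" using e(2) by force
    then show "finite {x \<in> {c..d}. e * \<rho> x = 0}" by (simp only: finite.emptyI)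
  qed (use e(2) nonvanishing_densityD(1)[OF \<rho>] in \<open>auto simp: density_on_def intro!: continuous_intros intro: less_imp_le\<close>)
  then show ?thesis by auto
qed

lemma Im_ct_nonvanishing:
  assumes M: "nondegenerate_on {c..d} M" and \<rho>: "density_on {c..d} \<rho>"
    and e: "\<And>x. x \<in> {c..d} \<Longrightarrow> 0 < e * \<rho> x" and z: "Im z > 0"
  shows "e * Im (ct M \<rho> z) < 0"
proof -
  note M' = nondegenerate_onD[OF M] compact_Icc[of c d]
  have "{x \<in> {c..d}. e * \<rho> x = 0} = {}" using e by force
  then have "finite {x \<in> {c..d}. e * \<rho> x = 0}" by (simp only: finite.emptyI)
  from Im_ct_neg[OF M' M density_on_cmult[OF \<rho>] less_imp_le[OF e] this z] have "Im (ct M (\<lambda>x. e * \<rho> x) z) < 0" .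
  then show ?thesis unfolding ct_cmult[OF M'] by simp
qed

text \<open>For x off the segment, the quotient of the density by x - y is itself a nonvanishing
  density, and its integral is therefore not zero.\<close>

lemma ct_real_nonzero:
  assumes M: "nondegenerate_on {c..d} M" and \<rho>: "nonvanishing_density {c..d} \<rho>" and x: "x \<notin> {c..d}"
  shows "ct M \<rho> (x :: real) \<noteq> 0"
proof -
  have \<rho>d: "\<rho> \<in> borel_measurable borel" "continuous_on {c..d} \<rho>" using \<rho> by (auto simp: nonvanishing_density_def density_on_def)
  have "nonvanishing_density {c..d} (\<lambda>y. \<rho> y / (x - y))"
    unfolding nonvanishing_density_def density_on_def
  proof (intro conjI)
    show "(\<lambda>y. \<rho> y / (x - y)) \<in> borel_measurable borel" using \<rho>d by measurable
  qed (use \<rho>d x nonvanishing_densityD(2)[OF \<rho>] in \<open>auto intro!: continuous_intros\<close>)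
  from integral_nonvanishing_density[OF M this] show ?thesis by (simp add: ct_def)
qed

text \<open>Nondegeneracy of the representing measure survives because otherwise the function would be rational.\<close>

theorem reciprocal_ct:
  assumes cd: "c < d" and M: "nondegenerate_on {c..d} M" and \<rho>: "nonvanishing_density {c..d} \<rho>"
    and nz: "\<And>x::real. x \<notin> {c..d} \<Longrightarrow> a + ct M \<rho> x \<noteq> 0"
  obtains N e \<alpha> \<beta> where "nondegenerate_on {c..d} N" "e \<noteq> 0" "a \<noteq> 0 \<Longrightarrow> \<alpha> = 0"
    "\<And>z. Im z > 0 \<Longrightarrow> 1 / (of_real a + ct M \<rho> z) = of_real \<alpha> * z + of_real \<beta> + ct N (\<lambda>_. e) z"
proof -
  let ?D = "complex_of_real ` {c..d}"
  note M' = nondegenerate_onD[OF M] compact_Icc[of c d]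
  note \<rho>d = nonvanishing_densityD(1)[OF \<rho>]
  from nonvanishing_density_sign[OF \<rho>] obtain e where e: "e \<in> {1, -1}" "\<And>x. x \<in> {c..d} \<Longrightarrow> 0 < e * \<rho> x" by blast
  define T where "T z = of_real a + ct M \<rho> z" for z :: complex
  have Tc: "T (cnj z) = cnj (T z)" for z by (simp add: T_def ct_cnj[OF M'])
  have ImT: "e * Im (T z) < 0" if "Im z > 0" for z
    using Im_ct_nonvanishing[OF M \<rho>d e(2) that] by (simp add: T_def)
  have T0: "T z \<noteq> 0" if "z \<notin> ?D" for z
  proof (cases "Im z" "0::real" rule: linorder_cases)
    case less
    then have "e * Im (T (cnj z)) < 0" by (intro ImT) simp
    then show ?thesis unfolding Tc by auto
  next
    case equal
    then obtain x where x: "z = of_real x" by (metis complex_is_Real_iff Reals_cases)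
    then have "x \<notin> {c..d}" using that by auto
    then show ?thesis using nz ct_of_real[OF M' \<rho>d] unfolding T_def x by (simp flip: of_real_add)
  next
    case greater then show ?thesis using ImT by fastforce
  qed
  define I where "I = integral\<^sup>L M \<rho>"
  have I0: "I \<noteq> 0" unfolding I_def by (rule integral_nonvanishing_density[OF M \<rho>])
  \<comment> \<open>For a = 0 the function T behaves like I / z at infinity, so e / T grows linearly
    with coefficient e / I; otherwise it stays bounded there.\<close>
  define \<alpha> where "\<alpha> = (if a = 0 then e / I else 0)"
  define \<Psi> where "\<Psi> z = of_real e / T z" for z
  obtain N \<beta> where N: "measure_on {c..d} N" "\<And>z. Im z > 0 \<Longrightarrow> \<Psi> z = of_real \<alpha> * z + of_real \<beta> - ct N (\<lambda>_. 1) z"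
  proof (rule nevanlinna_compact_representation[OF cd])
    show "\<Psi> holomorphic_on - ?D" unfolding \<Psi>_def T_def
      using T0 by (intro holomorphic_intros holomorphic_on_ct[OF M' \<rho>d]) (auto simp: T_def)
    show "\<Psi> (cnj z) = cnj (\<Psi> z)" for z by (simp add: \<Psi>_def Tc)
    show "Im (\<Psi> z) \<ge> 0" if "Im z > 0" for z
    proof -
      have "Im (\<Psi> z) = - (e * Im (T z)) / ((Re (T z))\<^sup>2 + (Im (T z))\<^sup>2)" unfolding \<Psi>_def by (simp add: Im_divide)
      moreover have "0 \<le> - (e * Im (T z)) / ((Re (T z))\<^sup>2 + (Im (T z))\<^sup>2)"
        by (rule divide_nonneg_nonneg) (use ImT[OF that] in auto)
      ultimately show ?thesis by simp
    qed
    have Tl: "(T \<longlongrightarrow> of_real a + 0) at_infinity" unfolding T_def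
      by (intro tendsto_intros tendsto_ct_at_infinity[OF M' \<rho>d])
    have inv: "((\<lambda>z::complex. 1 / z) \<longlongrightarrow> 0) at_infinity"
      using tendsto_inverse_0 by (simp add: divide_inverse)
    show "((\<lambda>z. \<Psi> z / z) \<longlongrightarrow> of_real \<alpha>) at_infinity"
    proof (cases "a = 0")
      case True
      have "((\<lambda>z. of_real e / (z * ct M \<rho> z)) \<longlongrightarrow> of_real e / of_real I) at_infinity"
        unfolding I_def by (intro tendsto_intros tendsto_z_ct_at_infinity[OF M' \<rho>d]) (use I0 I_def in simp)
      then show ?thesis using True by (simp add: \<Psi>_def T_def \<alpha>_def mult.commute)
    next
      case False
      have "((\<lambda>z. of_real e / T z * (1 / z)) \<longlongrightarrow> of_real e / (of_real a + 0) * 0) at_infinity"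
        by (intro tendsto_mult tendsto_divide tendsto_const Tl inv) (use False in simp)
      then show ?thesis using False by (simp add: \<Psi>_def \<alpha>_def)
    qed
  qed auto
  have ee: "e * e = 1" using e(1) by auto
  have rT: "1 / T z = of_real (e * \<alpha>) * z + of_real (e * \<beta>) + ct N (\<lambda>_. - e) z" if "Im z > 0" for z
  proof -
    have "1 / T z = of_real e * \<Psi> z" using ee by (simp add: \<Psi>_def flip: of_real_mult)
    also have "\<dots> = of_real (e * \<alpha>) * z + of_real (e * \<beta>) + of_real (- e) * ct N (\<lambda>_. 1) z"
      unfolding N(2)[OF that] by (simp add: algebra_simps)
    also have "of_real (- e) * ct N (\<lambda>_. 1) z = ct N (\<lambda>_. - e * 1) z" by (rule ct_cmult[OF N(1), symmetric]) simp
    finally show ?thesis by simp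
  qed
  have "nondegenerate_on {c..d} N"
    unfolding nondegenerate_on_def
  proof (intro conjI allI impI notI)
    fix F :: "real set" assume F: "finite F" "AE x in N. x \<in> F"
    note N' = N(1) compact_Icc[of c d]
    let ?c = "\<lambda>p. map_poly complex_of_real p"
    \<comment> \<open>If the measure sat on the finite set F, this polynomial would annihilate its
      transform and make 1 / T rational, with p = B T. Then B times the transform of \<rho> is a
      polynomial, so the transform of B \<rho> vanishes, hence also that of B^2 \<rho>, although
      this density keeps a constant sign.\<close>
    define p where "p = (\<Prod>y\<in>F. [:- y, 1:])"
    have p0: "p \<noteq> 0" and pF: "\<And>y. y \<in> F \<Longrightarrow> poly p y = 0"
      using F(1) by (auto simp: p_def poly_prod)
    have d1: "density_on {c..d} (\<lambda>_. - e)" by auto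
    from poly_ct[OF N' d1, of p, where 'a=complex] obtain q where q:
      "\<And>z. z \<notin> ?D \<Longrightarrow> poly (?c p) z * ct N (\<lambda>_. - e) z = ct N (\<lambda>x. poly p x * - e) z + poly (?c q) z" by blast
    have z0: "ct N (\<lambda>x. poly p x * - e) z = 0" for z :: complex
      unfolding ct_def by (rule integral_eq_zero_AE) (use F(2) in eventually_elim, simp add: pF)
    define B where "B = p * [:e * \<beta>, e * \<alpha>:] + q"
    have nD: "z \<notin> ?D" if "Im z > 0" for z using that by auto
    have B: "poly (?c p) z = poly (?c B) z * T z" if "Im z > 0" for z
    proof -
      have "poly (?c p) z * (1 / T z) = poly (?c B) z"
        unfolding rT[OF that] distrib_left q[OF nD[OF that]] z0 B_def
        by (simp add: poly_of_real_simps map_poly_pCons algebra_simps)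
      then show ?thesis using T0[OF nD[OF that]] by (simp add: field_simps)
    qed
    have B0: "B \<noteq> 0"
    proof
      assume "B = 0"
      then have "poly (?c p) z = 0" if "Im z > 0" for z using B[OF that] by simp
      then have "((\<lambda>y. poly (?c p) (\<i> * of_real y)) \<longlongrightarrow> 0) at_top"
        by (intro tendsto_eventually) (use eventually_gt_at_top[of 0] in eventually_elim, simp)
      then have "?c p = 0" by (rule poly_tendsto_zero_on_imaginary_axis)
      then show False using p0 by (simp add: map_poly_of_real_eq_0_iff)
    qed
    have B\<rho>: "density_on {c..d} (\<lambda>x. poly B x * \<rho> x)" "density_on {c..d} (\<lambda>x. poly B x * (poly B x * \<rho> x))"
      by (intro density_on_intros(5) density_on_poly \<rho>d)+
    from poly_ct[OF M' \<rho>d, of B, where 'a=complex] obtain q1 where q1: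
      "\<And>z. z \<notin> ?D \<Longrightarrow> poly (?c B) z * ct M \<rho> z = ct M (\<lambda>x. poly B x * \<rho> x) z + poly (?c q1) z" by blast
    have R0: "?c p - smult (of_real a) (?c B) - ?c q1 = 0"
    proof (rule ct_eq_poly_imp_zero[OF M' B\<rho>(1)])
      fix z :: complex assume z: "Im z > 0"
      show "ct M (\<lambda>x. poly B x * \<rho> x) z = poly (?c p - smult (of_real a) (?c B) - ?c q1) z"
        using B[OF z] q1[OF nD[OF z]] by (simp add: T_def algebra_simps)
    qed
    have z1: "ct M (\<lambda>x. poly B x * \<rho> x) z = 0" if "Im z > 0" for z
    proof -
      have "poly (?c p - smult (of_real a) (?c B) - ?c q1) z = 0" unfolding R0 by simp
      then show ?thesis using B[OF that] q1[OF nD[OF that]] by (simp add: T_def algebra_simps)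
    qed
    from poly_ct[OF M' B\<rho>(1), of B, where 'a=complex] obtain q2 where q2:
      "\<And>z. z \<notin> ?D \<Longrightarrow> poly (?c B) z * ct M (\<lambda>x. poly B x * \<rho> x) z = ct M (\<lambda>x. poly B x * (poly B x * \<rho> x)) z + poly (?c q2) z" by blast
    have "- ?c q2 = 0"
    proof (rule ct_eq_poly_imp_zero[OF M' B\<rho>(2)])
      fix z :: complex assume z: "Im z > 0"
      from q2[OF nD[OF z]] show "ct M (\<lambda>x. poly B x * (poly B x * \<rho> x)) z = poly (- ?c q2) z"
        unfolding z1[OF z] by (simp add: eq_neg_iff_add_eq_0)
    qed
    then have z2: "ct M (\<lambda>x. poly B x * (poly B x * \<rho> x)) \<i> = 0" using q2[of \<i>] z1[of \<i>] nD[of \<i>] by simp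
    have fin: "finite {x \<in> {c..d}. e * (poly B x * (poly B x * \<rho> x)) = 0}"
      by (rule finite_subset[OF _ poly_roots_finite[OF B0]]) (use e(2) in \<open>force\<close>)
    have "Im (ct M (\<lambda>x. e * (poly B x * (poly B x * \<rho> x))) \<i>) < 0"
    proof (rule Im_ct_neg[OF M' M _ _ fin])
      fix x assume "x \<in> {c..d}"
      from mult_nonneg_nonneg[OF zero_le_square[of "poly B x"] less_imp_le[OF e(2)[OF this]]]
      show "0 \<le> e * (poly B x * (poly B x * \<rho> x))" by (simp add: mult_ac)
    qed (use density_on_cmult[OF B\<rho>(2)] in auto)
    then show False unfolding ct_cmult[OF M'] z2 by simp
  qed (rule N(1))
  moreover have "- e \<noteq> 0" using e(1) by auto
  moreover have "a \<noteq> 0 \<Longrightarrow> e * \<alpha> = 0" by (simp add: \<alpha>_def)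
  ultimately show thesis using that rT unfolding T_def by blast
qed

section \<open>Boundary values on the real axis and the two cancellation identities\<close>

definition boundary_value :: "(complex \<Rightarrow> complex) \<Rightarrow> real \<Rightarrow> real \<Rightarrow> bool" where
  "boundary_value F x y \<longleftrightarrow> ((\<lambda>\<epsilon>. F (Complex x \<epsilon>)) \<longlongrightarrow> complex_of_real y) (at_right 0)"

lemma boundary_value_unique: "boundary_value F x y \<Longrightarrow> boundary_value F x y' \<Longrightarrow> y = y'"
  unfolding boundary_value_def using tendsto_unique[OF trivial_limit_at_right_real] of_real_eq_iff by blast

lemma boundary_value_cong:
  assumes "boundary_value F x y" "\<And>z. Im z > 0 \<Longrightarrow> F z = G z"
  shows "boundary_value G x y"
proof -
  have "\<forall>\<^sub>F \<epsilon> in at_right 0. F (Complex x \<epsilon>) = G (Complex x \<epsilon>)"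
    unfolding eventually_at_right_field by (rule exI[of _ 1]) (use assms(2) in auto)
  then show ?thesis using assms(1) unfolding boundary_value_def by (rule Lim_transform_eventually[rotated])
qed

lemma boundary_value_const [simp]: "boundary_value (\<lambda>_. 1) x 1"
  by (simp add: boundary_value_def)

lemma boundary_value_mult:
  "boundary_value F x y \<Longrightarrow> boundary_value G x w \<Longrightarrow> boundary_value (\<lambda>z. F z * G z) x (y * w)"
  unfolding boundary_value_def by (simp add: tendsto_mult)

lemma boundary_value_divide:
  "boundary_value F x y \<Longrightarrow> boundary_value G x w \<Longrightarrow> w \<noteq> 0 \<Longrightarrow> boundary_value (\<lambda>z. F z / G z) x (y / w)"
  unfolding boundary_value_def by (simp add: tendsto_divide)

lemma boundary_value_linear_ct:
  assumes "measure_on D M" "compact D" "density_on D f" "x \<notin> D"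
  shows "boundary_value (\<lambda>z. of_real \<alpha> * z + of_real \<beta> + ct M f z) x (\<alpha> * x + \<beta> + ct M f x)"
proof -
  have "((\<lambda>\<epsilon>. Complex x \<epsilon>) \<longlongrightarrow> of_real x) (at_right 0)"
    unfolding complex_of_real_def by (intro tendsto_intros)
  then have "((\<lambda>\<epsilon>. of_real \<alpha> * Complex x \<epsilon> + of_real \<beta> + ct M f (Complex x \<epsilon>)) \<longlongrightarrow> of_real \<alpha> * of_real x + of_real \<beta> + of_real (ct M f x)) (at_right 0)"
    by (rule tendsto_add[OF tendsto_add[OF tendsto_mult[OF tendsto_const] tendsto_const] ct_Complex_tendsto[OF assms]])
  then show ?thesis unfolding boundary_value_def by simp
qed

lemma filterlim_imaginary_axis: "filterlim (\<lambda>y. \<i> * complex_of_real y) at_infinity at_top"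
  by (simp add: filterlim_at_infinity_conv_norm_at_top norm_mult filterlim_abs_real)

lemma ct_imaginary_axis:
  assumes "measure_on D M" "compact D" "density_on D f"
  shows "((\<lambda>y. ct M f (\<i> * complex_of_real y)) \<longlongrightarrow> 0) at_top"
    and "((\<lambda>y. \<i> * complex_of_real y * ct M f (\<i> * complex_of_real y)) \<longlongrightarrow> of_real (integral\<^sup>L M f)) at_top"
  using filterlim_compose[OF tendsto_ct_at_infinity[OF assms] filterlim_imaginary_axis]
    filterlim_compose[OF tendsto_z_ct_at_infinity[OF assms] filterlim_imaginary_axis] by simp_all

text \<open>The transform vanishes along the imaginary axis, so a finite limit there leaves no room
  for a linear term. The growth of ratios at infinity is read off in this way.\<close>

lemma linear_ct_bounded_imp:
  assumes M: "measure_on D M" "compact D" "density_on D f"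
    and l: "((\<lambda>y. of_real \<alpha> * (\<i> * complex_of_real y) + of_real \<beta> + ct M f (\<i> * complex_of_real y)) \<longlongrightarrow> L) at_top"
  shows "\<alpha> = 0 \<and> of_real \<beta> = L"
proof -
  have "((\<lambda>y. of_real \<alpha> * (\<i> * complex_of_real y) + of_real \<beta> + ct M f (\<i> * complex_of_real y) - ct M f (\<i> * complex_of_real y)) \<longlongrightarrow> L - 0) at_top"
    by (rule tendsto_diff[OF l ct_imaginary_axis(1)[OF M]])
  then have *: "((\<lambda>y. poly [:of_real \<beta> - L, of_real \<alpha>:] (\<i> * complex_of_real y)) \<longlongrightarrow> 0) at_top"
    by (simp add: Lim_null[of _ L] algebra_simps)
  have "[:of_real \<beta> - L, complex_of_real \<alpha>:] = 0" by (rule poly_tendsto_zero_on_imaginary_axis[OF *])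
  then show ?thesis by simp
qed

text \<open>On D the two densities differ by the very factor that multiplies the second function,
  and \<open>ct_mult_ct\<close> produces the same integral over D. Hence the transforms over D
  cancel and a constant plus a transform over E remains. The condition on \<open>c\<^sub>i\<close>
  and \<alpha> removes the term linear in z.\<close>

lemma quotient_step:
  assumes N: "measure_on D N" "compact D" and M: "measure_on E M" "compact E" and DE: "D \<inter> E = {}"
    and \<eta>: "density_on D \<eta>\<^sub>i" "density_on D \<eta>\<^sub>j" and \<rho>: "density_on E \<rho>"
    and q: "\<And>x. x \<in> D \<Longrightarrow> \<eta>\<^sub>j x = \<eta>\<^sub>i x * (\<alpha> * x + \<beta> + ct M \<rho> x)"
    and ca: "c\<^sub>i * \<alpha> = 0" and z: "Im z > 0"
  shows "of_real c\<^sub>j + ct N \<eta>\<^sub>j z - (of_real c\<^sub>i + ct N \<eta>\<^sub>i z) * (of_real \<alpha> * z + of_real \<beta> + ct M \<rho> z)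
     = of_real (c\<^sub>j - \<alpha> * integral\<^sup>L N \<eta>\<^sub>i - c\<^sub>i * \<beta>) + ct M (\<lambda>y. - (c\<^sub>i + ct N \<eta>\<^sub>i y) * \<rho> y) z"
proof -
  have zD: "z \<notin> complex_of_real ` D" "z \<notin> complex_of_real ` E" using z by auto
  have dM: "density_on D (ct M \<rho>)" and dN: "density_on E (ct N \<eta>\<^sub>i)"
    using density_on_ct[OF M \<rho>] density_on_ct[OF N \<eta>(1)] DE by auto
  have d1: "density_on D (\<lambda>x. x * \<eta>\<^sub>i x)" "density_on D (\<lambda>x. \<eta>\<^sub>i x * ct M \<rho> x)"
    using \<eta> dM by auto
  have d2: "density_on D (\<lambda>x. \<alpha> * (x * \<eta>\<^sub>i x))" "density_on D (\<lambda>x. \<beta> * \<eta>\<^sub>i x)"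
    by (intro density_on_cmult d1 \<eta>)+
  have d3: "density_on E (\<lambda>y. \<rho> y * ct N \<eta>\<^sub>i y)" using \<rho> dN by auto
  have "ct N \<eta>\<^sub>j z = ct N (\<lambda>x. (\<alpha> * (x * \<eta>\<^sub>i x) + \<beta> * \<eta>\<^sub>i x) + \<eta>\<^sub>i x * ct M \<rho> x) z"
    by (rule ct_cong[OF N \<eta>(2)]) (use d1 d2 q in \<open>auto simp: algebra_simps\<close>)
  also have "\<dots> = of_real \<alpha> * ct N (\<lambda>x. x * \<eta>\<^sub>i x) z + of_real \<beta> * ct N \<eta>\<^sub>i z + ct N (\<lambda>x. \<eta>\<^sub>i x * ct M \<rho> x) z"
    using ct_add[OF N density_on_intros(3)[OF d2] d1(2) zD(1)] ct_add[OF N d2 zD(1)] by (simp only: ct_cmult[OF N])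
  finally have e1: "ct N \<eta>\<^sub>j z = of_real \<alpha> * (z * ct N \<eta>\<^sub>i z - of_real (integral\<^sup>L N \<eta>\<^sub>i)) + of_real \<beta> * ct N \<eta>\<^sub>i z + ct N (\<lambda>x. \<eta>\<^sub>i x * ct M \<rho> x) z"
    using z_ct[OF N \<eta>(1) zD(1)] by simp
  have "ct M (\<lambda>y. - (c\<^sub>i + ct N \<eta>\<^sub>i y) * \<rho> y) z = ct M (\<lambda>y. (- c\<^sub>i) * \<rho> y + (-1) * (\<rho> y * ct N \<eta>\<^sub>i y)) z"
    by (simp add: algebra_simps)
  also have "\<dots> = of_real (- c\<^sub>i) * ct M \<rho> z + of_real (-1) * ct M (\<lambda>y. \<rho> y * ct N \<eta>\<^sub>i y) z"
    unfolding ct_add[OF M density_on_cmult[OF \<rho>] density_on_cmult[OF d3] zD(2)] ct_cmult[OF M] ..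
  finally have e2: "ct M (\<lambda>y. - (c\<^sub>i + ct N \<eta>\<^sub>i y) * \<rho> y) z = of_real (- c\<^sub>i) * ct M \<rho> z + of_real (-1) * ct M (\<lambda>y. \<rho> y * ct N \<eta>\<^sub>i y) z" .
  have e3: "ct N \<eta>\<^sub>i z * ct M \<rho> z = ct N (\<lambda>x. \<eta>\<^sub>i x * ct M \<rho> x) z + ct M (\<lambda>y. \<rho> y * ct N \<eta>\<^sub>i y) z"
    by (rule ct_mult_ct[OF N M DE \<eta>(1) \<rho> zD])
  have ca': "of_real c\<^sub>i * complex_of_real \<alpha> = 0" using ca by (metis of_real_0 of_real_mult)
  define A B C G H w where "A = ct N \<eta>\<^sub>i z" and "B = ct M \<rho> z" and "C = ct N (\<lambda>x. \<eta>\<^sub>i x * ct M \<rho> x) z"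
    and "G = ct M (\<lambda>y. \<rho> y * ct N \<eta>\<^sub>i y) z" and "H = complex_of_real (integral\<^sup>L N \<eta>\<^sub>i)" and "w = of_real c\<^sub>i * complex_of_real \<alpha>"
  have "of_real c\<^sub>j + (of_real \<alpha> * (z * A - H) + of_real \<beta> * A + C) - (of_real c\<^sub>i + A) * (of_real \<alpha> * z + of_real \<beta> + B)
     = of_real c\<^sub>j - of_real \<alpha> * H - of_real c\<^sub>i * of_real \<beta> + (- of_real c\<^sub>i * B + - (A * B - C)) - w * z"
    unfolding w_def by (simp add: algebra_simps)
  moreover have "A * B - C = G" using e3 by (simp add: A_def B_def C_def G_def)
  moreover have "w = 0" using ca' by (simp add: w_def)
  ultimately show ?thesis unfolding e1 e2 A_def[symmetric] B_def[symmetric] C_def[symmetric] G_def[symmetric] H_def[symmetric]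
    by (simp add: H_def)
qed

text \<open>The dual cancellation: the relation \<open>r\<close> between the densities on E makes
  all transforms over E drop out, so that the result is carried by D, up to a linear
  polynomial.\<close>

lemma reciprocal_step:
  assumes \<kappa>: "measure_on D \<kappa>" "compact D" and M: "measure_on E M" "compact E" and DE: "D \<inter> E = {}"
    and \<rho>: "density_on E \<rho>'" "density_on E \<rho>" 
    and r: "\<And>y. y \<in> E \<Longrightarrow> (\<alpha>\<^sub>0 * y + \<beta>\<^sub>0 + ct \<kappa> (\<lambda>_. e) y) * \<rho> y = - \<rho>' y"
    and z: "Im z > 0"
  shows "(of_real \<alpha>\<^sub>0 * z + of_real \<beta>\<^sub>0 + ct \<kappa> (\<lambda>_. e) z) * (of_real a + ct M \<rho> z) + (of_real \<alpha> * z + of_real \<beta> + ct M \<rho>' z)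
    = of_real (\<alpha> + a * \<alpha>\<^sub>0) * z + of_real (\<beta> + a * \<beta>\<^sub>0 + \<alpha>\<^sub>0 * integral\<^sup>L M \<rho>) + ct \<kappa> (\<lambda>x. e * (a + ct M \<rho> x)) z"
proof -
  have zD: "z \<notin> complex_of_real ` D" "z \<notin> complex_of_real ` E" using z by auto
  have d0: "density_on D (\<lambda>_. e)" by auto
  have dM: "density_on D (ct M \<rho>)" and dN: "density_on E (ct \<kappa> (\<lambda>_. e))"
    using density_on_ct[OF M \<rho>(2)] density_on_ct[OF \<kappa> d0] DE by auto
  have d1: "density_on E (\<lambda>x. x * \<rho> x)" "density_on E (\<lambda>x. \<rho> x * ct \<kappa> (\<lambda>_. e) x)" "density_on D (\<lambda>x. e * ct M \<rho> x)"
    using \<rho> dN dM by (auto intro: density_on_cmult)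
  have d2: "density_on E (\<lambda>x. \<alpha>\<^sub>0 * (x * \<rho> x))" "density_on E (\<lambda>x. \<beta>\<^sub>0 * \<rho> x)"
    by (intro density_on_cmult d1 \<rho>)+
  have "ct M (\<lambda>y. - \<rho>' y) z = ct M (\<lambda>y. (\<alpha>\<^sub>0 * (y * \<rho> y) + \<beta>\<^sub>0 * \<rho> y) + \<rho> y * ct \<kappa> (\<lambda>_. e) y) z"
    by (rule ct_cong[OF M]) (use \<rho> d1 d2 r in \<open>auto simp: algebra_simps\<close>)
  also have "\<dots> = of_real \<alpha>\<^sub>0 * ct M (\<lambda>x. x * \<rho> x) z + of_real \<beta>\<^sub>0 * ct M \<rho> z + ct M (\<lambda>x. \<rho> x * ct \<kappa> (\<lambda>_. e) x) z"
    using ct_add[OF M density_on_intros(3)[OF d2] d1(2) zD(2)] ct_add[OF M d2 zD(2)] by (simp only: ct_cmult[OF M])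
  finally have e1: "- ct M \<rho>' z = of_real \<alpha>\<^sub>0 * (z * ct M \<rho> z - of_real (integral\<^sup>L M \<rho>)) + of_real \<beta>\<^sub>0 * ct M \<rho> z + ct M (\<lambda>x. \<rho> x * ct \<kappa> (\<lambda>_. e) x) z"
    using z_ct[OF M \<rho>(2) zD(2)] by (simp add: ct_minus[OF M])
  have "ct \<kappa> (\<lambda>x. e * (a + ct M \<rho> x)) z = ct \<kappa> (\<lambda>x. a * e + e * ct M \<rho> x) z" by (simp add: algebra_simps)
  also have "\<dots> = of_real a * ct \<kappa> (\<lambda>_. e) z + ct \<kappa> (\<lambda>x. e * ct M \<rho> x) z"
    unfolding ct_add[OF \<kappa> density_on_cmult[OF d0] d1(3) zD(1)] ct_cmult[OF \<kappa>] ..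
  finally have e2: "ct \<kappa> (\<lambda>x. e * (a + ct M \<rho> x)) z = of_real a * ct \<kappa> (\<lambda>_. e) z + ct \<kappa> (\<lambda>x. e * ct M \<rho> x) z" .
  have e3: "ct \<kappa> (\<lambda>_. e) z * ct M \<rho> z = ct \<kappa> (\<lambda>x. e * ct M \<rho> x) z + ct M (\<lambda>y. \<rho> y * ct \<kappa> (\<lambda>_. e) y) z"
    by (rule ct_mult_ct[OF \<kappa> M DE d0 \<rho>(2) zD])
  define A B C G H P where "A = ct \<kappa> (\<lambda>_. e) z" and "B = ct M \<rho> z" and "C = ct \<kappa> (\<lambda>x. e * ct M \<rho> x) z"
    and "G = ct M (\<lambda>y. \<rho> y * ct \<kappa> (\<lambda>_. e) y) z" and "H = complex_of_real (integral\<^sup>L M \<rho>)" and "P = ct M \<rho>' z"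
  have P: "P = - (of_real \<alpha>\<^sub>0 * (z * B - H) + of_real \<beta>\<^sub>0 * B + G)"
    using arg_cong[OF e1, of uminus] unfolding A_def B_def C_def G_def H_def P_def by simp
  have AB: "A * B = C + G" using e3 by (simp add: A_def B_def C_def G_def)
  have "(of_real \<alpha>\<^sub>0 * z + of_real \<beta>\<^sub>0 + A) * (of_real a + B) + (of_real \<alpha> * z + of_real \<beta> + P)
    = of_real \<alpha>\<^sub>0 * z * of_real a + of_real \<alpha>\<^sub>0 * z * B + of_real \<beta>\<^sub>0 * of_real a + of_real \<beta>\<^sub>0 * B + A * of_real a + (C + G) + of_real \<alpha> * z + of_real \<beta> + P"
    unfolding AB[symmetric] by (simp add: algebra_simps)
  also have "\<dots> = of_real \<alpha>\<^sub>0 * z * of_real a + of_real \<beta>\<^sub>0 * of_real a + A * of_real a + C + of_real \<alpha> * z + of_real \<beta> + of_real \<alpha>\<^sub>0 * H"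
    unfolding P by (simp add: algebra_simps)
  finally show ?thesis unfolding e2 A_def[symmetric] B_def[symmetric] C_def[symmetric] P_def[symmetric]
    by (simp add: H_def algebra_simps)
qed

section \<open>Ratio families of Nikishin systems\<close>

text \<open>\<open>R K i j\<close> stands for $W_{Kj}/W_{Ki}$, where $W_J$ is the minor of the first $|J|$ rows and the
  columns $J$ of the triangular matrix of the functions $\widehat s_{p+1,q}$, $r \le p \le q \le m$. It is
  analytic off the interval with index $t + 1$, where $t = r + |K|$. The second condition is a Pluecker
  relation; in the third one, the growth at infinity is controlled by comparing \<open>i\<close> and \<open>j\<close> with \<open>t\<close>.\<close>

definition ratio_column :: "nat \<Rightarrow> real set \<Rightarrow> nat set \<Rightarrow> (nat \<Rightarrow> complex \<Rightarrow> complex) \<Rightarrow> (nat \<Rightarrow> nat \<Rightarrow> complex \<Rightarrow> complex)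
    \<Rightarrow> nat \<Rightarrow> real measure \<Rightarrow> (nat \<Rightarrow> real \<Rightarrow> real) \<Rightarrow> (nat \<Rightarrow> real) \<Rightarrow> (nat \<Rightarrow> real) \<Rightarrow> bool" where
  "ratio_column t D J F G i M \<rho> \<alpha> \<beta> \<longleftrightarrow> nondegenerate_on D M \<and>
     (\<forall>j\<in>J. nonvanishing_density D (\<rho> j) \<and>
        (\<forall>z. Im z > 0 \<longrightarrow> F j z = of_real (\<alpha> j) * z + of_real (\<beta> j) + ct M (\<rho> j) z) \<and>
        (\<alpha> j \<noteq> 0 \<longrightarrow> j \<le> t \<and> t < i) \<and> (i \<le> t \<and> t < j \<longrightarrow> \<alpha> j = 0 \<and> \<beta> j = 0) \<and>
        (\<forall>l\<in>J. \<forall>x\<in>D. boundary_value (G l j) x (\<rho> j x / \<rho> l x)))"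

definition ratio_family :: "(nat \<Rightarrow> real) \<Rightarrow> (nat \<Rightarrow> real) \<Rightarrow> nat \<Rightarrow> nat \<Rightarrow> (nat set \<Rightarrow> nat \<Rightarrow> nat \<Rightarrow> complex \<Rightarrow> complex) \<Rightarrow> bool" where
  "ratio_family a b m r R \<longleftrightarrow>
     (\<forall>K\<subseteq>{r..m}. \<forall>i\<in>{r..m}-K. \<forall>j\<in>{r..m}-K. \<forall>l\<in>{r..m}-K. \<forall>z. Im z > 0 \<longrightarrow>
        R K i i z = 1 \<and> R K i j z * R K j l z = R K i l z) \<and>
     (\<forall>K\<subseteq>{r..m}. \<forall>p\<in>{r..m}-K. \<forall>i\<in>{r..m}-K. \<forall>j\<in>{r..m}-K. \<forall>z. Im z > 0 \<longrightarrow> p \<noteq> i \<longrightarrow> p \<noteq> j \<longrightarrow> i \<noteq> j \<longrightarrow>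
        R (insert p K) i j z = R K i j z - R K i p z * R (insert i K) p j z) \<and>
     (\<forall>K\<subseteq>{r..m}. \<forall>i\<in>{r..m}-K. {r..m}-K-{i} \<noteq> {} \<longrightarrow>
        (\<exists>M \<rho> \<alpha> \<beta>. ratio_column (r + card K) {a (Suc (r + card K))..b (Suc (r + card K))} ({r..m}-K-{i})
            (R K i) (R (insert i K)) i M \<rho> \<alpha> \<beta>))"

lemma ratio_family_cocycle:
  assumes "ratio_family a b m r R" "K \<subseteq> {r..m}" "i \<in> {r..m} - K" "j \<in> {r..m} - K" "Im z > 0"
  shows "R K i i z = 1" "R K i j z * R K j i z = 1" "R K i j z \<noteq> 0"
    and "l \<in> {r..m} - K \<Longrightarrow> R K i j z * R K j l z = R K i l z"
proof -
  note * = conjunct1[OF assms(1)[unfolded ratio_family_def], rule_format, OF assms(2-4) _ assms(5)]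
  show 1: "R K i i z = 1" by (rule conjunct1[OF *[OF assms(3)]])
  show 2: "R K i j z * R K j l z = R K i l z" if "l \<in> {r..m} - K" for l
    by (rule conjunct2[OF *[OF that]])
  from 2[OF assms(3)] 1 show "R K i j z * R K j i z = 1" by simp
  then show "R K i j z \<noteq> 0" by auto
qed

lemma ratio_family_plucker:
  assumes "ratio_family a b m r R" "K \<subseteq> {r..m}" "p \<in> {r..m} - K" "i \<in> {r..m} - K" "j \<in> {r..m} - K" "Im z > 0"
    "p \<noteq> i" "p \<noteq> j" "i \<noteq> j"
  shows "R (insert p K) i j z = R K i j z - R K i p z * R (insert i K) p j z"
  by (rule conjunct1[OF conjunct2[OF assms(1)[unfolded ratio_family_def]], rule_format, OF assms(2-)])

lemma ratio_family_column:
  assumes "ratio_family a b m r R" "K \<subseteq> {r..m}" "i \<in> {r..m} - K" "{r..m} - K - {i} \<noteq> {}"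
  obtains M \<rho> \<alpha> \<beta> where "ratio_column (r + card K) {a (Suc (r + card K))..b (Suc (r + card K))} ({r..m}-K-{i})
            (R K i) (R (insert i K)) i M \<rho> \<alpha> \<beta>"
proof -
  have "\<exists>M \<rho> \<alpha> \<beta>. ratio_column (r + card K) {a (Suc (r + card K))..b (Suc (r + card K))} ({r..m}-K-{i})
            (R K i) (R (insert i K)) i M \<rho> \<alpha> \<beta>"
    by (rule conjunct2[OF conjunct2[OF assms(1)[unfolded ratio_family_def]], rule_format, OF assms(2-)])
  then show thesis using that by (elim exE)
qed

lemma ratio_columnD:
  assumes "ratio_column t D J F G i M \<rho> \<alpha> \<beta>"
  shows "nondegenerate_on D M" "j \<in> J \<Longrightarrow> nonvanishing_density D (\<rho> j)"
    "j \<in> J \<Longrightarrow> Im z > 0 \<Longrightarrow> F j z = of_real (\<alpha> j) * z + of_real (\<beta> j) + ct M (\<rho> j) z"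
    "j \<in> J \<Longrightarrow> \<alpha> j \<noteq> 0 \<Longrightarrow> j \<le> t \<and> t < i" "j \<in> J \<Longrightarrow> i \<le> t \<Longrightarrow> t < j \<Longrightarrow> \<alpha> j = 0 \<and> \<beta> j = 0"
    "j \<in> J \<Longrightarrow> l \<in> J \<Longrightarrow> x \<in> D \<Longrightarrow> boundary_value (G l j) x (\<rho> j x / \<rho> l x)"
proof -
  note c = assms[unfolded ratio_column_def]
  note d = conjunct2[OF c, THEN bspec]
  show "nondegenerate_on D M" by (rule conjunct1[OF c])
  show "j \<in> J \<Longrightarrow> nonvanishing_density D (\<rho> j)" by (rule conjunct1[OF d])
  show "j \<in> J \<Longrightarrow> Im z > 0 \<Longrightarrow> F j z = of_real (\<alpha> j) * z + of_real (\<beta> j) + ct M (\<rho> j) z"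
    by (rule conjunct1[OF conjunct2[OF d], rule_format])
  show "j \<in> J \<Longrightarrow> \<alpha> j \<noteq> 0 \<Longrightarrow> j \<le> t \<and> t < i"
    by (rule conjunct1[OF conjunct2[OF conjunct2[OF d]], rule_format])
  show "j \<in> J \<Longrightarrow> i \<le> t \<Longrightarrow> t < j \<Longrightarrow> \<alpha> j = 0 \<and> \<beta> j = 0"
    by (rule conjunct1[OF conjunct2[OF conjunct2[OF conjunct2[OF d]]], rule_format]) auto
  show "j \<in> J \<Longrightarrow> l \<in> J \<Longrightarrow> x \<in> D \<Longrightarrow> boundary_value (G l j) x (\<rho> j x / \<rho> l x)"
    by (rule conjunct2[OF conjunct2[OF conjunct2[OF conjunct2[OF d]]], rule_format])
qed

lemma ratio_column_boundary:
  assumes "ratio_column t {c..d} J F G i M \<rho> \<alpha> \<beta>" "j \<in> J" "x \<notin> {c..d}"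
  shows "boundary_value (F j) x (\<alpha> j * x + \<beta> j + ct M (\<rho> j) x)"
  by (rule boundary_value_cong[OF boundary_value_linear_ct[OF nondegenerate_onD[OF ratio_columnD(1)[OF assms(1)]] compact_Icc
    nonvanishing_densityD(1)[OF ratio_columnD(2)[OF assms(1,2)]] assms(3)]])
    (simp add: ratio_columnD(3)[OF assms(1,2)])

text \<open>The inverse ratio has a boundary value as well, and the product of the two is 1.\<close>

lemma ratio_family_boundary_nonzero:
  assumes R: "ratio_family a b m r R" "K \<subseteq> {r..m}" "i \<in> {r..m} - K" "j \<in> {r..m} - K"
    and x: "x \<notin> {a (Suc (r + card K))..b (Suc (r + card K))}"
  obtains y where "boundary_value (R K i j) x y" "y \<noteq> 0"
proof (cases "i = j")
  case True
  have "boundary_value (R K i j) x 1"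
    by (rule boundary_value_cong[OF boundary_value_const]) (use True ratio_family_cocycle(1)[OF R] in simp)
  then show thesis using that by auto
next
  case False
  obtain M \<rho> \<alpha> \<beta> where c: "ratio_column (r + card K) {a (Suc (r + card K))..b (Suc (r + card K))} ({r..m}-K-{i}) (R K i) (R (insert i K)) i M \<rho> \<alpha> \<beta>"
    using ratio_family_column[OF R(1-3)] R(4) False by blast
  obtain M' \<rho>' \<alpha>' \<beta>' where c': "ratio_column (r + card K) {a (Suc (r + card K))..b (Suc (r + card K))} ({r..m}-K-{j}) (R K j) (R (insert j K)) j M' \<rho>' \<alpha>' \<beta>'"
    using ratio_family_column[OF R(1,2,4)] R(3) False by blast
  obtain y y' where y: "boundary_value (R K i j) x y" "boundary_value (R K j i) x y'"
    using ratio_column_boundary[OF c _ x, of j] ratio_column_boundary[OF c' _ x, of i] R(3,4) False by auto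
  have "boundary_value (\<lambda>_. 1) x (y * y')"
    by (rule boundary_value_cong[OF boundary_value_mult[OF y]]) (rule ratio_family_cocycle(2)[OF R])
  then have "y * y' = 1" using boundary_value_unique boundary_value_const by blast
  then have "y \<noteq> 0" by auto
  with y(1) show thesis by (rule that)
qed

section \<open>Adding one generator to a ratio family\<close>

locale ratio_step =
  fixes a b :: "nat \<Rightarrow> real" and m r :: nat and R' :: "nat set \<Rightarrow> nat \<Rightarrow> nat \<Rightarrow> complex \<Rightarrow> complex"
    and M :: "real measure" and \<rho>\<^sub>0 :: "nat \<Rightarrow> real \<Rightarrow> real"
  assumes ab: "\<And>t. t \<in> {Suc r..m} \<Longrightarrow> a t < b t"
    and disj: "\<And>t. Suc r \<le> t \<Longrightarrow> t < m \<Longrightarrow> {a t..b t} \<inter> {a (Suc t)..b (Suc t)} = {}"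
    and rm: "r < m" and inner: "ratio_family a b m (Suc r) R'"
    and M: "nondegenerate_on {a (Suc r)..b (Suc r)} M"
    and \<rho>\<^sub>0: "\<And>j. j \<in> {Suc r..m} \<Longrightarrow> nonvanishing_density {a (Suc r)..b (Suc r)} (\<rho>\<^sub>0 j)"
    and bv0: "\<And>j l x. j \<in> {Suc r..m} \<Longrightarrow> l \<in> {Suc r..m} \<Longrightarrow> x \<in> {a (Suc r)..b (Suc r)} \<Longrightarrow>
      boundary_value (R' {} l j) x (\<rho>\<^sub>0 j x / \<rho>\<^sub>0 l x)"
begin

abbreviation "A \<equiv> {Suc r..m}"
abbreviation "D t \<equiv> {a t..b t}"

text \<open>The enlarged matrix has a new first row 1, f_{r+1}, ..., f_m, where f_i is the transform
  with density \<open>\<rho>\<^sub>0 i\<close>, and a new column r equal to the first unit vector.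
  Expanding the new minor of the columns j, K along the first row and dividing by the old minor of
  the columns K gives \<open>T K j\<close>. For j = r the quotient is 1.\<close>

definition T :: "nat set \<Rightarrow> nat \<Rightarrow> complex \<Rightarrow> complex" where
  "T K j z = (if j = r then 1 else ct M (\<rho>\<^sub>0 j) z - (\<Sum>i\<in>K. ct M (\<rho>\<^sub>0 i) z * R' (K - {i}) i j z))"

lemma T_r [simp]: "T K r z = 1" by (simp add: T_def)

text \<open>The Pluecker relation of the old family, summed over the row expansion. This is one
  elimination step: the function with index p is removed from the one with index j.\<close>

lemma T_insert:
  assumes K: "K \<subseteq> A" and p: "p \<in> A - K" and j: "j \<in> A - K" "p \<noteq> j" and z: "Im z > 0"
  shows "T (insert p K) j z = T K j z - T K p z * R' K p j z"
proof -
  have fin: "finite K" using K finite_subset by blast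
  let ?f = "\<lambda>i. ct M (\<rho>\<^sub>0 i) z"
  have jr: "j \<noteq> r" "p \<noteq> r" using p j by auto
  have s: "?f i * R' (insert p K - {i}) i j z = ?f i * R' (K - {i}) i j z - ?f i * R' (K - {i}) i p z * R' K p j z" if "i \<in> K" for i
  proof -
    have e: "insert p K - {i} = insert p (K - {i})" "insert i (K - {i}) = K" using that p by auto
    have *: "R' (insert p (K - {i})) i j z = R' (K - {i}) i j z - R' (K - {i}) i p z * R' (insert i (K - {i})) p j z"
      using K p j that by (intro ratio_family_plucker[OF inner] z) auto
    show ?thesis unfolding e * by (simp add: algebra_simps)
  qed
  have "(\<Sum>i\<in>insert p K. ?f i * R' (insert p K - {i}) i j z) = ?f p * R' (insert p K - {p}) p j z + (\<Sum>i\<in>K. ?f i * R' (insert p K - {i}) i j z)"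
    using fin p by (intro sum.insert) auto
  also have "insert p K - {p} = K" using p by auto
  also have "(\<Sum>i\<in>K. ?f i * R' (insert p K - {i}) i j z) = (\<Sum>i\<in>K. ?f i * R' (K - {i}) i j z - ?f i * R' (K - {i}) i p z * R' K p j z)"
    by (rule sum.cong[OF refl s])
  also have "\<dots> = (\<Sum>i\<in>K. ?f i * R' (K - {i}) i j z) - (\<Sum>i\<in>K. ?f i * R' (K - {i}) i p z) * R' K p j z"
    by (simp add: sum_subtractf sum_distrib_right)
  finally show ?thesis unfolding T_def using jr by (simp add: algebra_simps)
qed

text \<open>Both sides are the same new minor with the columns p and j interchanged, which accounts
  for the sign; the factor \<open>R' K p j\<close> adjusts the old minor used for
  normalization.\<close>

lemma T_exchange:
  assumes K: "K \<subseteq> A" and p: "p \<in> A - K" and j: "j \<in> A - K" "p \<noteq> j" and z: "Im z > 0"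
  shows "T (insert p K) j z = - R' K p j z * T (insert j K) p z"
proof -
  have "R' K p j z * R' K j p z = 1" by (rule ratio_family_cocycle(2)[OF inner K p j(1) z])
  moreover have "T (insert j K) p z = T K p z - T K j z * R' K j p z" by (rule T_insert[OF K j(1) p j(2)[symmetric] z])
  moreover have "T (insert p K) j z = T K j z - T K p z * R' K p j z" by (rule T_insert[OF K p j z])
  ultimately show ?thesis by algebra
qed

text \<open>The last clause is the input of \<open>quotient_step\<close>: on this interval the old
  ratios are the quotients of the new densities. The clause on the constants records which of the
  functions vanish at infinity.\<close>

definition Trep :: "nat set \<Rightarrow> real measure \<Rightarrow> (nat \<Rightarrow> real \<Rightarrow> real) \<Rightarrow> (nat \<Rightarrow> real) \<Rightarrow> bool" where
  "Trep K N \<eta> c \<longleftrightarrow> nondegenerate_on (D (Suc (r + card K))) N \<and>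
     (\<forall>j\<in>A-K. nonvanishing_density (D (Suc (r + card K))) (\<eta> j) \<and>
        (\<forall>z. Im z > 0 \<longrightarrow> T K j z = of_real (c j) + ct N (\<eta> j) z) \<and> (r + card K < j \<longrightarrow> c j = 0)) \<and>
     (\<forall>j\<in>A-K. \<forall>l\<in>A-K. \<forall>x\<in>D (Suc (r + card K)). boundary_value (R' K l j) x (\<eta> j x / \<eta> l x))"

text \<open>Kept apart from \<open>Trep\<close> because it is proved for a set K only after
  representations are known for all sets of the same size.\<close>

definition Tnz :: "nat set \<Rightarrow> real measure \<Rightarrow> (nat \<Rightarrow> real \<Rightarrow> real) \<Rightarrow> (nat \<Rightarrow> real) \<Rightarrow> bool" where
  "Tnz K N \<eta> c \<longleftrightarrow> (\<forall>j\<in>A-K. (j \<le> r + card K \<longrightarrow> c j \<noteq> 0) \<and> (\<forall>x. x \<notin> D (Suc (r + card K)) \<longrightarrow> c j + ct N (\<eta> j) x \<noteq> 0))"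

lemma TrepD:
  assumes "Trep K N \<eta> c"
  shows "nondegenerate_on (D (Suc (r + card K))) N" "j \<in> A-K \<Longrightarrow> nonvanishing_density (D (Suc (r + card K))) (\<eta> j)"
    "j \<in> A-K \<Longrightarrow> Im z > 0 \<Longrightarrow> T K j z = of_real (c j) + ct N (\<eta> j) z" "j \<in> A-K \<Longrightarrow> r + card K < j \<Longrightarrow> c j = 0"
    "j \<in> A-K \<Longrightarrow> l \<in> A-K \<Longrightarrow> x \<in> D (Suc (r + card K)) \<Longrightarrow> boundary_value (R' K l j) x (\<eta> j x / \<eta> l x)"
  using assms unfolding Trep_def by blast+

lemma TnzD:
  assumes "Tnz K N \<eta> c" "j \<in> A-K"
  shows "j \<le> r + card K \<Longrightarrow> c j \<noteq> 0" "x \<notin> D (Suc (r + card K)) \<Longrightarrow> c j + ct N (\<eta> j) x \<noteq> 0"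
  using assms unfolding Tnz_def by blast+

lemma Trep_empty: "Trep {} M \<rho>\<^sub>0 (\<lambda>_. 0)"
  unfolding Trep_def using M \<rho>\<^sub>0 bv0 by (simp add: T_def)

lemma T_boundary:
  assumes T: "Trep K N \<eta> c" "j \<in> A-K" and x: "x \<notin> D (Suc (r + card K))"
  shows "boundary_value (T K j) x (c j + ct N (\<eta> j) x)"
proof -
  have "boundary_value (\<lambda>z. of_real 0 * z + of_real (c j) + ct N (\<eta> j) z) x (0 * x + c j + ct N (\<eta> j) x)"
    by (intro boundary_value_linear_ct[OF nondegenerate_onD[OF TrepD(1)[OF T(1)]] compact_Icc nonvanishing_densityD(1)[OF TrepD(2)[OF T]] x])
  then show ?thesis by (simp add: TrepD(3)[OF T] boundary_value_cong)
qed

lemma T_nonzero: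
  assumes T: "Trep K N \<eta> c" "j \<in> A-K" and z: "Im z > 0"
  shows "T K j z \<noteq> 0"
proof -
  note \<eta> = TrepD(2)[OF T]
  from nonvanishing_density_sign[OF \<eta>] obtain e where e: "\<And>x. x \<in> D (Suc (r + card K)) \<Longrightarrow> 0 < e * \<eta> j x" by blast
  have "e * Im (ct N (\<eta> j) z) < 0" by (rule Im_ct_nonvanishing[OF TrepD(1)[OF T(1)] nonvanishing_densityD(1)[OF \<eta>] e z])
  then have "Im (T K j z) \<noteq> 0" unfolding TrepD(3)[OF T z] by auto
  then show ?thesis by auto
qed

lemma card_bound:
  assumes "K \<subseteq> A" "X \<subseteq> A - K" shows "r + card K + card X \<le> m"
proof -
  have "finite K" "finite X" using assms by (auto intro: finite_subset)
  then have "card (K \<union> X) = card K + card X" using assms by (intro card_Un_disjoint) auto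
  moreover have "card (K \<union> X) \<le> card A" by (rule card_mono) (use assms in auto)
  ultimately show ?thesis using rm by simp
qed

text \<open>Two distinct indices outside K force r + |K| + 2 \<le> m, so both intervals belong to
  the system.\<close>

lemma disjoint_consecutive:
  assumes K: "K \<subseteq> A" "i \<in> A - K" "A - K - {i} \<noteq> {}"
  shows "D (Suc (r + card K)) \<inter> D (Suc (Suc (r + card K))) = {}"
proof -
  from K(3) obtain j where "j \<in> A - K - {i}" by blast
  then have "r + card K + card {i, j} \<le> m" using K by (intro card_bound) auto
  then show ?thesis using \<open>j \<in> _\<close> by (intro disj) auto
qed

text \<open>Elimination of the index i by \<open>quotient_step\<close>. Its hypothesis c_i
  \<alpha>_j = 0 holds because \<alpha>_j \<noteq> 0 forces i > r + |K|, and there c_i = 0. The new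
  densities have no zeros since \<open>Tnz\<close> keeps T away from 0 on the next interval.\<close>

lemma
  assumes K: "K \<subseteq> A" and i: "i \<in> A - K" and ne: "A - K - {i} \<noteq> {}"
    and Tr: "Trep K N \<eta> c" and Tn: "Tnz K N \<eta> c"
    and col: "ratio_column (Suc r + card K) (D (Suc (Suc r + card K))) (A - K - {i}) (R' K i) (R' (insert i K)) i M' \<rho>' \<alpha> \<beta>"
  shows Trep_insert: "Trep (insert i K) M' (\<lambda>j y. - (c i + ct N (\<eta> i) y) * \<rho>' j y) (\<lambda>j. c j - \<alpha> j * integral\<^sup>L N (\<eta> i) - c i * \<beta> j)"
proof -
  have fin: "finite K" using K finite_subset by blast
  have card: "card (insert i K) = Suc (card K)" using fin i by simp
  note DE = disjoint_consecutive[OF K i ne]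
  note N = nondegenerate_onD[OF TrepD(1)[OF Tr]] compact_Icc
  note M' = nondegenerate_onD[OF ratio_columnD(1)[OF col]] compact_Icc
  note \<eta>i = nonvanishing_densityD(1)[OF TrepD(2)[OF Tr i]]
  let ?E = "D (Suc (Suc r + card K))"
  have tN: "c i + ct N (\<eta> i) y \<noteq> 0" if "y \<in> ?E" for y
    using TnzD(2)[OF Tn i] that DE by auto
  have dT: "density_on ?E (\<lambda>y. c i + ct N (\<eta> i) y)"
    using density_on_ct[OF N \<eta>i, of ?E] DE by auto
  have nv: "nonvanishing_density ?E (\<lambda>y. - (c i + ct N (\<eta> i) y) * \<rho>' j y)" if "j \<in> A - K - {i}" for j
    unfolding nonvanishing_density_def
  proof (intro conjI ballI)
    note \<rho>' = ratio_columnD(2)[OF col that]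
    show "density_on ?E (\<lambda>y. - (c i + ct N (\<eta> i) y) * \<rho>' j y)"
      by (rule density_on_intros(5)[OF density_on_intros(6)[OF dT] nonvanishing_densityD(1)[OF \<rho>']])
    fix y assume "y \<in> ?E"
    with tN[of y] nonvanishing_densityD(2)[OF \<rho>'] show "- (c i + ct N (\<eta> i) y) * \<rho>' j y \<noteq> 0"
      by (metis mult_eq_0_iff neg_equal_0_iff_equal)
  qed
  have c0: "c i * \<alpha> j = 0" if "j \<in> A - K - {i}" for j
  proof (cases "\<alpha> j = 0")
    case False
    then have "r + card K < i" using ratio_columnD(4)[OF col that] by simp
    then show ?thesis using TrepD(4)[OF Tr i] by simp
  qed simp
  have Tz: "T (insert i K) j z = of_real (c j - \<alpha> j * integral\<^sup>L N (\<eta> i) - c i * \<beta> j) + ct M' (\<lambda>y. - (c i + ct N (\<eta> i) y) * \<rho>' j y) z"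
    if j: "j \<in> A - K - {i}" and z: "Im z > 0" for j z
  proof -
    have jA: "j \<in> A - K" "i \<noteq> j" using j by auto
    have q: "\<eta> j x = \<eta> i x * (\<alpha> j * x + \<beta> j + ct M' (\<rho>' j) x)" if x: "x \<in> D (Suc (r + card K))" for x
    proof -
      have "x \<notin> ?E" using x DE by auto
      from boundary_value_unique[OF TrepD(5)[OF Tr jA(1) i x] ratio_column_boundary[OF col j this]]
      show ?thesis using nonvanishing_densityD(2)[OF TrepD(2)[OF Tr i] x] by (simp add: field_simps)
    qed
    have "T (insert i K) j z = (of_real (c j) + ct N (\<eta> j) z) - (of_real (c i) + ct N (\<eta> i) z) * (of_real (\<alpha> j) * z + of_real (\<beta> j) + ct M' (\<rho>' j) z)"
      unfolding T_insert[OF K i jA z] TrepD(3)[OF Tr jA(1) z] TrepD(3)[OF Tr i z] ratio_columnD(3)[OF col j z] ..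
    also have "\<dots> = of_real (c j - \<alpha> j * integral\<^sup>L N (\<eta> i) - c i * \<beta> j) + ct M' (\<lambda>y. - (c i + ct N (\<eta> i) y) * \<rho>' j y) z"
      by (rule quotient_step[OF N M' _ \<eta>i nonvanishing_densityD(1)[OF TrepD(2)[OF Tr jA(1)]]
         nonvanishing_densityD(1)[OF ratio_columnD(2)[OF col j]] q c0[OF j] z]) (use DE in simp)
    finally show ?thesis .
  qed
  have cz: "c j - \<alpha> j * integral\<^sup>L N (\<eta> i) - c i * \<beta> j = 0" if j: "j \<in> A - K - {i}" and t: "r + card (insert i K) < j" for j
  proof -
    have "c j = 0" using TrepD(4)[OF Tr, of j] j t card by auto
    moreover have "\<alpha> j = 0" using ratio_columnD(4)[OF col j] t card by auto
    moreover have "c i * \<beta> j = 0"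
    proof (cases "i \<le> r + card K")
      case True
      then show ?thesis using ratio_columnD(5)[OF col j] t card by simp
    next
      case False
      then show ?thesis using TrepD(4)[OF Tr i] by simp
    qed
    ultimately show ?thesis by simp
  qed
  have eqs: "A - insert i K = A - K - {i}" "Suc (r + card (insert i K)) = Suc (Suc r + card K)" using card by auto
  show ?thesis unfolding Trep_def eqs
  proof (intro conjI ballI allI impI)
    show "nondegenerate_on ?E M'" by (rule ratio_columnD(1)[OF col])
    fix j l x assume j: "j \<in> A - K - {i}" and l: "l \<in> A - K - {i}" and x: "x \<in> ?E"
    have "(- (c i + ct N (\<eta> i) x) * \<rho>' j x) / (- (c i + ct N (\<eta> i) x) * \<rho>' l x) = \<rho>' j x / \<rho>' l x"
      using tN[OF x] by simp
    then show "boundary_value (R' (insert i K) l j) x ((- (c i + ct N (\<eta> i) x) * \<rho>' j x) / (- (c i + ct N (\<eta> i) x) * \<rho>' l x))"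
      using ratio_columnD(6)[OF col j l x] by simp
  qed (use nv Tz cz in auto)
qed

text \<open>For a small index \<open>j\<close> the constant does not vanish and no sign argument is available; there one
  exchanges \<open>j\<close> with a large index \<open>k\<close> of \<open>K\<close>.\<close>

lemma Tnz_of_Trep:
  assumes K: "K \<subseteq> A" and Tr: "Trep K N \<eta> c"
    and ex: "\<And>K'. K' \<subseteq> A \<Longrightarrow> card K' = card K \<Longrightarrow> A - K' \<noteq> {} \<Longrightarrow> \<exists>N \<eta> c. Trep K' N \<eta> c"
  shows "Tnz K N \<eta> c"
  unfolding Tnz_def
proof (intro ballI)
  fix j assume j: "j \<in> A - K"
  define t where "t = r + card K"
  have fin: "finite K" using K finite_subset by blast
  show "(j \<le> r + card K \<longrightarrow> c j \<noteq> 0) \<and> (\<forall>x. x \<notin> D (Suc (r + card K)) \<longrightarrow> c j + ct N (\<eta> j) x \<noteq> 0)"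
  proof (cases "t < j")
    case True
    then have "c j = 0" using TrepD(4)[OF Tr j] by (simp add: t_def)
    then show ?thesis using True ct_real_nonzero[OF TrepD(1)[OF Tr] TrepD(2)[OF Tr j]] by (simp add: t_def)
  next
    case False
    \<comment> \<open>Exactly |K| indices lie in {r + 1..t}. As j is one of them and not in K, the
      set K must contain an index beyond t.\<close>
    have "\<exists>k\<in>K. t < k"
    proof (rule ccontr)
      assume "\<not> ?thesis"
      then have "insert j K \<subseteq> {Suc r..t}" using K j False by force
      then have "card (insert j K) \<le> card {Suc r..t}" by (intro card_mono) auto
      then show False using fin j by (simp add: t_def)
    qed
    then obtain k where k: "k \<in> K" "t < k" by blast
    define K0 where "K0 = K - {k}"
    have K0: "K0 \<subseteq> A" "K = insert k K0" "k \<in> A - K0" "j \<in> A - K0" "k \<noteq> j" "k \<notin> K0" using K k j by (auto simp: K0_def)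
    have "finite K0" using fin by (simp add: K0_def)
    then have cK: "card K = Suc (card K0)" "card (insert j K0) = card K" using K0 by auto
    have k1: "k \<in> A - insert j K0" using K0 by auto
    obtain N1 \<eta>1 c1 where T1: "Trep (insert j K0) N1 \<eta>1 c1"
      using ex[of "insert j K0"] K0 cK k1 by blast
    have c1: "c1 k = 0" using TrepD(4)[OF T1 k1] k(2) unfolding cK t_def by simp
    have exch: "T K j z = - R' K0 k j z * T (insert j K0) k z" if "Im z > 0" for z
      unfolding K0(2) by (rule T_exchange[OF K0(1) K0(3) K0(4,5) that])
    have tt: "Suc r + card K0 = t" by (simp add: t_def cK)
    have "A - K0 - {j} \<noteq> {}" using K0 by auto
    from ratio_family_column[OF inner K0(1) K0(4) this] obtain M' \<rho>' \<alpha> \<beta> where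
      col: "ratio_column t (D (Suc t)) (A - K0 - {j}) (R' K0 j) (R' (insert j K0)) j M' \<rho>' \<alpha> \<beta>" unfolding tt by blast
    have kk: "k \<in> A - K0 - {j}" using K0 by auto
    note \<eta>1 = TrepD(2)[OF T1 k1]
    have real: "c j + ct N (\<eta> j) x \<noteq> 0" if x: "x \<notin> D (Suc (r + card K))" for x
    proof -
      have x': "x \<notin> D (Suc (Suc r + card K0))" using x by (simp add: cK)
      obtain y where y: "boundary_value (R' K0 k j) x y" "y \<noteq> 0"
        using ratio_family_boundary_nonzero[OF inner K0(1,3,4) x'] by blast
      have x1: "x \<notin> D (Suc (r + card (insert j K0)))" using x cK by simp
      have "boundary_value (\<lambda>z. R' K0 k j z * T (insert j K0) k z) x (y * (c1 k + ct N1 (\<eta>1 k) x))"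
        by (rule boundary_value_mult[OF y(1) T_boundary[OF T1 k1 x1]])
      then have "boundary_value (\<lambda>z. - (R' K0 k j z * T (insert j K0) k z)) x (- (y * (c1 k + ct N1 (\<eta>1 k) x)))"
        unfolding boundary_value_def of_real_minus by (rule tendsto_minus)
      then have "boundary_value (T K j) x (- (y * (c1 k + ct N1 (\<eta>1 k) x)))"
        by (rule boundary_value_cong) (simp add: exch)
      from boundary_value_unique[OF this T_boundary[OF Tr j x]]
      have "c j + ct N (\<eta> j) x = - (y * ct N1 (\<eta>1 k) x)" using c1 by simp
      then show ?thesis using y(2) ct_real_nonzero[OF TrepD(1)[OF T1] \<eta>1 x1] by simp
    qed
    \<comment> \<open>If the constant vanished, \<open>T K j\<close> would tend to 0 at infinity. As
      \<open>R' K0 j k\<close> is O(1 / z), the exchange relation would make z times the transform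
      for k tend to 0, although its limit is a total mass different from 0.\<close>
    have "c j \<noteq> 0"
    proof
      assume cj: "c j = 0"
      let ?w = "\<lambda>y. \<i> * complex_of_real y"
      have \<alpha>\<beta>: "\<alpha> k = 0" "\<beta> k = 0" using ratio_columnD(5)[OF col kk] False k(2) by auto
      note \<rho>' = ratio_columnD(2)[OF col kk]
      have l1: "((\<lambda>y. T K j (?w y)) \<longlongrightarrow> 0) at_top"
      proof (rule Lim_transform_eventually)
        show "((\<lambda>y. ct N (\<eta> j) (?w y)) \<longlongrightarrow> 0) at_top"
          by (rule ct_imaginary_axis(1)[OF nondegenerate_onD[OF TrepD(1)[OF Tr]] compact_Icc nonvanishing_densityD(1)[OF TrepD(2)[OF Tr j]]])
        show "\<forall>\<^sub>F y in at_top. ct N (\<eta> j) (?w y) = T K j (?w y)"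
          using eventually_gt_at_top[of 0] by eventually_elim (simp add: TrepD(3)[OF Tr j] cj)
      qed
      have l2: "((\<lambda>y. ?w y * ct M' (\<rho>' k) (?w y)) \<longlongrightarrow> of_real (integral\<^sup>L M' (\<rho>' k))) at_top"
        by (rule ct_imaginary_axis(2)[OF nondegenerate_onD[OF ratio_columnD(1)[OF col]] compact_Icc nonvanishing_densityD(1)[OF \<rho>']])
      have l3: "((\<lambda>y. ?w y * ct N1 (\<eta>1 k) (?w y)) \<longlongrightarrow> of_real (integral\<^sup>L N1 (\<eta>1 k))) at_top"
        by (rule ct_imaginary_axis(2)[OF nondegenerate_onD[OF TrepD(1)[OF T1]] compact_Icc nonvanishing_densityD(1)[OF \<eta>1]])
      have "((\<lambda>y. - (T K j (?w y) * (?w y * ct M' (\<rho>' k) (?w y)))) \<longlongrightarrow> - (0 * of_real (integral\<^sup>L M' (\<rho>' k)))) at_top"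
        by (intro tendsto_intros l1 l2)
      moreover have "\<forall>\<^sub>F y in at_top. - (T K j (?w y) * (?w y * ct M' (\<rho>' k) (?w y))) = ?w y * ct N1 (\<eta>1 k) (?w y)"
        using eventually_gt_at_top[of 0]
      proof eventually_elim
        case (elim y)
        then have z: "Im (?w y) > 0" by simp
        have "R' K0 k j (?w y) * R' K0 j k (?w y) = 1" by (rule ratio_family_cocycle(2)[OF inner K0(1,3,4) z])
        moreover have "R' K0 j k (?w y) = ct M' (\<rho>' k) (?w y)" using ratio_columnD(3)[OF col kk z] \<alpha>\<beta> by simp
        moreover have "T (insert j K0) k (?w y) = ct N1 (\<eta>1 k) (?w y)" using TrepD(3)[OF T1 k1 z] c1 by simp
        ultimately show ?case using exch[OF z] by algebra
      qed
      ultimately have "((\<lambda>y. ?w y * ct N1 (\<eta>1 k) (?w y)) \<longlongrightarrow> - (0 * of_real (integral\<^sup>L M' (\<rho>' k)))) at_top"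
        by (rule Lim_transform_eventually)
      from tendsto_unique[OF trivial_limit_at_top_linorder this l3]
      have "integral\<^sup>L N1 (\<eta>1 k) = 0" by simp
      then show False using integral_nonvanishing_density[OF TrepD(1)[OF T1] \<eta>1] by simp
    qed
    with real show ?thesis by blast
  qed
qed

text \<open>\<open>Trep\<close> is built by adding one index to a smaller set; then
  \<open>Tnz\<close> follows by comparison with other sets of the same size. Hence the induction
  treats all sets of a given size together.\<close>

lemma T_exists:
  assumes "K \<subseteq> A" "A - K \<noteq> {}"
  shows "\<exists>N \<eta> c. Trep K N \<eta> c \<and> Tnz K N \<eta> c"
  using assms
proof (induction "card K" arbitrary: K)
  case 0
  then have "K = {}" using finite_subset by fastforce
  moreover have "Tnz {} M \<rho>\<^sub>0 (\<lambda>_. 0)" 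
  proof (rule Tnz_of_Trep[OF _ Trep_empty])
    fix K' assume "K' \<subseteq> A" "card K' = card ({} :: nat set)"
    then have "K' = {}" using finite_subset by fastforce
    then show "\<exists>N \<eta> c. Trep K' N \<eta> c" using Trep_empty by blast
  qed simp
  ultimately show ?case using Trep_empty by blast
next
  case (Suc n)
  have rep: "\<exists>N \<eta> c. Trep K' N \<eta> c" if K': "K' \<subseteq> A" "card K' = card K" "A - K' \<noteq> {}" for K'
  proof -
    have "K' \<noteq> {}" using K' Suc(2) by auto
    then obtain i where i: "i \<in> K'" by blast
    define K0 where "K0 = K' - {i}"
    have "finite K'" using K' finite_subset by blast
    then have c0: "n = card K0" using i K' Suc(2) by (simp add: K0_def)
    have K0: "K0 \<subseteq> A" "i \<in> A - K0" "A - K0 - {i} \<noteq> {}" "K' = insert i K0" using K' i by (auto simp: K0_def)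
    from Suc(1)[OF c0 K0(1)] K0 obtain N \<eta> c where T: "Trep K0 N \<eta> c" "Tnz K0 N \<eta> c" by blast
    from ratio_family_column[OF inner K0(1-3)] obtain M' \<rho>' \<alpha> \<beta> where
      "ratio_column (Suc r + card K0) (D (Suc (Suc r + card K0))) (A - K0 - {i}) (R' K0 i) (R' (insert i K0)) i M' \<rho>' \<alpha> \<beta>" by blast
    from Trep_insert[OF K0(1-3) T this] show ?thesis unfolding K0(4) by blast
  qed
  then obtain N \<eta> c where "Trep K N \<eta> c" using Suc.prems by blast
  with Tnz_of_Trep[OF Suc.prems(1) this rep] show ?case by blast
qed

lemma T_nz: "K \<subseteq> A \<Longrightarrow> j \<in> insert r A - K \<Longrightarrow> Im z > 0 \<Longrightarrow> T K j z \<noteq> 0"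
  using T_exists[of K] T_nonzero[of K] by (cases "j = r") (simp, blast)

text \<open>If r belongs to K, the unit column r reduces the new minors to old ones. Otherwise the
  old minor of the columns K is common to numerator and denominator and cancels.\<close>

definition R :: "nat set \<Rightarrow> nat \<Rightarrow> nat \<Rightarrow> complex \<Rightarrow> complex" where
  "R K i j z = (if r \<in> K then R' (K - {r}) i j z else T K j z / T K i z)"

lemma Ar: "{r..m} = insert r A" using rm by auto

lemma R_cocycle:
  assumes "K \<subseteq> {r..m}" "i \<in> {r..m} - K" "j \<in> {r..m} - K" "l \<in> {r..m} - K" "Im z > 0"
  shows "R K i i z = 1 \<and> R K i j z * R K j l z = R K i l z"
proof (cases "r \<in> K")
  case True
  then have "K - {r} \<subseteq> A" "i \<in> A - (K - {r})" "j \<in> A - (K - {r})" "l \<in> A - (K - {r})" using assms unfolding Ar by auto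
  from ratio_family_cocycle(1,4)[OF inner this(1-3) assms(5)] this show ?thesis using True by (simp add: R_def)
next
  case False
  then have K: "K \<subseteq> A" "i \<in> insert r A - K" "j \<in> insert r A - K" using assms unfolding Ar by auto
  from T_nz[OF K(1,2) assms(5)] T_nz[OF K(1,3) assms(5)] show ?thesis using False by (simp add: R_def)
qed

text \<open>Unless r lies in K, where the old relation applies, the position of r among p, i, j
  decides which ratios are old and which are new. In each case \<open>T_insert\<close> and the
  cocycle rule of the old family reduce the claim to algebra.\<close>

lemma R_plucker:
  assumes "K \<subseteq> {r..m}" "p \<in> {r..m} - K" "i \<in> {r..m} - K" "j \<in> {r..m} - K" and z: "Im z > 0"
    and ne: "p \<noteq> i" "p \<noteq> j" "i \<noteq> j"
  shows "R (insert p K) i j z = R K i j z - R K i p z * R (insert i K) p j z"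
proof (cases "r \<in> K")
  case True
  then have K: "K - {r} \<subseteq> A" "p \<in> A - (K - {r})" "i \<in> A - (K - {r})" "j \<in> A - (K - {r})" using assms unfolding Ar by auto
  have "insert p K - {r} = insert p (K - {r})" "insert i K - {r} = insert i (K - {r})" using K by auto
  then show ?thesis using ratio_family_plucker[OF inner K z ne] True by (simp add: R_def)
next
  case False
  then have K: "K \<subseteq> A" "p \<in> insert r A - K" "i \<in> insert r A - K" "j \<in> insert r A - K" using assms unfolding Ar by auto
  have nz: "x \<in> insert r A - K \<Longrightarrow> T K x z \<noteq> 0" for x using T_nz[OF K(1) _ z] .
  have ins: "T (insert x K) y z = T K y z - T K x z * R' K x y z" if "x \<in> A - K" "y \<in> A - K" "x \<noteq> y" for x y
    by (rule T_insert[OF K(1) that z])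
  have nz2: "x \<in> A - K \<Longrightarrow> y \<in> insert r A - K \<Longrightarrow> x \<noteq> y \<Longrightarrow> T (insert x K) y z \<noteq> 0" for x y
    using K(1) by (intro T_nz z) auto
  have inv: "R' K x y z * R' K y x z = 1" if "x \<in> A - K" "y \<in> A - K" for x y by (rule ratio_family_cocycle(2)[OF inner K(1) that z])
  consider "p = r" | "i = r" | "j = r" | "p \<in> A" "i \<in> A" "j \<in> A" using K by blast
  then show ?thesis
  proof cases
    case 1
    then have x: "i \<in> A - K" "j \<in> A - K" using K ne by auto
    have "r \<notin> insert i K" using False x by auto
    moreover have "insert r K - {r} = K" using False by auto
    ultimately show ?thesis using 1 False nz[OF K(3)] ins[OF x ne(3)] by (simp add: R_def field_simps)
  next
    case 2
    then have x: "p \<in> A - K" "j \<in> A - K" using K ne by auto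
    have "r \<notin> insert p K" using False x by auto
    moreover have "insert r K - {r} = K" using False by auto
    ultimately show ?thesis using 2 False ins[OF x ne(2)] by (simp add: R_def)
  next
    case 3
    then have x: "p \<in> A - K" "i \<in> A - K" using K ne by auto
    have r: "r \<notin> insert p K" "r \<notin> insert i K" using False x by auto
    have n: "T K i z \<noteq> 0" "T (insert p K) i z \<noteq> 0" "T (insert i K) p z \<noteq> 0" using nz nz2 x K ne by auto
    note i1 = ins[OF x(1,2) ne(1)] and i2 = ins[OF x(2,1) ne(1)[symmetric]] and v = inv[OF x]
    have "1 / T (insert p K) i z = 1 / T K i z - T K p z / T K i z * (1 / T (insert i K) p z)"
    proof -
      have "T (insert i K) p z = - R' K i p z * T (insert p K) i z" using i1 i2 v by algebra
      moreover have "T (insert i K) p z - T K p z = - T K i z * R' K i p z" using i2 by algebra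
      moreover have "R' K i p z \<noteq> 0" using v by auto
      moreover have "1 / T K i z - T K p z / T K i z * (1 / T (insert i K) p z) = (T (insert i K) p z - T K p z) / (T K i z * T (insert i K) p z)"
        using n by (simp add: field_simps)
      ultimately show ?thesis using n by simp
    qed
    then show ?thesis using 3 False r by (simp add: R_def)
  next
    case 4
    then have x: "p \<in> A - K" "i \<in> A - K" "j \<in> A - K" using K by auto
    have r: "r \<notin> insert p K" "r \<notin> insert i K" using False x by auto
    have n: "T K i z \<noteq> 0" "T (insert p K) i z \<noteq> 0" "T (insert i K) p z \<noteq> 0" using nz nz2 x K ne by auto
    define tp ti tj u v w where "tp = T K p z" and "ti = T K i z" and "tj = T K j z"
      and "u = R' K p i z" and "v = R' K p j z" and "w = R' K i j z"
    have e: "T (insert p K) i z = ti - tp * u" "T (insert p K) j z = tj - tp * v" "T (insert i K) j z = tj - ti * w"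
      "T (insert i K) p z = tp - ti * R' K i p z"
      using ins x ne unfolding tp_def ti_def tj_def u_def v_def w_def by auto
    have uv: "v = u * w" unfolding u_def v_def w_def
      using ratio_family_cocycle(4)[OF inner K(1) x(1,2) z x(3)] by simp
    have ui: "u * R' K i p z = 1" unfolding u_def by (rule inv[OF x(1,2)])
    then have u0: "u \<noteq> 0" by auto
    then have ri: "R' K i p z = 1 / u" using ui by (simp add: field_simps)
    have d: "ti - tp * u \<noteq> 0" "ti \<noteq> 0" "tp - ti * (1 / u) \<noteq> 0" using n unfolding e ri by (auto simp: ti_def)
    have d3: "tp - ti * (1 / u) = - (ti - tp * u) / u" using u0 by (simp add: field_simps)
    have "(tj - tp * v) / (ti - tp * u) = tj / ti - tp / ti * ((tj - ti * w) / (tp - ti * (1 / u)))"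
      unfolding d3 uv using d(1,2) u0 by (simp add: divide_simps) (simp add: algebra_simps)
    then show ?thesis using False r unfolding R_def e ri[symmetric] by (simp add: e tp_def ti_def tj_def)
  qed
qed

text \<open>For r in K the column is an old one, and for i = r it is the representation of T itself.
  Otherwise the reciprocal of \<open>T K i\<close> is represented by \<open>reciprocal_ct\<close>,
  and \<open>reciprocal_step\<close> transfers this to the other functions of the column.\<close>

lemma R_column:
  assumes K: "K \<subseteq> {r..m}" and i: "i \<in> {r..m} - K" and ne: "{r..m} - K - {i} \<noteq> {}"
  shows "\<exists>N \<rho> \<alpha> \<beta>. ratio_column (r + card K) (D (Suc (r + card K))) ({r..m} - K - {i}) (R K i) (R (insert i K)) i N \<rho> \<alpha> \<beta>"
proof -
  have fin: "finite K" using K finite_subset by blast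
  consider "r \<in> K" | "r \<notin> K" "i = r" | "r \<notin> K" "i \<noteq> r" by blast
  then show ?thesis
  proof cases
    case 1
    define K0 where "K0 = K - {r}"
    have K0: "K0 \<subseteq> A" "i \<in> A - K0" "A - K0 - {i} \<noteq> {}" "{r..m} - K - {i} = A - K0 - {i}" using K i ne 1 unfolding Ar K0_def by auto
    have t: "Suc r + card K0 = r + card K" using fin 1 card_gt_0_iff[of K] by (auto simp: K0_def)
    have "insert i K - {r} = insert i K0" using i 1 by (auto simp: K0_def)
    then have "R K i = R' K0 i" "R (insert i K) = R' (insert i K0)" using 1 by (auto simp: R_def K0_def fun_eq_iff)
    then show ?thesis using ratio_family_column[OF inner K0(1-3)] unfolding K0(4) t by metis
  next
    case 2
    then have K': "K \<subseteq> A" "{r..m} - K - {i} = A - K" using K unfolding Ar by auto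
    from T_exists[OF K'(1)] ne K' obtain N \<eta> c where T: "Trep K N \<eta> c" "Tnz K N \<eta> c" by auto
    have "insert r K - {r} = K" using 2 by auto
    then have R1: "R (insert i K) = R' K" using 2 by (auto simp: R_def fun_eq_iff)
    have "ratio_column (r + card K) (D (Suc (r + card K))) (A - K) (R K i) (R (insert i K)) i N \<eta> (\<lambda>_. 0) c"
      unfolding ratio_column_def R1
    proof (intro conjI ballI allI impI)
      fix j z assume "j \<in> A - K" "0 < Im z"
      then show "R K i j z = of_real 0 * z + of_real (c j) + ct N (\<eta> j) z"
        using 2 TrepD(3)[OF T(1)] by (simp add: R_def)
    qed (use TrepD[OF T(1)] in auto)
    then show ?thesis unfolding K'(2) by blast
  next
    case 3
    then have K': "K \<subseteq> A" "i \<in> A - K" "{r..m} - K - {i} = insert r (A - K - {i})" using K i unfolding Ar by auto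
    let ?t = "r + card K"
    from T_exists[OF K'(1)] K' obtain N \<eta> c where T: "Trep K N \<eta> c" "Tnz K N \<eta> c" by blast
    note N = nondegenerate_onD[OF TrepD(1)[OF T(1)]] compact_Icc
    have "card K + card {i} + r \<le> m" using card_bound[of K "{i}"] K' by simp
    then have tA: "Suc ?t \<in> A" by simp
    obtain \<kappa> e \<alpha>\<^sub>0 \<beta>\<^sub>0 where \<kappa>: "nondegenerate_on (D (Suc ?t)) \<kappa>" and e0: "e \<noteq> 0" and ca: "c i \<noteq> 0 \<Longrightarrow> \<alpha>\<^sub>0 = 0"
      and rec: "\<And>z. Im z > 0 \<Longrightarrow> 1 / (of_real (c i) + ct N (\<eta> i) z) = of_real \<alpha>\<^sub>0 * z + of_real \<beta>\<^sub>0 + ct \<kappa> (\<lambda>_. e) z"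
      using reciprocal_ct[OF ab[OF tA] TrepD(1)[OF T(1)] TrepD(2)[OF T(1) K'(2)] TnzD(2)[OF T(2) K'(2)]] by metis
    note \<kappa>' = nondegenerate_onD[OF \<kappa>] compact_Icc
    have de: "density_on (D (Suc ?t)) (\<lambda>_. e)" by auto
    have Ri: "R K i j z = T K j z / T K i z" for j z using 3 by (simp add: R_def)
    have rR: "R K i r z = of_real \<alpha>\<^sub>0 * z + of_real \<beta>\<^sub>0 + ct \<kappa> (\<lambda>_. e) z" if "Im z > 0" for z
      using rec[OF that] TrepD(3)[OF T(1) K'(2) that] by (simp add: Ri)
    have r0: "\<alpha>\<^sub>0 \<noteq> 0 \<longrightarrow> r \<le> ?t \<and> ?t < i" using ca TnzD(1)[OF T(2) K'(2)] by (auto simp: not_less[symmetric])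
    have rt: "\<not> (i \<le> ?t \<and> ?t < r)" by simp
    have R2: "R (insert i K) l j z = T (insert i K) j z / T (insert i K) l z" for l j z using 3 K' by (simp add: R_def)
    show ?thesis
    proof (cases "A - K - {i} = {}")
      case True
      have "ratio_column ?t (D (Suc ?t)) {r} (R K i) (R (insert i K)) i \<kappa> (\<lambda>_ _. e) (\<lambda>_. \<alpha>\<^sub>0) (\<lambda>_. \<beta>\<^sub>0)"
        unfolding ratio_column_def
      proof (intro conjI ballI allI impI)
        fix j l x assume "j \<in> {r}" "l \<in> {r}"
        then have "R (insert i K) l j = (\<lambda>_. 1)" by (auto simp: R2 fun_eq_iff)
        then show "boundary_value (R (insert i K) l j) x (e / e)" using e0 by simp
      qed (use \<kappa> e0 rR r0 rt de in \<open>auto simp: nonvanishing_density_def\<close>)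
      then show ?thesis unfolding K'(3) True by blast
    next
      case False
      from ratio_family_column[OF inner K'(1,2) False] obtain M' \<rho>' \<alpha> \<beta> where
        col: "ratio_column (Suc r + card K) (D (Suc (Suc r + card K))) (A - K - {i}) (R' K i) (R' (insert i K)) i M' \<rho>' \<alpha> \<beta>" by blast
      define \<rho> where "\<rho> j y = - (c i + ct N (\<eta> i) y) * \<rho>' j y" for j y
      define c' where "c' j = c j - \<alpha> j * integral\<^sup>L N (\<eta> i) - c i * \<beta> j" for j
      have T': "Trep (insert i K) M' \<rho> c'" using Trep_insert[OF K'(1,2) False T col] unfolding \<rho>_def c'_def .
      have ci: "card (insert i K) = Suc (card K)" using fin K' by simp
      have eqs: "A - insert i K = A - K - {i}" "Suc (r + card (insert i K)) = Suc (Suc r + card K)" using ci by auto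
      let ?E = "D (Suc (Suc r + card K))"
      have DE: "D (Suc ?t) \<inter> ?E = {}" using disjoint_consecutive[OF K'(1,2) False] by simp
      note M' = nondegenerate_onD[OF ratio_columnD(1)[OF col]] compact_Icc
      have \<rho>d: "nonvanishing_density ?E (\<rho> j)" if "j \<in> A - K - {i}" for j
        using TrepD(2)[OF T', of j] that unfolding eqs by simp
      have Tb: "boundary_value (T (insert i K) j) x (c' j + ct M' (\<rho> j) x)" if "j \<in> A - K - {i}" "x \<in> D (Suc ?t)" for j x
      proof (rule T_boundary[OF T'])
        show "j \<in> A - insert i K" unfolding eqs by (rule that)
        show "x \<notin> D (Suc (r + card (insert i K)))" unfolding eqs using that(2) DE by blast
      qed
      \<comment> \<open>\<open>T_exists\<close> may supply another measure for the enlarged set.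
        Boundary values are unique, so the nonvanishing carries over to the representation at
        hand.\<close>
      have Tnz': "c' j + ct M' (\<rho> j) x \<noteq> 0" if j: "j \<in> A - K - {i}" and x: "x \<in> D (Suc ?t)" for j x
      proof -
        have iK: "insert i K \<subseteq> A" "A - insert i K \<noteq> {}" using K'(1,2) j by blast+
        from T_exists[OF this] obtain N2 \<eta>2 c2 where T2: "Trep (insert i K) N2 \<eta>2 c2" "Tnz (insert i K) N2 \<eta>2 c2" by blast
        have jx: "j \<in> A - insert i K" "x \<notin> D (Suc (r + card (insert i K)))"
          unfolding eqs using j x DE by blast+
        from boundary_value_unique[OF T_boundary[OF T2(1) jx] Tb[OF j x]] TnzD(2)[OF T2(2) jx] show ?thesis by simp
      qed
      \<comment> \<open>Up to the factor \<open>e\<close>, the densities of the new column are the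
        boundary values of T for the enlarged set; on the present interval these are regular, being
        transforms over the next one.\<close>
      define \<tau> where "\<tau> j x = (if j = r then 1 else c' j + ct M' (\<rho> j) x)" for j x
      have \<tau>b: "boundary_value (T (insert i K) j) x (\<tau> j x)" "\<tau> j x \<noteq> 0" if "j \<in> insert r (A - K - {i})" "x \<in> D (Suc ?t)" for j x
      proof -
        have "boundary_value (T (insert i K) r) x 1" by (rule boundary_value_cong[OF boundary_value_const]) simp
        then show "boundary_value (T (insert i K) j) x (\<tau> j x)" "\<tau> j x \<noteq> 0"
          using that Tb Tnz' by (auto simp: \<tau>_def)
      qed
      define \<alpha>' where "\<alpha>' j = (if j = r then \<alpha>\<^sub>0 else \<alpha> j + c' j * \<alpha>\<^sub>0)" for j
      define \<beta>' where "\<beta>' j = (if j = r then \<beta>\<^sub>0 else \<beta> j + c' j * \<beta>\<^sub>0 + \<alpha>\<^sub>0 * integral\<^sup>L M' (\<rho> j))" for j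
      define \<rho>'' where "\<rho>'' j x = e * \<tau> j x" for j x
      have dn: "nonvanishing_density (D (Suc ?t)) (\<rho>'' j)" if "j \<in> insert r (A - K - {i})" for j
      proof (cases "j = r")
        case True
        then have "\<rho>'' j = (\<lambda>_. e)" by (simp add: \<rho>''_def \<tau>_def fun_eq_iff)
        then show ?thesis using de e0 by (simp add: nonvanishing_density_def)
      next
        case False
        then have j: "j \<in> A - K - {i}" using that by simp
        have "density_on (D (Suc ?t)) (\<lambda>x. c' j + ct M' (\<rho> j) x)"
          using density_on_ct[OF M' nonvanishing_densityD(1)[OF \<rho>d[OF j]]] DE by (auto simp: Int_commute)
        then have "density_on (D (Suc ?t)) (\<lambda>x. e * (c' j + ct M' (\<rho> j) x))" by (rule density_on_cmult)
        moreover have "\<rho>'' j = (\<lambda>x. e * (c' j + ct M' (\<rho> j) x))" using False by (simp add: \<rho>''_def \<tau>_def fun_eq_iff)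
        ultimately have "density_on (D (Suc ?t)) (\<rho>'' j)" by simp
        moreover have "\<forall>x\<in>D (Suc ?t). \<rho>'' j x \<noteq> 0" using \<tau>b(2)[OF that] e0 by (simp add: \<rho>''_def)
        ultimately show ?thesis unfolding nonvanishing_density_def by blast
      qed
      have rep: "R K i j z = of_real (\<alpha>' j) * z + of_real (\<beta>' j) + ct \<kappa> (\<rho>'' j) z" if jj: "j \<in> insert r (A - K - {i})" and z: "Im z > 0" for j z
      proof (cases "j = r")
        case True
        then show ?thesis using rR[OF z] by (simp add: \<alpha>'_def \<beta>'_def \<rho>''_def[abs_def] \<tau>_def)
      next
        case False
        then have j: "j \<in> A - K - {i}" using jj by simp
        then have jA: "j \<in> A - K" "i \<noteq> j" "j \<in> A - insert i K" by auto
        have Ti: "T K i z \<noteq> 0" by (rule T_nonzero[OF T(1) K'(2) z])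
        \<comment> \<open>On the next interval the represented function has the boundary value 1 /
          T, which is the relation between densities that \<open>reciprocal_step\<close> asks
          for.\<close>
        have rr: "(\<alpha>\<^sub>0 * y + \<beta>\<^sub>0 + ct \<kappa> (\<lambda>_. e) y) * \<rho> j y = - \<rho>' j y" if y: "y \<in> ?E" for y
        proof -
          have yD: "y \<notin> D (Suc ?t)" using y DE by auto
          have ny: "c i + ct N (\<eta> i) y \<noteq> 0" by (rule TnzD(2)[OF T(2) K'(2) yD])
          have "boundary_value (\<lambda>z. 1 / T K i z) y (1 / (c i + ct N (\<eta> i) y))"
            by (rule boundary_value_divide[OF boundary_value_const T_boundary[OF T(1) K'(2) yD] ny])
          then have "boundary_value (R K i r) y (1 / (c i + ct N (\<eta> i) y))" by (rule boundary_value_cong) (simp add: Ri)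
          moreover have "boundary_value (R K i r) y (\<alpha>\<^sub>0 * y + \<beta>\<^sub>0 + ct \<kappa> (\<lambda>_. e) y)"
            by (rule boundary_value_cong[OF boundary_value_linear_ct[OF \<kappa>' de yD]]) (simp add: rR)
          ultimately have "\<alpha>\<^sub>0 * y + \<beta>\<^sub>0 + ct \<kappa> (\<lambda>_. e) y = 1 / (c i + ct N (\<eta> i) y)" by (rule boundary_value_unique[rotated])
          moreover have "1 / w * (- w * v) = - v" if "w \<noteq> 0" for w v :: real using that by simp
          ultimately show ?thesis unfolding \<rho>_def using ny by presburger
        qed
        have "T K j z = T (insert i K) j z + T K i z * R' K i j z" using T_insert[OF K'(1,2) jA(1,2) z] by simp
        then have "R K i j z = 1 / T K i z * T (insert i K) j z + R' K i j z" using Ti by (simp add: Ri field_simps)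
        also have "1 / T K i z = of_real \<alpha>\<^sub>0 * z + of_real \<beta>\<^sub>0 + ct \<kappa> (\<lambda>_. e) z" using rR[OF z] by (simp add: Ri)
        also have "T (insert i K) j z = of_real (c' j) + ct M' (\<rho> j) z" by (rule TrepD(3)[OF T' jA(3) z])
        also have "R' K i j z = of_real (\<alpha> j) * z + of_real (\<beta> j) + ct M' (\<rho>' j) z" by (rule ratio_columnD(3)[OF col j z])
        also have "(of_real \<alpha>\<^sub>0 * z + of_real \<beta>\<^sub>0 + ct \<kappa> (\<lambda>_. e) z) * (of_real (c' j) + ct M' (\<rho> j) z) + (of_real (\<alpha> j) * z + of_real (\<beta> j) + ct M' (\<rho>' j) z)
           = of_real (\<alpha> j + c' j * \<alpha>\<^sub>0) * z + of_real (\<beta> j + c' j * \<beta>\<^sub>0 + \<alpha>\<^sub>0 * integral\<^sup>L M' (\<rho> j)) + ct \<kappa> (\<lambda>x. e * (c' j + ct M' (\<rho> j) x)) z"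
          by (rule reciprocal_step[OF \<kappa>' M' DE nonvanishing_densityD(1)[OF ratio_columnD(2)[OF col j]] nonvanishing_densityD(1)[OF \<rho>d[OF j]] rr z])
        finally show ?thesis using False by (simp add: \<alpha>'_def \<beta>'_def \<rho>''_def[abs_def] \<tau>_def)
      qed
      \<comment> \<open>Compared along the imaginary axis: for i \<le> t the denominator has a limit
        different from 0; for i and j beyond t both transforms decay like 1 / z and the quotient has
        a finite limit; for j \<le> t < i a linear term is permitted.\<close>
      have growth: "(\<alpha>' j \<noteq> 0 \<longrightarrow> j \<le> ?t \<and> ?t < i) \<and> (i \<le> ?t \<and> ?t < j \<longrightarrow> \<alpha>' j = 0 \<and> \<beta>' j = 0)" if jj: "j \<in> insert r (A - K - {i})" for j
      proof (cases "j = r")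
        case True then show ?thesis using r0 by (simp add: \<alpha>'_def)
      next
        case False
        then have j: "j \<in> A - K - {i}" using jj by simp
        then have jA: "j \<in> A - K" by auto
        let ?w = "\<lambda>y. \<i> * complex_of_real y"
        note \<eta>i = TrepD(2)[OF T(1) K'(2)] and \<eta>j = TrepD(2)[OF T(1) jA]
        note di = nonvanishing_densityD(1)[OF \<eta>i] and dj = nonvanishing_densityD(1)[OF \<eta>j]
        have ev: "\<forall>\<^sub>F y in at_top. T K k (?w y) = of_real (c k) + ct N (\<eta> k) (?w y)" if "k \<in> A - K" for k
          using eventually_gt_at_top[of 0] by eventually_elim (simp add: TrepD(3)[OF T(1) that])
        have lT: "((\<lambda>y. T K k (?w y)) \<longlongrightarrow> of_real (c k)) at_top" if "k \<in> A - K" for k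
        proof (rule Lim_transform_eventually)
          show "((\<lambda>y. of_real (c k) + ct N (\<eta> k) (?w y)) \<longlongrightarrow> of_real (c k)) at_top"
            using tendsto_add[OF tendsto_const ct_imaginary_axis(1)[OF N nonvanishing_densityD(1)[OF TrepD(2)[OF T(1) that]]], of "of_real (c k)"] by simp
          show "\<forall>\<^sub>F y in at_top. of_real (c k) + ct N (\<eta> k) (?w y) = T K k (?w y)"
            using ev[OF that] by eventually_elim simp
        qed
        have evR: "\<forall>\<^sub>F y in at_top. R K i j (?w y) = of_real (\<alpha>' j) * ?w y + of_real (\<beta>' j) + ct \<kappa> (\<rho>'' j) (?w y)"
          using eventually_gt_at_top[of 0] by eventually_elim (simp add: rep[OF jj])
        have concl: "\<alpha>' j = 0 \<and> of_real (\<beta>' j) = L" if "((\<lambda>y. R K i j (?w y)) \<longlongrightarrow> L) at_top" for L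
          by (rule linear_ct_bounded_imp[OF \<kappa>' nonvanishing_densityD(1)[OF dn[OF jj]]])
            (rule Lim_transform_eventually[OF that evR])
        consider "i \<le> ?t" | "?t < i" "?t < j" | "?t < i" "j \<le> ?t" by linarith
        then show ?thesis
        proof cases
          case 1
          then have ci: "c i \<noteq> 0" using TnzD(1)[OF T(2) K'(2)] by simp
          have "((\<lambda>y. R K i j (?w y)) \<longlongrightarrow> of_real (c j) / of_real (c i)) at_top"
            unfolding Ri using ci by (intro tendsto_divide lT jA K') simp
          from concl[OF this] have "\<alpha>' j = 0" "complex_of_real (\<beta>' j) = of_real (c j) / of_real (c i)" by auto
          then show ?thesis using TrepD(4)[OF T(1) jA] by auto
        next
          case 2
          then have c0: "c i = 0" "c j = 0" using TrepD(4)[OF T(1)] K' jA by auto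
          have "((\<lambda>y. ?w y * ct N (\<eta> j) (?w y) / (?w y * ct N (\<eta> i) (?w y))) \<longlongrightarrow> of_real (integral\<^sup>L N (\<eta> j)) / of_real (integral\<^sup>L N (\<eta> i))) at_top"
            using integral_nonvanishing_density[OF TrepD(1)[OF T(1)] \<eta>i]
            by (intro tendsto_divide ct_imaginary_axis(2)[OF N] di dj) simp
          then have "((\<lambda>y. R K i j (?w y)) \<longlongrightarrow> of_real (integral\<^sup>L N (\<eta> j)) / of_real (integral\<^sup>L N (\<eta> i))) at_top"
          proof (rule Lim_transform_eventually)
            show "\<forall>\<^sub>F y in at_top. ?w y * ct N (\<eta> j) (?w y) / (?w y * ct N (\<eta> i) (?w y)) = R K i j (?w y)"
              using ev[OF K'(2)] ev[OF jA] eventually_gt_at_top[of 0] by eventually_elim (simp add: Ri c0)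
          qed
          then show ?thesis using concl 2 by auto
        qed auto
      qed
      have "ratio_column ?t (D (Suc ?t)) (insert r (A - K - {i})) (R K i) (R (insert i K)) i \<kappa> \<rho>'' \<alpha>' \<beta>'"
        unfolding ratio_column_def
      proof (intro conjI ballI)
        fix j l x assume j: "j \<in> insert r (A - K - {i})" and l: "l \<in> insert r (A - K - {i})" and x: "x \<in> D (Suc ?t)"
        have "boundary_value (\<lambda>z. T (insert i K) j z / T (insert i K) l z) x (\<tau> j x / \<tau> l x)"
          by (intro boundary_value_divide \<tau>b j l x)
        moreover have "\<rho>'' j x / \<rho>'' l x = \<tau> j x / \<tau> l x" using e0 by (simp add: \<rho>''_def)
        ultimately show "boundary_value (R (insert i K) l j) x (\<rho>'' j x / \<rho>'' l x)"
          by (simp add: R2[abs_def])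
      qed (use \<kappa> dn rep growth in blast)+
      then show ?thesis unfolding K'(3) by blast
    qed
  qed
qed

theorem ratio_family_step: "ratio_family a b m r R"
  unfolding ratio_family_def
proof (intro conjI)
  show "\<forall>K\<subseteq>{r..m}. \<forall>i\<in>{r..m}-K. \<forall>j\<in>{r..m}-K. \<forall>l\<in>{r..m}-K. \<forall>z. Im z > 0 \<longrightarrow>
        R K i i z = 1 \<and> R K i j z * R K j l z = R K i l z"
    by (intro allI impI ballI) (rule R_cocycle; assumption)
  show "\<forall>K\<subseteq>{r..m}. \<forall>p\<in>{r..m}-K. \<forall>i\<in>{r..m}-K. \<forall>j\<in>{r..m}-K. \<forall>z. Im z > 0 \<longrightarrow> p \<noteq> i \<longrightarrow> p \<noteq> j \<longrightarrow> i \<noteq> j \<longrightarrow>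
        R (insert p K) i j z = R K i j z - R K i p z * R (insert i K) p j z"
    by (intro allI impI ballI) (rule R_plucker; assumption)
  show "\<forall>K\<subseteq>{r..m}. \<forall>i\<in>{r..m}-K. {r..m}-K-{i} \<noteq> {} \<longrightarrow>
        (\<exists>M \<rho> \<alpha> \<beta>. ratio_column (r + card K) {a (Suc (r + card K))..b (Suc (r + card K))} ({r..m}-K-{i})
            (R K i) (R (insert i K)) i M \<rho> \<alpha> \<beta>)"
    by (intro allI impI ballI) (rule R_column; assumption)
qed

lemma R_empty: "j \<in> A \<Longrightarrow> R {} r j z = ct M (\<rho>\<^sub>0 j) z"
  by (auto simp: R_def T_def)

end

lemma ratio_family_base: "ratio_family a b m m (\<lambda>_ _ _ _. 1)"
  unfolding ratio_family_def by auto

section \<open>Counting zeros\<close>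

text \<open>The sum is the coefficient of degree |X| - 1 in the interpolation polynomial of p, and
  this polynomial is p itself, of smaller degree.\<close>

lemma lagrange_sum_zero:
  fixes p :: "'a::field poly"
  assumes fin: "finite X" and deg: "degree p + 2 \<le> card X \<or> p = 0"
  shows "(\<Sum>x\<in>X. poly p x / (\<Prod>y\<in>X-{x}. x - y)) = 0"
proof (cases "p = 0")
  case False
  define l where "l x = smult (poly p x / (\<Prod>y\<in>X-{x}. x - y)) (\<Prod>y\<in>X-{x}. [:- y, 1:])" for x
  define q where "q = (\<Sum>x\<in>X. l x)"
  have ev: "poly (l x) w = (if w = x then poly p x else 0)" if "x \<in> X" "w \<in> X" for x w
    using that fin by (auto simp: l_def poly_prod prod_zero_iff)
  have dl: "degree (\<Prod>y\<in>X-{x}. [:- y, 1:]) = card X - 1" if "x \<in> X" for x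
    using that fin by (subst degree_prod_eq_sum_degree) auto
  have "p = q"
  proof (rule poly_eqI_degree[of X])
    show "poly p x = poly q x" if "x \<in> X" for x
      using that fin ev by (simp add: q_def poly_sum sum.delta cong: if_cong)
    show "degree p < card X" using deg False by auto
    have "degree q \<le> card X - 1"
      unfolding q_def
    proof (rule degree_sum_le[OF fin])
      fix x assume "x \<in> X"
      then show "degree (l x) \<le> card X - 1" unfolding l_def by (intro order_trans[OF degree_smult_le]) (simp add: dl)
    qed
    moreover have "card X > 0" using deg False by auto
    ultimately show "degree q < card X" by linarith
  qed
  then have "coeff q (card X - 1) = 0" using deg False by (intro coeff_eq_0) auto
  moreover have "coeff (l x) (card X - 1) = poly p x / (\<Prod>y\<in>X-{x}. x - y)" if "x \<in> X" for x
  proof -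
    have "lead_coeff (\<Prod>y\<in>X-{x}. [:- y, 1:]) = 1" by (simp add: lead_coeff_prod)
    then have "coeff (\<Prod>y\<in>X-{x}. [:- y, 1:]) (card X - 1) = 1" using dl[OF that] by simp
    then show ?thesis by (simp add: l_def)
  qed
  ultimately show ?thesis by (simp add: q_def coeff_sum cong: sum.cong)
qed simp

text \<open>This is \<open>lagrange_sum_zero\<close> for the nodes X together with z.\<close>

lemma partial_fraction:
  fixes q :: "'a::field poly"
  assumes fin: "finite X" and deg: "degree q < card X" and z: "z \<notin> X"
  shows "poly q z / (\<Prod>y\<in>X. z - y) = (\<Sum>x\<in>X. poly q x / (\<Prod>y\<in>X-{x}. x - y) / (z - x))"
proof -
  have "(\<Sum>x\<in>insert z X. poly q x / (\<Prod>y\<in>insert z X-{x}. x - y)) = 0"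
    by (rule lagrange_sum_zero) (use fin deg z in auto)
  moreover have "(\<Sum>x\<in>X. poly q x / (\<Prod>y\<in>insert z X-{x}. x - y)) = - (\<Sum>x\<in>X. poly q x / (\<Prod>y\<in>X-{x}. x - y) / (z - x))"
    unfolding sum_negf[symmetric]
  proof (rule sum.cong[OF refl])
    fix x assume x: "x \<in> X"
    have "insert z X - {x} = insert z (X - {x})" "z \<notin> X - {x}" using z x by auto
    then have "(\<Prod>y\<in>insert z X-{x}. x - y) = (x - z) * (\<Prod>y\<in>X-{x}. x - y)" using fin by simp
    also have "\<dots> = - ((\<Prod>y\<in>X-{x}. x - y) * (z - x))" by (simp add: algebra_simps)
    finally show "poly q x / (\<Prod>y\<in>insert z X-{x}. x - y) = - (poly q x / (\<Prod>y\<in>X-{x}. x - y) / (z - x))"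
      by simp
  qed
  moreover have "insert z X - {z} = X" using z by auto
  ultimately show ?thesis using fin z by simp
qed

lemma homogeneous_system_nontrivial:
  fixes g :: "'b \<Rightarrow> 'c \<Rightarrow> real"
  assumes "finite X" "finite B" "card X < card B"
  shows "\<exists>c. (\<exists>b\<in>B. c b \<noteq> 0) \<and> (\<forall>x\<in>X. (\<Sum>b\<in>B. c b * g b x) = 0)"
  using assms
proof (induction X arbitrary: B g rule: finite_induct)
  case empty
  then obtain b where "b \<in> B" by fastforce
  then show ?case by (intro exI[of _ "\<lambda>_. 1"]) auto
next
  case (insert x X)
  show ?case
  proof (cases "\<forall>b\<in>B. g b x = 0")
    case True
    have "card X < card B" using insert by simp
    from insert.IH[OF insert.prems(1) this, of g] obtain c where c: "\<exists>b\<in>B. c b \<noteq> 0" "\<forall>x\<in>X. (\<Sum>b\<in>B. c b * g b x) = 0" by blast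
    then show ?thesis using True by (intro exI[of _ c]) auto
  next
    case False
    then obtain b0 where b0: "b0 \<in> B" "g b0 x \<noteq> 0" by blast
    define g' where "g' b y = g b y - g b x / g b0 x * g b0 y" for b y
    have "card X < card (B - {b0})" using insert b0 by simp
    from insert.IH[OF _ this, of g'] insert.prems obtain c where c: "\<exists>b\<in>B-{b0}. c b \<noteq> 0" "\<forall>y\<in>X. (\<Sum>b\<in>B-{b0}. c b * g' b y) = 0" by auto
    define s where "s = - (\<Sum>b\<in>B-{b0}. c b * g b x) / g b0 x"
    define c' where "c' b = (if b = b0 then s else c b)" for b
    have sum': "(\<Sum>b\<in>B. c' b * g b y) = s * g b0 y + (\<Sum>b\<in>B-{b0}. c b * g b y)" for y
    proof -
      have "(\<Sum>b\<in>B. c' b * g b y) = c' b0 * g b0 y + (\<Sum>b\<in>B-{b0}. c' b * g b y)"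
        using insert.prems b0 by (intro sum.remove) auto
      also have "(\<Sum>b\<in>B-{b0}. c' b * g b y) = (\<Sum>b\<in>B-{b0}. c b * g b y)" by (rule sum.cong) (auto simp: c'_def)
      finally show ?thesis by (simp add: c'_def)
    qed
    have g'e: "(\<Sum>b\<in>B-{b0}. c b * g' b y) = s * g b0 y + (\<Sum>b\<in>B-{b0}. c b * g b y)" for y
    proof -
      have "(\<Sum>b\<in>B-{b0}. c b * g' b y) = (\<Sum>b\<in>B-{b0}. c b * g b y - c b * g b x * (g b0 y / g b0 x))"
        by (rule sum.cong) (auto simp: g'_def algebra_simps)
      also have "\<dots> = (\<Sum>b\<in>B-{b0}. c b * g b y) - (\<Sum>b\<in>B-{b0}. c b * g b x) * (g b0 y / g b0 x)"
        by (simp only: sum_subtractf sum_distrib_right)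
      finally show ?thesis by (simp add: s_def)
    qed
    have "(\<Sum>b\<in>B. c' b * g b y) = 0" if "y \<in> insert x X" for y
    proof (cases "y = x")
      case True then show ?thesis unfolding sum' using b0 by (simp add: s_def)
    next
      case False then show ?thesis using c(2) that g'e[of y] unfolding sum' by simp
    qed
    moreover have "\<exists>b\<in>B. c' b \<noteq> 0" using c(1) by (auto simp: c'_def)
    ultimately show ?thesis by (intro exI[of _ c']) auto
  qed
qed

text \<open>If a solution vanishing at the prescribed points did not change sign at one of them, a small
  perturbation would produce one zero too many.\<close>

lemma chebyshev_prescribed_signs:
  fixes g :: "'b \<Rightarrow> real \<Rightarrow> real"
  assumes B: "finite B" and Z: "finite Z" "Z \<subseteq> {c..d}" "card B = Suc (card Z)" and cd: "c < d"
    and cont: "\<And>b. b \<in> B \<Longrightarrow> continuous_on {c..d} (g b)"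
    and cheb: "\<And>k X. finite X \<Longrightarrow> X \<subseteq> {c..d} \<Longrightarrow> card B \<le> card X \<Longrightarrow> (\<And>x. x \<in> X \<Longrightarrow> (\<Sum>b\<in>B. k b * g b x) = 0) \<Longrightarrow> \<forall>b\<in>B. k b = 0"
    and int: "Z \<subseteq> {c<..<d}"
  shows "\<exists>k e. (\<exists>b\<in>B. k b \<noteq> 0) \<and> e \<in> {1, -1::real} \<and> (\<forall>x\<in>{c..d}. 0 \<le> e * (\<Sum>b\<in>B. k b * g b x) * (\<Prod>z\<in>Z. x - z)) \<and> {x\<in>{c..d}. (\<Sum>b\<in>B. k b * g b x) = 0} = Z"
proof -
  obtain k where k: "\<exists>b\<in>B. k b \<noteq> 0" "\<forall>x\<in>Z. (\<Sum>b\<in>B. k b * g b x) = 0"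
    using homogeneous_system_nontrivial[of Z B g] B Z by auto
  define F where "F x = (\<Sum>b\<in>B. k b * g b x)" for x
  have Fc: "continuous_on {c..d} F" unfolding F_def by (intro continuous_intros cont)
  have zeros: "{x\<in>{c..d}. F x = 0} = Z"
  proof (rule ccontr)
    assume "{x\<in>{c..d}. F x = 0} \<noteq> Z"
    then obtain y where y: "y \<in> {c..d}" "F y = 0" "y \<notin> Z" using k Z by (auto simp: F_def)
    have "\<forall>b\<in>B. k b = 0"
      by (rule cheb[of "insert y Z"]) (use y Z k in \<open>auto simp: F_def\<close>)
    then show False using k by blast
  qed
  have "finite {x\<in>{c..d}. F x = 0}" using zeros Z(1) by simp
  from sign_pattern[OF is_interval_cc Fc this] obtain Z' e where Z': "Z' \<subseteq> Z" "e \<in> {1, -1::real}" "\<forall>x\<in>{c..d}. 0 \<le> e * F x * (\<Prod>y\<in>Z'. x - y)"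
    unfolding zeros by blast
  have "Z' = Z"
  proof (rule ccontr)
    assume "Z' \<noteq> Z"
    then obtain z where z: "z \<in> Z" "z \<notin> Z'" using Z' by blast
    have fZ': "finite Z'" using Z' Z finite_subset by blast
    define S where "S = - Z"
    define P where "P x = e * (\<Prod>y\<in>Z'. x - y)" for x
    have Pz: "P z \<noteq> 0" using z fZ' Z' by (auto simp: P_def)
    obtain \<delta> where \<delta>: "\<delta> > 0" "{z-\<delta>..z+\<delta>} \<subseteq> {c..d}" "\<And>x. x \<in> {z-\<delta>..z+\<delta>} \<Longrightarrow> x \<in> Z \<Longrightarrow> x = z" "\<And>x. x \<in> {z-\<delta>..z+\<delta>} \<Longrightarrow> P x * P z > 0"
    proof -
      have Pc: "isCont P z" unfolding P_def by (intro continuous_intros)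
      obtain d1 where d1: "d1 > 0" "\<And>x. \<bar>x - z\<bar> < d1 \<Longrightarrow> \<bar>P x - P z\<bar> < \<bar>P z\<bar>"
        using Pc[unfolded continuous_at_eps_delta, rule_format, of "\<bar>P z\<bar>"] Pz by (auto simp: dist_real_def)
      have "open (- (Z - {z}))" using Z by (intro open_Compl finite_imp_closed) auto
      then obtain d2 where d2: "d2 > 0" "ball z d2 \<subseteq> - (Z - {z})" using open_contains_ball[of "- (Z - {z})"] by auto
      have zz: "c < z" "z < d" using int z by auto
      define d3 where "d3 = Min {d1, d2, z - c, d - z} / 2"
      have "Min {d1, d2, z - c, d - z} > 0" using d1 d2 zz by simp
      moreover have "Min {d1, d2, z - c, d - z} \<le> d1" "Min {d1, d2, z - c, d - z} \<le> d2" "Min {d1, d2, z - c, d - z} \<le> z - c" "Min {d1, d2, z - c, d - z} \<le> d - z" by auto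
      ultimately have d3: "d3 > 0" "d3 < d1" "d3 < d2" "d3 < z - c" "d3 < d - z" unfolding d3_def by linarith+
      show thesis
      proof (rule that[of d3])
        show "{z-d3..z+d3} \<subseteq> {c..d}" using d3 by auto
        show "x = z" if "x \<in> {z-d3..z+d3}" "x \<in> Z" for x
        proof -
          have "x \<in> ball z d2" using that d3 by (auto simp: dist_real_def)
          then show ?thesis using d2 that by auto
        qed
        show "P x * P z > 0" if "x \<in> {z-d3..z+d3}" for x
        proof -
          have "\<bar>P x - P z\<bar> < \<bar>P z\<bar>" using that d3 by (intro d1) auto
          then show ?thesis using Pz by (cases "P z > 0") (auto simp: zero_less_mult_iff abs_if split: if_splits)
        qed
      qed (rule d3)
    qed
    \<comment> \<open>A function H vanishing at y and at the other points of Z has as many zeros as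
      a nontrivial combination may have, hence H z \<noteq> 0. The endpoint c can serve as y because
      Z is interior.\<close>
    obtain y where y: "y \<in> {c..d}" "y \<notin> Z" using int cd by (intro that[of c]) auto
    have cZ: "card (insert y (Z - {z})) < card B"
      using Z z y card_Suc_Diff1[of Z z] by (simp del: card_Diff_insert)
    obtain h where h: "\<exists>b\<in>B. h b \<noteq> 0" "\<forall>x\<in>insert y (Z - {z}). (\<Sum>b\<in>B. h b * g b x) = 0"
      using homogeneous_system_nontrivial[OF _ B cZ, of g] Z(1) by blast
    define H where "H x = (\<Sum>b\<in>B. h b * g b x)" for x
    have Hc: "continuous_on {c..d} H" unfolding H_def by (intro continuous_intros cont)
    have Hz: "H z \<noteq> 0"
    proof
      assume "H z = 0"
      have "\<forall>b\<in>B. h b = 0"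
        by (rule cheb[of "insert y Z"]) (use h \<open>H z = 0\<close> y Z in \<open>auto simp: H_def\<close>)
      then show False using h by blast
    qed
    define \<sigma> where "\<sigma> = P z"
    have Fpos: "0 < F x * \<sigma>" if "x \<in> {z-\<delta>..z+\<delta>}" "x \<noteq> z" for x
    proof -
      have "F x \<noteq> 0" using zeros \<delta>(2,3) that by blast
      moreover have "0 \<le> e * F x * (\<Prod>y\<in>Z'. x - y)" using Z'(3) \<delta>(2) that by blast
      then have "0 \<le> F x * P x" by (simp add: P_def mult_ac)
      ultimately show ?thesis using \<delta>(4)[OF that(1)] unfolding \<sigma>_def
        by (auto simp: zero_le_mult_iff zero_less_mult_iff)
    qed
    define Fm where "Fm = min (F (z - \<delta>) * \<sigma>) (F (z + \<delta>) * \<sigma>)"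
    have Fm: "Fm > 0" using Fpos[of "z - \<delta>"] Fpos[of "z + \<delta>"] \<delta>(1) by (simp add: Fm_def)
    define Hm where "Hm = \<bar>H (z - \<delta>) * \<sigma>\<bar> + \<bar>H (z + \<delta>) * \<sigma>\<bar> + 1"
    have Hm: "Hm > 0" by (simp add: Hm_def add_nonneg_pos)
    \<comment> \<open>The sign of s makes F - s H differ in sign at z from its neighbours; the size
      of s is too small to change the signs at z - \<delta> and z + \<delta>. Two zeros thus replace
      the single zero z.\<close>
    define s where "s = (if H z * \<sigma> > 0 then 1 else -1) * (Fm / (2 * Hm))"
    define G where "G x = (F x - s * H x) * \<sigma>" for x
    have Hzs: "H z * \<sigma> \<noteq> 0" using Hz Pz by (simp add: \<sigma>_def)
    have "F z = 0" using k z by (simp add: F_def)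
    then have Gz: "G z < 0"
      proof -
      have "G z = - (Fm / (2 * Hm)) * \<bar>H z * \<sigma>\<bar>"
        unfolding G_def s_def \<open>F z = 0\<close> using Hzs by (auto simp: abs_if)
      also have "\<dots> < 0" using Hzs Fm Hm by (intro mult_neg_pos) auto
      finally show ?thesis .
    qed
    have Ge: "G x > 0" if "x = z - \<delta> \<or> x = z + \<delta>" for x
    proof -
      have "\<bar>s * (H x * \<sigma>)\<bar> = Fm / (2 * Hm) * \<bar>H x * \<sigma>\<bar>" unfolding s_def using Fm Hm by (simp add: abs_mult)
      also have "\<dots> \<le> Fm / (2 * Hm) * Hm" using that Fm Hm by (intro mult_left_mono) (auto simp: Hm_def)
      also have "\<dots> < Fm" using Fm Hm by simp
      also have "Fm \<le> F x * \<sigma>" using that by (auto simp: Fm_def)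
      finally show ?thesis by (simp add: G_def algebra_simps abs_if split: if_splits)
    qed
    have Gc: "continuous_on {z-\<delta>..z+\<delta>} G" unfolding G_def
      by (intro continuous_intros continuous_on_subset[OF Fc \<delta>(2)] continuous_on_subset[OF Hc \<delta>(2)])
    obtain x1 where x1: "z - \<delta> \<le> x1" "x1 \<le> z" "G x1 = 0"
      using IVT2'[of G z 0 "z - \<delta>"] Gz Ge[of "z - \<delta>"] \<delta>(1) Gc by (force intro: continuous_on_subset less_imp_le)
    obtain x2 where x2: "z \<le> x2" "x2 \<le> z + \<delta>" "G x2 = 0"
      using IVT'[of G z 0 "z + \<delta>"] Gz Ge[of "z + \<delta>"] \<delta>(1) Gc by (force intro: continuous_on_subset less_imp_le)
    have x12: "x1 \<noteq> z" "x2 \<noteq> z" "x1 \<noteq> x2" using x1 x2 Gz by auto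
    have s0: "\<sigma> \<noteq> 0" using Pz by (simp add: \<sigma>_def)
    have FH: "(\<Sum>b\<in>B. (k b - s * h b) * g b x) = F x - s * H x" for x
      by (simp add: F_def H_def sum_subtractf sum_distrib_left algebra_simps)
    have "\<forall>b\<in>B. k b - s * h b = 0"
    proof (rule cheb[of "insert x1 (insert x2 (Z - {z}))"])
      have n: "x1 \<notin> Z - {z}" "x2 \<notin> Z - {z}" using \<delta>(3) x1 x2 x12 \<delta>(1) by (meson Diff_iff atLeastAtMost_iff insertI1 order_trans add_increasing2 less_imp_le diff_le_eq le_add_same_cancel1)+
      show "card B \<le> card (insert x1 (insert x2 (Z - {z})))" using n x12 Z z by (simp add: card_Diff_singleton)
      show "insert x1 (insert x2 (Z - {z})) \<subseteq> {c..d}" using x1 x2 \<delta>(1,2) Z by auto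
      fix x assume "x \<in> insert x1 (insert x2 (Z - {z}))"
      then show "(\<Sum>b\<in>B. (k b - s * h b) * g b x) = 0"
        unfolding FH using x1(3) x2(3) s0 k h by (auto simp: G_def F_def H_def)
    qed (use Z in auto)
    then have "\<forall>x. F x = s * H x" using FH by (simp add: F_def H_def sum_distrib_left mult.assoc)
    then show False using \<open>F z = 0\<close> Hz Fm Hm by (auto simp: s_def split: if_splits)
  qed
  then show ?thesis using k(1) Z' zeros unfolding F_def by blast
qed

text \<open>Degree less than n, in a form without exception for the zero polynomial:
  \<open>below p 0\<close> means p = 0. Stated through coefficients, the condition is visibly
  linear.\<close>

definition below :: "'a::zero poly \<Rightarrow> nat \<Rightarrow> bool" where
  "below p n \<longleftrightarrow> (\<forall>k\<ge>n. coeff p k = 0)"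

lemma below_0 [simp]: "below 0 n" by (simp add: below_def)

lemma below_iff: "below p n \<longleftrightarrow> p = 0 \<or> degree p < n"
  unfolding below_def
  by (metis coeff_0 coeff_eq_0 leading_coeff_0_iff less_le_trans not_le)

lemma below_add: "below p n \<Longrightarrow> below q n \<Longrightarrow> below (p + q) n" for p q :: "'a::comm_monoid_add poly"
  by (simp add: below_def)

lemma below_sum: "(\<And>i. i \<in> I \<Longrightarrow> below (f i) n) \<Longrightarrow> below (\<Sum>i\<in>I. f i) n" for f :: "'b \<Rightarrow> 'a::comm_monoid_add poly"
  by (simp add: below_def coeff_sum)

lemma below_mono: "below p n \<Longrightarrow> n \<le> n' \<Longrightarrow> below p n'"
  by (auto simp: below_def)

lemma below_zero: "below p 0 \<Longrightarrow> p = 0"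
  by (auto simp: below_def poly_eq_iff)

lemma below_roots:
  fixes p :: "'a::idom poly"
  assumes "below p n" "finite X" "n \<le> card X" "\<And>x. x \<in> X \<Longrightarrow> poly p x = 0"
  shows "p = 0"
proof (rule ccontr)
  assume p: "p \<noteq> 0"
  have "card X \<le> card {x. poly p x = 0}" using poly_roots_finite[OF p] assms by (intro card_mono) auto
  also have "\<dots> \<le> degree p" by (rule card_poly_roots_bound[OF p])
  finally show False using assms p by (auto simp: below_iff)
qed

section \<open>Linear forms with polynomial coefficients and their Chebyshev property\<close>

lemma poly_ct_real:
  fixes x :: real
  assumes "measure_on D M" "compact D" "density_on D f" "below p n"
  obtains c where "below c n" "\<And>x::real. x \<notin> D \<Longrightarrow> poly p x * ct M f x = ct M (\<lambda>y. poly p y * f y) x + poly c x"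
proof -
  have e: "poly (map_poly of_real q) x = poly q x" for q and x :: real
    using poly_of_real_eq[of q x, where 'a=real] by simp
  obtain c where "degree c < degree p \<or> c = 0"
    "\<And>x::real. x \<notin> of_real ` D \<Longrightarrow> poly (map_poly of_real p) x * ct M f x = ct M (\<lambda>y. poly p y * f y) x + poly (map_poly of_real c) x"
    using poly_ct[OF assms(1-3), of p, where 'a=real] by blast
  then show thesis using assms(4) by (intro that[of c]) (auto simp: e below_iff)
qed

text \<open>Passing from the ratios relative to i0 to those relative to i divides all values at x by
  \<open>v i\<close>. The divisor of an elimination step can thus be chosen freely.\<close>

lemma ratio_family_boundary_change:
  assumes R: "ratio_family a b m r R" "K \<subseteq> {r..m}" and i: "i0 \<in> {r..m} - K" "i \<in> {r..m} - K"
    and v: "\<And>j. j \<in> {r..m} - K \<Longrightarrow> boundary_value (R K i0 j) x (v j)"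
    and w: "boundary_value (R K i i0) x w"
  shows "v i \<noteq> 0" "j \<in> {r..m} - K \<Longrightarrow> boundary_value (R K i j) x (v j / v i)"
proof -
  have "boundary_value (\<lambda>_. 1) x (v i * w)"
    by (rule boundary_value_cong[OF boundary_value_mult[OF v[OF i(2)] w]])
      (rule ratio_family_cocycle(2)[OF R i])
  then have 1: "v i * w = 1" using boundary_value_unique boundary_value_const by blast
  then show "v i \<noteq> 0" by auto
  assume j: "j \<in> {r..m} - K"
  have "boundary_value (R K i j) x (w * v j)"
    by (rule boundary_value_cong[OF boundary_value_mult[OF w v[OF j]]])
      (rule ratio_family_cocycle(4)[OF R i(2,1) _ j])
  moreover have "w * v j = v j / v i" using 1 \<open>v i \<noteq> 0\<close> by (simp add: nonzero_eq_divide_eq mult.commute mult.left_commute)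
  ultimately show "boundary_value (R K i j) x (v j / v i)" by simp
qed

lemma density_on_sum: "(\<And>i. i \<in> I \<Longrightarrow> density_on D (f i)) \<Longrightarrow> density_on D (\<lambda>x. \<Sum>i\<in>I. f i x)"
  by (auto simp: density_on_def intro!: continuous_intros borel_measurable_sum)

text \<open>The induction step divides by a function of maximal degree, the first one among these. The
  polynomial parts are then absorbed into the coefficient of the divisor, and the orthogonality relations
  carry over to the next interval, where one index fewer is left.\<close>

theorem ratio_family_chebyshev:
  fixes p :: "nat \<Rightarrow> real poly"
  assumes R: "ratio_family a b m r R" and disj: "\<And>t. Suc r \<le> t \<Longrightarrow> t < m \<Longrightarrow> {a t..b t} \<inter> {a (Suc t)..b (Suc t)} = {}"
    and "K \<subseteq> {r..m}" and "i0 \<in> {r..m} - K"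
    and p: "\<And>j. j \<in> {r..m} - K \<Longrightarrow> below (p j) (n j)"
    and "finite X" and "sum n ({r..m} - K) \<le> card X"
    and "{r..m} - K \<noteq> {i0} \<Longrightarrow> X \<inter> {a (Suc (r + card K))..b (Suc (r + card K))} = {}"
    and "\<And>x. x \<in> X \<Longrightarrow> \<exists>v. (\<forall>j\<in>{r..m}-K. boundary_value (R K i0 j) x (v j)) \<and> (\<Sum>j\<in>{r..m}-K. poly (p j) x * v j) = 0"
  shows "\<forall>j\<in>{r..m}-K. p j = 0"
  using assms(3-)
proof (induction "card ({r..m} - K)" arbitrary: K i0 X)
  case 0
  then show ?case by auto
next
  case (Suc N)
  let ?J = "{r..m} - K"
  define t where "t = r + card K"
  note K = Suc.prems(1) and i0 = Suc.prems(2) and pb = Suc.prems(3) and X = Suc.prems(4-7)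
  have finK: "finite K" using K finite_subset by blast
  show ?case
  proof (cases "?J = {i0}")
    case True
    have v1: "v i0 = 1" if "\<forall>j\<in>?J. boundary_value (R K i0 j) x (v j)" for v x
    proof -
      have "boundary_value (R K i0 i0) x 1"
        by (rule boundary_value_cong[OF boundary_value_const]) (simp add: ratio_family_cocycle(1)[OF R K i0 i0])
      then show ?thesis using that i0 boundary_value_unique by blast
    qed
    have "poly (p i0) x = 0" if "x \<in> X" for x
      using X(4)[OF that] v1 unfolding True by fastforce
    then have "p i0 = 0" using below_roots[OF pb[OF i0] X(1)] X(2) unfolding True by simp
    then show ?thesis unfolding True by simp
  next
    case False
    define mx where "mx = Max (n ` ?J)"
    define S where "S = {j\<in>?J. n j = mx}"
    have "mx \<in> n ` ?J" unfolding mx_def using i0 by (intro Max_in) auto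
    then have S: "finite S" "S \<noteq> {}" by (auto simp: S_def)
    \<comment> \<open>The smallest index of maximal degree: all earlier indices have strictly
      smaller degrees. This leaves room for the linear factors, since \<alpha> j \<noteq> 0 occurs
      only for j < i.\<close>
    define i where "i = Min S"
    have i: "i \<in> ?J" "n i = mx" using Min_in[OF S] by (auto simp: i_def S_def)
    have nle: "n j \<le> n i" if "j \<in> ?J" for j unfolding i(2) mx_def using that by (intro Max_ge) auto
    have nlt: "n j < n i" if "j \<in> ?J" "j < i" for j
    proof -
      have "j \<notin> S" using that S Min_le[of S j] by (auto simp: i_def)
      then show ?thesis using nle[OF that(1)] that(1) i(2) by (auto simp: S_def)
    qed
    define J' where "J' = ?J - {i}"
    have J'ne: "J' \<noteq> {}"
    proof
      assume "J' = {}"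
      then have "?J = {i}" using i by (auto simp: J'_def)
      then show False using False i0 by auto
    qed
    have JJ': "?J = insert i J'" "i \<notin> J'" "finite J'" using i by (auto simp: J'_def)
    let ?D = "{a (Suc t)..b (Suc t)}"
    have XD: "X \<inter> ?D = {}" using X(3)[OF False] by (simp add: t_def)
    obtain M \<rho> \<alpha> \<beta> where col: "ratio_column t ?D J' (R K i) (R (insert i K)) i M \<rho> \<alpha> \<beta>"
      using ratio_family_column[OF R K i(1)] J'ne unfolding J'_def t_def by blast
    note M = nondegenerate_onD[OF ratio_columnD(1)[OF col]] compact_Icc[of "a (Suc t)" "b (Suc t)"]
    note \<rho> = ratio_columnD(2)[OF col]
    have eqX: "poly (p i) x + (\<Sum>j\<in>J'. poly (p j) x * (\<alpha> j * x + \<beta> j + ct M (\<rho> j) x)) = 0" if x: "x \<in> X" for x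
    proof -
      obtain v where v: "\<forall>j\<in>?J. boundary_value (R K i0 j) x (v j)" "(\<Sum>j\<in>?J. poly (p j) x * v j) = 0" using X(4)[OF x] by blast
      have xD: "x \<notin> {a (Suc (r + card K))..b (Suc (r + card K))}" using XD x by (auto simp: t_def)
      obtain w where w: "boundary_value (R K i i0) x w" using ratio_family_boundary_nonzero[OF R K i(1) i0 xD] by blast
      note ch = ratio_family_boundary_change[OF R K i0 i(1) _ w]
      have vi: "v i \<noteq> 0" by (rule ch(1)) (use v(1) in blast)
      have vj: "v j / v i = \<alpha> j * x + \<beta> j + ct M (\<rho> j) x" if j: "j \<in> J'" for j
      proof (rule boundary_value_unique)
        show "boundary_value (R K i j) x (v j / v i)" by (rule ch(2)) (use v(1) j JJ' in auto)
        show "boundary_value (R K i j) x (\<alpha> j * x + \<beta> j + ct M (\<rho> j) x)"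
          by (rule ratio_column_boundary[OF col j]) (use xD in \<open>simp add: t_def\<close>)
      qed
      have "(\<Sum>j\<in>?J. poly (p j) x * v j) / v i = poly (p i) x + (\<Sum>j\<in>J'. poly (p j) x * (v j / v i))"
        unfolding JJ'(1) using JJ'(2,3) vi by (simp add: add_divide_distrib sum_divide_distrib)
      also have "(\<Sum>j\<in>J'. poly (p j) x * (v j / v i)) = (\<Sum>j\<in>J'. poly (p j) x * (\<alpha> j * x + \<beta> j + ct M (\<rho> j) x))"
        by (rule sum.cong[OF refl]) (simp add: vj)
      finally show ?thesis using v(2) by simp
    qed
    have "\<forall>j\<in>J'. \<exists>c. below c (n j) \<and> (\<forall>x::real. x \<notin> ?D \<longrightarrow> poly (p j) x * ct M (\<rho> j) x = ct M (\<lambda>y. poly (p j) y * \<rho> j y) x + poly c x)"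
    proof
      fix j assume j: "j \<in> J'"
      then have "j \<in> ?J" by (auto simp: J'_def)
      from poly_ct_real[OF M nonvanishing_densityD(1)[OF \<rho>[OF j]] pb[OF this]] show
        "\<exists>c. below c (n j) \<and> (\<forall>x::real. x \<notin> ?D \<longrightarrow> poly (p j) x * ct M (\<rho> j) x = ct M (\<lambda>y. poly (p j) y * \<rho> j y) x + poly c x)" by metis
    qed
    then obtain C where C: "\<And>j. j \<in> J' \<Longrightarrow> below (C j) (n j)"
      "\<And>j x. j \<in> J' \<Longrightarrow> x \<notin> ?D \<Longrightarrow> poly (p j) x * ct M (\<rho> j) x = ct M (\<lambda>y. poly (p j) y * \<rho> j y) (x::real) + poly (C j) x" by metis
    \<comment> \<open>Collects everything polynomial in the linear form divided by the i-th
      function; the rest is the transform of \<Theta>. At the points of X the two cancel.\<close>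
    define P where "P = p i + (\<Sum>j\<in>J'. p j * [:\<beta> j, \<alpha> j:] + C j)"
    define \<Theta> where "\<Theta> y = (\<Sum>j\<in>J'. poly (p j) y * \<rho> j y)" for y
    have \<Theta>j: "density_on ?D (\<lambda>y. poly (p j) y * \<rho> j y)" if "j \<in> J'" for j
      using nonvanishing_densityD(1)[OF \<rho>[OF that]] by auto
    have \<Theta>d: "density_on ?D \<Theta>" unfolding \<Theta>_def by (intro density_on_sum \<Theta>j)
    have Pb: "below P (n i)"
      unfolding P_def
    proof (intro below_add below_sum)
      show "below (p i) (n i)" by (rule pb[OF i(1)])
      fix j assume j: "j \<in> J'"
      then have jJ: "j \<in> ?J" by (auto simp: J'_def)
      show "below (C j) (n i)" by (rule below_mono[OF C(1)[OF j] nle[OF jJ]])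
      show "below (p j * [:\<beta> j, \<alpha> j:]) (n i)"
      proof (cases "\<alpha> j = 0")
        case True
        then show ?thesis using below_mono[OF pb[OF jJ] nle[OF jJ]] by (simp add: below_def)
      next
        case False
        then have "j < i" using ratio_columnD(4)[OF col j] by auto
        from nlt[OF jJ this] pb[OF jJ] degree_mult_le[of "p j" "[:\<beta> j, \<alpha> j:]"] False show ?thesis
          by (auto simp: below_iff simp del: mult_pCons_right)
      qed
    qed
    have PX: "ct M \<Theta> x = - poly P x" if x: "x \<in> X" for x :: real
    proof -
      have xD: "x \<notin> ?D" using XD x by blast
      have xD': "x \<notin> of_real ` ?D" using xD by auto
      have "ct M \<Theta> x = (\<Sum>j\<in>J'. ct M (\<lambda>y. poly (p j) y * \<rho> j y) x)" unfolding \<Theta>_def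
        by (rule ct_sum[OF M JJ'(3) \<Theta>j xD'])
      also have "\<dots> = (\<Sum>j\<in>J'. poly (p j) x * ct M (\<rho> j) x - poly (C j) x)"
        by (rule sum.cong[OF refl]) (simp add: C(2)[OF _ xD])
      also have "\<dots> = - poly P x" using eqX[OF x]
        by (simp add: P_def poly_sum sum.distrib sum_subtractf algebra_simps)
      finally show ?thesis .
    qed
    define N' where "N' = sum n J'"
    have cX: "n i + N' \<le> card X" using X(2) unfolding JJ'(1) N'_def using JJ' by simp
    \<comment> \<open>Partial fractions with poles in X turn the integral into the sum of
      \<open>lagrange_sum_zero\<close> for q P, whose degree is at most |X| - 2.\<close>
    have orth: "(\<integral>y. poly q y * \<Theta> y / (\<Prod>x\<in>X. y - x) \<partial>M) = 0" if q: "below q N'" for q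
    proof (cases "q = 0")
      case False
      define k where "k x = poly q x / (\<Prod>y\<in>X-{x}. x - y)" for x
      have xD': "x \<notin> of_real ` ?D" if "x \<in> X" for x :: real using that XD by auto
      have \<Theta>m: "\<Theta> \<in> borel_measurable borel" using \<Theta>d by (simp add: density_on_def)
      have qm: "poly q \<in> borel_measurable borel" by (intro borel_measurable_continuous_onI continuous_intros)
      have dq: "degree q < card X" using q False cX by (auto simp: below_iff)
      have "(\<integral>y. poly q y * \<Theta> y / (\<Prod>x\<in>X. y - x) \<partial>M) = (\<integral>y. (\<Sum>x\<in>X. (- k x) * (of_real (\<Theta> y) / (x - of_real y))) \<partial>M)"
      proof (rule nd_integral_cong[OF M])
        fix y assume y: "y \<in> ?D"
        then have "y \<notin> X" using XD by auto
        from partial_fraction[OF X(1) dq this] have "poly q y / (\<Prod>x\<in>X. y - x) * \<Theta> y = (\<Sum>x\<in>X. k x / (y - x)) * \<Theta> y"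
          by (simp add: k_def)
        moreover have "k x / (y - x) * \<Theta> y = - k x * (\<Theta> y / (x - y))" for x
          by (metis minus_diff_eq minus_divide_right mult_minus_left mult_minus_right times_divide_eq_left times_divide_eq_right)
        ultimately show "poly q y * \<Theta> y / (\<Prod>x\<in>X. y - x) = (\<Sum>x\<in>X. (- k x) * (of_real (\<Theta> y) / (x - of_real y)))"
          by (simp add: sum_distrib_right)
      next
        show "(\<lambda>y. poly q y * \<Theta> y / (\<Prod>x\<in>X. y - x)) \<in> borel_measurable borel"
          by (intro borel_measurable_divide borel_measurable_times \<Theta>m qm borel_measurable_prod borel_measurable_diff borel_measurable_const measurable_ident_sets[OF refl])
        show "(\<lambda>y. \<Sum>x\<in>X. - k x * (of_real (\<Theta> y) / (x - of_real y))) \<in> borel_measurable borel"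
          unfolding of_real_eq_id id_def
          by (intro borel_measurable_sum borel_measurable_divide borel_measurable_times \<Theta>m borel_measurable_diff borel_measurable_const measurable_ident_sets[OF refl])
      qed
      also have "\<dots> = (\<Sum>x\<in>X. - k x * ct M \<Theta> x)"
        unfolding ct_def integral_mult_right_zero[symmetric]
        by (rule Bochner_Integration.integral_sum) (intro integrable_mult_right integrable_ct_integrand[OF M \<Theta>d] xD')
      also have "\<dots> = (\<Sum>x\<in>X. poly (q * P) x / (\<Prod>y\<in>X-{x}. x - y))"
        by (rule sum.cong[OF refl]) (simp add: PX k_def)
      also have "\<dots> = 0"
      proof (rule lagrange_sum_zero[OF X(1)])
        show "degree (q * P) + 2 \<le> card X \<or> q * P = 0"
        proof (cases "P = 0")
          case False
          then have "degree P < n i" "degree q < N'" using Pb q \<open>q \<noteq> 0\<close> by (auto simp: below_iff)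
          then show ?thesis using degree_mult_le[of q P] cX by auto
        qed simp
      qed
      finally show ?thesis .
    qed simp
    show ?thesis
    proof (rule ccontr)
      assume nz: "\<not> (\<forall>j\<in>?J. p j = 0)"
      have "\<exists>j\<in>J'. p j \<noteq> 0"
      proof (rule ccontr)
        assume z: "\<not> ?thesis"
        have "poly (p i) x = 0" if "x \<in> X" for x using eqX[OF that] z by simp
        then have "p i = 0" using below_roots[OF pb[OF i(1)] X(1)] cX by simp
        with z nz JJ' show False by auto
      qed
      then obtain j1 where j1: "j1 \<in> J'" "p j1 \<noteq> 0" by blast
      have K': "insert i K \<subseteq> {r..m}" "{r..m} - insert i K = J'" "card (insert i K) = Suc (card K)"
        using K i finK by (auto simp: J'_def)
      \<comment> \<open>On this interval the densities are proportional to the ratios with i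
        adjoined to K. A zero of \<Theta> is therefore a zero of a linear form with one index fewer,
        and the induction hypothesis limits their number.\<close>
      have few: "\<not> (finite Y \<and> Y \<subseteq> {y\<in>?D. \<Theta> y = 0} \<and> N' \<le> card Y)" for Y
      proof
        assume Y: "finite Y \<and> Y \<subseteq> {y\<in>?D. \<Theta> y = 0} \<and> N' \<le> card Y"
        have "\<forall>j\<in>{r..m} - insert i K. p j = 0"
        proof (rule Suc.hyps(1)[of "insert i K" j1 Y])
          show "N = card ({r..m} - insert i K)" using Suc.hyps(2) JJ' unfolding K'(2) JJ'(1) by simp
          show "j1 \<in> {r..m} - insert i K" unfolding K'(2) by (rule j1)
          show "below (p j) (n j)" if "j \<in> {r..m} - insert i K" for j using that pb by auto
          show "sum n ({r..m} - insert i K) \<le> card Y" using Y unfolding K'(2) N'_def by blast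
          show "Y \<inter> {a (Suc (r + card (insert i K)))..b (Suc (r + card (insert i K)))} = {}" if ne: "{r..m} - insert i K \<noteq> {j1}"
          proof -
            from ne j1 obtain j2 where "j2 \<in> J'" "j2 \<noteq> j1" unfolding K'(2) by blast
            then have j2: "j2 \<noteq> i" "i \<noteq> j1" "j1 \<noteq> j2" using j1(1) JJ'(2) by auto
            have "card {i, j1, j2} + card K = card ({i, j1, j2} \<union> K)"
              using K i j1 finK \<open>j2 \<in> J'\<close> by (intro card_Un_disjoint[symmetric]) (auto simp: J'_def)
            also have "\<dots> \<le> card {r..m}" using K i j1 \<open>j2 \<in> J'\<close> by (intro card_mono) (auto simp: J'_def)
            finally have "card {i, j1, j2} + card K \<le> card {r..m}" .
            moreover have "card {i, j1, j2} = 3" using j2 by simp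
            moreover have "r \<le> m" using i by auto
            ultimately have "Suc t < m" by (simp add: t_def)
            then show ?thesis using disj[of "Suc t"] Y K'(3) by (auto simp: t_def)
          qed
          show "\<exists>v. (\<forall>j\<in>{r..m} - insert i K. boundary_value (R (insert i K) j1 j) y (v j)) \<and> (\<Sum>j\<in>{r..m} - insert i K. poly (p j) y * v j) = 0" if y: "y \<in> Y" for y
          proof (intro exI conjI ballI)
            have yD: "y \<in> ?D" "\<Theta> y = 0" using y Y by auto
            show "boundary_value (R (insert i K) j1 j) y (\<rho> j y / \<rho> j1 y)" if "j \<in> {r..m} - insert i K" for j
              using ratio_columnD(6)[OF col _ j1(1) yD(1)] that unfolding K'(2) by blast
            have "(\<Sum>j\<in>J'. poly (p j) y * (\<rho> j y / \<rho> j1 y)) = \<Theta> y / \<rho> j1 y"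
              by (simp add: \<Theta>_def sum_divide_distrib)
            then show "(\<Sum>j\<in>{r..m} - insert i K. poly (p j) y * (\<rho> j y / \<rho> j1 y)) = 0" unfolding K'(2) using yD by simp
          qed
        qed (use K'(1) Y in auto)
        then show False using j1 unfolding K'(2) by blast
      qed
      have finZ: "finite {y\<in>?D. \<Theta> y = 0}"
        using few infinite_arbitrarily_large[of "{y\<in>?D. \<Theta> y = 0}" N'] by (metis order_refl)
      from sign_pattern[OF is_interval_cc _ this] \<Theta>d obtain Z e where Z: "Z \<subseteq> {y\<in>?D. \<Theta> y = 0}" "e \<in> {1, -1}"
        "\<And>x. x \<in> ?D \<Longrightarrow> 0 \<le> e * \<Theta> x * (\<Prod>y\<in>Z. x - y)" unfolding density_on_def by blast
      have fZ: "finite Z" using Z(1) finZ finite_subset by blast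
      have cZ: "card Z < N'" using few[of Z] fZ Z(1) by auto
      have wc: "continuous_on ?D (\<lambda>y. \<Prod>x\<in>X. y - x)" by (intro continuous_intros)
      have w0: "(\<Prod>x\<in>X. y - x) \<noteq> 0" if "y \<in> ?D" for y using that XD X(1) by auto
      obtain e' where e': "e' \<in> {1, -1::real}" "\<And>y. y \<in> ?D \<Longrightarrow> 0 < e' * (\<Prod>x\<in>X. y - x)"
        using connected_const_sign[OF _ wc w0] by auto
      \<comment> \<open>There are fewer than N' sign changes, so this polynomial is admissible in
        the orthogonality relation, although it makes the integrand keep one sign.\<close>
      define q where "q = (\<Prod>z\<in>Z. [:- z, 1:])"
      have qz: "poly q y = (\<Prod>z\<in>Z. y - z)" for y by (simp add: q_def poly_prod)
      have "degree q = card Z" unfolding q_def by (subst degree_prod_eq_sum_degree) auto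
      then have "below q N'" using cZ by (simp add: below_iff)
      from orth[OF this] have 0: "(\<integral>y. poly q y * \<Theta> y / (\<Prod>x\<in>X. y - x) \<partial>M) = 0" .
      have "0 < (\<integral>y. e * e' * (poly q y * \<Theta> y / (\<Prod>x\<in>X. y - x)) \<partial>M)"
      proof (rule nd_integral_pos[OF M ratio_columnD(1)[OF col]])
        have [measurable]: "\<Theta> \<in> borel_measurable borel" using \<Theta>d by (simp add: density_on_def)
        have [measurable]: "poly q \<in> borel_measurable borel" by (intro borel_measurable_continuous_onI continuous_intros)
        show "(\<lambda>y. e * e' * (poly q y * \<Theta> y / (\<Prod>x\<in>X. y - x))) \<in> borel_measurable borel" by measurable
        show "continuous_on ?D (\<lambda>y. e * e' * (poly q y * \<Theta> y / (\<Prod>x\<in>X. y - x)))"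
          using \<Theta>d w0 by (auto intro!: continuous_intros simp: density_on_def)
        show "0 \<le> e * e' * (poly q y * \<Theta> y / (\<Prod>x\<in>X. y - x))" if y: "y \<in> ?D" for y
        proof -
          have "0 \<le> (e * \<Theta> y * poly q y) * (e' / (\<Prod>x\<in>X. y - x))"
          proof (rule mult_nonneg_nonneg)
            show "0 \<le> e * \<Theta> y * poly q y" using Z(3)[OF y] unfolding qz .
            show "0 \<le> e' / (\<Prod>x\<in>X. y - x)" using e'(2)[OF y] by (auto simp: zero_le_divide_iff zero_less_mult_iff)
          qed
          then show ?thesis by (simp add: mult_ac)
        qed
        have "{y\<in>?D. e * e' * (poly q y * \<Theta> y / (\<Prod>x\<in>X. y - x)) = 0} \<subseteq> {y\<in>?D. \<Theta> y = 0} \<union> Z"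
        proof
          fix y assume y: "y \<in> {y\<in>?D. e * e' * (poly q y * \<Theta> y / (\<Prod>x\<in>X. y - x)) = 0}"
          then have "poly q y = 0 \<or> \<Theta> y = 0" using w0[of y] Z(2) e'(1) by auto
          then show "y \<in> {y\<in>?D. \<Theta> y = 0} \<union> Z" using y fZ by (auto simp: qz)
        qed
        then show "finite {y\<in>?D. e * e' * (poly q y * \<Theta> y / (\<Prod>x\<in>X. y - x)) = 0}" using finZ fZ finite_subset by blast
      qed
      then show False unfolding integral_mult_right_zero 0 by simp
    qed
  qed
qed


section \<open>Zeros of functions orthogonal to linear forms\<close>

lemma sum_between:
  fixes n :: "'a \<Rightarrow> nat"
  assumes "finite J" "k \<le> sum n J"
  shows "\<exists>n'. (\<forall>j\<in>J. n' j \<le> n j) \<and> sum n' J = k"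
  using assms
proof (induction J arbitrary: k rule: finite_induct)
  case (insert x J)
  have "k - min k (n x) \<le> sum n J" using insert by auto
  from insert.IH[OF this] obtain n' where n': "\<forall>j\<in>J. n' j \<le> n j" "sum n' J = k - min k (n x)" by blast
  have "sum (n'(x := min k (n x))) J = sum n' J" using insert by (intro sum.cong) auto
  then show ?case using n' insert by (intro exI[of _ "n'(x := min k (n x))"]) auto
qed auto

text \<open>\<open>chebyshev_prescribed_signs\<close> wants its points in the interior. A zero at an
  endpoint becomes interior after an enlargement that still avoids the other interval.\<close>

lemma enlarge_interval:
  fixes c d p q :: real
  assumes "{c..d} \<inter> {p..q} = {}" "c \<le> d"
  obtains c' d' where "c' < c" "d < d'" "{c'..d'} \<inter> {p..q} = {}"
proof (cases "p \<le> q")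
  case True
  consider "d < p" | "q < c" using assms True by (force simp: disjoint_iff not_le)
  then show thesis
  proof cases
    case 1 then show ?thesis by (intro that[of "c - 1" "(d + p) / 2"]) (auto simp: disjoint_iff simp del: Int_atLeastAtMost)
  next
    case 2 then show ?thesis by (intro that[of "(c + q) / 2" "d + 1"]) (auto simp: disjoint_iff simp del: Int_atLeastAtMost)
  qed
qed (rule that[of "c - 1" "d + 1"], auto)

text \<open>With fewer zeros there would be an admissible linear form changing sign exactly where g
  does. Its product with g then has constant sign and finitely many zeros, against
  orthogonality.\<close>

theorem ratio_family_orthogonal_zeros:
  fixes g :: "real \<Rightarrow> real" and n :: "nat \<Rightarrow> nat"
  assumes R: "ratio_family a b m r R" and disj: "\<And>t. Suc r \<le> t \<Longrightarrow> t < m \<Longrightarrow> {a t..b t} \<inter> {a (Suc t)..b (Suc t)} = {}"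
    and K: "K \<subseteq> {r..m}" and i0: "i0 \<in> {r..m} - K"
    and \<mu>: "nondegenerate_on {c\<^sub>0..d\<^sub>0} \<mu>"
    and sep: "{r..m} - K \<noteq> {i0} \<Longrightarrow> {c\<^sub>0..d\<^sub>0} \<inter> {a (Suc (r + card K))..b (Suc (r + card K))} = {}"
    and h: "\<And>j. j \<in> {r..m} - K \<Longrightarrow> density_on {c\<^sub>0..d\<^sub>0} (h j)" "nonvanishing_density {c\<^sub>0..d\<^sub>0} (h i0)"
    and bv: "\<And>j x. j \<in> {r..m} - K \<Longrightarrow> x \<in> {c\<^sub>0..d\<^sub>0} \<Longrightarrow> boundary_value (R K i0 j) x (h j x / h i0 x)"
    and g: "density_on {c\<^sub>0..d\<^sub>0} g"
    and orth: "\<And>p. (\<And>j. j \<in> {r..m} - K \<Longrightarrow> below (p j) (n j)) \<Longrightarrow> (\<integral>x. g x * (\<Sum>j\<in>{r..m} - K. poly (p j) x * h j x) \<partial>\<mu>) = 0"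
  shows "\<exists>Z\<subseteq>{c\<^sub>0..d\<^sub>0}. finite Z \<and> card Z = sum n ({r..m} - K) \<and> (\<forall>z\<in>Z. g z = 0)"
proof (rule ccontr)
  assume no: "\<not> ?thesis"
  let ?J = "{r..m} - K" and ?I = "{c\<^sub>0..d\<^sub>0}"
  note \<mu>' = nondegenerate_onD[OF \<mu>] compact_Icc[of c\<^sub>0 d\<^sub>0]
  have cd0: "c\<^sub>0 \<le> d\<^sub>0"
  proof (rule ccontr)
    assume "\<not> c\<^sub>0 \<le> d\<^sub>0"
    then have "?I = {}" by simp
    then have "AE x in \<mu>. x \<in> {}" using nd_AE[OF \<mu>'] by simp
    then show False using \<mu> unfolding nondegenerate_on_def by (metis finite.emptyI)
  qed
  define S where "S = {x\<in>?I. g x = 0}"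
  have few: "\<not> (finite Y \<and> Y \<subseteq> S \<and> sum n ?J \<le> card Y)" for Y
  proof
    assume Y: "finite Y \<and> Y \<subseteq> S \<and> sum n ?J \<le> card Y"
    then obtain Z where "Z \<subseteq> Y" "card Z = sum n ?J" "finite Z" by (metis obtain_subset_with_card_n)
    with Y show False using no unfolding S_def by blast
  qed
  have finS: "finite S" using few infinite_arbitrarily_large[of S "sum n ?J"] by (metis order_refl)
  from sign_pattern[OF is_interval_cc _ finS[unfolded S_def]] g obtain Z e where Z: "Z \<subseteq> S" "e \<in> {1, -1}"
    "\<And>x. x \<in> ?I \<Longrightarrow> 0 \<le> e * g x * (\<Prod>y\<in>Z. x - y)" unfolding density_on_def S_def[symmetric] by blast
  have fZ: "finite Z" using Z(1) finS finite_subset by blast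
  have "Suc (card Z) \<le> sum n ?J" using few[of Z] fZ Z(1) by auto
  \<comment> \<open>The construction of a form with prescribed sign changes takes exactly |Z| + 1
    free coefficients, so the multi-index is lowered to this total.\<close>
  from sum_between[OF _ this] obtain n' where n': "\<forall>j\<in>?J. n' j \<le> n j" "sum n' ?J = Suc (card Z)" by auto
  obtain c d where cd: "c < c\<^sub>0" "d\<^sub>0 < d" "?J \<noteq> {i0} \<Longrightarrow> {c..d} \<inter> {a (Suc (r + card K))..b (Suc (r + card K))} = {}"
  proof (cases "?J = {i0}")
    case True then show thesis by (intro that[of "c\<^sub>0 - 1" "d\<^sub>0 + 1"]) auto
  next
    case False from enlarge_interval[OF sep[OF False] cd0] that show thesis by metis
  qed
  \<comment> \<open>The quotients \<open>h j x / h i0 x\<close> are given on the original interval;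
    the representation of the column continues them to the enlarged one.\<close>
  obtain v :: "nat \<Rightarrow> real \<Rightarrow> real" where v: "\<And>j. j \<in> ?J \<Longrightarrow> continuous_on {c..d} (v j)"
    "\<And>j x. j \<in> ?J \<Longrightarrow> x \<in> {c..d} \<Longrightarrow> boundary_value (R K i0 j) x (v j x)"
  proof (cases "?J = {i0}")
    case True
    have "boundary_value (R K i0 i0) x 1" for x
      by (rule boundary_value_cong[OF boundary_value_const]) (simp add: ratio_family_cocycle(1)[OF R K i0 i0])
    then show thesis using True by (intro that[of "\<lambda>_ _. 1"]) auto
  next
    case False
    let ?D = "{a (Suc (r + card K))..b (Suc (r + card K))}"
    obtain M \<rho> \<alpha> \<beta> where col: "ratio_column (r + card K) ?D (?J - {i0}) (R K i0) (R (insert i0 K)) i0 M \<rho> \<alpha> \<beta>"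
      using ratio_family_column[OF R K i0] False i0 by blast
    note M = nondegenerate_onD[OF ratio_columnD(1)[OF col]] compact_Icc[of "a (Suc (r + card K))" "b (Suc (r + card K))"]
    have neJ: "?J \<noteq> {i0}" by (rule False)
    have dis: "x \<notin> ?D" if "x \<in> {c..d}" for x using cd(3)[OF False] that by auto
    show thesis
    proof (rule that[of "\<lambda>j x. if j = i0 then 1 else \<alpha> j * x + \<beta> j + ct M (\<rho> j) x"])
      fix j assume j: "j \<in> ?J"
      show "continuous_on {c..d} (\<lambda>x. if j = i0 then 1 else \<alpha> j * x + \<beta> j + ct M (\<rho> j) x)"
      proof (cases "j = i0")
        case False
        then have "density_on {c..d} (ct M (\<rho> j))"
          using density_on_ct[OF M nonvanishing_densityD(1)[OF ratio_columnD(2)[OF col]], of j "{c..d}"] j cd(3)[OF neJ] by (auto simp del: Int_atLeastAtMost)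
        then show ?thesis using False by (auto simp: density_on_def intro!: continuous_intros)
      qed simp
      fix x assume x: "x \<in> {c..d}"
      show "boundary_value (R K i0 j) x (if j = i0 then 1 else \<alpha> j * x + \<beta> j + ct M (\<rho> j) x)"
      proof (cases "j = i0")
        case True
        have "boundary_value (R K i0 i0) x 1"
          by (rule boundary_value_cong[OF boundary_value_const]) (simp add: ratio_family_cocycle(1)[OF R K i0 i0])
        then show ?thesis using True by simp
      next
        case False
        then show ?thesis using ratio_column_boundary[OF col _ dis[OF x], of j] j by simp
      qed
    qed
  qed
  have vh: "h j x = v j x * h i0 x" if "j \<in> ?J" "x \<in> ?I" for j x
  proof -
    have "x \<in> {c..d}" using that cd by auto
    from boundary_value_unique[OF v(2)[OF that(1) this] bv[OF that]]
    show ?thesis using nonvanishing_densityD(2)[OF h(2) that(2)] by simp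
  qed
  define B where "B = Sigma ?J (\<lambda>j. {..<n' j})"
  define G where "G bk x = x ^ snd bk * v (fst bk) x" for bk :: "nat \<times> nat" and x
  define P where "P k j = (\<Sum>i<n' j. monom (k (j, i)) i)" for k :: "nat \<times> nat \<Rightarrow> real" and j
  have Pc: "coeff (P k j) i = (if i < n' j then k (j, i) else 0)" for k j i
    unfolding P_def coeff_sum coeff_monom by (subst sum.delta) auto
  have Pb: "below (P k j) (n' j)" for k j by (simp add: below_def Pc)
  have sumP: "(\<Sum>bk\<in>B. k bk * G bk x) = (\<Sum>j\<in>?J. poly (P k j) x * v j x)" for k x
  proof -
    have "(\<Sum>bk\<in>B. k bk * G bk x) = (\<Sum>j\<in>?J. \<Sum>i<n' j. k (j, i) * G (j, i) x)"
      unfolding B_def by (subst sum.Sigma) (auto simp: split_beta)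
    also have "\<dots> = (\<Sum>j\<in>?J. poly (P k j) x * v j x)"
      by (rule sum.cong[OF refl]) (simp add: G_def P_def poly_sum poly_monom sum_distrib_left sum_distrib_right mult_ac)
    finally show ?thesis .
  qed
  have finB: "finite B" by (simp add: B_def)
  have cardB: "card B = Suc (card Z)" unfolding B_def using n'(2) by simp
  have "\<exists>k e. (\<exists>b\<in>B. k b \<noteq> 0) \<and> e \<in> {1, -1::real} \<and> (\<forall>x\<in>{c..d}. 0 \<le> e * (\<Sum>b\<in>B. k b * G b x) * (\<Prod>z\<in>Z. x - z)) \<and> {x\<in>{c..d}. (\<Sum>b\<in>B. k b * G b x) = 0} = Z"
  proof (rule chebyshev_prescribed_signs[OF finB fZ _ cardB])
    show "Z \<subseteq> {c..d}" "Z \<subseteq> {c<..<d}" using Z(1) cd by (force simp: S_def)+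
    show "c < d" using cd cd0 by simp
    show "continuous_on {c..d} (G b)" if "b \<in> B" for b
      using that v(1) unfolding G_def B_def by (auto intro!: continuous_intros)
    fix k :: "nat \<times> nat \<Rightarrow> real" and X assume X: "finite X" "X \<subseteq> {c..d}" "card B \<le> card X" and z: "\<And>x. x \<in> X \<Longrightarrow> (\<Sum>b\<in>B. k b * G b x) = 0"
    have "\<forall>j\<in>?J. P k j = 0"
    proof (rule ratio_family_chebyshev[OF R disj K i0 Pb X(1)])
      show "sum n' ?J \<le> card X" using X(3) cardB n'(2) by simp
      show "X \<inter> {a (Suc (r + card K))..b (Suc (r + card K))} = {}" if "?J \<noteq> {i0}" using cd(3)[OF that] X(2) by blast
      show "\<exists>w. (\<forall>j\<in>?J. boundary_value (R K i0 j) x (w j)) \<and> (\<Sum>j\<in>?J. poly (P k j) x * w j) = 0" if "x \<in> X" for x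
        using v(2) that X(2) z[OF that] unfolding sumP by (intro exI[of _ "\<lambda>j. v j x"]) auto
    qed
    then have "k (j, i) = 0" if "j \<in> ?J" "i < n' j" for j i using Pc[of k j i] that by simp
    then show "\<forall>b\<in>B. k b = 0" by (auto simp: B_def)
  qed
  then obtain k e1 where k: "e1 \<in> {1, -1::real}" "\<And>x. x \<in> {c..d} \<Longrightarrow> 0 \<le> e1 * (\<Sum>b\<in>B. k b * G b x) * (\<Prod>z\<in>Z. x - z)"
    "{x\<in>{c..d}. (\<Sum>b\<in>B. k b * G b x) = 0} = Z" by blast
  from nonvanishing_density_sign[OF h(2)] obtain e2 where e2: "e2 \<in> {1, -1}" "\<And>x. x \<in> ?I \<Longrightarrow> 0 < e2 * h i0 x" by blast
  define \<Theta> where "\<Theta> x = (\<Sum>j\<in>?J. poly (P k j) x * h j x)" for x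
  have \<Theta>h: "\<Theta> x = (\<Sum>b\<in>B. k b * G b x) * h i0 x" if "x \<in> ?I" for x
    unfolding \<Theta>_def sumP sum_distrib_right using vh that by (intro sum.cong) (auto simp: mult_ac)
  have \<Theta>d: "density_on ?I \<Theta>" unfolding \<Theta>_def density_on_def
    using h(1) by (auto simp: density_on_def intro!: continuous_intros borel_measurable_sum borel_measurable_times borel_measurable_continuous_onI[of "poly _"])
  have 0: "(\<integral>x. g x * \<Theta> x \<partial>\<mu>) = 0" unfolding \<Theta>_def
    by (rule orth) (use below_mono[OF Pb] n'(1) in blast)
  have "0 < (\<integral>x. e * e1 * e2 * (g x * \<Theta> x) \<partial>\<mu>)"
  proof (rule nd_integral_pos[OF \<mu>' \<mu>])
    have d: "density_on ?I (\<lambda>x. e * e1 * e2 * (g x * \<Theta> x))"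
      by (intro density_on_cmult density_on_intros(5) g \<Theta>d)
    then show "(\<lambda>x. e * e1 * e2 * (g x * \<Theta> x)) \<in> borel_measurable borel" "continuous_on ?I (\<lambda>x. e * e1 * e2 * (g x * \<Theta> x))"
      by (auto simp: density_on_def)
    show "0 \<le> e * e1 * e2 * (g x * \<Theta> x)" if x: "x \<in> ?I" for x
    proof (cases "x \<in> Z")
      case True
      then have "g x = 0" using Z(1) by (auto simp: S_def)
      then show ?thesis by simp
    next
      case False
      define p where "p = (\<Prod>y\<in>Z. x - y)"
      have p0: "p \<noteq> 0" using False fZ by (auto simp: p_def)
      have xx: "x \<in> {c..d}" using x cd by auto
      define s where "s = (\<Sum>b\<in>B. k b * G b x)"
      have "0 \<le> (e * g x * p) * (e1 * s * p) * (e2 * h i0 x)"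
        using Z(3)[OF x] k(2)[OF xx] e2(2)[OF x] unfolding p_def s_def by (simp only: mult_nonneg_nonneg less_imp_le)
      also have "\<dots> = (e * e1 * e2 * (g x * \<Theta> x)) * (p * p)" unfolding \<Theta>h[OF x] s_def[symmetric] by (simp add: mult_ac)
      finally have "0 \<le> (e * e1 * e2 * (g x * \<Theta> x)) * (p * p)" .
      moreover have "0 < p * p" using p0 not_real_square_gt_zero by blast
      ultimately show ?thesis by (simp only: zero_le_mult_iff) linarith
    qed
    have "{x\<in>?I. e * e1 * e2 * (g x * \<Theta> x) = 0} \<subseteq> S \<union> Z"
    proof
      fix x assume x: "x \<in> {x\<in>?I. e * e1 * e2 * (g x * \<Theta> x) = 0}"
      then have xI: "x \<in> ?I" and "g x = 0 \<or> \<Theta> x = 0" using Z(2) k(1) e2(1) by auto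
      then consider "g x = 0" | "(\<Sum>b\<in>B. k b * G b x) = 0" using \<Theta>h[OF xI] nonvanishing_densityD(2)[OF h(2) xI] by auto
      then show "x \<in> S \<union> Z"
      proof cases
        case 1 then show ?thesis using xI by (simp add: S_def)
      next
        case 2
        have "x \<in> {c..d}" using xI cd by auto
        then show ?thesis using 2 k(3) by blast
      qed
    qed
    then show "finite {x\<in>?I. e * e1 * e2 * (g x * \<Theta> x) = 0}" using finS fZ finite_subset by blast
  qed
  then show False unfolding integral_mult_right_zero 0 by simp
qed

section \<open>A bound for the approximation error\<close>

lemma lagrange_interpolation:
  fixes p :: "'a::field poly"
  assumes fin: "finite X" and deg: "below p (card X)"
  shows "p = (\<Sum>x\<in>X. smult (poly p x / (\<Prod>y\<in>X-{x}. x - y)) (\<Prod>y\<in>X-{x}. [:- y, 1:]))"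
proof -
  define l where "l x = smult (poly p x / (\<Prod>y\<in>X-{x}. x - y)) (\<Prod>y\<in>X-{x}. [:- y, 1:])" for x
  have ev: "poly (l x) w = (if w = x then poly p x else 0)" if "x \<in> X" "w \<in> X" for x w
    using that fin by (auto simp: l_def poly_prod prod_zero_iff)
  have "below (l x) (card X)" if "x \<in> X" for x
  proof -
    have "degree (\<Prod>y\<in>X-{x}. [:- y, 1:]) = card X - 1" using that fin by (subst degree_prod_eq_sum_degree) auto
    moreover have "card X > 0" using that fin by (auto simp: card_gt_0_iff)
    moreover have "degree (l x) \<le> degree (\<Prod>y\<in>X-{x}. [:- y, 1:])" unfolding l_def by (rule degree_smult_le)
    ultimately show ?thesis unfolding below_iff by linarith
  qed
  then have "below (p - sum l X) (card X)"
    using deg below_sum[of X l "card X"] by (simp add: below_def)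
  moreover have "poly (p - sum l X) w = 0" if "w \<in> X" for w
    using that fin ev by (simp add: poly_sum sum.delta cong: if_cong)
  ultimately have "p - sum l X = 0" using fin by (intro below_roots[of _ "card X" X]) auto
  then show ?thesis unfolding l_def by simp
qed

lemma degree_map_poly_of_real [simp]: "degree (map_poly of_real p :: complex poly) = degree p"
  by (rule degree_map_poly) simp

definition roots_poly :: "real set \<Rightarrow> real poly" where
  "roots_poly X = (\<Prod>x\<in>X. [:- x, 1:])"

lemma poly_roots_poly: "poly (roots_poly X) w = (\<Prod>x\<in>X. w - x)"
  by (simp add: roots_poly_def poly_prod)

lemma degree_roots_poly: "degree (roots_poly X) = card X"
  unfolding roots_poly_def by (subst degree_prod_eq_sum_degree) auto

lemma roots_poly_nonzero [simp]: "roots_poly X \<noteq> 0"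
  unfolding roots_poly_def by (cases "finite X") (auto simp: prod_zero_iff)

lemma poly_of_real_roots_poly:
  assumes "finite Y" shows "poly (map_poly of_real (roots_poly Y)) w = (\<Prod>x\<in>Y. w - complex_of_real x)"
  using assms
proof (induction Y rule: finite_induct)
  case (insert x F)
  have "poly (map_poly of_real (roots_poly (insert x F))) w = poly (map_poly of_real [:- x, 1:]) w * poly (map_poly of_real (roots_poly F)) w"
    unfolding poly_of_real_mult[symmetric] roots_poly_def prod.insert[OF insert.hyps] ..
  also have "poly (map_poly of_real [:- x, 1:]) w = w - of_real x" by (simp add: map_poly_pCons)
  finally show ?case using insert by simp
qed (simp add: roots_poly_def)

text \<open>\<open>X\<close> are the zeros of the denominator and \<open>Z\<close> the zeros of the remainder outside the support. The
  quadrature formula at \<open>X\<close> for the measure divided by the polynomial with zeros \<open>Z\<close> has at most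
  \<open>s / 2\<close> weights of the wrong sign; multiplying the error by the square of the polynomial with these
  nodes as zeros turns it into the error of a positive quadrature formula.\<close>

theorem approximant_error_bound:
  assumes \<mu>: "nondegenerate_on {c..d} \<mu>" and \<rho>: "nonvanishing_density {c..d} \<rho>"
    and X: "finite X" "X \<subseteq> {c..d}" and Z: "finite Z" "Z \<inter> {c..d} = {}"
    and n: "n \<ge> 1" and card: "card X = n + card Z + s"
    and orth: "\<And>p. below p n \<Longrightarrow> (\<integral>x. poly (roots_poly X) x * poly p x * \<rho> x \<partial>\<mu>) = 0"
    and interp: "\<And>z. z \<in> Z \<Longrightarrow> ct \<mu> (\<lambda>x. poly (roots_poly X) x * \<rho> x) z = 0"
    and B: "\<And>x. x \<in> {c..d} \<Longrightarrow> \<bar>\<rho> x\<bar> \<le> B"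
    and \<eta>: "0 < \<eta>" "\<And>x. x \<in> {c..d} \<Longrightarrow> \<eta> \<le> cmod (w - of_real x)" and L: "\<eta> \<le> L" "d - c \<le> L"
  shows "cmod (ct \<mu> (\<lambda>x. poly (roots_poly X) x * \<rho> x) w / poly (map_poly of_real (roots_poly X)) w)
    \<le> 2 * (B * measure \<mu> UNIV) / \<eta> * (L / \<eta>) ^ s"
proof -
  let ?I = "{c..d}"
  note \<mu>' = nondegenerate_onD[OF \<mu>] compact_Icc[of c d]
  note \<rho>d = nonvanishing_densityD(1)[OF \<rho>]
  have wI: "w \<notin> of_real ` ?I" using \<eta> by force
  define Q where "Q = roots_poly X"
  define W where "W = roots_poly Z"
  have W0: "poly W x \<noteq> 0" if "x \<in> ?I" for x using that Z unfolding W_def poly_roots_poly by auto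
  \<comment> \<open>Dividing the density by the polynomial with zeros Z turns the interpolation
    conditions at Z into |Z| further orthogonality relations.\<close>
  define \<sigma> where "\<sigma> x = \<rho> x / poly W x" for x
  have pd: "density_on ?I (poly p)" for p :: "real poly" by auto
  have \<sigma>: "nonvanishing_density ?I \<sigma>"
  proof -
    have [measurable]: "\<rho> \<in> borel_measurable borel" "poly W \<in> borel_measurable borel"
      using \<rho>d pd[of W] by (auto simp: density_on_def)
    have "\<sigma> \<in> borel_measurable borel" unfolding \<sigma>_def by measurable
    moreover have "continuous_on ?I \<sigma>" unfolding \<sigma>_def using \<rho>d W0 by (auto simp: density_on_def intro!: continuous_intros)
    ultimately show ?thesis using nonvanishing_densityD(2)[OF \<rho>] W0
      by (simp add: nonvanishing_density_def density_on_def) (simp add: \<sigma>_def)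
  qed
  note \<sigma>d = nonvanishing_densityD(1)[OF \<sigma>]
  have W\<sigma>: "poly W x * \<sigma> x = \<rho> x" if "x \<in> ?I" for x using W0[OF that] by (simp add: \<sigma>_def)
  have int: "integrable \<mu> f" if "density_on ?I f" for f :: "real \<Rightarrow> real"
    using that by (intro nd_integrable[OF \<mu>']) (auto simp: density_on_def)
  have dp: "density_on ?I (\<lambda>x. poly p x * f x)" if "density_on ?I f" for p f
    by (rule density_on_intros(5)[OF pd that])
  have icong: "integral\<^sup>L \<mu> f = integral\<^sup>L \<mu> g" if "density_on ?I f" "density_on ?I g" "\<And>x. x \<in> ?I \<Longrightarrow> f x = g x" for f g :: "real \<Rightarrow> real"
    using that by (intro nd_integral_cong[OF \<mu>']) (auto simp: density_on_def)
  have O: "(\<integral>x. poly (Q * p) x * \<sigma> x \<partial>\<mu>) = 0" if p: "below p (n + card Z)" for p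
  proof -
    \<comment> \<open>Division by W: the quotient is covered by \<open>orth\<close>. For the
      remainder, R / W splits into partial fractions with poles in Z, and the resulting integrals
      are the transforms that vanish by \<open>interp\<close>.\<close>
    define A R where "A = p div W" and "R = p mod W"
    have pAR: "p = W * A + R" by (simp add: A_def R_def)
    have R: "below R (card Z)"
    proof (cases "R = 0")
      case False
      have "W \<noteq> 0" by (simp add: W_def)
      then have "degree R < degree W" using degree_mod_less[of W p] False by (simp add: R_def)
      then show ?thesis by (simp add: below_iff W_def degree_roots_poly)
    qed simp
    have A: "below A n"
    proof (rule ccontr)
      assume "\<not> below A n"
      then have a: "A \<noteq> 0" "n \<le> degree A" by (auto simp: below_iff)
      then have "degree (W * A) = card Z + degree A" by (subst degree_mult_eq) (auto simp: W_def degree_roots_poly)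
      moreover have "below (W * A) (n + card Z)"
      proof -
        have "W * A = p - R" using pAR by simp
        then show ?thesis using p R by (auto simp: below_def)
      qed
      ultimately show False using a by (auto simp: below_iff W_def)
    qed
    have dA: "density_on ?I (\<lambda>x. poly Q x * poly A x * \<rho> x)" "density_on ?I (\<lambda>x. poly (Q * R) x * \<sigma> x)"
      using dp[OF \<rho>d, of "Q * A"] dp[OF \<sigma>d, of "Q * R"] by auto
    have "(\<integral>x. poly (Q * p) x * \<sigma> x \<partial>\<mu>) = (\<integral>x. poly Q x * poly A x * \<rho> x + poly (Q * R) x * \<sigma> x \<partial>\<mu>)"
    proof (rule icong)
      show "density_on ?I (\<lambda>x. poly (Q * p) x * \<sigma> x)" by (rule dp[OF \<sigma>d])
      show "density_on ?I (\<lambda>x. poly Q x * poly A x * \<rho> x + poly (Q * R) x * \<sigma> x)" using dA by auto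
      fix x assume x: "x \<in> ?I"
      have "poly (Q * p) x * \<sigma> x = poly Q x * poly A x * (poly W x * \<sigma> x) + poly (Q * R) x * \<sigma> x"
        unfolding pAR by (simp add: algebra_simps)
      then show "poly (Q * p) x * \<sigma> x = poly Q x * poly A x * \<rho> x + poly (Q * R) x * \<sigma> x" unfolding W\<sigma>[OF x] .
    qed
    also have "\<dots> = (\<integral>x. poly Q x * poly A x * \<rho> x \<partial>\<mu>) + (\<integral>x. poly (Q * R) x * \<sigma> x \<partial>\<mu>)"
      by (rule Bochner_Integration.integral_add[OF int[OF dA(1)] int[OF dA(2)]])
    also have "(\<integral>x. poly Q x * poly A x * \<rho> x \<partial>\<mu>) = 0" unfolding Q_def by (rule orth[OF A])
    also have "(\<integral>x. poly (Q * R) x * \<sigma> x \<partial>\<mu>) = 0"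
    proof (cases "R = 0")
      case False
      define k where "k z = poly R z / (\<Prod>y\<in>Z-{z}. z - y)" for z
      have dR: "degree R < card Z" using R False by (simp add: below_iff)
      have zI: "z \<notin> of_real ` ?I" if "z \<in> Z" for z :: real using that Z by auto
      have dQ: "density_on ?I (\<lambda>x. poly Q x * \<rho> x)" by (rule dp[OF \<rho>d])
      have [measurable]: "\<rho> \<in> borel_measurable borel" "poly Q \<in> borel_measurable borel"
        using \<rho>d pd[of Q] by (auto simp: density_on_def)
      have "(\<integral>x. poly (Q * R) x * \<sigma> x \<partial>\<mu>) = (\<integral>x. (\<Sum>z\<in>Z. (- k z) * (of_real (poly Q x * \<rho> x) / (z - of_real x))) \<partial>\<mu>)"
      proof (rule nd_integral_cong[OF \<mu>'])
        fix x assume x: "x \<in> ?I"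
        then have xZ: "x \<notin> Z" using Z by auto
        have "poly (Q * R) x * \<sigma> x = poly R x / (\<Prod>y\<in>Z. x - y) * (poly Q x * \<rho> x)"
          by (simp add: \<sigma>_def W_def poly_roots_poly)
        also have "\<dots> = (\<Sum>z\<in>Z. k z / (x - z)) * (poly Q x * \<rho> x)"
          unfolding partial_fraction[OF Z(1) dR xZ] k_def ..
        also have "\<dots> = (\<Sum>z\<in>Z. (- k z) * (of_real (poly Q x * \<rho> x) / (z - of_real x)))"
          unfolding sum_distrib_right
        proof (rule sum.cong[OF refl])
          fix z assume "z \<in> Z"
          then have "x - z \<noteq> 0" "z - x \<noteq> 0" using xZ by auto
          then show "k z / (x - z) * (poly Q x * \<rho> x) = (- k z) * (of_real (poly Q x * \<rho> x) / (z - of_real x))"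
            by (simp add: divide_simps) (simp add: algebra_simps)
        qed
        finally show "poly (Q * R) x * \<sigma> x = (\<Sum>z\<in>Z. (- k z) * (of_real (poly Q x * \<rho> x) / (z - of_real x)))" .
      next
        show "(\<lambda>x. poly (Q * R) x * \<sigma> x) \<in> borel_measurable borel" using dA(2) by (simp add: density_on_def)
        show "(\<lambda>x. \<Sum>z\<in>Z. (- k z) * (of_real (poly Q x * \<rho> x) / (z - of_real x))) \<in> borel_measurable borel" by measurable
      qed
      also have "\<dots> = (\<Sum>z\<in>Z. \<integral>x. (- k z) * (of_real (poly Q x * \<rho> x) / (z - of_real x)) \<partial>\<mu>)"
        by (rule Bochner_Integration.integral_sum) (intro integrable_mult_right integrable_ct_integrand[OF \<mu>' dQ] zI)
      also have "\<dots> = (\<Sum>z\<in>Z. (- k z) * ct \<mu> (\<lambda>x. poly Q x * \<rho> x) z)" unfolding ct_def integral_mult_right_zero ..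
      also have "\<dots> = 0" using interp by (simp add: Q_def)
      finally show ?thesis .
    qed simp
    finally show ?thesis by simp
  qed
  define l where "l x = smult (1 / (\<Prod>y\<in>X-{x}. x - y)) (\<Prod>y\<in>X-{x}. [:- y, 1:])" for x
  define lam where "lam x = (\<integral>y. poly (l x) y * \<sigma> y \<partial>\<mu>)" for x
  \<comment> \<open>The Gaussian argument: interpolation at X accounts for degrees below |X|, and
    the orthogonality of Q adds n + |Z| = |X| - s further degrees.\<close>
  have quad: "(\<integral>y. poly p y * \<sigma> y \<partial>\<mu>) = (\<Sum>x\<in>X. lam x * poly p x)" if p: "below p (card X + (n + card Z))" for p
  proof -
    define A R where "A = p div Q" and "R = p mod Q"
    have pAR: "p = Q * A + R" by (simp add: A_def R_def)
    have R: "below R (card X)"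
    proof (cases "R = 0")
      case False
      have "Q \<noteq> 0" by (simp add: Q_def)
      then have "degree R < degree Q" using degree_mod_less[of Q p] False by (simp add: R_def)
      then show ?thesis by (simp add: below_iff Q_def degree_roots_poly)
    qed simp
    have A: "below A (n + card Z)"
    proof (rule ccontr)
      assume "\<not> below A (n + card Z)"
      then have a: "A \<noteq> 0" "n + card Z \<le> degree A" by (auto simp: below_iff)
      then have "degree (Q * A) = card X + degree A" by (subst degree_mult_eq) (auto simp: Q_def degree_roots_poly)
      moreover have "below (Q * A) (card X + (n + card Z))"
      proof -
        have "Q * A = p - R" using pAR by simp
        then show ?thesis using p R by (auto simp: below_def)
      qed
      ultimately show False using a by (auto simp: below_iff Q_def)
    qed
    have Rx: "poly p x = poly R x" if "x \<in> X" for x using that X unfolding pAR Q_def by (auto simp: poly_roots_poly prod_zero_iff)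
    have "(\<integral>y. poly p y * \<sigma> y \<partial>\<mu>) = (\<integral>y. poly (Q * A) y * \<sigma> y + poly R y * \<sigma> y \<partial>\<mu>)"
      unfolding pAR by (simp add: algebra_simps)
    also have "\<dots> = (\<integral>y. poly (Q * A) y * \<sigma> y \<partial>\<mu>) + (\<integral>y. poly R y * \<sigma> y \<partial>\<mu>)"
      by (rule Bochner_Integration.integral_add[OF int[OF dp[OF \<sigma>d]] int[OF dp[OF \<sigma>d]]])
    also have "(\<integral>y. poly (Q * A) y * \<sigma> y \<partial>\<mu>) = 0" by (rule O[OF A])
    also have "(\<integral>y. poly R y * \<sigma> y \<partial>\<mu>) = (\<integral>y. (\<Sum>x\<in>X. poly R x * (poly (l x) y * \<sigma> y)) \<partial>\<mu>)"
    proof (rule Bochner_Integration.integral_cong[OF refl])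
      fix y
      have "poly R y = (\<Sum>x\<in>X. poly R x * poly (l x) y)"
        by (subst lagrange_interpolation[OF X(1) R]) (simp add: poly_sum l_def)
      then show "poly R y * \<sigma> y = (\<Sum>x\<in>X. poly R x * (poly (l x) y * \<sigma> y))" by (simp add: sum_distrib_right mult.assoc)
    qed
    also have "\<dots> = (\<Sum>x\<in>X. \<integral>y. poly R x * (poly (l x) y * \<sigma> y) \<partial>\<mu>)"
      by (rule Bochner_Integration.integral_sum) (intro integrable_mult_right int dp \<sigma>d)
    also have "\<dots> = (\<Sum>x\<in>X. lam x * poly p x)"
      unfolding integral_mult_right_zero lam_def[symmetric] by (rule sum.cong) (simp_all add: Rx mult.commute)
    finally show ?thesis by simp
  qed
  from nonvanishing_density_sign[OF \<sigma>] obtain e where e: "e \<in> {1, -1}" "\<And>x. x \<in> ?I \<Longrightarrow> 0 < e * \<sigma> x" by blast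
  define Neg where "Neg = {x\<in>X. e * lam x \<le> 0}"
  have Neg: "Neg \<subseteq> X" "finite Neg" using X by (auto simp: Neg_def)
  have cNeg: "2 * card Neg \<le> s"
  proof (rule ccontr)
    assume "\<not> ?thesis"
    then have big: "s < 2 * card Neg" by simp
    \<comment> \<open>Its square has degree 2 |X| - 2 |Neg| < 2 |X| - s, so the formula is exact for
      it. The weights at its nonzero nodes all have the wrong sign, whereas the integral has the
      right one.\<close>
    define q where "q = roots_poly (X - Neg)"
    have "degree (q * q) = 2 * card (X - Neg)" unfolding q_def by (subst degree_mult_eq) (auto simp: degree_roots_poly)
    moreover have "card (X - Neg) = card X - card Neg" "card Neg \<le> card X" using Neg X by (auto simp: card_Diff_subset card_mono)
    ultimately have "below (q * q) (card X + (n + card Z))" using big card unfolding below_iff by linarith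
    from quad[OF this] have "e * (\<integral>y. poly (q * q) y * \<sigma> y \<partial>\<mu>) = (\<Sum>x\<in>X. (e * lam x) * (poly q x * poly q x))"
      by (simp add: sum_distrib_left mult.assoc)
    also have "\<dots> \<le> 0"
    proof (rule sum_nonpos)
      fix x assume x: "x \<in> X"
      show "(e * lam x) * (poly q x * poly q x) \<le> 0"
      proof (cases "x \<in> Neg")
        case True then have "e * lam x \<le> 0" by (simp add: Neg_def)
        then show ?thesis by (rule mult_nonpos_nonneg) simp
      next
        case False
        then have "poly q x = 0" unfolding q_def poly_roots_poly using x X by (intro prod_zero) auto
        then show ?thesis by simp
      qed
    qed
    finally have "e * (\<integral>y. poly (q * q) y * \<sigma> y \<partial>\<mu>) \<le> 0" .
    moreover have "0 < (\<integral>y. e * (poly (q * q) y * \<sigma> y) \<partial>\<mu>)"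
    proof (rule nd_integral_pos[OF \<mu>' \<mu>])
      have "density_on ?I (\<lambda>y. e * (poly (q * q) y * \<sigma> y))" by (intro density_on_cmult dp \<sigma>d)
      then show "(\<lambda>y. e * (poly (q * q) y * \<sigma> y)) \<in> borel_measurable borel" "continuous_on ?I (\<lambda>y. e * (poly (q * q) y * \<sigma> y))"
        by (auto simp: density_on_def)
      show "0 \<le> e * (poly (q * q) y * \<sigma> y)" if "y \<in> ?I" for y
      proof -
        have "0 \<le> (poly q y * poly q y) * (e * \<sigma> y)" using e(2)[OF that] by (intro mult_nonneg_nonneg[OF zero_le_square]) (rule less_imp_le)
        then show ?thesis by (simp add: mult_ac)
      qed
      have "{y\<in>?I. e * (poly (q * q) y * \<sigma> y) = 0} \<subseteq> {y. poly q y = 0}" using e(2) by force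
      moreover have "q \<noteq> 0" by (simp add: q_def)
      ultimately show "finite {y\<in>?I. e * (poly (q * q) y * \<sigma> y) = 0}" using poly_roots_finite finite_subset by blast
    qed
    ultimately show False by simp
  qed
  define q where "q = roots_poly Neg"
  have dq: "degree (q * q) = 2 * card Neg" unfolding q_def by (subst degree_mult_eq) (auto simp: degree_roots_poly)
  let ?c = "\<lambda>p. map_poly complex_of_real p"
  define Qw qw where "Qw = poly (?c Q) w" and "qw = poly (?c q) w"
  note prodw = poly_of_real_roots_poly[where w = w]
  have Qw0: "Qw \<noteq> 0" unfolding Qw_def Q_def prodw[OF X(1)] using X wI by auto
  have qw\<eta>: "\<eta> ^ card Neg \<le> cmod qw"
  proof -
    have "(\<Prod>x\<in>Neg. \<eta>) \<le> (\<Prod>x\<in>Neg. cmod (w - of_real x))"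
      by (rule prod_mono) (use \<eta> Neg X in auto)
    then show ?thesis unfolding qw_def q_def prodw[OF Neg(2)] by (simp add: prod_norm)
  qed
  have qw0: "qw \<noteq> 0" using qw\<eta> \<eta>(1) by (metis norm_zero not_le zero_less_power)
  have qL: "poly q x * poly q x \<le> L ^ (2 * card Neg)" if "x \<in> ?I" for x
  proof -
    have "\<bar>poly q x\<bar> \<le> (\<Prod>y\<in>Neg. L)"
      unfolding q_def poly_roots_poly abs_prod
    proof (rule prod_mono)
      fix y assume "y \<in> Neg"
      then have "y \<in> ?I" using Neg X by auto
      then show "0 \<le> \<bar>x - y\<bar> \<and> \<bar>x - y\<bar> \<le> L" using that L by auto
    qed
    then have "\<bar>poly q x\<bar> * \<bar>poly q x\<bar> \<le> L ^ card Neg * L ^ card Neg" by (intro mult_mono) auto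
    then show ?thesis by (simp add: power_add mult_2)
  qed
  have cquad: "(\<integral>y. poly p (of_real y) * of_real (\<sigma> y) \<partial>\<mu>) = (\<Sum>x\<in>X. of_real (lam x) * poly p (of_real x))"
    if p: "below p (card X + (n + card Z))" for p :: "complex poly"
  proof -
    have m: "(\<integral>y. of_real (y ^ k * \<sigma> y) \<partial>\<mu>) = (\<Sum>x\<in>X. complex_of_real (lam x * x ^ k))" if "coeff p k \<noteq> 0" for k
    proof -
      have "k < card X + (n + card Z)" using p that by (metis below_def not_le)
      then have "below (monom (1::real) k) (card X + (n + card Z))" by (simp add: below_iff degree_monom_eq)
      from quad[OF this] have "(\<integral>y. y ^ k * \<sigma> y \<partial>\<mu>) = (\<Sum>x\<in>X. lam x * x ^ k)" by (simp add: poly_monom)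
      then show ?thesis by (simp only: integral_complex_of_real of_real_sum)
    qed
    have d: "density_on ?I (\<lambda>y. y ^ k * \<sigma> y)" for k using dp[OF \<sigma>d, of "monom 1 k"] by (simp add: poly_monom)
    have "(\<integral>y. poly p (of_real y) * of_real (\<sigma> y) \<partial>\<mu>) = (\<integral>y. (\<Sum>k\<le>degree p. coeff p k * of_real (y ^ k * \<sigma> y)) \<partial>\<mu>)"
      unfolding poly_altdef by (simp add: sum_distrib_right mult.assoc)
    also have "\<dots> = (\<Sum>k\<le>degree p. \<integral>y. coeff p k * of_real (y ^ k * \<sigma> y) \<partial>\<mu>)"
      by (rule Bochner_Integration.integral_sum) (intro integrable_mult_right integrable_of_real int d)
    also have "\<dots> = (\<Sum>k\<le>degree p. coeff p k * (\<Sum>x\<in>X. complex_of_real (lam x * x ^ k)))"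
      unfolding integral_mult_right_zero by (rule sum.cong[OF refl]) (use m in force)
    also have "\<dots> = (\<Sum>x\<in>X. of_real (lam x) * poly p (of_real x))"
      unfolding poly_altdef sum_distrib_left by (subst sum.swap) (simp add: mult_ac)
    finally show ?thesis .
  qed
  \<comment> \<open>Chosen such that q^2 - \<kappa> Q vanishes at w and is divisible by z - w. The
    quotient times W is a polynomial to which the quadrature formula applies; this trades Q for q^2
    in the error.\<close>
  define \<kappa> where "\<kappa> = qw * qw / Qw"
  define U where "U = ?c (q * q) - smult \<kappa> (?c Q)"
  define V where "V = U div [:- w, 1:]"
  have "poly U w = 0" unfolding U_def \<kappa>_def using Qw0 by (simp add: poly_of_real_mult Qw_def qw_def)
  then have UV: "U = [:- w, 1:] * V" unfolding V_def by (simp only: poly_eq_0_iff_dvd dvd_mult_div_cancel)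
  have cX: "card X \<ge> 1" "s \<le> card X" using card n by auto
  have U: "below U (Suc (card X))"
  proof -
    have "degree (?c (q * q)) \<le> card X" using dq cNeg cX degree_map_poly_of_real[of "q * q"] by linarith
    moreover have "degree (smult \<kappa> (?c Q)) \<le> card X"
      using degree_smult_le[of \<kappa> "?c Q"] degree_map_poly_of_real[of Q] by (simp add: Q_def degree_roots_poly)
    ultimately have "degree U \<le> card X" unfolding U_def by (rule degree_diff_le)
    then show ?thesis by (simp add: below_iff)
  qed
  have V: "below V (card X)"
  proof (cases "V = 0")
    case False
    then have "degree U = Suc (degree V)" unfolding UV by (subst degree_mult_eq) auto
    moreover have "U \<noteq> 0" using UV False by (metis mult_eq_0_iff pCons_eq_0_iff zero_neq_one)
    ultimately show ?thesis using U by (auto simp: below_iff)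
  qed simp
  have Vx: "poly V (of_real x) = - poly U (of_real x) / (w - of_real x)" if "x \<in> ?I" for x
  proof -
    have "w - of_real x \<noteq> 0" using that wI by auto
    then show ?thesis unfolding UV by (simp add: field_simps)
  qed
  define G where "G = - (?c W * V)"
  have "below G (card X + (n + card Z))"
  proof (cases "V = 0")
    case False
    have "degree G \<le> degree (?c W) + degree V" unfolding G_def degree_minus by (rule degree_mult_le)
    also have "\<dots> \<le> card Z + degree V" using degree_map_poly_of_real[of W] by (simp add: W_def degree_roots_poly)
    finally show ?thesis using V False by (simp add: below_iff)
  qed (simp add: G_def)
  from cquad[OF this] have GG: "(\<integral>y. poly G (of_real y) * of_real (\<sigma> y) \<partial>\<mu>) = (\<Sum>x\<in>X. of_real (lam x) * poly G (of_real x))" .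
  have dqq: "density_on ?I (\<lambda>x. poly (q * q) x * \<rho> x)" "density_on ?I (\<lambda>x. poly Q x * \<rho> x)" by (rule dp[OF \<rho>d])+
  have lhs: "(\<integral>y. poly G (of_real y) * of_real (\<sigma> y) \<partial>\<mu>) = ct \<mu> (\<lambda>x. poly (q * q) x * \<rho> x) w - \<kappa> * ct \<mu> (\<lambda>x. poly Q x * \<rho> x) w"
  proof -
    have [measurable]: "\<rho> \<in> borel_measurable borel" "\<sigma> \<in> borel_measurable borel" "poly (q * q) \<in> borel_measurable borel" "poly Q \<in> borel_measurable borel"
      using \<rho>d \<sigma>d pd[of "q * q"] pd[of Q] by (auto simp: density_on_def)
    have [measurable]: "(\<lambda>y. poly G (complex_of_real y)) \<in> borel_measurable borel"
      by (intro borel_measurable_continuous_onI continuous_intros)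
    have "(\<integral>y. poly G (of_real y) * of_real (\<sigma> y) \<partial>\<mu>) = (\<integral>y. of_real (poly (q * q) y * \<rho> y) / (w - of_real y) - \<kappa> * (of_real (poly Q y * \<rho> y) / (w - of_real y)) \<partial>\<mu>)"
    proof (rule nd_integral_cong[OF \<mu>'])
      fix y assume y: "y \<in> ?I"
      have n: "w - of_real y \<noteq> 0" using y wI by auto
      have "poly G (of_real y) * of_real (\<sigma> y) = - poly V (of_real y) * of_real (poly W y * \<sigma> y)"
        by (simp add: G_def poly_of_real_eq)
      also have "\<dots> = poly U (of_real y) / (w - of_real y) * of_real (\<rho> y)" unfolding W\<sigma>[OF y] Vx[OF y] by simp
      also have "poly U (of_real y) = of_real (poly (q * q) y) - \<kappa> * of_real (poly Q y)"
        unfolding U_def by (simp add: poly_of_real_eq del: poly_mult)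
      finally show "poly G (of_real y) * of_real (\<sigma> y) = of_real (poly (q * q) y * \<rho> y) / (w - of_real y) - \<kappa> * (of_real (poly Q y * \<rho> y) / (w - of_real y))"
        by (simp add: diff_divide_distrib left_diff_distrib del: poly_mult)
    qed measurable
    also have "\<dots> = ct \<mu> (\<lambda>x. poly (q * q) x * \<rho> x) w - \<kappa> * ct \<mu> (\<lambda>x. poly Q x * \<rho> x) w"
      unfolding ct_def integral_mult_right_zero[symmetric]
      by (intro Bochner_Integration.integral_diff integrable_mult_right integrable_ct_integrand[OF \<mu>'] dqq wI)
    finally show ?thesis .
  qed
  have Gx: "poly G (of_real x) = of_real (poly W x * (poly q x * poly q x)) / (w - of_real x)" if "x \<in> X" for x
  proof -
    have xI: "x \<in> ?I" using that X by auto
    have "poly Q x = 0" unfolding Q_def poly_roots_poly using that X by (intro prod_zero) auto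
    then have "poly U (of_real x) = of_real (poly q x * poly q x)" unfolding U_def by (simp add: poly_of_real_mult poly_of_real_eq)
    then show ?thesis unfolding G_def by (simp add: Vx[OF xI] poly_of_real_eq)
  qed
  \<comment> \<open>The factor q^2 deletes the nodes of wrong sign. The remaining terms, apart from
    the factors 1 / (w - x), have one sign, so the sum of their moduli is again an exact quadrature
    sum.\<close>
  define S where "S = (\<Sum>x\<in>X. of_real (lam x * poly W x * (poly q x * poly q x)) / (w - of_real x))"
  have main: "\<kappa> * ct \<mu> (\<lambda>x. poly Q x * \<rho> x) w = ct \<mu> (\<lambda>x. poly (q * q) x * \<rho> x) w - S"
  proof -
    have "(\<Sum>x\<in>X. of_real (lam x) * poly G (of_real x)) = S" unfolding S_def
      by (rule sum.cong[OF refl]) (simp add: Gx mult.assoc)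
    then show ?thesis using GG lhs by (simp add: algebra_simps)
  qed
  define Km where "Km = L ^ (2 * card Neg) * B * measure \<mu> UNIV"
  have B0: "0 \<le> B" if "x \<in> ?I" for x using B[OF that] by linarith
  have Ine: "?I \<noteq> {}"
  proof
    assume "?I = {}"
    then have "AE x in \<mu>. x \<in> {}" using nd_AE[OF \<mu>'] by simp
    then show False using \<mu> unfolding nondegenerate_on_def by (metis finite.emptyI)
  qed
  then have B0: "0 \<le> B" using B0 by blast
  have L0: "0 < L" using \<eta>(1) L(1) by linarith
  have qb: "\<bar>poly (q * q) x * \<rho> x\<bar> \<le> L ^ (2 * card Neg) * B" if "x \<in> ?I" for x
  proof -
    have "\<bar>poly q x * poly q x\<bar> \<le> L ^ (2 * card Neg)" using qL[OF that] by simp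
    from mult_mono[OF this B[OF that]] show ?thesis using L0 by (simp add: abs_mult)
  qed
  have b1: "cmod (ct \<mu> (\<lambda>x. poly (q * q) x * \<rho> x) w) \<le> Km / \<eta>"
  proof -
    have "cmod (ct \<mu> (\<lambda>x. poly (q * q) x * \<rho> x) w) \<le> (L ^ (2 * card Neg) * B / \<eta>) * measure \<mu> UNIV"
      unfolding ct_def
    proof (rule nd_integral_bound[OF \<mu>'])
      fix x assume x: "x \<in> ?I"
      show "cmod (of_real (poly (q * q) x * \<rho> x) / (w - of_real x)) \<le> L ^ (2 * card Neg) * B / \<eta>"
        unfolding norm_divide norm_of_real using qb[OF x] \<eta>(1) \<eta>(2)[OF x] L0 B0 by (intro frac_le) auto
    qed (use L0 B0 \<eta> in auto)
    then show ?thesis by (simp add: Km_def)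
  qed
  have b2: "cmod S \<le> Km / \<eta>"
  proof -
    obtain e' where e': "e' \<in> {1, -1::real}" "\<And>y. y \<in> ?I \<Longrightarrow> 0 < e' * poly W y"
      using connected_const_sign[OF connected_Icc continuous_on_poly[OF continuous_on_id] W0] by blast
    have dWq: "below (W * (q * q)) (card X + (n + card Z))"
    proof -
      have "degree (W * (q * q)) \<le> card Z + 2 * card Neg" using degree_mult_le[of W "q * q"] dq by (simp add: W_def degree_roots_poly)
      then show ?thesis using cNeg cX n by (simp add: below_iff)
    qed
    have "cmod S \<le> (\<Sum>x\<in>X. cmod (of_real (lam x * poly W x * (poly q x * poly q x)) / (w - of_real x)))"
      unfolding S_def by (rule norm_sum)
    also have "\<dots> \<le> (\<Sum>x\<in>X. (e * e') * (lam x * poly (W * (q * q)) x) / \<eta>)"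
    proof (rule sum_mono)
      fix x assume x: "x \<in> X"
      then have xI: "x \<in> ?I" using X by auto
      have "\<bar>lam x * poly W x * (poly q x * poly q x)\<bar> = (e * e') * (lam x * poly (W * (q * q)) x)"
      proof (cases "x \<in> Neg")
        case True
        then have "poly q x = 0" unfolding q_def poly_roots_poly using Neg by (intro prod_zero) auto
        then show ?thesis by simp
      next
        case False
        then have "e * lam x > 0" using x by (auto simp: Neg_def)
        then have "0 \<le> (e * lam x) * (e' * poly W x) * (poly q x * poly q x)" using e'(2)[OF xI]
          by (intro mult_nonneg_nonneg[OF mult_nonneg_nonneg zero_le_square]) (auto intro: less_imp_le)
        then have 1: "0 \<le> (e * e') * (lam x * poly W x * (poly q x * poly q x))" by (simp add: mult_ac)
        have "\<bar>e * e'\<bar> = 1" using e(1) e'(1) by auto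
        then have "\<bar>lam x * poly W x * (poly q x * poly q x)\<bar> = \<bar>(e * e') * (lam x * poly W x * (poly q x * poly q x))\<bar>"
          by (simp only: abs_mult[of "e * e'"])
        then show ?thesis using 1 by (simp add: mult.assoc)
      qed
      then show "cmod (of_real (lam x * poly W x * (poly q x * poly q x)) / (w - of_real x)) \<le> (e * e') * (lam x * poly (W * (q * q)) x) / \<eta>"
        unfolding norm_divide norm_of_real using \<eta>(1) \<eta>(2)[OF xI] by (metis abs_ge_zero frac_le order_refl)
    qed
    also have "\<dots> = (e * e') * (\<Sum>x\<in>X. lam x * poly (W * (q * q)) x) / \<eta>"
      by (simp add: sum_distrib_left sum_divide_distrib del: poly_mult)
    also have "(\<Sum>x\<in>X. lam x * poly (W * (q * q)) x) = (\<integral>y. poly (W * (q * q)) y * \<sigma> y \<partial>\<mu>)" by (rule quad[OF dWq, symmetric])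
    also have "\<dots> = (\<integral>y. poly (q * q) y * \<rho> y \<partial>\<mu>)"
      by (rule icong[OF dp[OF \<sigma>d] dqq(1)]) (use W\<sigma> in \<open>simp add: mult_ac\<close>)
    also have "(e * e') * (\<integral>y. poly (q * q) y * \<rho> y \<partial>\<mu>) / \<eta> \<le> Km / \<eta>"
    proof (rule divide_right_mono)
      have "\<bar>e * e'\<bar> = 1" using e(1) e'(1) by auto
      then have "(e * e') * (\<integral>y. poly (q * q) y * \<rho> y \<partial>\<mu>) \<le> \<bar>\<integral>y. poly (q * q) y * \<rho> y \<partial>\<mu>\<bar>"
        by (metis abs_ge_self abs_mult mult_1)
      also have "\<dots> \<le> (L ^ (2 * card Neg) * B) * measure \<mu> UNIV"
        using nd_integral_bound[OF \<mu>', of "\<lambda>y. poly (q * q) y * \<rho> y"] qb L0 B0 by simp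
      finally show "(e * e') * (\<integral>y. poly (q * q) y * \<rho> y \<partial>\<mu>) \<le> Km" by (simp add: Km_def)
    qed (use \<eta> in simp)
    finally show ?thesis .
  qed
  have fin: "ct \<mu> (\<lambda>x. poly Q x * \<rho> x) w / Qw = (ct \<mu> (\<lambda>x. poly (q * q) x * \<rho> x) w - S) / (qw * qw)"
    unfolding main[symmetric] \<kappa>_def using Qw0 qw0 by (simp add: field_simps)
  have "cmod (ct \<mu> (\<lambda>x. poly Q x * \<rho> x) w / Qw) = cmod (ct \<mu> (\<lambda>x. poly (q * q) x * \<rho> x) w - S) / (cmod qw * cmod qw)"
    unfolding fin by (simp add: norm_divide norm_mult)
  also have "\<dots> \<le> (2 * Km / \<eta>) / (\<eta> ^ card Neg * \<eta> ^ card Neg)"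
  proof (rule frac_le)
    show "cmod (ct \<mu> (\<lambda>x. poly (q * q) x * \<rho> x) w - S) \<le> 2 * Km / \<eta>"
      using norm_triangle_ineq4[of "ct \<mu> (\<lambda>x. poly (q * q) x * \<rho> x) w" S] b1 b2 by simp
    show "\<eta> ^ card Neg * \<eta> ^ card Neg \<le> cmod qw * cmod qw" using qw\<eta> \<eta>(1) by (intro mult_mono) auto
    show "0 \<le> 2 * Km / \<eta>" using B0 L0 \<eta>(1) by (simp add: Km_def)
  qed (use \<eta> in simp)
  also have "\<dots> = 2 * (B * measure \<mu> UNIV) / \<eta> * (L / \<eta>) ^ (2 * card Neg)"
  proof -
    have "2 * (A * b * m) / h / (E * E) = 2 * (b * m) / h * (A / (E * E))" for A b m h E :: real by simp
    then show ?thesis unfolding Km_def power_divide mult_2[of "card Neg"] power_add[of \<eta>] by blast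
  qed
  also have "\<dots> \<le> 2 * (B * measure \<mu> UNIV) / \<eta> * (L / \<eta>) ^ s"
    using L \<eta>(1) B0 cNeg by (intro mult_left_mono power_increasing) auto
  finally show ?thesis unfolding Q_def Qw_def .
qed

section \<open>The complement of a segment in the sphere\<close>

definition joukowski_sphere :: "real \<Rightarrow> real \<Rightarrow> complex \<Rightarrow> complex option" where
  "joukowski_sphere c d w = (if w = 0 then None else Some (joukowski c d w))"

lemma bij_betw_joukowski_sphere:
  assumes cd: "c < d"
  shows "bij_betw (joukowski_sphere c d) (ball 0 1) (UNIV - real_embed {c..d})"
  unfolding bij_betw_def
proof
  show "inj_on (joukowski_sphere c d) (ball 0 1)"
    using joukowski_inj[OF cd] by (auto simp: inj_on_def joukowski_sphere_def split: if_splits)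
  show "joukowski_sphere c d ` ball 0 1 = UNIV - real_embed {c..d}"
  proof (intro equalityI subsetI)
    fix p assume "p \<in> joukowski_sphere c d ` ball 0 1"
    then obtain w where w: "cmod w < 1" "p = joukowski_sphere c d w" by auto
    then show "p \<in> UNIV - real_embed {c..d}"
      using joukowski_notin[OF cd _ w(1)] by (cases "w = 0") (auto simp: joukowski_sphere_def real_embed_def image_iff)
  next
    fix p assume p: "p \<in> UNIV - real_embed {c..d}"
    show "p \<in> joukowski_sphere c d ` ball 0 1"
    proof (cases p)
      case None
      then show ?thesis by (intro image_eqI[of _ _ 0]) (auto simp: joukowski_sphere_def)
    next
      case (Some z)
      then have "z \<notin> of_real ` {c..d}" using p by (auto simp: real_embed_def)
      from joukowski_surj[OF cd this] obtain w where "w \<noteq> 0" "cmod w < 1" "joukowski c d w = z" .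
      then show ?thesis using Some by (intro image_eqI[of _ _ w]) (auto simp: joukowski_sphere_def)
    qed
  qed
qed

lemma holomorphic_joukowski: "joukowski c d holomorphic_on - {0}"
  by (rule holomorphic_on_joukowski[where f = "\<lambda>x. x"]) auto

text \<open>Away from the origin this is the open mapping theorem. If U contains a disc of radius r
  about the origin, the complement of the image consists of the segment and of images of points with
  |w| \<ge> r, so it is bounded, and open sets around infinity are those with compact
  complement.\<close>

lemma openin_joukowski_sphere_image:
  assumes cd: "c < d" and U: "open U" "U \<subseteq> ball 0 1"
  shows "openin riemann_sphere (joukowski_sphere c d ` U)"
proof -
  let ?J = "joukowski_sphere c d" and ?V = "joukowski c d ` (U - {0})"
  have op: "open ?V"
  proof (rule open_mapping_thm3)
    show "joukowski c d holomorphic_on U - {0}"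
      by (rule holomorphic_on_subset[OF holomorphic_joukowski]) auto
    show "open (U - {0})" using U by auto
    show "inj_on (joukowski c d) (U - {0})"
      using joukowski_inj[OF cd] U(2) by (auto simp: inj_on_def subset_iff)
  qed
  have im: "?J ` (U - {0}) = Some ` ?V"
    unfolding image_image by (rule image_cong) (auto simp: joukowski_sphere_def)
  show ?thesis
  proof (cases "0 \<in> U")
    case False
    then have "U - {0} = U" by auto
    then have "?J ` U = Some ` ?V" using im by simp
    then show ?thesis using op by (simp add: riemann_sphere_def)
  next
    case True
    define C where "C = - ?V"
    obtain r where r: "r > 0" "ball 0 r \<subseteq> U" using True U open_contains_ball by blast
    let ?b = "\<bar>(c + d) / 2\<bar> + (d - c) / 4 * (1 + 1 / r)"
    have "C \<subseteq> cball 0 ?b \<union> of_real ` {c..d}"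
    proof
      fix z assume z: "z \<in> C"
      show "z \<in> cball 0 ?b \<union> of_real ` {c..d}"
      proof (cases "z \<in> of_real ` {c..d}")
        case False
        from joukowski_surj[OF cd this] obtain w where w: "w \<noteq> 0" "cmod w < 1" "joukowski c d w = z" .
        have "w \<notin> U" using z w by (auto simp: C_def)
        then have "w \<notin> ball 0 r" using r(2) by blast
        then have rw: "r \<le> cmod w" by simp
        have "cmod z \<le> cmod (of_real ((c + d) / 2)) + cmod (of_real ((d - c) / 4) * (w + 1 / w))"
          unfolding w(3)[symmetric] joukowski_def by (rule norm_triangle_ineq)
        also have "\<dots> \<le> \<bar>(c + d) / 2\<bar> + (d - c) / 4 * (cmod w + 1 / cmod w)"
          unfolding norm_mult norm_of_real using cd norm_triangle_ineq[of w "1 / w"]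
          by (intro add_mono mult_mono) (auto simp: norm_divide)
        also have "\<dots> \<le> ?b"
          using w rw r cd by (intro add_left_mono mult_left_mono add_mono divide_left_mono) auto
        finally show ?thesis by simp
      qed simp
    qed
    moreover have "compact (cball (0::complex) ?b \<union> of_real ` {c..d})"
      by (intro compact_Un compact_cball compact_continuous_image continuous_intros compact_Icc)
    ultimately have "bounded C" using bounded_subset compact_imp_bounded by metis
    moreover have "closed C" unfolding C_def using op by (simp add: closed_Compl)
    ultimately have "compact C" by (simp add: compact_eq_bounded_closed)
    have "U = insert 0 (U - {0})" using True by auto
    then have "?J ` U = insert (?J 0) (?J ` (U - {0}))" by (metis image_insert)
    also have "\<dots> = insert None (Some ` (topspace euclidean - C))"
      unfolding im by (simp add: joukowski_sphere_def C_def Diff_eq)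
    finally show ?thesis using \<open>compact C\<close> \<open>closed C\<close>
      unfolding riemann_sphere_def openin_Alexandroff_compactification by auto
  qed
qed

text \<open>The preceding openness makes the inverse bijection continuous, and continuous images of
  compact sets are compact.\<close>

lemma compact_joukowski_sphere_preimage:
  assumes cd: "c < d" and K: "compactin riemann_sphere K" "K \<subseteq> UNIV - real_embed {c..d}"
  obtains W where "compact W" "W \<subseteq> ball 0 1" "joukowski_sphere c d ` W = K"
proof -
  let ?J = "joukowski_sphere c d" and ?O = "UNIV - real_embed {c..d}"
  note bij = bij_betw_joukowski_sphere[OF cd]
  define \<zeta> where "\<zeta> = the_inv_into (ball 0 1) ?J"
  have z1: "\<zeta> p \<in> ball 0 1" "?J (\<zeta> p) = p" if "p \<in> ?O" for p
    unfolding \<zeta>_def using bij_betwE[OF bij_betw_the_inv_into[OF bij]] f_the_inv_into_f_bij_betw[OF bij] that by blast+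
  have z2: "\<zeta> (?J w) = w" if "w \<in> ball 0 1" for w
    unfolding \<zeta>_def by (rule the_inv_into_f_f[OF bij_betw_imp_inj_on[OF bij] that])
  have top: "topspace riemann_sphere = UNIV" by (simp add: riemann_sphere_def UNIV_option_conv)
  have "continuous_map (subtopology riemann_sphere ?O) euclidean \<zeta>"
    unfolding continuous_map_def
  proof (intro conjI allI impI)
    fix U :: "complex set" assume "openin euclidean U"
    then have U: "open U" by simp
    have "{x \<in> topspace (subtopology riemann_sphere ?O). \<zeta> x \<in> U} = ?J ` (U \<inter> ball 0 1) \<inter> ?O" (is "?L = ?R")
    proof (intro equalityI subsetI)
      fix p assume "p \<in> ?L"
      then have p: "p \<in> ?O" "\<zeta> p \<in> U" by auto
      then show "p \<in> ?R" using z1[OF p(1)] by (metis IntI image_eqI)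
    next
      fix p assume "p \<in> ?R"
      then show "p \<in> ?L" using z2 by (auto simp: top)
    qed
    also have "openin (subtopology riemann_sphere ?O) (?J ` (U \<inter> ball 0 1) \<inter> ?O)"
      by (intro openin_subtopology_Int openin_joukowski_sphere_image[OF cd]) (use U in auto)
    finally show "openin (subtopology riemann_sphere ?O) {x \<in> topspace (subtopology riemann_sphere ?O). \<zeta> x \<in> U}" .
  qed simp
  moreover have "compactin (subtopology riemann_sphere ?O) K" using K by (simp add: compactin_subtopology)
  ultimately have "compactin euclidean (\<zeta> ` K)" using image_compactin by blast
  then have "compact (\<zeta> ` K)" by simp
  moreover have "\<zeta> ` K \<subseteq> ball 0 1" using z1(1) K(2) by blast
  moreover have "?J ` \<zeta> ` K = K" using z1(2) K(2) by (force simp: image_image)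
  ultimately show thesis by (rule that)
qed

text \<open>The Joukowski map conjugates the conformal representation into an automorphism of the disc, to
  which the Schwarz lemma applies in both directions.\<close>

lemma conformal_representation_norm:
  assumes cd: "c < d"
    and phi: "conformal_representation (UNIV - real_embed {c..d}) (joukowski_sphere c d a) \<phi>"
    and a: "cmod a < 1" and w: "cmod w < 1"
  shows "cmod (\<phi> (joukowski_sphere c d w)) = cmod (Moebius_function 0 a w)"
proof -
  let ?J = "joukowski_sphere c d" and ?O = "UNIV - real_embed {c..d}" and ?B = "ball 0 1 :: complex set"
  note bij = bij_betw_joukowski_sphere[OF cd]
  from phi have hol: "(\<phi> \<circ> Some) holomorphic_on (Some -` ?O)"
      "(\<phi> \<circ> chart_at_infinity) holomorphic_on (chart_at_infinity -` ?O)"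
    and b: "bij_betw \<phi> ?O ?B" and 0: "\<phi> (?J a) = 0"
    by (auto simp: conformal_representation_def sphere_holomorphic_on_def)
  define g where "g = \<phi> \<circ> ?J"
  have gb: "bij_betw g ?B ?B" unfolding g_def by (rule bij_betw_trans[OF bij b])
  have JO: "?J u \<in> ?O" if "u \<in> ?B" for u using bij_betwE[OF bij] that by blast
  have g1: "g holomorphic_on ?B - {0}"
  proof -
    have "((\<phi> \<circ> Some) \<circ> joukowski c d) holomorphic_on ?B - {0}"
    proof (rule holomorphic_on_compose_gen[OF _ hol(1)])
      show "joukowski c d holomorphic_on ?B - {0}"
        by (rule holomorphic_on_subset[OF holomorphic_joukowski]) auto
      show "joukowski c d ` (?B - {0}) \<subseteq> Some -` ?O"
      proof
        fix z assume "z \<in> joukowski c d ` (?B - {0})"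
        then obtain u where "u \<in> ?B" "u \<noteq> 0" "z = joukowski c d u" by blast
        then show "z \<in> Some -` ?O" using JO[of u] by (simp add: joukowski_sphere_def)
      qed
    qed
    then show ?thesis by (rule holomorphic_transform) (simp add: g_def joukowski_sphere_def)
  qed
  \<comment> \<open>For u \<noteq> 0 this is u times the Joukowski map at u, continued across the
    origin. In the chart at infinity the map therefore reads u / D u, which is holomorphic at
    0.\<close>
  define D where "D u = of_real ((c + d) / 2) * u + of_real ((d - c) / 4) * (u\<^sup>2 + 1)" for u :: complex
  define U where "U = ?B \<inter> {u. D u \<noteq> 0}"
  have D0: "D 0 \<noteq> 0" using cd by (simp add: D_def flip: of_real_diff)
  have U: "open U" unfolding U_def D_def by (intro open_Int open_ball open_Collect_neq continuous_intros)
  have hJ: "chart_at_infinity (u / D u) = ?J u" if "u \<in> U" for u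
  proof (cases "u = 0")
    case False
    have "1 / (u / D u) = joukowski c d u"
      using False by (simp add: D_def joukowski_def add_divide_distrib distrib_left power2_eq_square)
    then show ?thesis using False that by (simp add: chart_at_infinity_def joukowski_sphere_def U_def)
  qed (simp add: chart_at_infinity_def joukowski_sphere_def)
  have g2: "g holomorphic_on U"
  proof -
    have "((\<phi> \<circ> chart_at_infinity) \<circ> (\<lambda>u. u / D u)) holomorphic_on U"
    proof (rule holomorphic_on_compose_gen[OF _ hol(2)])
      show "(\<lambda>u. u / D u) holomorphic_on U" unfolding D_def by (intro holomorphic_intros) (auto simp: U_def D_def)
      show "(\<lambda>u. u / D u) ` U \<subseteq> chart_at_infinity -` ?O"
      proof
        fix z assume "z \<in> (\<lambda>u. u / D u) ` U"
        then obtain u where "u \<in> U" "z = u / D u" by blast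
        then show "z \<in> chart_at_infinity -` ?O" using hJ[of u] JO[of u] by (simp add: U_def)
      qed
    qed
    then show ?thesis by (rule holomorphic_transform) (simp add: g_def hJ)
  qed
  have "g holomorphic_on (?B - {0}) \<union> U" by (rule holomorphic_on_Un[OF g1 g2]) (use U in auto)
  then have gh: "g holomorphic_on ?B" by (rule holomorphic_on_subset) (use D0 in \<open>auto simp: U_def\<close>)
  have a': "cmod (- a) < 1" using a by simp
  have Mb: "bij_betw (Moebius_function 0 (- a)) ?B ?B"
    by (rule bij_betw_byWitness[where f' = "Moebius_function 0 a"])
      (use a Moebius_function_norm_lt_1 Moebius_function_compose[of a "-a"] Moebius_function_compose[of "-a" a] in auto)
  \<comment> \<open>The Moebius function of -a sends 0 to a, so \<open>k\<close> fixes the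
    origin.\<close>
  define k where "k = g \<circ> Moebius_function 0 (- a)"
  have kb: "bij_betw k ?B ?B" unfolding k_def by (rule bij_betw_trans[OF Mb gb])
  have kh: "k holomorphic_on ?B" unfolding k_def
    by (rule holomorphic_on_compose_gen[OF Moebius_function_holomorphic[OF a'] gh]) (use bij_betw_imp_surj_on[OF Mb] in simp)
  have k0: "k 0 = 0" using 0 by (simp add: k_def g_def Moebius_function_of_zero)
  have kim: "k ` ?B = ?B" by (rule bij_betw_imp_surj_on[OF kb])
  obtain l where l: "l holomorphic_on ?B" "\<And>z. z \<in> ?B \<Longrightarrow> l (k z) = z"
    using holomorphic_has_inverse[OF kh open_ball bij_betw_imp_inj_on[OF kb]] unfolding kim by metis
  have kn: "cmod (k z) < 1" if "cmod z < 1" for z using bij_betwE[OF kb] that by simp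
  have le1: "cmod (k z) \<le> cmod z" if "cmod z < 1" for z by (rule Schwarz_Lemma(1)[OF kh k0 kn that])
  have l0: "l 0 = 0" using l(2)[of 0] k0 by simp
  have ln: "cmod (l z) < 1" if "cmod z < 1" for z
  proof -
    have "z \<in> k ` ?B" using that kim by simp
    then obtain y where "y \<in> ?B" "z = k y" by blast
    then show ?thesis using l(2) by simp
  qed
  define z where "z = Moebius_function 0 a w"
  have z: "cmod z < 1" "Moebius_function 0 (- a) z = w"
    unfolding z_def using Moebius_function_norm_lt_1[OF a w] Moebius_function_compose[of "-a" a w] a w by auto
  have "cmod (l (k z)) \<le> cmod (k z)" by (rule Schwarz_Lemma(1)[OF l(1) l0 ln kn[OF z(1)]])
  then have "cmod (k z) = cmod z" using le1[OF z(1)] l(2)[of z] z(1) by simp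
  then show ?thesis using z(2) by (simp add: k_def g_def z_def)
qed

section \<open>Zeros and the maximum principle in the unit disc\<close>

lemma holomorphic_factor_zeros:
  assumes F: "F holomorphic_on S" "open S" and Z: "finite Z" "Z \<subseteq> S" "\<And>a. a \<in> Z \<Longrightarrow> F a = 0"
  shows "\<exists>G. G holomorphic_on S \<and> (\<forall>w\<in>S. F w = (\<Prod>a\<in>Z. w - a) * G w)"
  using Z
proof (induction Z rule: finite_induct)
  case empty
  then show ?case using F by auto
next
  case (insert a Z)
  then obtain G where G: "G holomorphic_on S" "\<forall>w\<in>S. F w = (\<Prod>b\<in>Z. w - b) * G w" by auto
  have "(\<Prod>b\<in>Z. a - b) \<noteq> 0" using insert.hyps by (auto simp: prod_zero_iff)
  moreover have "F a = (\<Prod>b\<in>Z. a - b) * G a" using G(2) insert.prems(1) by auto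
  ultimately have Ga: "G a = 0" using insert.prems(2)[of a] by auto
  define G' where "G' w = (if w = a then deriv G a else (G w - G a) / (w - a))" for w
  have "G' holomorphic_on S" unfolding G'_def by (rule pole_lemma_open[OF G(1) F(2)])
  moreover have "G w = (w - a) * G' w" for w using Ga by (simp add: G'_def)
  then have "\<forall>w\<in>S. F w = (\<Prod>b\<in>insert a Z. w - b) * G' w"
    using G(2) insert.hyps by (simp add: mult_ac)
  ultimately show ?case by blast
qed

lemma disc_denominator_nonzero:
  assumes "cmod a < 1" "cmod w \<le> 1" shows "1 - cnj a * w \<noteq> 0"
proof
  assume "1 - cnj a * w = 0"
  then have "cmod (cnj a * w) = 1" by (metis eq_iff_diff_eq_0 norm_one)
  moreover have "cmod (cnj a * w) \<le> cmod a" unfolding norm_mult using assms mult_left_le[of "cmod w" "cmod a"] by simp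
  ultimately show False using assms by simp
qed

text \<open>The quotient of F by w^M and by the Moebius functions of its zeros is holomorphic in the
  disc. On |w| \<le> \<rho> it is bounded by its maximum on the circle, where each of the M + |Z|
  factors is at least q in modulus.\<close>

lemma disc_zeros_bound:
  assumes F: "F holomorphic_on ball 0 1 - {0}" and M: "\<forall>\<^sub>F w in at 0. cmod (F w) \<le> B\<^sub>0 * cmod w ^ M"
    and Z: "finite Z" "Z \<subseteq> ball 0 1 - {0}" "\<And>a. a \<in> Z \<Longrightarrow> F a = 0"
    and \<rho>: "0 < \<rho>" "\<rho> < 1" and q: "0 < q" "q \<le> \<rho>" "\<And>a u. a \<in> Z \<Longrightarrow> cmod u = \<rho> \<Longrightarrow> q \<le> cmod (Moebius_function 0 a u)"
    and B: "\<And>u. cmod u = \<rho> \<Longrightarrow> cmod (F u) \<le> B" and w: "w \<noteq> 0" "cmod w \<le> \<rho>"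
  shows "cmod (F w) \<le> B * (cmod w ^ M * (\<Prod>a\<in>Z. cmod (Moebius_function 0 a w))) / q ^ (M + card Z)"
proof -
  have "(\<lambda>w. F w / w ^ M) holomorphic_on ball 0 1 - {0}" by (intro holomorphic_intros F) auto
  moreover have "\<forall>\<^sub>F w in at 0. cmod (F w / w ^ M) \<le> B\<^sub>0"
    using M eventually_neq_at_within[of 0 0 UNIV] by eventually_elim (simp add: norm_divide norm_power field_simps)
  ultimately obtain F\<^sub>2 where F2: "F\<^sub>2 holomorphic_on ball 0 1" "\<And>w. w \<in> ball 0 1 - {0} \<Longrightarrow> F\<^sub>2 w = F w / w ^ M"
    using holomorphic_on_extend_bounded[of "\<lambda>w. F w / w ^ M" "ball 0 1" 0] by auto
  have "F\<^sub>2 a = 0" if "a \<in> Z" for a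
  proof -
    have "a \<in> ball 0 1 - {0}" using that Z(2) by blast
    then show ?thesis using F2(2) Z(3)[OF that] by simp
  qed
  then obtain G where G: "G holomorphic_on ball 0 1" "\<And>w. w \<in> ball 0 1 \<Longrightarrow> F\<^sub>2 w = (\<Prod>a\<in>Z. w - a) * G w"
    using holomorphic_factor_zeros[OF F2(1) open_ball Z(1)] Z(2) by (metis Diff_subset subset_trans)
  \<comment> \<open>The factors 1 - cnj a w have no zeros in the disc; they complete the linear
    factors to Moebius functions.\<close>
  define H where "H w = G w * (\<Prod>a\<in>Z. 1 - cnj a * w)" for w
  have Hh: "H holomorphic_on ball 0 1" unfolding H_def by (intro holomorphic_intros G)
  have FH: "F u = H u * (u ^ M * (\<Prod>a\<in>Z. Moebius_function 0 a u))" if "u \<noteq> 0" "cmod u < 1" for u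
  proof -
    have "1 - cnj a * u \<noteq> 0" if "a \<in> Z" for a
      using disc_denominator_nonzero[of a u] Z(2) that \<open>cmod u < 1\<close> by auto
    then have "(\<Prod>a\<in>Z. 1 - cnj a * u) \<noteq> 0" using Z(1) by (auto simp: prod_zero_iff)
    then have "H u * (\<Prod>a\<in>Z. Moebius_function 0 a u) = F\<^sub>2 u"
      unfolding Moebius_function_simple prod_dividef H_def using G(2)[of u] that by simp
    then show ?thesis using F2(2)[of u] that by (simp add: field_simps)
  qed
  have FN: "cmod (F u) = cmod (H u) * (cmod u ^ M * (\<Prod>a\<in>Z. cmod (Moebius_function 0 a u)))" if "u \<noteq> 0" "cmod u < 1" for u
    unfolding FH[OF that] by (simp add: norm_mult norm_power prod_norm)
  have HB: "cmod (H u) \<le> B / q ^ (M + card Z)" if u: "cmod u = \<rho>" for u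
  proof -
    have "q ^ card Z \<le> (\<Prod>a\<in>Z. cmod (Moebius_function 0 a u))"
      using prod_mono[of Z "\<lambda>_. q" "\<lambda>a. cmod (Moebius_function 0 a u)"] q u by simp
    then have "q ^ (M + card Z) \<le> cmod u ^ M * (\<Prod>a\<in>Z. cmod (Moebius_function 0 a u))"
      unfolding power_add using q u by (intro mult_mono power_mono) auto
    then have "cmod (H u) * q ^ (M + card Z) \<le> cmod (F u)"
      using FN[of u] u \<rho> by (cases "u = 0") (simp_all add: mult_left_mono)
    then show ?thesis using B[OF u] q(1) by (simp add: pos_le_divide_eq)
  qed
  have cs: "cball 0 \<rho> \<subseteq> (ball 0 1 :: complex set)" using \<rho> by auto
  have "cmod (H w) \<le> B / q ^ (M + card Z)"
  proof (rule maximum_modulus_frontier[where S = "cball 0 \<rho>" and f = H and \<xi> = w])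
    show "H holomorphic_on interior (cball 0 \<rho>)"
      using cs by (intro holomorphic_on_subset[OF Hh]) (use interior_subset in blast)
    show "continuous_on (closure (cball 0 \<rho>)) H"
      using cs holomorphic_on_imp_continuous_on[OF Hh] by (simp add: continuous_on_subset)
    show "cmod (H z) \<le> B / q ^ (M + card Z)" if "z \<in> frontier (cball 0 \<rho>)" for z
      using HB[of z] that \<rho> by simp
  qed (use w in auto)
  then have "cmod (F w) \<le> B / q ^ (M + card Z) * (cmod w ^ M * (\<Prod>a\<in>Z. cmod (Moebius_function 0 a w)))"
    using FN[OF w(1)] w(2) \<rho> by (simp only:) (intro mult_right_mono mult_nonneg_nonneg prod_nonneg; simp)
  then show ?thesis by simp
qed

text \<open>Divided by |1 - cnj a u|^2, this expresses 1 - |M|^2 for the value M of the Moebius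
  function of a at u, and shows how it shrinks as |u| tends to 1.\<close>

lemma Moebius_function_norm_identity:
  "(cmod (1 - cnj a * u))\<^sup>2 - (cmod (u - a))\<^sup>2 = (1 - (cmod a)\<^sup>2) * (1 - (cmod u)\<^sup>2)"
  by (simp add: cmod_power2) (simp add: power2_eq_square algebra_simps)

text \<open>On a circle close to the boundary the Moebius functions are close to \<open>1\<close> in modulus, uniformly
  for zeros in a compact subset of the disc.\<close>

lemma disc_rate:
  assumes W: "W \<subseteq> ball 0 1" and A: "compact A" "A \<subseteq> ball 0 1"
    and \<delta>: "0 < \<delta>" "\<delta> < \<theta>" "\<theta> < 1" "\<And>w. w \<in> W \<Longrightarrow> cmod w \<le> \<delta>" "\<And>w a. w \<in> W \<Longrightarrow> a \<in> A \<Longrightarrow> cmod (Moebius_function 0 a w) \<le> \<delta>"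
  obtains \<rho> where "0 < \<rho>" "\<rho> < 1"
    "\<And>F M Z B\<^sub>0 B w. F holomorphic_on ball 0 1 - {0} \<Longrightarrow> \<forall>\<^sub>F w in at 0. cmod (F w) \<le> B\<^sub>0 * cmod w ^ M \<Longrightarrow>
      finite Z \<Longrightarrow> Z \<subseteq> A - {0} \<Longrightarrow> (\<And>a. a \<in> Z \<Longrightarrow> F a = 0) \<Longrightarrow> (\<And>u. cmod u = \<rho> \<Longrightarrow> cmod (F u) \<le> B) \<Longrightarrow>
      w \<in> W - {0} \<Longrightarrow> cmod (F w) \<le> B * \<theta> ^ (M + card Z)"
proof -
  \<comment> \<open>On the circle each factor may drop from 1 to q, so the rate \<delta> per zero
    worsens to \<delta> / q = \<theta> and no further.\<close>
  define q where "q = \<delta> / \<theta>"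
  have q: "0 < q" "q < 1" using \<delta> by (auto simp: q_def)
  obtain r where r: "0 \<le> r" "r < 1" "\<And>a. a \<in> A \<Longrightarrow> cmod a \<le> r"
  proof (cases "A = {}")
    case False
    obtain a where "a \<in> A" "\<And>b. b \<in> A \<Longrightarrow> cmod b \<le> cmod a"
      using continuous_attains_sup[OF A(1) False continuous_on_norm_id] by blast
    then show thesis using A(2) by (intro that[of "cmod a"]) auto
  qed (use that[of 0] in auto)
  \<comment> \<open>A Moebius function with zero a in A is at least q on the circle as soon as 1 -
    \<rho>^2 \<le> (1 - q^2) |1 - cnj a u|^2, and |1 - cnj a u| \<ge> 1 - r.\<close>
  define e where "e = (1 - q\<^sup>2) * (1 - r)\<^sup>2"
  have q2: "0 < q\<^sup>2" "q\<^sup>2 < 1" using q by (auto simp: power_less_one_iff abs_square_less_1)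
  have r2: "0 < (1 - r)\<^sup>2" "(1 - r)\<^sup>2 \<le> 1" using r by (auto intro: power_le_one)
  have e: "0 < e" "e \<le> 1"
  proof -
    show "0 < e" using q2 r2 by (simp add: e_def)
    have "e \<le> 1 - q\<^sup>2" unfolding e_def using q2 r2 by (intro mult_left_le) auto
    then show "e \<le> 1" using q2 by linarith
  qed
  define \<rho> where "\<rho> = max (max q \<delta>) (1 - e / 2)"
  have \<rho>: "0 < \<rho>" "\<rho> < 1" "q \<le> \<rho>" "\<delta> \<le> \<rho>" "1 - e / 2 \<le> \<rho>" using q \<delta> e by (auto simp: \<rho>_def)
  have qM: "q \<le> cmod (Moebius_function 0 a u)" if a: "a \<in> A" and u: "cmod u = \<rho>" for a u
  proof -
    have ar: "cmod a \<le> r" by (rule r(3)[OF a])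
    have "cmod (cnj a * u) \<le> r" unfolding norm_mult using ar u \<rho> r mult_mono[of "cmod a" r \<rho> 1] by simp
    moreover have "1 - cmod (cnj a * u) \<le> cmod (1 - cnj a * u)" using norm_triangle_ineq2[of 1 "cnj a * u"] by simp
    ultimately have n: "1 - r \<le> cmod (1 - cnj a * u)" by linarith
    then have "(1 - r)\<^sup>2 \<le> (cmod (1 - cnj a * u))\<^sup>2" using r by (intro power_mono) auto
    then have 1: "e \<le> (1 - q\<^sup>2) * (cmod (1 - cnj a * u))\<^sup>2" unfolding e_def using q2 by (intro mult_left_mono) auto
    have "1 - \<rho>\<^sup>2 = (1 - \<rho>) * (1 + \<rho>)" by (simp add: power2_eq_square algebra_simps)
    also have "\<dots> \<le> (e / 2) * 2" using \<rho> by (intro mult_mono) auto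
    finally have 2: "1 - \<rho>\<^sup>2 \<le> e" by simp
    have "(cmod a)\<^sup>2 \<le> 1" using ar r by (intro power_le_one) auto
    moreover have "0 \<le> 1 - \<rho>\<^sup>2" using \<rho> by (simp add: power_le_one)
    ultimately have "(1 - (cmod a)\<^sup>2) * (1 - \<rho>\<^sup>2) \<le> 1 - \<rho>\<^sup>2" using mult_right_mono[of "1 - (cmod a)\<^sup>2" 1 "1 - \<rho>\<^sup>2"] by simp
    with 1 2 Moebius_function_norm_identity[of a u] have "q\<^sup>2 * (cmod (1 - cnj a * u))\<^sup>2 \<le> (cmod (u - a))\<^sup>2"
      unfolding u by (simp add: left_diff_distrib)
    then have "(q * cmod (1 - cnj a * u))\<^sup>2 \<le> (cmod (u - a))\<^sup>2" by (simp add: power_mult_distrib)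
    then have "q * cmod (1 - cnj a * u) \<le> cmod (u - a)" by (rule power2_le_imp_le) simp
    moreover have "0 < cmod (1 - cnj a * u)" using n r by linarith
    ultimately show ?thesis by (simp add: Moebius_function_simple norm_divide pos_le_divide_eq)
  qed
  show thesis
  proof (rule that[OF \<rho>(1,2)])
    fix F :: "complex \<Rightarrow> complex" and M Z B\<^sub>0 B w
    assume F: "F holomorphic_on ball 0 1 - {0}" "\<forall>\<^sub>F w in at 0. cmod (F w) \<le> B\<^sub>0 * cmod w ^ M"
      and Z: "finite Z" "Z \<subseteq> A - {0}" "\<And>a. a \<in> Z \<Longrightarrow> F a = 0"
      and B: "\<And>u. cmod u = \<rho> \<Longrightarrow> cmod (F u) \<le> B" and w: "w \<in> W - {0}"
    have wd: "cmod w \<le> \<delta>" using w \<delta>(4) by blast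
    have "cmod (F w) \<le> B * (cmod w ^ M * (\<Prod>a\<in>Z. cmod (Moebius_function 0 a w))) / q ^ (M + card Z)"
      by (rule disc_zeros_bound[OF F Z(1) _ Z(3) \<rho>(1,2) q(1) \<rho>(3) qM B]) (use Z(2) A(2) w wd \<rho>(4) in auto)
    also have "\<dots> \<le> B * \<delta> ^ (M + card Z) / q ^ (M + card Z)"
    proof -
      have "(\<Prod>a\<in>Z. cmod (Moebius_function 0 a w)) \<le> (\<Prod>a\<in>Z. \<delta>)"
        using Z(2) w \<delta>(5) by (intro prod_mono) auto
      then have "cmod w ^ M * (\<Prod>a\<in>Z. cmod (Moebius_function 0 a w)) \<le> \<delta> ^ (M + card Z)"
        unfolding power_add using wd \<delta>(1) by (intro mult_mono power_mono) (auto intro: prod_nonneg)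
      moreover have "0 \<le> B" using B[of "of_real \<rho>"] \<rho> norm_ge_zero order_trans by (metis abs_of_pos norm_of_real)
      ultimately show ?thesis using q by (intro divide_right_mono mult_left_mono) auto
    qed
    also have "\<dots> = B * \<theta> ^ (M + card Z)" using \<delta> by (simp add: q_def power_divide)
    finally show "cmod (F w) \<le> B * \<theta> ^ (M + card Z)" .
  qed
qed

section \<open>Nikishin systems as densities\<close>

text \<open>Points outside the support have open null neighbourhoods. By the Lindelof property
  countably many of them cover the complement of the hull, so the measure is carried by the hull. An
  infinite support excludes a degenerate hull and concentration on a finite set.\<close>

lemma meas_class_measure:
  assumes "s \<in> meas_class \<Delta>"
  obtains \<mu> e a b where "e \<in> {1, -1 :: real}" "a < b" "\<Delta> = {a..b}" "nondegenerate_on {a..b} \<mu>"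
    "\<And>A. A \<in> sets borel \<Longrightarrow> s A = e * measure \<mu> A"
proof -
  from assms obtain \<mu> e where \<mu>: "finite_measure \<mu>" "sets \<mu> = sets borel" and e: "e \<in> {1, -1 :: real}"
    and s: "\<And>A. A \<in> sets borel \<Longrightarrow> s A = e * measure \<mu> A"
    and sc: "compact (supp s)" "infinite (supp s)" and D: "\<Delta> = convex hull (supp s)"
    unfolding meas_class_def const_sign_measure_def by auto
  interpret finite_measure \<mu> by (rule \<mu>)
  have "connected \<Delta> \<and> compact \<Delta>" unfolding D by (intro conjI convex_connected convex_convex_hull compact_convex_hull sc)
  then obtain a b where ab: "\<Delta> = {a..b}" using connected_compact_interval_1 by blast
  have sub: "supp s \<subseteq> {a..b}" using hull_subset[of "supp s" convex] D ab by simp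
  have "a < b"
  proof (rule ccontr)
    assume "\<not> a < b"
    then have "finite {a..b}" by (cases "a = b") auto
    then show False using sc(2) sub finite_subset by blast
  qed
  define F where "F = {U. open U \<and> measure \<mu> U = 0}"
  obtain F' where F': "F' \<subseteq> F" "countable F'" "\<Union>F' = \<Union>F"
    using Lindelof[of F] by (auto simp: F_def)
  have null: "U \<in> null_sets \<mu>" if "U \<in> F" for U
    using that \<mu>(2) by (auto simp: null_sets_def emeasure_eq_measure F_def)
  have "\<Union>F' \<in> null_sets \<mu>"
    using null_sets_UN'[of F' "\<lambda>U. U" \<mu>] F'(1,2) null by auto
  moreover have "- {a..b} \<subseteq> \<Union>F"
  proof
    fix x assume "x \<in> - {a..b}"
    then have "x \<notin> supp s" using sub by blast
    then obtain U where U: "open U" "x \<in> U" "s U = 0" unfolding supp_def by blast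
    then have "measure \<mu> U = 0" using s[of U] e by auto
    then show "x \<in> \<Union>F" using U by (auto simp: F_def)
  qed
  ultimately have "AE x in \<mu>. x \<in> {a..b}" using F'(3) by (intro AE_I'[of "\<Union>F'"]) auto
  then have M: "measure_on {a..b} \<mu>" using \<mu> by (simp add: measure_on_def)
  have "\<not> (AE x in \<mu>. x \<in> F)" if "finite F" for F
  proof
    assume ae: "AE x in \<mu>. x \<in> F"
    have "\<not> supp s \<subseteq> F" using sc(2) that finite_subset by blast
    then obtain x where x: "x \<in> supp s" "x \<notin> F" by blast
    have op: "open (- F)" using that by (intro open_Compl finite_imp_closed)
    have "s (- F) \<noteq> 0" using x op unfolding supp_def by blast
    moreover have "- F \<in> null_sets \<mu>" using ae op \<mu>(2) by (subst AE_iff_null_sets) auto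
    then have "measure \<mu> (- F) = 0" by (rule measure_eq_0_null_sets)
    ultimately show False using s[of "- F"] op by simp
  qed
  then have "nondegenerate_on {a..b} \<mu>" using M by (simp add: nondegenerate_on_def)
  then show thesis using that e \<open>a < b\<close> ab s by blast
qed

text \<open>A nonvanishing continuous density has a constant sign e on the interval. The variation
  is then the measure with density |\<rho>|, and e is the sign of the total mass.\<close>

lemma sint_density:
  fixes f :: "real \<Rightarrow> 'a::{banach, second_countable_topology}"
  assumes \<mu>: "nondegenerate_on {a..b} \<mu>" and \<rho>: "nonvanishing_density {a..b} \<rho>"
    and s: "\<And>A. A \<in> sets borel \<Longrightarrow> s A = (\<integral>x. indicator A x * \<rho> x \<partial>\<mu>)" and f: "f \<in> borel_measurable borel"
  shows "sint s f = (\<integral>x. \<rho> x *\<^sub>R f x \<partial>\<mu>)"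
proof -
  note \<mu>' = nondegenerate_onD[OF \<mu>] compact_Icc[of a b]
  note \<rho>d = nonvanishing_densityD(1)[OF \<rho>]
  from nonvanishing_density_sign[OF \<rho>] obtain e where e: "e \<in> {1, -1}" "\<And>x. x \<in> {a..b} \<Longrightarrow> 0 < e * \<rho> x" by blast
  have \<rho>e: "e * \<bar>\<rho> x\<bar> = \<rho> x" if "x \<in> {a..b}" for x using e(1) e(2)[OF that] by (auto simp: abs_if)
  have m[measurable]: "\<rho> \<in> borel_measurable borel" using \<rho>d by (simp add: density_on_def)
  note [measurable] = f
  have sets [simp]: "sets \<mu> = sets borel" by (rule nd_sets[OF \<mu>'])
  have bm: "h \<in> measurable \<mu> N \<longleftrightarrow> h \<in> measurable borel N" for h :: "real \<Rightarrow> 'b" and N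
    by (simp only: measurable_cong_sets[OF sets refl])
  have sp: "space \<mu> = UNIV" by (rule nd_space[OF \<mu>'])
  have ac: "continuous_on {a..b} (\<lambda>x. \<bar>\<rho> x\<bar>)" using \<rho>d by (auto simp: density_on_def intro!: continuous_intros)
  have i: "integrable \<mu> (\<lambda>x. \<bar>\<rho> x\<bar>)" by (rule nd_integrable[OF \<mu>' _ ac]) measurable
  define \<nu> where "\<nu> = density \<mu> (\<lambda>x. ennreal \<bar>\<rho> x\<bar>)"
  define p where "p A = (\<integral>x. indicator A x * \<bar>\<rho> x\<bar> \<partial>\<mu>)" for A
  have p0: "0 \<le> p A" for A by (simp add: p_def)
  have sA: "s A = e * p A" if A: "A \<in> sets borel" for A
  proof -
    have [measurable]: "A \<in> sets borel" by (rule A)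
    have "s A = (\<integral>x. e * (indicator A x * \<bar>\<rho> x\<bar>) \<partial>\<mu>)" unfolding s[OF A]
    proof (rule nd_integral_cong[OF \<mu>'])
      fix x assume "x \<in> {a..b}"
      from \<rho>e[OF this] show "indicator A x * \<rho> x = e * (indicator A x * \<bar>\<rho> x\<bar>)" by (metis mult.left_commute)
    qed measurable
    then show ?thesis by (simp only: integral_mult_right_zero p_def)
  qed
  have em: "emeasure \<nu> A = ennreal (p A)" if A: "A \<in> sets borel" for A
  proof -
    have [measurable]: "A \<in> sets borel" by (rule A)
    have "emeasure \<nu> A = (\<integral>\<^sup>+x. ennreal \<bar>\<rho> x\<bar> * indicator A x \<partial>\<mu>)"
      unfolding \<nu>_def by (rule emeasure_density) (simp_all only: bm sets, measurable)
    also have "\<dots> = (\<integral>\<^sup>+x. ennreal (indicator A x * \<bar>\<rho> x\<bar>) \<partial>\<mu>)"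
      by (rule nn_integral_cong) (simp split: split_indicator)
    also have "\<dots> = ennreal (p A)" unfolding p_def
    proof (rule nn_integral_eq_integral)
      show "integrable \<mu> (\<lambda>x. indicator A x * \<bar>\<rho> x\<bar>)"
      proof (rule Bochner_Integration.integrable_bound[OF i])
        show "(\<lambda>x. indicator A x * \<bar>\<rho> x\<bar>) \<in> borel_measurable \<mu>" unfolding bm by measurable
        show "AE x in \<mu>. norm (indicator A x * \<bar>\<rho> x\<bar>) \<le> norm \<bar>\<rho> x\<bar>" by (rule AE_I2) (simp split: split_indicator)
      qed
    qed simp
    finally show ?thesis .
  qed
  have "variation s = measure_of UNIV (sets borel) (emeasure \<nu>)"
    unfolding variation_def
  proof (rule measure_of_eq)
    fix A :: "real set" assume "A \<in> sigma_sets UNIV (sets borel)"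
    then have A: "A \<in> sets borel" using sets.sigma_sets_eq[of "borel :: real measure"] by simp
    have "\<bar>s A\<bar> = p A" unfolding sA[OF A] using e(1) p0[of A] by (auto simp: abs_mult)
    then show "ennreal \<bar>s A\<bar> = emeasure \<nu> A" by (simp add: em[OF A])
  qed simp
  also have "\<dots> = \<nu>" using measure_of_of_measure[of \<nu>] sp by (simp add: \<nu>_def)
  finally have v: "variation s = \<nu>" .
  have "{x \<in> {a..b}. \<bar>\<rho> x\<bar> = 0} = {}" using nonvanishing_densityD(2)[OF \<rho>] by auto
  then have "finite {x \<in> {a..b}. \<bar>\<rho> x\<bar> = 0}" by (simp only: finite.emptyI)
  from nd_integral_pos[OF \<mu>' \<mu> _ ac _ this] have "0 < p UNIV" by (simp add: p_def)
  moreover have "s UNIV = e * p UNIV" by (rule sA) simp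
  ultimately have sg: "sgn (s UNIV) = e" using e(1) by (auto simp: sgn_mult)
  have "sint s f = e *\<^sub>R (\<integral>x. \<bar>\<rho> x\<bar> *\<^sub>R f x \<partial>\<mu>)"
    unfolding sint_def v sg \<nu>_def by (subst integral_density) (auto simp: bm f)
  also have "\<dots> = (\<integral>x. e *\<^sub>R (\<bar>\<rho> x\<bar> *\<^sub>R f x) \<partial>\<mu>)" by (rule integral_scaleR_right[symmetric])
  also have "\<dots> = (\<integral>x. \<rho> x *\<^sub>R f x \<partial>\<mu>)"
    by (rule nd_integral_cong[OF \<mu>']) (simp_all add: \<rho>e)
  finally show ?thesis .
qed

lemma cauchy_transform_density:
  assumes \<mu>: "nondegenerate_on {a..b} \<mu>" and \<rho>: "nonvanishing_density {a..b} \<rho>"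
    and s: "\<And>A. A \<in> sets borel \<Longrightarrow> s A = (\<integral>x. indicator A x * \<rho> x \<partial>\<mu>)"
  shows "cauchy_transform s z = ct \<mu> \<rho> z"
proof -
  have "(\<lambda>x. 1 / (z - of_real x)) \<in> borel_measurable borel"
    using borel_measurable_ct_integrand[OF nondegenerate_onD[OF \<mu>] compact_Icc density_on_intros(1)[of _ 1], of z] by simp
  from sint_density[OF \<mu> \<rho> s this] show ?thesis
    by (simp add: cauchy_transform_def ct_def scaleR_conv_of_real)
qed

text \<open>Repeated multiplication by z peels off one moment at a time as the limit at infinity.
  The densities f and g come from the real and imaginary parts of a complex denominator; since their
  moments are real, both vanish separately.\<close>

lemma moments_vanish:
  assumes M: "measure_on D M" "compact D" and fg: "density_on D f" "density_on D g"
    and O: "(\<lambda>z. ct M f z + \<i> * ct M g z) \<in> O[at_infinity](\<lambda>z. 1 / z ^ (n + 1))" and k: "k < n"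
  shows "(\<integral>x. x ^ k * f x \<partial>M) = 0 \<and> (\<integral>x. x ^ k * g x \<partial>M) = 0"
proof -
  let ?S = "complex_of_real ` D"
  define F where "F z = ct M f z + \<i> * ct M g z" for z
  have d: "density_on D (\<lambda>x. x ^ i * h x)" if "density_on D h" for i h
    using density_on_intros(5)[OF density_on_poly[of D "monom 1 i"] that] by (simp add: poly_monom)
  have out: "\<forall>\<^sub>F z in at_infinity. z \<notin> ?S"
  proof -
    have "bounded ?S" by (intro compact_imp_bounded compact_continuous_image M continuous_intros)
    then obtain L where "\<And>z. z \<in> ?S \<Longrightarrow> cmod z \<le> L" unfolding bounded_iff by blast
    then show ?thesis unfolding eventually_at_infinity by (intro exI[of _ "L + 1"]) force
  qed
  have big: "\<forall>\<^sub>F z::complex in at_infinity. 1 \<le> cmod z" unfolding eventually_at_infinity by blast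
  obtain C where C: "\<forall>\<^sub>F z in at_infinity. cmod (F z) \<le> C * cmod (1 / z ^ (n + 1))"
    using landau_o.bigE[OF O] unfolding F_def by metis
  have "i \<le> n \<longrightarrow> (\<forall>j<i. (\<integral>x. x ^ j * f x \<partial>M) = 0 \<and> (\<integral>x. x ^ j * g x \<partial>M) = 0) \<and>
      (\<forall>z. z \<notin> ?S \<longrightarrow> z ^ i * F z = ct M (\<lambda>x. x ^ i * f x) z + \<i> * ct M (\<lambda>x. x ^ i * g x) z)" for i
  proof (induction i)
    case 0
    then show ?case by (simp add: F_def)
  next
    case (Suc i)
    show ?case
    proof
      assume i: "Suc i \<le> n"
      let ?f = "integral\<^sup>L M (\<lambda>x. x ^ i * f x)" and ?g = "integral\<^sup>L M (\<lambda>x. x ^ i * g x)"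
      have IH: "\<And>j. j < i \<Longrightarrow> (\<integral>x. x ^ j * f x \<partial>M) = 0 \<and> (\<integral>x. x ^ j * g x \<partial>M) = 0"
        "\<And>z. z \<notin> ?S \<Longrightarrow> z ^ i * F z = ct M (\<lambda>x. x ^ i * f x) z + \<i> * ct M (\<lambda>x. x ^ i * g x) z"
        using Suc i by auto
      have "((\<lambda>z. z * ct M (\<lambda>x. x ^ i * f x) z + \<i> * (z * ct M (\<lambda>x. x ^ i * g x) z)) \<longlongrightarrow> of_real ?f + \<i> * of_real ?g) at_infinity"
        by (intro tendsto_intros tendsto_z_ct_at_infinity[OF M] d fg)
      then have "((\<lambda>z. z ^ Suc i * F z) \<longlongrightarrow> of_real ?f + \<i> * of_real ?g) at_infinity"
      proof (rule Lim_transform_eventually)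
        show "\<forall>\<^sub>F z in at_infinity. z * ct M (\<lambda>x. x ^ i * f x) z + \<i> * (z * ct M (\<lambda>x. x ^ i * g x) z) = z ^ Suc i * F z"
          using out
        proof eventually_elim
          case (elim z)
          have "z ^ Suc i * F z = z * (z ^ i * F z)" by simp
          then show ?case unfolding IH(2)[OF elim] by (simp add: algebra_simps)
        qed
      qed
      moreover have "((\<lambda>z. z ^ Suc i * F z) \<longlongrightarrow> 0) at_infinity"
      proof (rule Lim_null_comparison)
        show "\<forall>\<^sub>F z in at_infinity. cmod (z ^ Suc i * F z) \<le> \<bar>C\<bar> * cmod (inverse z)"
          using C big
        proof eventually_elim
          case (elim z)
          have z: "1 \<le> cmod z" using elim(2) by simp
          have "cmod (z ^ Suc i * F z) \<le> cmod z ^ Suc i * (\<bar>C\<bar> / cmod z ^ (n + 1))"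
            unfolding norm_mult norm_power using elim(1)
            by (intro mult_left_mono order_trans[OF elim(1)]) (auto simp: norm_divide norm_mult norm_power intro!: divide_right_mono)
          also have "\<dots> \<le> cmod z ^ n * (\<bar>C\<bar> / cmod z ^ (n + 1))"
            using i z by (intro mult_right_mono power_increasing) auto
          also have "\<dots> = \<bar>C\<bar> * inverse (cmod z)"
          proof -
            have "cmod z \<noteq> 0" using z by linarith
            then show ?thesis by (simp add: field_simps del: norm_eq_zero zero_less_norm_iff)
          qed
          also have "\<dots> = \<bar>C\<bar> * cmod (inverse z)" by (simp only: norm_inverse)
          finally show ?case .
        qed
        show "((\<lambda>z::complex. \<bar>C\<bar> * cmod (inverse z)) \<longlongrightarrow> 0) at_infinity"
          by (intro tendsto_mult_right_zero tendsto_norm_zero tendsto_inverse_0)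
      qed
      ultimately have "of_real ?f + \<i> * of_real ?g = 0" by (rule tendsto_unique[OF trivial_limit_at_infinity])
      then have 0: "?f = 0" "?g = 0" by (auto simp: complex_eq_iff)
      show "(\<forall>j<Suc i. (\<integral>x. x ^ j * f x \<partial>M) = 0 \<and> (\<integral>x. x ^ j * g x \<partial>M) = 0) \<and>
        (\<forall>z. z \<notin> ?S \<longrightarrow> z ^ Suc i * F z = ct M (\<lambda>x. x ^ Suc i * f x) z + \<i> * ct M (\<lambda>x. x ^ Suc i * g x) z)"
      proof (intro conjI allI impI)
        fix j assume "j < Suc i"
        then show "(\<integral>x. x ^ j * f x \<partial>M) = 0" "(\<integral>x. x ^ j * g x \<partial>M) = 0"
          using IH(1)[of j] 0 by (cases "j = i"; simp)+
      next
        fix z assume z: "z \<notin> ?S"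
        have "z ^ Suc i * F z = z * (z ^ i * F z)" by simp
        also have "\<dots> = z * ct M (\<lambda>x. x ^ i * f x) z + \<i> * (z * ct M (\<lambda>x. x ^ i * g x) z)"
          unfolding IH(2)[OF z] by (simp add: algebra_simps)
        also have "\<dots> = ct M (\<lambda>x. x ^ Suc i * f x) z + \<i> * ct M (\<lambda>x. x ^ Suc i * g x) z"
          unfolding z_ct[OF M d[OF fg(1)] z] z_ct[OF M d[OF fg(2)] z] 0 by (simp add: mult.assoc)
        finally show "z ^ Suc i * F z = ct M (\<lambda>x. x ^ Suc i * f x) z + \<i> * ct M (\<lambda>x. x ^ Suc i * g x) z" .
      qed
    qed
  qed
  from this[of "Suc k"] k show ?thesis by auto
qed

lemma moments_poly:
  assumes M: "measure_on D M" "compact D" and f: "density_on D f"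
    and mom: "\<And>k. k < n \<Longrightarrow> (\<integral>x. x ^ k * f x \<partial>M) = 0" and p: "below p n"
  shows "(\<integral>x. poly p x * f x \<partial>M) = 0"
proof -
  have i: "integrable M (\<lambda>x. x ^ k * f x)" for k
    using density_on_intros(5)[OF density_on_poly[of D "monom 1 k"] f]
    by (intro nd_integrable[OF M]) (auto simp: density_on_def poly_monom)
  have "(\<integral>x. poly p x * f x \<partial>M) = (\<integral>x. (\<Sum>k\<le>degree p. coeff p k * (x ^ k * f x)) \<partial>M)"
    by (simp add: poly_altdef sum_distrib_right mult.assoc)
  also have "\<dots> = (\<Sum>k\<le>degree p. coeff p k * (\<integral>x. x ^ k * f x \<partial>M))"
    unfolding integral_mult_right_zero[symmetric]
    by (rule Bochner_Integration.integral_sum) (intro integrable_mult_right i)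
  also have "\<dots> = 0"
  proof (rule sum.neutral, rule ballI)
    fix k
    show "coeff p k * (\<integral>x. x ^ k * f x \<partial>M) = 0"
      using p mom[of k] by (cases "k < n") (auto simp: below_def)
  qed
  finally show ?thesis .
qed

text \<open>Compare the behaviour at infinity in the product formula for Cauchy transforms.\<close>

lemma ct_pairing:
  assumes M: "measure_on D M" "compact D" and N: "measure_on E N" "compact E"
    and DE: "D \<inter> E = {}" and f: "density_on D f" and g: "density_on E g"
  shows "(\<integral>x. f x * ct N g x \<partial>M) = - (\<integral>y. g y * ct M f y \<partial>N)"
proof -
  have d: "density_on D (\<lambda>x. f x * ct N g x)" "density_on E (\<lambda>y. g y * ct M f y)"
    using density_on_intros(5)[OF f density_on_ct[OF N g]] density_on_intros(5)[OF g density_on_ct[OF M f]] DE by (auto simp: Int_commute)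
  let ?i = "\<integral>x. f x * ct N g x \<partial>M" and ?j = "\<integral>y. g y * ct M f y \<partial>N"
  have "((\<lambda>z. z * ct M (\<lambda>x. f x * ct N g x) z + z * ct N (\<lambda>y. g y * ct M f y) z) \<longlongrightarrow> complex_of_real ?i + of_real ?j) at_infinity"
    by (intro tendsto_add tendsto_z_ct_at_infinity[OF M d(1)] tendsto_z_ct_at_infinity[OF N d(2)])
  moreover have "((\<lambda>z. (z * ct M f z) * ct N g z) \<longlongrightarrow> complex_of_real (integral\<^sup>L M f) * 0) at_infinity"
    by (intro tendsto_mult tendsto_z_ct_at_infinity[OF M f] tendsto_ct_at_infinity[OF N g])
  then have "((\<lambda>z. (z * ct M f z) * ct N g z) \<longlongrightarrow> (0::complex)) at_infinity" by simp
  then have "((\<lambda>z::complex. z * ct M (\<lambda>x. f x * ct N g x) z + z * ct N (\<lambda>y. g y * ct M f y) z) \<longlongrightarrow> 0) at_infinity"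
  proof (rule Lim_transform_eventually)
    have "compact (complex_of_real ` D \<union> of_real ` E)"
      by (intro compact_Un compact_continuous_image M N continuous_intros)
    then have "bounded (complex_of_real ` D \<union> of_real ` E)" by (rule compact_imp_bounded)
    then obtain L where L: "\<And>z. z \<in> complex_of_real ` D \<union> of_real ` E \<Longrightarrow> cmod z \<le> L" unfolding bounded_iff by blast
    have "\<forall>\<^sub>F z::complex in at_infinity. L + 1 \<le> cmod z" unfolding eventually_at_infinity by blast
    then show "\<forall>\<^sub>F z::complex in at_infinity. z * ct M f z * ct N g z = z * ct M (\<lambda>x. f x * ct N g x) z + z * ct N (\<lambda>y. g y * ct M f y) z"
    proof eventually_elim
      case (elim z)
      then have "z \<notin> complex_of_real ` D" "z \<notin> of_real ` E" using L[of z] by auto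
      from ct_mult_ct[OF M N DE f g this] show ?case by (simp add: algebra_simps)
    qed
  qed
  ultimately have "complex_of_real ?i + of_real ?j = 0" by (rule tendsto_unique[OF trivial_limit_at_infinity])
  then have "?i + ?j = 0" by (metis of_real_add of_real_eq_0_iff)
  then show ?thesis by simp
qed

section \<open>The ratio families attached to a Nikishin system\<close>

locale nikishin_system =
  fixes m :: nat and \<sigma> :: "nat \<Rightarrow> real set \<Rightarrow> real" and a b e :: "nat \<Rightarrow> real" and \<mu> :: "nat \<Rightarrow> real measure"
  assumes ab: "\<And>j. j \<le> m \<Longrightarrow> a j < b j" and e: "\<And>j. j \<le> m \<Longrightarrow> e j \<in> {1, -1}"
    and \<mu>: "\<And>j. j \<le> m \<Longrightarrow> nondegenerate_on {a j..b j} (\<mu> j)"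
    and \<sigma>: "\<And>j A. j \<le> m \<Longrightarrow> A \<in> sets borel \<Longrightarrow> \<sigma> j A = e j * measure (\<mu> j) A"
    and disj: "\<And>j. j < m \<Longrightarrow> {a j..b j} \<inter> {a (Suc j)..b (Suc j)} = {}"
begin

text \<open>The density of s_{j,k} with respect to \<open>\<mu> j\<close>, the sign of the generator
  included.\<close>

definition \<rho> :: "nat \<Rightarrow> nat \<Rightarrow> real \<Rightarrow> real" where
  "\<rho> j k x = (if j < k then e j * cauchy_transform (nikishin \<sigma> (Suc j) k) x else e j)"

lemma e0: "j \<le> m \<Longrightarrow> e j \<noteq> 0" using e by fastforce

lemma \<mu>': "j \<le> m \<Longrightarrow> measure_on {a j..b j} (\<mu> j)" using \<mu> nondegenerate_onD by blast

lemma generator_density: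
  assumes j: "j \<le> m"
  shows "nonvanishing_density {a j..b j} (\<lambda>_. e j)"
    and "A \<in> sets borel \<Longrightarrow> \<sigma> j A = (\<integral>x. indicator A x * e j \<partial>\<mu> j)"
proof -
  show "nonvanishing_density {a j..b j} (\<lambda>_. e j)"
    using e0[OF j] density_on_intros(1) by (simp add: nonvanishing_density_def)
  show "\<sigma> j A = (\<integral>x. indicator A x * e j \<partial>\<mu> j)" if "A \<in> sets borel"
    using \<sigma>[OF j that] nd_space[OF \<mu>'[OF j] compact_Icc] by simp
qed

text \<open>Downward induction on j: the transform of the inner measure has no zeros on the present
  interval, by \<open>ct_real_nonzero\<close> and disjointness, so it can serve as a nonvanishing
  density.\<close>

lemma nikishin_density:
  assumes "j \<le> k" "k \<le> m"
  shows "nonvanishing_density {a j..b j} (\<rho> j k) \<and>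
    (\<forall>A\<in>sets borel. nikishin \<sigma> j k A = (\<integral>x. indicator A x * \<rho> j k x \<partial>\<mu> j))"
  using assms
proof (induction "k - j" arbitrary: j)
  case 0
  then have jk: "j = k" by simp
  have "\<rho> j k = (\<lambda>_. e j)" by (auto simp: \<rho>_def jk fun_eq_iff)
  then show ?case using generator_density[of k] 0 jk nikishin.simps[of \<sigma> k k] by simp
next
  case (Suc d)
  then have jk: "j < k" "j < m" "j \<le> m" "Suc j \<le> m" by auto
  from Suc.hyps(1)[of "Suc j"] Suc.hyps(2) jk Suc.prems
  have IH: "nonvanishing_density {a (Suc j)..b (Suc j)} (\<rho> (Suc j) k)"
    "\<And>A. A \<in> sets borel \<Longrightarrow> nikishin \<sigma> (Suc j) k A = (\<integral>x. indicator A x * \<rho> (Suc j) k x \<partial>\<mu> (Suc j))" by auto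
  note IHd = nonvanishing_densityD(1)[OF IH(1)]
  let ?g = "ct (\<mu> (Suc j)) (\<rho> (Suc j) k) :: real \<Rightarrow> real"
  have c: "cauchy_transform (nikishin \<sigma> (Suc j) k) x = ?g x" for x
    by (rule cauchy_transform_density[OF \<mu>[OF jk(4)] IH])
  have r: "\<rho> j k = (\<lambda>x. e j * ?g x)" using jk by (auto simp: \<rho>_def c fun_eq_iff)
  have "density_on {a j..b j} (\<lambda>x. e j * ?g x)"
    by (intro density_on_cmult density_on_ct[OF \<mu>'[OF jk(4)] compact_Icc IHd]) (use disj[OF jk(2)] in blast)
  moreover have "e j * ?g x \<noteq> 0" if "x \<in> {a j..b j}" for x
  proof -
    have "x \<notin> {a (Suc j)..b (Suc j)}" using disj[OF jk(2)] that by auto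
    from ct_real_nonzero[OF \<mu>[OF jk(4)] IH(1) this] show ?thesis using e0[OF jk(3)] by simp
  qed
  ultimately have 1: "nonvanishing_density {a j..b j} (\<rho> j k)" by (simp add: nonvanishing_density_def r)
  moreover have "nikishin \<sigma> j k A = (\<integral>x. indicator A x * \<rho> j k x \<partial>\<mu> j)" if A: "A \<in> sets borel" for A
  proof -
    have [measurable]: "A \<in> sets borel" "?g \<in> borel_measurable borel"
      using A borel_measurable_ct[OF \<mu>'[OF jk(4)] compact_Icc IHd] by auto
    have "nikishin \<sigma> j k A = sint (\<sigma> j) (\<lambda>x. indicator A x * ?g x)"
      unfolding nikishin.simps[of \<sigma> j k] meas_prod_def c using jk by simp
    also have "\<dots> = (\<integral>x. e j *\<^sub>R (indicator A x * ?g x) \<partial>\<mu> j)"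
      by (rule sint_density[OF \<mu>[OF jk(3)] generator_density[OF jk(3)]]) (assumption, measurable)
    also have "\<dots> = (\<integral>x. indicator A x * \<rho> j k x \<partial>\<mu> j)" by (simp add: r mult.left_commute)
    finally show ?thesis .
  qed
  ultimately show ?case by blast
qed

lemma \<rho>_nonvanishing: "j \<le> k \<Longrightarrow> k \<le> m \<Longrightarrow> nonvanishing_density {a j..b j} (\<rho> j k)"
  using nikishin_density by blast

lemma \<rho>_density: "j \<le> k \<Longrightarrow> k \<le> m \<Longrightarrow> density_on {a j..b j} (\<rho> j k)"
  using \<rho>_nonvanishing nonvanishing_densityD(1) by blast

lemma cauchy_transform_nikishin:
  assumes "j \<le> k" "k \<le> m" shows "cauchy_transform (nikishin \<sigma> j k) z = ct (\<mu> j) (\<rho> j k) z"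
proof -
  have "j \<le> m" using assms by simp
  from cauchy_transform_density[OF \<mu>[OF this]] nikishin_density[OF assms] show ?thesis by blast
qed

lemma \<rho>_self: "\<rho> j j x = e j" by (simp add: \<rho>_def)

lemma \<rho>_Suc: "j < k \<Longrightarrow> k \<le> m \<Longrightarrow> \<rho> j k x = e j * ct (\<mu> (Suc j)) (\<rho> (Suc j) k) x"
  using cauchy_transform_nikishin[of "Suc j" k x] by (simp add: \<rho>_def)

text \<open>Ties an abstract family to the system: for the empty column set, the ratios relative to
  r have to be the transforms of s_{r+1,j}, the first row of the matrix.\<close>

definition linked :: "nat \<Rightarrow> (nat set \<Rightarrow> nat \<Rightarrow> nat \<Rightarrow> complex \<Rightarrow> complex) \<Rightarrow> bool" where
  "linked r R \<longleftrightarrow> ratio_family a b m r R \<and> (\<forall>j\<in>{Suc r..m}. \<forall>z. R {} r j z = ct (\<mu> (Suc r)) (\<rho> (Suc r) j) z)"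

text \<open>On the interval with index r the densities of the s_{r,j} are these ratios times the
  common constant \<open>e r\<close>. Their quotients give the hypothesis under which
  \<open>ratio_step\<close> can add a further generator.\<close>

lemma linked_boundary:
  assumes R: "linked r R" and r: "r \<le> m" and l: "l \<in> {r..m}" and j: "j \<in> {r..m}" and x: "x \<in> {a r..b r}"
  shows "boundary_value (R {} l j) x (\<rho> r j x / \<rho> r l x)"
proof -
  have RF: "ratio_family a b m r R" and Rj: "\<And>j z. j \<in> {Suc r..m} \<Longrightarrow> R {} r j z = ct (\<mu> (Suc r)) (\<rho> (Suc r) j) z"
    using R by (auto simp: linked_def)
  have rr: "r \<in> {r..m} - {}" using r by simp
  have 1: "boundary_value (R {} r j) x (\<rho> r j x / e r)" if j: "j \<in> {r..m}" for j
  proof (cases "j = r")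
    case True
    have "\<rho> r j x / e r = 1" using True e0[OF r] by (simp add: \<rho>_self)
    moreover have "boundary_value (R {} r r) x 1"
      by (rule boundary_value_cong[OF boundary_value_const])
        (simp add: ratio_family_cocycle(1)[OF RF empty_subsetI rr rr])
    ultimately show ?thesis using True by simp
  next
    case False
    then have j': "r < j" "j \<le> m" "Suc r \<le> m" using j by auto
    have "\<rho> r j x / e r = ct (\<mu> (Suc r)) (\<rho> (Suc r) j) x" using \<rho>_Suc[OF j'(1,2)] e0[OF r] by simp
    moreover have xn: "x \<notin> {a (Suc r)..b (Suc r)}" using disj[of r] j' x by auto
    have "boundary_value (ct (\<mu> (Suc r)) (\<rho> (Suc r) j)) x (ct (\<mu> (Suc r)) (\<rho> (Suc r) j) x)"
      unfolding boundary_value_def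
      by (rule ct_Complex_tendsto[OF \<mu>'[OF j'(3)] compact_Icc \<rho>_density xn]) (use j' in auto)
    then have "boundary_value (R {} r j) x (ct (\<mu> (Suc r)) (\<rho> (Suc r) j) x)"
      by (rule boundary_value_cong) (use Rj j' in simp)
    ultimately show ?thesis by simp
  qed
  have l0: "\<rho> r l x \<noteq> 0" using nonvanishing_densityD(2)[OF \<rho>_nonvanishing[of r l] x] l by auto
  have "boundary_value (\<lambda>z. R {} r j z / R {} r l z) x ((\<rho> r j x / e r) / (\<rho> r l x / e r))"
    by (rule boundary_value_divide[OF 1[OF j] 1[OF l]]) (use l0 e0[OF r] in simp)
  then have "boundary_value (R {} l j) x ((\<rho> r j x / e r) / (\<rho> r l x / e r))"
  proof (rule boundary_value_cong)
    fix z :: complex assume z: "Im z > 0"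
    have "R {} r l z * R {} l j z = R {} r j z" "R {} r l z \<noteq> 0"
      using ratio_family_cocycle(4)[OF RF empty_subsetI rr _ z, of l j] ratio_family_cocycle(3)[OF RF empty_subsetI rr _ z, of l] l j by auto
    then show "R {} r j z / R {} r l z = R {} l j z" by (simp add: field_simps)
  qed
  moreover have "(\<rho> r j x / e r) / (\<rho> r l x / e r) = \<rho> r j x / \<rho> r l x" using e0[OF r] by simp
  ultimately show ?thesis by (simp only:)
qed

text \<open>Downward from r = m, where a single index remains; the interpretation of
  \<open>ratio_step\<close> supplies each further family together with its first row.\<close>

lemma linked_exists: "r \<le> m \<Longrightarrow> \<exists>R. linked r R"
proof (induction "m - r" arbitrary: r)
  case 0
  then have "r = m" by simp
  then show ?case using ratio_family_base by (intro exI[of _ "\<lambda>_ _ _ _. 1"]) (simp add: linked_def)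
next
  case (Suc d)
  then have r: "r < m" "Suc r \<le> m" by auto
  have "d = m - Suc r" using Suc.hyps(2) by simp
  from Suc.hyps(1)[OF this r(2)] obtain R' where R': "linked (Suc r) R'" by blast
  interpret S: ratio_step a b m r R' "\<mu> (Suc r)" "\<rho> (Suc r)"
  proof
    show "ratio_family a b m (Suc r) R'" using R' by (simp add: linked_def)
    show "boundary_value (R' {} l j) x (\<rho> (Suc r) j x / \<rho> (Suc r) l x)"
      if "j \<in> {Suc r..m}" "l \<in> {Suc r..m}" "x \<in> {a (Suc r)..b (Suc r)}" for j l x
      by (rule linked_boundary[OF R' r(2) that(2,1,3)])
    show "nonvanishing_density {a (Suc r)..b (Suc r)} (\<rho> (Suc r) j)" if "j \<in> {Suc r..m}" for j
      by (rule \<rho>_nonvanishing) (use that in auto)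
  qed (use ab disj \<mu> r in auto)
  have "linked r S.R" unfolding linked_def using S.ratio_family_step S.R_empty by blast
  then show ?case by blast
qed

end

section \<open>Orthogonality relations of the common denominator and of the remainders\<close>

lemma below_mult_linear: "below p n \<Longrightarrow> below (p * [:c, d:]) (Suc n)" for p :: "'a::comm_semiring_0 poly"
  by (auto simp: below_def coeff_pCons split: nat.splits)

lemma eventually_outside_compact:
  assumes "compact S" shows "\<forall>\<^sub>F z in at_infinity. z \<notin> (S :: complex set)"
proof -
  obtain L where "\<And>z. z \<in> S \<Longrightarrow> cmod z \<le> L" using compact_imp_bounded[OF assms] unfolding bounded_iff by blast
  then show ?thesis unfolding eventually_at_infinity by (intro exI[of _ "L + 1"]) force
qed

lemma bigo_tendsto_0:
  fixes f g :: "'a \<Rightarrow> complex"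
  assumes "f \<in> O[F](g)" "(g \<longlongrightarrow> 0) F" shows "(f \<longlongrightarrow> 0) F"
proof -
  obtain C where "\<forall>\<^sub>F x in F. norm (f x) \<le> C * norm (g x)" using landau_o.bigE[OF assms(1)] by blast
  moreover have "((\<lambda>x. C * norm (g x)) \<longlongrightarrow> 0) F" by (intro tendsto_mult_right_zero tendsto_norm_zero assms)
  ultimately show ?thesis by (rule Lim_null_comparison)
qed

lemma compact_of_real_Icc: "compact (complex_of_real ` {a..b})"
  by (intro compact_continuous_image continuous_intros compact_Icc)

context nikishin_system
begin

definition type_II_orthogonal :: "nat list \<Rightarrow> real poly \<Rightarrow> bool" where
  "type_II_orthogonal n A \<longleftrightarrow> (\<forall>k\<le>m. \<forall>p. below p (n ! k) \<longrightarrow> (\<integral>x. poly A x * poly p x * \<rho> 0 k x \<partial>\<mu> 0) = 0)"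

lemma \<rho>_poly_density: "k \<le> m \<Longrightarrow> density_on {a 0..b 0} (\<lambda>x. poly A x * \<rho> 0 k x)"
  using density_on_intros(5)[OF density_on_poly \<rho>_density] by simp

lemma integrable_\<rho>: "k \<le> m \<Longrightarrow> integrable (\<mu> 0) (\<lambda>x. poly A x * \<rho> 0 k x)"
  using \<rho>_poly_density[of k A] by (intro nd_integrable[OF \<mu>'[OF le0] compact_Icc]) (auto simp: density_on_def)

lemma orthogonal_diff_smult:
  assumes "type_II_orthogonal n A" "type_II_orthogonal n B" shows "type_II_orthogonal n (smult c A - smult d B)"
  unfolding type_II_orthogonal_def
proof (intro allI impI)
  fix k and p :: "real poly" assume k: "k \<le> m" and p: "below p (n ! k)"
  have "(\<integral>x. poly (smult c A - smult d B) x * poly p x * \<rho> 0 k x \<partial>\<mu> 0)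
      = (\<integral>x. c * (poly (A * p) x * \<rho> 0 k x) - d * (poly (B * p) x * \<rho> 0 k x) \<partial>\<mu> 0)"
    by (simp add: algebra_simps)
  also have "\<dots> = c * (\<integral>x. poly (A * p) x * \<rho> 0 k x \<partial>\<mu> 0) - d * (\<integral>x. poly (B * p) x * \<rho> 0 k x \<partial>\<mu> 0)"
    unfolding integral_mult_right_zero[symmetric]
    by (intro Bochner_Integration.integral_diff integrable_mult_right integrable_\<rho> k)
  also have "\<dots> = 0" using assms k p unfolding type_II_orthogonal_def by simp
  finally show "(\<integral>x. poly (smult c A - smult d B) x * poly p x * \<rho> 0 k x \<partial>\<mu> 0) = 0" .
qed

text \<open>\<open>ratio_family_orthogonal_zeros\<close> for the empty column set. Applied to
  combinations of orthogonal polynomials it also yields uniqueness.\<close>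

lemma orthogonal_zeros:
  assumes A: "type_II_orthogonal n A" and n: "length n = m + 1"
  shows "\<exists>Z\<subseteq>{a 0..b 0}. finite Z \<and> card Z = sum_list n \<and> (\<forall>z\<in>Z. poly A z = 0)"
proof -
  obtain R where R: "linked 0 R" using linked_exists[of 0] by auto
  then have RF: "ratio_family a b m 0 R" by (simp add: linked_def)
  have "sum_list n = sum ((!) n) {0..<m + 1}" using n by (simp add: sum_list_sum_nth)
  then have sn: "sum ((!) n) ({0..m} - {}) = sum_list n" by (simp add: atLeastLessThanSuc_atLeastAtMost)
  have "\<exists>Z\<subseteq>{a 0..b 0}. finite Z \<and> card Z = sum ((!) n) ({0..m} - {}) \<and> (\<forall>z\<in>Z. poly A z = 0)"
  proof (rule ratio_family_orthogonal_zeros[OF RF _ empty_subsetI _ \<mu>[OF le0], of 0 "\<rho> 0"])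
    show "{a 0..b 0} \<inter> {a (Suc (0 + card {}))..b (Suc (0 + card {}))} = {}" if "{0..m} - {} \<noteq> {0}"
    proof -
      have "0 < m" using that by (cases m) auto
      then show ?thesis using disj[of 0] by simp
    qed
    show "boundary_value (R {} 0 j) x (\<rho> 0 j x / \<rho> 0 0 x)" if "j \<in> {0..m} - {}" "x \<in> {a 0..b 0}" for j x
      by (rule linked_boundary[OF R]) (use that in auto)
    fix p :: "nat \<Rightarrow> real poly" assume p: "\<And>j. j \<in> {0..m} - {} \<Longrightarrow> below (p j) (n ! j)"
    have "(\<integral>x. poly A x * (\<Sum>j\<in>{0..m} - {}. poly (p j) x * \<rho> 0 j x) \<partial>\<mu> 0)
        = (\<integral>x. (\<Sum>j\<in>{0..m} - {}. poly (A * p j) x * \<rho> 0 j x) \<partial>\<mu> 0)"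
      by (simp add: sum_distrib_left mult.assoc)
    also have "\<dots> = (\<Sum>j\<in>{0..m} - {}. \<integral>x. poly (A * p j) x * \<rho> 0 j x \<partial>\<mu> 0)"
      by (rule Bochner_Integration.integral_sum) (auto intro!: integrable_\<rho> simp del: poly_mult)
    also have "\<dots> = 0" using A p by (intro sum.neutral ballI) (auto simp: type_II_orthogonal_def)
    finally show "(\<integral>x. poly A x * (\<Sum>j\<in>{0..m} - {}. poly (p j) x * \<rho> 0 j x) \<partial>\<mu> 0) = 0" .
  qed (use \<rho>_density \<rho>_nonvanishing disj in auto)
  then show ?thesis unfolding sn .
qed

text \<open>A combination of two solutions in which the coefficient of degree |n| cancels still has
  |n| zeros, so it is 0. All solutions are thus multiples of one monic polynomial with simple real
  zeros.\<close>

lemma orthogonal_unique: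
  assumes A: "type_II_orthogonal n A" "A \<noteq> 0" "degree A \<le> sum_list n" and n: "length n = m + 1"
  obtains X where "finite X" "X \<subseteq> {a 0..b 0}" "card X = sum_list n" "type_II_orthogonal n (roots_poly X)"
    "\<And>C. type_II_orthogonal n C \<Longrightarrow> degree C \<le> sum_list n \<Longrightarrow> C = smult (coeff C (sum_list n)) (roots_poly X)"
proof -
  let ?N = "sum_list n"
  obtain X where X: "X \<subseteq> {a 0..b 0}" "finite X" "card X = ?N" "\<forall>z\<in>X. poly A z = 0"
    using orthogonal_zeros[OF A(1) n] by blast
  have RX: "degree (roots_poly X) = ?N" "coeff (roots_poly X) ?N = 1"
    "\<And>z. z \<in> X \<Longrightarrow> poly (roots_poly X) z = 0"
  proof -
    show d: "degree (roots_poly X) = ?N" by (simp add: degree_roots_poly X(3))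
    have "lead_coeff (roots_poly X) = 1" by (simp add: roots_poly_def lead_coeff_prod)
    then show "coeff (roots_poly X) ?N = 1" using d by simp
    show "poly (roots_poly X) z = 0" if "z \<in> X" for z unfolding poly_roots_poly using that X(2) by (intro prod_zero) auto
  qed
  have bel: "below (C - smult (coeff C ?N) (roots_poly X)) ?N" if "degree C \<le> ?N" for C
    unfolding below_def
  proof (intro allI impI)
    fix k assume k: "?N \<le> k"
    show "coeff (C - smult (coeff C ?N) (roots_poly X)) k = 0"
    proof (cases "k = ?N")
      case True then show ?thesis using RX(2) by simp
    next
      case False
      then have "coeff C k = 0" "coeff (roots_poly X) k = 0" using k that RX(1) by (auto intro!: coeff_eq_0)
      then show ?thesis by simp
    qed
  qed
  have A0: "A = smult (coeff A ?N) (roots_poly X)"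
  proof -
    have "A - smult (coeff A ?N) (roots_poly X) = 0"
      by (rule below_roots[OF bel[OF A(3)] X(2)]) (use X RX(3) in auto)
    then show ?thesis by simp
  qed
  then have c0: "coeff A ?N \<noteq> 0" using A(2) by auto
  have "roots_poly X = smult (1 / coeff A ?N) A - smult 0 A" by (subst A0) (use c0 in simp)
  then have oX: "type_II_orthogonal n (roots_poly X)" using orthogonal_diff_smult[OF A(1) A(1)] by metis
  show thesis
  proof (rule that[OF X(2,1,3) oX])
    fix C assume C: "type_II_orthogonal n C" "degree C \<le> ?N"
    have "smult 1 C - smult (coeff C ?N) (roots_poly X) = C - smult (coeff C ?N) (roots_poly X)" by simp
    then have "type_II_orthogonal n (C - smult (coeff C ?N) (roots_poly X))" using orthogonal_diff_smult[OF C(1) oX] by metis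
    from orthogonal_zeros[OF this n] obtain Z where Z: "finite Z" "card Z = ?N"
      "\<forall>z\<in>Z. poly (C - smult (coeff C ?N) (roots_poly X)) z = 0" by blast
    have "C - smult (coeff C ?N) (roots_poly X) = 0"
      by (rule below_roots[OF bel[OF C(2)] Z(1)]) (use Z in auto)
    then show "C = smult (coeff C ?N) (roots_poly X)" by simp
  qed
qed

text \<open>The real and imaginary parts of Q satisfy the same real orthogonality relations, so both
  are multiples of one real polynomial. The numerator is identified because a polynomial tending to
  0 at infinity is 0.\<close>

lemma type_II_structure:
  assumes ap: "type_II_approximant m (nikishin \<sigma> 0) n Q P" and n: "length n = m + 1"
  obtains q X where "q \<noteq> 0" "finite X" "X \<subseteq> {a 0..b 0}" "card X = sum_list n" "type_II_orthogonal n (roots_poly X)"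
    "Q = smult q (map_poly of_real (roots_poly X))"
    "\<And>k z. k \<le> m \<Longrightarrow> z \<notin> of_real ` {a 0..b 0} \<Longrightarrow>
      poly Q z * cauchy_transform (nikishin \<sigma> 0 k) z - poly (P k) z = q * ct (\<mu> 0) (\<lambda>x. poly (roots_poly X) x * \<rho> 0 k x) z"
    "\<And>k. k \<le> m \<Longrightarrow> ct (\<mu> 0) (\<lambda>x. poly (roots_poly X) x * \<rho> 0 k x) \<in> O[at_infinity](\<lambda>z::complex. 1 / z ^ (n ! k + 1))"
proof -
  let ?I = "{a 0..b 0}" and ?N = "sum_list n" and ?c = "map_poly complex_of_real"
  note M = \<mu>'[OF le0] compact_Icc[of "a 0" "b 0"]
  from ap have Q: "Q \<noteq> 0" "degree Q \<le> ?N"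
    and O: "\<And>k. k \<le> m \<Longrightarrow> (\<lambda>z. poly Q z * cauchy_transform (nikishin \<sigma> 0 k) z - poly (P k) z) \<in> O[at_infinity](\<lambda>z. 1 / z ^ (n ! k + 1))"
    by (auto simp: type_II_approximant_def)
  define A where "A = map_poly Re Q"
  define B where "B = map_poly Im Q"
  have QAB: "Q = ?c A + smult \<i> (?c B)"
    by (rule poly_eqI) (simp add: A_def B_def coeff_map_poly complex_eq_iff)
  have dAB: "degree A \<le> ?N" "degree B \<le> ?N"
  proof -
    have "coeff Q i = 0" if "?N < i" for i by (rule coeff_eq_0) (use Q(2) that in linarith)
    then show "degree A \<le> ?N" "degree B \<le> ?N" unfolding A_def B_def by (auto intro!: degree_le simp: coeff_map_poly)
  qed
  define G where "G k z = ct (\<mu> 0) (\<lambda>x. poly A x * \<rho> 0 k x) z + \<i> * ct (\<mu> 0) (\<lambda>x. poly B x * \<rho> 0 k x) z" for k and z :: complex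
  have QG: "poly Q z * cauchy_transform (nikishin \<sigma> 0 k) z - poly (P k) z = G k z"
    if k: "k \<le> m" and z: "z \<notin> of_real ` ?I" for k z
  proof -
    have C: "\<exists>C. \<forall>z. z \<notin> of_real ` ?I \<longrightarrow> poly (?c E) z * ct (\<mu> 0) (\<rho> 0 k) z = ct (\<mu> 0) (\<lambda>x. poly E x * \<rho> 0 k x) z + poly (?c C) z" for E
      using poly_ct[OF M \<rho>_density[OF le0 k], of E, where 'a=complex] by blast
    obtain CA CB where C: "\<And>z. z \<notin> of_real ` ?I \<Longrightarrow> poly (?c A) z * ct (\<mu> 0) (\<rho> 0 k) z = ct (\<mu> 0) (\<lambda>x. poly A x * \<rho> 0 k x) z + poly (?c CA) z"
      "\<And>z. z \<notin> of_real ` ?I \<Longrightarrow> poly (?c B) z * ct (\<mu> 0) (\<rho> 0 k) z = ct (\<mu> 0) (\<lambda>x. poly B x * \<rho> 0 k x) z + poly (?c CB) z"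
      using C[of A] C[of B] by blast
    define D where "D = ?c CA + smult \<i> (?c CB) - P k"
    have e: "poly Q z * cauchy_transform (nikishin \<sigma> 0 k) z - poly (P k) z = G k z + poly D z" if "z \<notin> of_real ` ?I" for z
      unfolding cauchy_transform_nikishin[OF le0 k] QAB G_def D_def using C(1)[OF that] C(2)[OF that]
      by (simp add: distrib_right mult.assoc) (simp add: distrib_left)
    have G0: "(G k \<longlongrightarrow> 0) at_infinity"
    proof -
      have "(G k \<longlongrightarrow> 0 + \<i> * 0) at_infinity" unfolding G_def
        by (intro tendsto_intros tendsto_ct_at_infinity[OF M] \<rho>_poly_density k)
      then show ?thesis by simp
    qed
    have "((\<lambda>z::complex. 1 / z ^ (n ! k + 1)) \<longlongrightarrow> 0) at_infinity"
    proof -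
      have "(\<lambda>z::complex. 1 / z ^ (n ! k + 1)) = (\<lambda>z. inverse z ^ (n ! k + 1))"
        by (rule ext) (simp only: power_inverse divide_inverse mult_1)
      then show ?thesis using tendsto_power[OF tendsto_inverse_0, of "n ! k + 1"] by simp
    qed
    then have "((\<lambda>z. poly Q z * cauchy_transform (nikishin \<sigma> 0 k) z - poly (P k) z) \<longlongrightarrow> 0) at_infinity"
      by (rule bigo_tendsto_0[OF O[OF k]])
    from tendsto_diff[OF this G0] have "((\<lambda>z. poly Q z * cauchy_transform (nikishin \<sigma> 0 k) z - poly (P k) z - G k z) \<longlongrightarrow> 0) at_infinity"
      by simp
    then have "(poly D \<longlongrightarrow> 0) at_infinity"
    proof (rule Lim_transform_eventually)
      show "\<forall>\<^sub>F z in at_infinity. poly Q z * cauchy_transform (nikishin \<sigma> 0 k) z - poly (P k) z - G k z = poly D z"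
        using eventually_outside_compact[OF compact_of_real_Icc[of "a 0" "b 0"]] by eventually_elim (simp add: e)
    qed
    then have "D = 0" by (intro poly_tendsto_zero_on_imaginary_axis filterlim_compose[OF _ filterlim_imaginary_axis])
    then show ?thesis using e[OF z] by simp
  qed
  have GO: "G k \<in> O[at_infinity](\<lambda>z. 1 / z ^ (n ! k + 1))" if k: "k \<le> m" for k
  proof (rule landau_o.big.in_cong[THEN iffD1, OF _ O[OF k]])
    show "\<forall>\<^sub>F z in at_infinity. poly Q z * cauchy_transform (nikishin \<sigma> 0 k) z - poly (P k) z = G k z"
      using eventually_outside_compact[OF compact_of_real_Icc[of "a 0" "b 0"]] by eventually_elim (rule QG[OF k])
  qed
  have oAB: "type_II_orthogonal n A" "type_II_orthogonal n B"
  proof -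
    have *: "(\<integral>x. x ^ i * (poly A x * \<rho> 0 k x) \<partial>\<mu> 0) = 0 \<and> (\<integral>x. x ^ i * (poly B x * \<rho> 0 k x) \<partial>\<mu> 0) = 0"
      if "k \<le> m" "i < n ! k" for k i
      by (rule moments_vanish[OF M _ _ GO[OF that(1), unfolded G_def] that(2)]) (intro \<rho>_poly_density that)+
    have "(\<integral>x. poly p x * (poly E x * \<rho> 0 k x) \<partial>\<mu> 0) = 0"
      if "E = A \<or> E = B" "k \<le> m" "below p (n ! k)" for E p k
      using that * by (intro moments_poly[OF M _ _ that(3)] \<rho>_poly_density) auto
    then have "(\<integral>x. poly E x * poly p x * \<rho> 0 k x \<partial>\<mu> 0) = 0"
      if "E = A \<or> E = B" "k \<le> m" "below p (n ! k)" for E p k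
      using that by (simp only: mult_ac)
    then show "type_II_orthogonal n A" "type_II_orthogonal n B" unfolding type_II_orthogonal_def by blast+
  qed
  have "A \<noteq> 0 \<or> B \<noteq> 0" using Q(1) QAB by auto
  then obtain X where X: "finite X" "X \<subseteq> ?I" "card X = ?N" "type_II_orthogonal n (roots_poly X)"
    "\<And>C. type_II_orthogonal n C \<Longrightarrow> degree C \<le> ?N \<Longrightarrow> C = smult (coeff C ?N) (roots_poly X)"
    using orthogonal_unique[OF oAB(1) _ dAB(1) n] orthogonal_unique[OF oAB(2) _ dAB(2) n] by metis
  define q where "q = of_real (coeff A ?N) + \<i> * of_real (coeff B ?N)"
  have AX: "A = smult (coeff A ?N) (roots_poly X)" and BX: "B = smult (coeff B ?N) (roots_poly X)"
    using X(5) oAB dAB by auto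
  have QX: "Q = smult q (?c (roots_poly X))"
  proof -
    have "?c (smult t E) = smult (of_real t) (?c E)" for t E by (rule poly_eqI) (simp add: coeff_map_poly)
    then have "Q = smult (of_real (coeff A ?N)) (?c (roots_poly X)) + smult \<i> (smult (of_real (coeff B ?N)) (?c (roots_poly X)))"
      using QAB AX BX by metis
    then show ?thesis by (simp add: q_def smult_add_left)
  qed
  have q0: "q \<noteq> 0" using QX Q(1) by auto
  have GX: "G k z = q * ct (\<mu> 0) (\<lambda>x. poly (roots_poly X) x * \<rho> 0 k x) z" for k z
  proof -
    have h: "ct (\<mu> 0) (\<lambda>x. poly (smult t (roots_poly X)) x * \<rho> 0 k x) z = of_real t * ct (\<mu> 0) (\<lambda>x. poly (roots_poly X) x * \<rho> 0 k x) z" for t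
      unfolding poly_smult mult.assoc by (rule ct_cmult[OF M])
    show ?thesis unfolding G_def h[of "coeff A ?N", folded AX] h[of "coeff B ?N", folded BX] q_def
      by (simp add: distrib_right mult.assoc)
  qed
  show thesis
  proof (rule that[OF q0 X(1-4) QX])
    show "poly Q z * cauchy_transform (nikishin \<sigma> 0 k) z - poly (P k) z = q * ct (\<mu> 0) (\<lambda>x. poly (roots_poly X) x * \<rho> 0 k x) z"
      if "k \<le> m" "z \<notin> of_real ` ?I" for k z using QG[OF that] GX by simp
    show "ct (\<mu> 0) (\<lambda>x. poly (roots_poly X) x * \<rho> 0 k x) \<in> O[at_infinity](\<lambda>z::complex. 1 / z ^ (n ! k + 1))" if k: "k \<le> m" for k
    proof -
      have "(\<lambda>z. q * ct (\<mu> 0) (\<lambda>x. poly (roots_poly X) x * \<rho> 0 k x) z) \<in> O[at_infinity](\<lambda>z. 1 / z ^ (n ! k + 1))"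
        using GO[OF k] unfolding GX[abs_def] .
      then show ?thesis using q0 by simp
    qed
  qed
qed

text \<open>The remainder is orthogonal on the second interval with respect to the densities of a column of the
  family of ratios.\<close>

lemma remainder_zeros:
  assumes Q: "type_II_orthogonal n Q" and k: "k \<le> m"
  obtains Z where "finite Z" "Z \<subseteq> (if m = 0 then {} else {a 1..b 1})" "card Z = (\<Sum>j\<in>{0..m} - {k}. min (n ! j) (n ! k - 1))"
    "\<And>z. z \<in> Z \<Longrightarrow> ct (\<mu> 0) (\<lambda>x. poly Q x * \<rho> 0 k x) z = (0 :: real)"
proof (cases "m = 0")
  case True
  then have "{0..m} - {k} = {}" using k by auto
  then show thesis using True by (intro that[of "{}"]) auto
next
  case False
  let ?J = "{0..m} - {k}" and ?I = "{a 0..b 0}" and ?D = "{a 1..b 1}"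
  obtain l where l: "l \<in> ?J"
  proof (cases "k = 0")
    case True then show thesis using False by (intro that[of m]) auto
  qed (use that[of 0] in auto)
  obtain R where R: "linked 0 R" using linked_exists[of 0] by auto
  then have RF: "ratio_family a b m 0 R" by (simp add: linked_def)
  have kJ: "k \<in> {0..m} - {}" using k by simp
  have "{0..m} - {} - {k} \<noteq> {}" using l by auto
  from ratio_family_column[OF RF empty_subsetI kJ this]
  obtain N \<eta> \<alpha> \<beta> where "ratio_column (0 + card ({}::nat set)) {a (Suc (0 + card ({}::nat set)))..b (Suc (0 + card ({}::nat set)))} ({0..m} - {} - {k}) (R {} k) (R (insert k {})) k N \<eta> \<alpha> \<beta>" by blast
  then have col: "ratio_column 0 ?D ?J (R {} k) (R {k}) k N \<eta> \<alpha> \<beta>" by simp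
  note N = ratio_columnD(1)[OF col] and \<eta> = ratio_columnD(2)[OF col]
  note M = \<mu>'[OF le0] compact_Icc[of "a 0" "b 0"] and N' = nondegenerate_onD[OF N] compact_Icc[of "a 1" "b 1"]
  have ID: "?I \<inter> ?D = {}" using disj[of 0] False by simp
  define f where "f x = poly Q x * \<rho> 0 k x" for x
  have fd: "density_on ?I f" unfolding f_def by (rule \<rho>_poly_density[OF k])
  have gd: "density_on ?D (ct (\<mu> 0) f)" by (rule density_on_ct[OF M fd ID])
  have \<eta>d: "density_on ?D (\<lambda>x. poly p x * \<eta> j x)" if "j \<in> ?J" for p j
    by (rule density_on_intros(5)[OF density_on_poly nonvanishing_densityD(1)[OF \<eta>[OF that]]])
  \<comment> \<open>\<open>ct_pairing\<close> moves the integral to the first interval. There \<rho>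
    0 j / \<rho> 0 k is the linear polynomial plus the transform of \<eta> j, which leaves a
    difference of two integrals that vanish by the orthogonality of Q.\<close>
  have orth: "(\<integral>x. poly p x * \<eta> j x * ct (\<mu> 0) f x \<partial>N) = 0"
    if j: "j \<in> ?J" and p: "below p (min (n ! j) (n ! k - 1))" for p j
  proof -
    have jm: "j \<le> m" using j by simp
    obtain c where c: "below c (min (n ! j) (n ! k - 1))"
      "\<And>x::real. x \<notin> ?D \<Longrightarrow> poly p x * ct N (\<eta> j) x = ct N (\<lambda>y. poly p y * \<eta> j y) x + poly c x"
      using poly_ct_real[OF N' nonvanishing_densityD(1)[OF \<eta>[OF j]] p] by blast
    define s where "s = p * [:\<beta> j, \<alpha> j:] + c"
    \<comment> \<open>The linear factor costs one degree, whence n ! k - 1 in the bound. If n ! k =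
      0, truncated subtraction gives 0 and forces p = 0.\<close>
    have sb: "below s (n ! k)"
    proof (cases "n ! k = 0")
      case True
      then have "p = 0" "c = 0" using p c(1) by (auto intro: below_zero)
      then show ?thesis by (simp add: s_def)
    next
      case False
      have "below (p * [:\<beta> j, \<alpha> j:]) (n ! k)"
        by (rule below_mono[OF below_mult_linear[OF p]]) (use False in auto)
      moreover have "below c (n ! k)" by (rule below_mono[OF c(1)]) auto
      ultimately show ?thesis unfolding s_def by (rule below_add)
    qed
    have pb: "below p (n ! j)" by (rule below_mono[OF p]) auto
    have "(\<integral>x. f x * ct N (\<lambda>y. poly p y * \<eta> j y) x \<partial>\<mu> 0)
        = (\<integral>x. poly (Q * p) x * \<rho> 0 j x - poly (Q * s) x * \<rho> 0 k x \<partial>\<mu> 0)"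
    proof (rule nd_integral_cong[OF M])
      fix x assume x: "x \<in> ?I"
      then have xD: "x \<notin> ?D" using ID by blast
      have "boundary_value (R {} k j) x (\<rho> 0 j x / \<rho> 0 k x)" by (rule linked_boundary[OF R]) (use jm k x in auto)
      then have "\<rho> 0 j x / \<rho> 0 k x = \<alpha> j * x + \<beta> j + ct N (\<eta> j) x"
        using ratio_column_boundary[OF col j xD] boundary_value_unique by blast
      moreover have "\<rho> 0 k x \<noteq> 0" using nonvanishing_densityD(2)[OF \<rho>_nonvanishing[OF le0 k] x] .
      ultimately have "\<rho> 0 j x = \<rho> 0 k x * (\<alpha> j * x + \<beta> j + ct N (\<eta> j) x)" by (simp add: field_simps)
      moreover have "ct N (\<lambda>y. poly p y * \<eta> j y) x = poly p x * ct N (\<eta> j) x - poly c x" using c(2)[OF xD] by simp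
      moreover have "poly s x = poly p x * (\<alpha> j * x + \<beta> j) + poly c x" by (simp add: s_def algebra_simps)
      ultimately show "f x * ct N (\<lambda>y. poly p y * \<eta> j y) x = poly (Q * p) x * \<rho> 0 j x - poly (Q * s) x * \<rho> 0 k x"
        unfolding f_def poly_mult by algebra
    next
      have "density_on ?I (ct N (\<lambda>y. poly p y * \<eta> j y))"
        by (rule density_on_ct[OF N' \<eta>d[OF j]]) (use ID in blast)
      from density_on_intros(5)[OF fd this] show "(\<lambda>x. f x * ct N (\<lambda>y. poly p y * \<eta> j y) x) \<in> borel_measurable borel"
        by (simp add: density_on_def)
      from density_on_intros(4)[OF \<rho>_poly_density[OF jm] \<rho>_poly_density[OF k]]
      show "(\<lambda>x. poly (Q * p) x * \<rho> 0 j x - poly (Q * s) x * \<rho> 0 k x) \<in> borel_measurable borel"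
        by (simp only: density_on_def)
    qed
    also have "\<dots> = (\<integral>x. poly (Q * p) x * \<rho> 0 j x \<partial>\<mu> 0) - (\<integral>x. poly (Q * s) x * \<rho> 0 k x \<partial>\<mu> 0)"
      by (rule Bochner_Integration.integral_diff[OF integrable_\<rho>[OF jm] integrable_\<rho>[OF k]])
    also have "\<dots> = 0" using Q jm k pb sb by (simp add: type_II_orthogonal_def)
    finally show ?thesis using ct_pairing[OF M N' ID fd \<eta>d[OF j]] by simp
  qed
  have finkJ: "card {k} = 1" by simp
  have "\<exists>Z\<subseteq>?D. finite Z \<and> card Z = sum (\<lambda>j. min (n ! j) (n ! k - 1)) ?J \<and> (\<forall>z\<in>Z. ct (\<mu> 0) f z = 0)"
  proof (rule ratio_family_orthogonal_zeros[OF RF _ _ l N, of \<eta>])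
    show "?D \<inter> {a (Suc (0 + card {k}))..b (Suc (0 + card {k}))} = {}" if "?J \<noteq> {l}"
    proof -
      from that l obtain l' where "l' \<in> ?J" "l' \<noteq> l" by blast
      then have "l \<le> m" "l' \<le> m" "l \<noteq> k" "l' \<noteq> k" "l' \<noteq> l" using l by auto
      then have "1 < m" using k by arith
      then show ?thesis using disj[of 1] by (simp add: numeral_2_eq_2)
    qed
    show "boundary_value (R {k} l j) x (\<eta> j x / \<eta> l x)" if "j \<in> ?J" "x \<in> ?D" for j x
      by (rule ratio_columnD(6)[OF col that(1) l that(2)])
    show "density_on ?D (\<eta> j)" if "j \<in> ?J" for j by (rule nonvanishing_densityD(1)[OF \<eta>[OF that]])
    show "nonvanishing_density ?D (\<eta> l)" by (rule \<eta>[OF l])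
    show "density_on ?D (ct (\<mu> 0) f)" by (rule gd)
    fix p :: "nat \<Rightarrow> real poly" assume p: "\<And>j. j \<in> ?J \<Longrightarrow> below (p j) (min (n ! j) (n ! k - 1))"
    have "(\<integral>x. ct (\<mu> 0) f x * (\<Sum>j\<in>?J. poly (p j) x * \<eta> j x) \<partial>N) = (\<integral>x. (\<Sum>j\<in>?J. poly (p j) x * \<eta> j x * ct (\<mu> 0) f x) \<partial>N)"
      by (simp add: sum_distrib_left mult.commute)
    also have "\<dots> = (\<Sum>j\<in>?J. \<integral>x. poly (p j) x * \<eta> j x * ct (\<mu> 0) f x \<partial>N)"
    proof (rule Bochner_Integration.integral_sum)
      fix j assume "j \<in> ?J"
      from density_on_intros(5)[OF \<eta>d[OF this] gd] show "integrable N (\<lambda>x. poly (p j) x * \<eta> j x * ct (\<mu> 0) f x)"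
        by (intro nd_integrable[OF N']) (auto simp: density_on_def)
    qed
    also have "\<dots> = 0" using orth p by (intro sum.neutral ballI) blast
    finally show "(\<integral>x. ct (\<mu> 0) f x * (\<Sum>j\<in>?J. poly (p j) x * \<eta> j x) \<partial>N) = 0" .
  qed (use disj k in auto)
  then obtain Z where "Z \<subseteq> ?D" "finite Z" "card Z = sum (\<lambda>j. min (n ! j) (n ! k - 1)) ?J" "\<forall>z\<in>Z. ct (\<mu> 0) f z = 0" by blast
  moreover have "f = (\<lambda>x. poly Q x * \<rho> 0 k x)" by (rule ext) (simp add: f_def)
  ultimately show thesis using False by (intro that[of Z]) auto
qed

end

section \<open>Rate of convergence\<close>

lemma inverse_linear_bigo: "(\<lambda>z::complex. 1 / (z - x)) \<in> O[at_infinity](\<lambda>z. 1 / z)"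
proof (rule bigoI[of _ 2])
  have "\<forall>\<^sub>F z in at_infinity. 2 * cmod x + 1 \<le> cmod z" unfolding eventually_at_infinity by blast
  then show "\<forall>\<^sub>F z in at_infinity. cmod (1 / (z - x)) \<le> 2 * cmod (1 / z)"
  proof eventually_elim
    case (elim z)
    have z: "0 < cmod z" using elim norm_ge_zero[of x] by linarith
    have "cmod z / 2 \<le> cmod (z - x)" using elim norm_triangle_ineq2[of z x] norm_ge_zero[of x] by linarith
    then have "1 / cmod (z - x) \<le> 1 / (cmod z / 2)" using z by (intro divide_left_mono mult_pos_pos) auto
    then show ?case by (simp add: norm_divide)
  qed
qed

lemma inverse_roots_poly_bigo:
  assumes "finite X"
  shows "(\<lambda>z::complex. 1 / poly (map_poly of_real (roots_poly X)) z) \<in> O[at_infinity](\<lambda>z. 1 / z ^ card X)"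
proof -
  have "(\<lambda>z::complex. \<Prod>x\<in>X. 1 / (z - of_real x)) \<in> O[at_infinity](\<lambda>z. \<Prod>x\<in>X. 1 / z)"
    using assms
  proof (induction X rule: finite_induct)
    case (insert x F)
    have "(\<lambda>z::complex. 1 / (z - of_real x) * (\<Prod>x\<in>F. 1 / (z - of_real x))) \<in> O[at_infinity](\<lambda>z. 1 / z * (\<Prod>x\<in>F. 1 / z))"
      by (rule landau_o.big.mult[OF inverse_linear_bigo insert.IH])
    then show ?case by (simp only: prod.insert[OF insert.hyps])
  qed simp
  moreover have "(\<lambda>z. 1 / poly (map_poly of_real (roots_poly X)) z) = (\<lambda>z. \<Prod>x\<in>X. 1 / (z - complex_of_real x))"
    by (rule ext) (simp add: poly_of_real_roots_poly[OF assms] prod_dividef)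
  moreover have "(\<lambda>z::complex. 1 / z ^ card X) = (\<lambda>z. \<Prod>x\<in>X. 1 / z)"
    by (rule ext) (simp add: prod_constant power_one_over)
  ultimately show ?thesis by simp
qed

text \<open>The product of w with the Joukowski map at w tends to (d - c) / 4 at the origin. Decay
  of order M at infinity thus becomes a zero of order M in the disc.\<close>

lemma inverse_joukowski_bigo:
  assumes "c < d" shows "(\<lambda>w. 1 / joukowski c d w) \<in> O[at 0](\<lambda>w. w)"
proof (rule bigoI_tendsto)
  let ?p = "of_real ((c + d) / 2)" and ?q = "of_real ((d - c) / 4) :: complex"
  have q: "?q \<noteq> 0" using assms by (simp flip: of_real_diff)
  have "((\<lambda>w::complex. 1 / (?p * w + ?q * (w\<^sup>2 + 1))) \<longlongrightarrow> 1 / (?p * 0 + ?q * (0\<^sup>2 + 1))) (at 0)"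
    by (intro tendsto_intros) (use q in simp)
  then show "((\<lambda>w. 1 / joukowski c d w / w) \<longlongrightarrow> 1 / (?p * 0 + ?q * (0\<^sup>2 + 1))) (at 0)"
  proof (rule Lim_transform_eventually)
    show "\<forall>\<^sub>F w in at 0. 1 / (?p * w + ?q * (w\<^sup>2 + 1)) = 1 / joukowski c d w / w"
      using eventually_neq_at_within[of 0 0 UNIV]
    proof eventually_elim
      case (elim w)
      have "joukowski c d w * w = ?p * w + ?q * (w\<^sup>2 + 1)"
        using elim by (simp add: joukowski_def distrib_right distrib_left power2_eq_square)
      then show ?case by simp
    qed
  qed
  show "\<forall>\<^sub>F w in at 0. w \<noteq> (0::complex)" by (rule eventually_neq_at_within)
qed

text \<open>In the logarithm the constants enter with weights 1 / N and s / N, both tending to 0, so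
  that ln \<theta> remains.\<close>

lemma rate_limit:
  fixes N s :: "nat \<Rightarrow> nat"
  assumes N: "filterlim N at_top sequentially" and s: "(\<lambda>i. real (s i) / real (N i)) \<longlonglongrightarrow> 0"
    and sN: "\<And>i. s i \<le> 2 * N i" and C: "0 < C" and D: "0 < D" and \<theta>: "0 < \<theta>"
  shows "(\<lambda>i. (C * D ^ s i * \<theta> ^ (2 * N i - s i)) powr (1 / (2 * real (N i)))) \<longlonglongrightarrow> \<theta>"
proof -
  have Nr: "filterlim (\<lambda>i. real (N i)) at_top sequentially" by (rule filterlim_compose[OF filterlim_real_sequentially N])
  have "(\<lambda>i. ln C / 2 / real (N i) + real (s i) / real (N i) * ((ln D - ln \<theta>) / 2) + ln \<theta>) \<longlonglongrightarrow> 0 + 0 * ((ln D - ln \<theta>) / 2) + ln \<theta>"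
    by (intro tendsto_intros s tendsto_divide_0[OF tendsto_const filterlim_at_top_imp_at_infinity[OF Nr]])
  from tendsto_exp[OF this]
  have "(\<lambda>i. exp (ln C / 2 / real (N i) + real (s i) / real (N i) * ((ln D - ln \<theta>) / 2) + ln \<theta>)) \<longlonglongrightarrow> \<theta>" using \<theta> by simp
  then show ?thesis
  proof (rule Lim_transform_eventually)
    have "\<forall>\<^sub>F i in sequentially. 1 \<le> N i" using N unfolding filterlim_at_top by blast
    then show "\<forall>\<^sub>F i in sequentially. exp (ln C / 2 / real (N i) + real (s i) / real (N i) * ((ln D - ln \<theta>) / 2) + ln \<theta>)
        = (C * D ^ s i * \<theta> ^ (2 * N i - s i)) powr (1 / (2 * real (N i)))"
    proof eventually_elim
      case (elim i)
      have "ln (C * D ^ s i * \<theta> ^ (2 * N i - s i)) = ln C + real (s i) * ln D + (2 * real (N i) - real (s i)) * ln \<theta>"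
        using C D \<theta> sN[of i] by (simp add: ln_mult_pos ln_realpow of_nat_diff)
      moreover have "1 / (2 * real (N i)) * (ln C + real (s i) * ln D + (2 * real (N i) - real (s i)) * ln \<theta>)
          = ln C / 2 / real (N i) + real (s i) / real (N i) * ((ln D - ln \<theta>) / 2) + ln \<theta>"
        using elim by (simp add: field_simps)
      moreover have "0 < C * D ^ s i * \<theta> ^ (2 * N i - s i)" using C D \<theta> by simp
      moreover have "x powr y = exp (y * ln x)" if "0 < x" for x y :: real using that by (simp add: powr_def)
      ultimately show ?case by metis
    qed
  qed
qed

text \<open>Root test: eventually \<open>x i\<close> is at most the power 2 N of a fixed number
  between \<theta> and 1.\<close>

lemma tendsto_zero_of_root:
  fixes x :: "nat \<Rightarrow> real" and N :: "nat \<Rightarrow> nat"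
  assumes N: "filterlim N at_top sequentially" and x: "\<And>i. 0 < x i"
    and lim: "(\<lambda>i. x i powr (1 / (2 * real (N i)))) \<longlonglongrightarrow> \<theta>" and \<theta>: "0 < \<theta>" "\<theta> < 1"
  shows "x \<longlonglongrightarrow> 0"
proof (rule Lim_null_comparison)
  let ?t = "(1 + \<theta>) / 2"
  have t: "0 < ?t" "?t < 1" "\<theta> < ?t" using \<theta> by auto
  have "\<forall>\<^sub>F i in sequentially. 1 \<le> N i" using N unfolding filterlim_at_top by blast
  with order_tendstoD(2)[OF lim t(3)] show "\<forall>\<^sub>F i in sequentially. norm (x i) \<le> ?t ^ (2 * N i)"
  proof eventually_elim
    case (elim i)
    have "x i = (x i powr (1 / (2 * real (N i)))) powr (2 * real (N i))"
      using elim(2) x[of i] by (simp add: powr_powr)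
    also have "\<dots> \<le> ?t powr (2 * real (N i))" using elim by (intro powr_mono2) auto
    also have "\<dots> = ?t powr real (2 * N i)" by simp
    also have "\<dots> = ?t ^ (2 * N i)" by (rule powr_realpow[OF t(1)])
    finally show ?case using x[of i] by simp
  qed
  have "filterlim (\<lambda>i. 2 * N i) at_top sequentially"
    by (rule filterlim_at_top_mono[OF N]) simp
  from filterlim_compose[OF LIMSEQ_realpow_zero[of ?t] this] t show "(\<lambda>i. ?t ^ (2 * N i)) \<longlonglongrightarrow> 0" by simp
qed

text \<open>There are finitely many lists of a given length with bounded entries, and each occurs at
  most once in the sequence.\<close>

lemma sum_list_at_top:
  fixes \<Lambda> :: "nat \<Rightarrow> nat list"
  assumes "inj \<Lambda>" "\<And>i. length (\<Lambda> i) = l"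
  shows "filterlim (\<lambda>i. sum_list (\<Lambda> i)) at_top sequentially"
  unfolding filterlim_at_top
proof
  fix Z :: nat
  have "finite (\<Lambda> -` {xs. set xs \<subseteq> {..Z} \<and> length xs = l})"
    by (rule finite_vimageI[OF finite_lists_length_eq assms(1)]) simp
  moreover have "{i. \<not> Z \<le> sum_list (\<Lambda> i)} \<subseteq> \<Lambda> -` {xs. set xs \<subseteq> {..Z} \<and> length xs = l}"
  proof
    fix i assume "i \<in> {i. \<not> Z \<le> sum_list (\<Lambda> i)}"
    then have "x \<le> Z" if "x \<in> set (\<Lambda> i)" for x using member_le_sum_list[OF that] by simp
    then show "i \<in> \<Lambda> -` {xs. set xs \<subseteq> {..Z} \<and> length xs = l}" using assms(2) by auto
  qed
  ultimately have "finite {i. \<not> Z \<le> sum_list (\<Lambda> i)}" by (rule finite_subset[rotated])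
  then show "\<forall>\<^sub>F i in sequentially. Z \<le> sum_list (\<Lambda> i)"
    unfolding cofinite_eq_sequentially[symmetric] eventually_cofinite .
qed

text \<open>The number of lost interpolation conditions: for each j \<noteq> k the count in
  \<open>remainder_zeros\<close> contains the minimum where the full n ! j would be ideal.\<close>

definition deficiency :: "nat \<Rightarrow> nat list \<Rightarrow> nat \<Rightarrow> nat" where
  "deficiency m n k = (\<Sum>j\<in>{0..m} - {k}. n ! j - min (n ! j) (n ! k - 1))"

lemma sum_list_split:
  assumes "length n = m + 1" "k \<le> m"
  shows "sum_list n = n ! k + (\<Sum>j\<in>{0..m} - {k}. n ! j)"
proof -
  have "sum_list n = sum ((!) n) {0..m}"
    using assms(1) by (simp add: sum_list_sum_nth atLeastLessThanSuc_atLeastAtMost)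
  then show ?thesis using assms(2) sum.remove[of "{0..m}" k "(!) n"] by simp
qed

lemma deficiency:
  assumes "length n = m + 1" "k \<le> m"
  shows "sum_list n = n ! k + (\<Sum>j\<in>{0..m} - {k}. min (n ! j) (n ! k - 1)) + deficiency m n k"
proof -
  have "(\<Sum>j\<in>{0..m} - {k}. min (n ! j) (n ! k - 1)) + deficiency m n k = (\<Sum>j\<in>{0..m} - {k}. n ! j)"
    unfolding deficiency_def sum.distrib[symmetric] by (rule sum.cong) auto
  then show ?thesis using sum_list_split[OF assms] by simp
qed

text \<open>As the sum is fixed, lower bounds for the other components give an upper bound for each
  single one. Hence a component exceeds another by at most (m + 1) h; the extra 1 is the degree lost
  to the linear factor.\<close>

lemma deficiency_le:
  fixes h :: real
  assumes n: "length n = m + 1" and k: "k \<le> m" and h: "0 \<le> h"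
    and bal: "\<And>j. j \<le> m \<Longrightarrow> real (sum_list n) / real (m + 1) - h \<le> real (n ! j)"
  shows "real (deficiency m n k) \<le> real m * (real (m + 1) * h + 1)"
proof -
  let ?N = "real (sum_list n)"
  have up: "real (n ! j) \<le> ?N / real (m + 1) + real m * h" if j: "j \<le> m" for j
  proof -
    have "real m * (?N / real (m + 1) - h) = (\<Sum>l\<in>{0..m} - {j}. ?N / real (m + 1) - h)" using j by simp
    also have "\<dots> \<le> (\<Sum>l\<in>{0..m} - {j}. real (n ! l))" by (rule sum_mono) (use bal in auto)
    also have "\<dots> = ?N - real (n ! j)" using sum_list_split[OF n j] by simp
    finally have "real (n ! j) \<le> ?N - real m * (?N / real (m + 1)) + real m * h" by (simp add: algebra_simps)
    also have "?N - real m * (?N / real (m + 1)) = ?N / real (m + 1)" by (simp add: field_simps)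
    finally show ?thesis .
  qed
  have "real (deficiency m n k) = (\<Sum>j\<in>{0..m} - {k}. real (n ! j - min (n ! j) (n ! k - 1)))"
    by (simp add: deficiency_def)
  also have "\<dots> \<le> (\<Sum>j\<in>{0..m} - {k}. real (m + 1) * h + 1)"
  proof (rule sum_mono)
    fix j assume "j \<in> {0..m} - {k}"
    then have j: "j \<le> m" by simp
    have "real (n ! j - min (n ! j) (n ! k - 1)) \<le> max 0 (real (n ! j) - real (n ! k) + 1)" by linarith
    also have "\<dots> \<le> real (m + 1) * h + 1"
    proof -
      have "real (n ! j) - real (n ! k) \<le> real m * h + h" using up[OF j] bal[OF k] by linarith
      moreover have "0 \<le> real (m + 1) * h + 1" using h by simp
      moreover have "real (m + 1) * h = real m * h + h" by (simp add: algebra_simps)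
      ultimately show ?thesis by simp
    qed
    finally show "real (n ! j - min (n ! j) (n ! k - 1)) \<le> real (m + 1) * h + 1" .
  qed
  also have "\<dots> = real m * (real (m + 1) * h + 1)" using k by simp
  finally show ?thesis .
qed

text \<open>\<open>deficiency_le\<close> with h = c |n|^\<kappa>, which is o(|n|) because \<kappa> <
  1. The same estimate makes every component eventually positive, as the error bound
  demands.\<close>

lemma balanced_asymptotics:
  fixes \<Lambda> :: "nat \<Rightarrow> nat list"
  assumes N: "filterlim (\<lambda>i. sum_list (\<Lambda> i)) at_top sequentially" and len: "\<And>i. length (\<Lambda> i) = m + 1"
    and c: "0 < c" and \<kappa>: "\<kappa> < 1" and k: "k \<le> m"
    and bal: "\<And>i j. j \<le> m \<Longrightarrow> real (sum_list (\<Lambda> i)) / real (m + 1) - c * real (sum_list (\<Lambda> i)) powr \<kappa> \<le> real (\<Lambda> i ! j)"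
  shows "(\<lambda>i. real (deficiency m (\<Lambda> i) k) / real (sum_list (\<Lambda> i))) \<longlonglongrightarrow> 0" "\<forall>\<^sub>F i in sequentially. 1 \<le> \<Lambda> i ! k"
proof -
  let ?N = "\<lambda>i. real (sum_list (\<Lambda> i))"
  have Nr: "filterlim ?N at_top sequentially" by (rule filterlim_compose[OF filterlim_real_sequentially N])
  have pw: "(\<lambda>i. ?N i powr (\<kappa> - 1)) \<longlonglongrightarrow> 0" by (rule tendsto_neg_powr[OF _ Nr]) (use \<kappa> in simp)
  have inv: "(\<lambda>i. 1 / ?N i) \<longlonglongrightarrow> 0"
    by (rule tendsto_divide_0[OF tendsto_const filterlim_at_top_imp_at_infinity[OF Nr]])
  have pos: "\<forall>\<^sub>F i in sequentially. 1 \<le> sum_list (\<Lambda> i)" using N unfolding filterlim_at_top by blast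
  have pd: "?N i powr \<kappa> / ?N i = ?N i powr (\<kappa> - 1)" if "1 \<le> sum_list (\<Lambda> i)" for i
    using that by (simp add: powr_diff)
  show "(\<lambda>i. real (deficiency m (\<Lambda> i) k) / ?N i) \<longlonglongrightarrow> 0"
  proof (rule Lim_null_comparison)
    show "\<forall>\<^sub>F i in sequentially. norm (real (deficiency m (\<Lambda> i) k) / ?N i)
        \<le> real m * (real (m + 1) * c * ?N i powr (\<kappa> - 1) + 1 / ?N i)"
      using pos
    proof eventually_elim
      case (elim i)
      have "real (deficiency m (\<Lambda> i) k) / ?N i \<le> real m * (real (m + 1) * (c * ?N i powr \<kappa>) + 1) / ?N i"
        using c by (intro divide_right_mono deficiency_le[OF len k _ bal]) auto
      also have "\<dots> = real m * (real (m + 1) * c * (?N i powr \<kappa> / ?N i) + 1 / ?N i)"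
        by (simp add: add_divide_distrib distrib_left)
      finally show ?case unfolding pd[OF elim] by simp
    qed
    have "(\<lambda>i. real m * (real (m + 1) * c * ?N i powr (\<kappa> - 1) + 1 / ?N i)) \<longlonglongrightarrow> real m * (real (m + 1) * c * 0 + 0)"
      by (intro tendsto_intros pw inv)
    then show "(\<lambda>i. real m * (real (m + 1) * c * ?N i powr (\<kappa> - 1) + 1 / ?N i)) \<longlonglongrightarrow> 0" by simp
  qed
  have "(\<lambda>i. 1 / real (m + 1) - c * ?N i powr (\<kappa> - 1)) \<longlonglongrightarrow> 1 / real (m + 1) - c * 0" by (intro tendsto_intros pw)
  moreover have "0 < 1 / real (m + 1) - c * 0" by simp
  ultimately have "\<forall>\<^sub>F i in sequentially. 0 < 1 / real (m + 1) - c * ?N i powr (\<kappa> - 1)" by (rule order_tendstoD(1))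
  with pos show "\<forall>\<^sub>F i in sequentially. 1 \<le> \<Lambda> i ! k"
  proof eventually_elim
    case (elim i)
    have N0: "0 < ?N i" using elim(1) by simp
    have "0 < (1 / real (m + 1) - c * (?N i powr \<kappa> / ?N i)) * ?N i"
      unfolding pd[OF elim(1)] using elim(2) N0 by (rule mult_pos_pos)
    also have "\<dots> = ?N i / real (m + 1) - c * ?N i powr \<kappa>" using N0 by (simp add: left_diff_distrib)
    also have "\<dots> \<le> real (\<Lambda> i ! k)" by (rule bal[OF k])
    finally show ?case by simp
  qed
qed

context nikishin_system
begin

text \<open>C and D come from the image of one fixed circle and do not depend on the multi-index or
  the approximant. Pulled back to the disc, the error has a zero of order |n| + n_k + 1 at the
  origin, from the behaviour at infinity, and further zeros over the second interval.\<close>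

lemma approximation_rate:
  assumes k: "k \<le> m" and W: "W \<subseteq> ball 0 1" and A: "compact A" "A \<subseteq> ball 0 1"
    and A1: "\<And>t. m \<noteq> 0 \<Longrightarrow> t \<in> {a 1..b 1} \<Longrightarrow> \<exists>u\<in>A. joukowski_sphere (a 0) (b 0) u = Some (of_real t)"
    and \<delta>: "0 < \<delta>" "\<delta> < \<theta>" "\<theta> < 1" "\<And>w. w \<in> W \<Longrightarrow> cmod w \<le> \<delta>" "\<And>w u. w \<in> W \<Longrightarrow> u \<in> A \<Longrightarrow> cmod (Moebius_function 0 u w) \<le> \<delta>"
  obtains C D :: real where "0 < C" "0 < D"
    "\<And>n Q P w. type_II_approximant m (nikishin \<sigma> 0) n Q P \<Longrightarrow> length n = m + 1 \<Longrightarrow> 1 \<le> n ! k \<Longrightarrow> w \<in> W \<Longrightarrow>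
      cmod (sphere_ext (cauchy_transform (nikishin \<sigma> 0 k)) (joukowski_sphere (a 0) (b 0) w)
          - sphere_ext (\<lambda>z. poly (P k) z / poly Q z) (joukowski_sphere (a 0) (b 0) w))
        \<le> C * D ^ deficiency m n k * \<theta> ^ (2 * sum_list n - deficiency m n k)"
proof -
  let ?J = "joukowski (a 0) (b 0)" and ?I = "{a 0..b 0}" and ?T = "complex_of_real ` {a 0..b 0}"
  note M = \<mu>'[OF le0] compact_Icc[of "a 0" "b 0"]
  have ab0: "a 0 < b 0" using ab by simp
  show thesis
  proof (rule disc_rate[OF W A \<delta>])
  fix r :: real
  assume r: "0 < r" "r < 1"
    "\<And>F M Z B\<^sub>0 B w. F holomorphic_on ball 0 1 - {0} \<Longrightarrow> \<forall>\<^sub>F w in at 0. cmod (F w) \<le> B\<^sub>0 * cmod w ^ M \<Longrightarrow>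
      finite Z \<Longrightarrow> Z \<subseteq> A - {0} \<Longrightarrow> (\<And>a. a \<in> Z \<Longrightarrow> F a = 0) \<Longrightarrow> (\<And>u. cmod u = r \<Longrightarrow> cmod (F u) \<le> B) \<Longrightarrow>
      w \<in> W - {0} \<Longrightarrow> cmod (F w) \<le> B * \<theta> ^ (M + card Z)"
  have "compact (?J ` sphere 0 r)"
    by (intro compact_continuous_image compact_sphere holomorphic_on_imp_continuous_on holomorphic_on_subset[OF holomorphic_joukowski])
      (use r in auto)
  moreover have "closed ?T" by (intro compact_imp_closed compact_of_real_Icc)
  moreover have "?J ` sphere 0 r \<inter> ?T = {}"
    using joukowski_notin[OF ab0] r by (fastforce simp: disjoint_iff)
  ultimately obtain \<eta> where \<eta>: "0 < \<eta>" "\<And>x y. x \<in> ?J ` sphere 0 r \<Longrightarrow> y \<in> ?T \<Longrightarrow> \<eta> \<le> dist x y"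
    using separate_compact_closed by metis
  \<comment> \<open>At least the length of the interval, to bound distances inside it, and at least
    \<eta>, so that the base L / \<eta> is not below 1.\<close>
  define L where "L = max \<eta> (b 0 - a 0)"
  have L: "\<eta> \<le> L" "b 0 - a 0 \<le> L" by (auto simp: L_def)
  obtain B where B: "B > 0" "\<And>x. x \<in> ?I \<Longrightarrow> \<bar>\<rho> 0 k x\<bar> \<le> B"
    using density_bound[OF M \<rho>_density[OF le0 k]] by blast
  define C\<^sub>0 where "C\<^sub>0 = 2 * (B * measure (\<mu> 0) UNIV) / \<eta>"
  have C0: "0 \<le> C\<^sub>0" using B \<eta> by (simp add: C\<^sub>0_def)
  have D1: "0 < L / \<eta>" using \<eta> L by simp
  show thesis
  proof (rule that[of "C\<^sub>0 + 1" "L / \<eta>"])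
    show "0 < C\<^sub>0 + 1" using C0 by simp
    show "0 < L / \<eta>" by (rule D1)
    fix n Q P w
    assume ap: "type_II_approximant m (nikishin \<sigma> 0) n Q P" and n: "length n = m + 1" and nk: "1 \<le> n ! k" and w: "w \<in> W"
    let ?s = "deficiency m n k" and ?N = "sum_list n"
    let ?err = "\<lambda>p. sphere_ext (cauchy_transform (nikishin \<sigma> 0 k)) p - sphere_ext (\<lambda>z. poly (P k) z / poly Q z) p"
    obtain q X where q: "q \<noteq> 0" and X: "finite X" "X \<subseteq> ?I" "card X = ?N" "type_II_orthogonal n (roots_poly X)"
      and QX: "Q = smult q (map_poly of_real (roots_poly X))"
      and E: "\<And>k z. k \<le> m \<Longrightarrow> z \<notin> ?T \<Longrightarrow> poly Q z * cauchy_transform (nikishin \<sigma> 0 k) z - poly (P k) z = q * ct (\<mu> 0) (\<lambda>x. poly (roots_poly X) x * \<rho> 0 k x) z"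
      and EO: "\<And>k. k \<le> m \<Longrightarrow> ct (\<mu> 0) (\<lambda>x. poly (roots_poly X) x * \<rho> 0 k x) \<in> O[at_infinity](\<lambda>z::complex. 1 / z ^ (n ! k + 1))"
    proof (rule type_II_structure[OF ap n], goal_cases)
      case (1 q X)
      show ?case by (rule 1(1)[OF 1(2-)])
    qed
    note E = E[OF k] and EO = EO[OF k]
    let ?f = "\<lambda>x. poly (roots_poly X) x * \<rho> 0 k x" and ?q = "\<lambda>z. poly (map_poly complex_of_real (roots_poly X)) z"
    have fd: "density_on ?I ?f" by (rule \<rho>_poly_density[OF k])
    define G where "G z = ct (\<mu> 0) ?f z / ?q z" for z
    have q0: "?q z \<noteq> 0" if "z \<notin> ?T" for z
      unfolding poly_of_real_roots_poly[OF X(1)] using X(1,2) that by (auto simp: prod_zero_iff)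
    have EG: "cauchy_transform (nikishin \<sigma> 0 k) z - poly (P k) z / poly Q z = G z" if z: "z \<notin> ?T" for z
    proof -
      have Qz: "poly Q z = q * ?q z" by (simp add: QX)
      have "poly Q z \<noteq> 0" unfolding Qz using q q0[OF z] by simp
      then have "cauchy_transform (nikishin \<sigma> 0 k) z - poly (P k) z / poly Q z = (q * ct (\<mu> 0) ?f z) / poly Q z"
        unfolding E[OF z, symmetric] by (simp add: field_simps)
      then show ?thesis unfolding Qz G_def using q by simp
    qed
    have GO: "G \<in> O[at_infinity](\<lambda>z. 1 / z ^ (n ! k + 1 + ?N))"
    proof -
      have "(\<lambda>z. ct (\<mu> 0) ?f z * (1 / ?q z)) \<in> O[at_infinity](\<lambda>z. 1 / z ^ (n ! k + 1) * (1 / z ^ card X))"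
        by (rule landau_o.big.mult[OF EO inverse_roots_poly_bigo[OF X(1)]])
      then show ?thesis unfolding G_def[abs_def] X(3) power_add by simp
    qed
    define F where "F u = G (?J u)" for u
    have Fh: "F holomorphic_on ball 0 1 - {0}"
    proof -
      have "G holomorphic_on - ?T" unfolding G_def[abs_def]
      proof (rule holomorphic_on_divide)
        show "ct (\<mu> 0) ?f holomorphic_on - ?T" by (rule holomorphic_on_ct[OF M fd])
        show "?q holomorphic_on - ?T" by (intro holomorphic_intros)
      qed (use q0 in auto)
      then have "(G \<circ> ?J) holomorphic_on ball 0 1 - {0}"
      proof (rule holomorphic_on_compose_gen[rotated])
        show "?J holomorphic_on ball 0 1 - {0}"
          by (rule holomorphic_on_subset[OF holomorphic_joukowski]) auto
        show "?J ` (ball 0 1 - {0}) \<subseteq> - ?T"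
        proof
          fix z assume "z \<in> ?J ` (ball 0 1 - {0})"
          then obtain v where v: "v \<in> ball 0 1 - {0}" "z = ?J v" by blast
          have "?J v \<notin> ?T" by (rule joukowski_notin[OF ab0]) (use v in auto)
          then show "z \<in> - ?T" using v(2) by simp
        qed
      qed
      then show ?thesis by (simp add: F_def[abs_def] comp_def)
    qed
    have "F \<in> O[at 0](\<lambda>u. 1 / ?J u ^ (n ! k + 1 + ?N))"
      unfolding F_def[abs_def] by (rule landau_o.big.compose[OF GO filterlim_joukowski[OF ab0]])
    moreover have "(\<lambda>u. (1 / ?J u) ^ (n ! k + 1 + ?N)) \<in> O[at 0](\<lambda>u. u ^ (n ! k + 1 + ?N))"
      by (rule landau_o.big_power[OF inverse_joukowski_bigo[OF ab0]])
    ultimately have "F \<in> O[at 0](\<lambda>u. u ^ (n ! k + 1 + ?N))"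
      unfolding power_one_over by (rule landau_o.big_trans)
    then obtain B\<^sub>0 where B0: "\<forall>\<^sub>F u in at 0. cmod (F u) \<le> B\<^sub>0 * cmod (u ^ (n ! k + 1 + ?N))"
      using landau_o.bigE by blast
    then have B0: "\<forall>\<^sub>F u in at 0. cmod (F u) \<le> B\<^sub>0 * cmod u ^ (n ! k + 1 + ?N)" by (simp only: norm_power)
    obtain Z where Z: "finite Z" "Z \<subseteq> (if m = 0 then {} else {a 1..b 1})" "card Z = (\<Sum>j\<in>{0..m} - {k}. min (n ! j) (n ! k - 1))"
      "\<And>z. z \<in> Z \<Longrightarrow> ct (\<mu> 0) ?f z = (0 :: real)"
      using remainder_zeros[OF X(4) k] by blast
    have ZI: "z \<notin> ?I" if "z \<in> Z" for z using that Z(2) disj[of 0] by (cases "m = 0") auto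
    have "\<forall>t\<in>Z. \<exists>u\<in>A. joukowski_sphere (a 0) (b 0) u = Some (of_real t)"
      using Z(2) A1 by (cases "m = 0") auto
    then obtain u where u: "\<And>t. t \<in> Z \<Longrightarrow> u t \<in> A" "\<And>t. t \<in> Z \<Longrightarrow> joukowski_sphere (a 0) (b 0) (u t) = Some (of_real t)" by metis
    have u': "u t \<noteq> 0" "?J (u t) = of_real t" if "t \<in> Z" for t
      using u(2)[OF that] by (auto simp: joukowski_sphere_def split: if_splits)
    have "inj_on u Z" using u'(2) by (metis inj_onI of_real_eq_iff)
    then have cu: "card (u ` Z) = card Z" by (rule card_image)
    have Fu: "F v = 0" if v: "v \<in> u ` Z" for v
    proof -
      obtain t where t: "t \<in> Z" "v = u t" using v by blast
      have "ct (\<mu> 0) ?f (complex_of_real t) = of_real (ct (\<mu> 0) ?f t)"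
        by (rule ct_of_real[OF M fd ZI[OF t(1)]])
      then show ?thesis using Z(4)[OF t(1)] by (simp add: F_def t(2) u'(2)[OF t(1)] G_def)
    qed
    have split_N: "?N = n ! k + card Z + ?s" unfolding Z(3) by (rule deficiency[OF n k])
    have circle: "cmod (F v) \<le> C\<^sub>0 * (L / \<eta>) ^ ?s" if v: "cmod v = r" for v
      unfolding F_def G_def C\<^sub>0_def
    proof (rule approximant_error_bound[OF \<mu>[OF le0] \<rho>_nonvanishing[OF le0 k] X(1,2) Z(1) _ nk])
      show "Z \<inter> ?I = {}" using ZI by blast
      show "card X = n ! k + card Z + ?s" using X(3) split_N by simp
      show "(\<integral>x. poly (roots_poly X) x * poly p x * \<rho> 0 k x \<partial>\<mu> 0) = 0" if "below p (n ! k)" for p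
        using X(4) k that by (simp add: type_II_orthogonal_def)
      show "\<eta> \<le> cmod (?J v - of_real x)" if "x \<in> ?I" for x
        using \<eta>(2)[of "?J v" "of_real x"] that v by (simp add: dist_norm)
    qed (use Z(4) B(2) \<eta>(1) L in auto)
    \<comment> \<open>The zeros number |n| + n_k + 1 + |Z| = 2 |n| - s + 1, one more than the
      exponent claimed.\<close>
    have exp_le: "2 * ?N - ?s \<le> n ! k + 1 + ?N + card (u ` Z)" using split_N cu by simp
    have nonneg: "0 \<le> (L / \<eta>) ^ ?s * \<theta> ^ (2 * ?N - ?s)" using D1 \<delta> by simp
    have le: "C\<^sub>0 * (L / \<eta>) ^ ?s * \<theta> ^ (2 * ?N - ?s) \<le> (C\<^sub>0 + 1) * (L / \<eta>) ^ ?s * \<theta> ^ (2 * ?N - ?s)"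
      using nonneg by (simp add: distrib_right)
    show "cmod (?err (joukowski_sphere (a 0) (b 0) w)) \<le> (C\<^sub>0 + 1) * (L / \<eta>) ^ ?s * \<theta> ^ (2 * ?N - ?s)"
    proof (cases "w = 0")
      case False
      have w1: "cmod w < 1" using w W by auto
      have wT: "?J w \<notin> ?T" by (rule joukowski_notin[OF ab0 False w1])
      have err: "?err (joukowski_sphere (a 0) (b 0) w) = F w"
        using False EG[OF wT] by (simp add: joukowski_sphere_def sphere_ext_def F_def)
      have "cmod (?err (joukowski_sphere (a 0) (b 0) w)) \<le> C\<^sub>0 * (L / \<eta>) ^ ?s * \<theta> ^ (n ! k + 1 + ?N + card (u ` Z))"
      proof -
        have uA: "u ` Z \<subseteq> A - {0}" by (rule image_subsetI) (simp add: u(1) u'(1))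
        have wW: "w \<in> W - {0}" using w False by simp
        show ?thesis unfolding err using r(3)[OF Fh B0 finite_imageI[OF Z(1)] uA Fu circle wW] by simp
      qed
      also have "\<dots> \<le> C\<^sub>0 * (L / \<eta>) ^ ?s * \<theta> ^ (2 * ?N - ?s)"
        using exp_le C0 D1 \<delta> by (intro mult_left_mono power_decreasing) auto
      finally show ?thesis using le by linarith
    next
      case True
      \<comment> \<open>At infinity the transform and the fraction both have the limit 0, so the
        extended error vanishes there.\<close>
      have s0: "(cauchy_transform (nikishin \<sigma> 0 k) \<longlongrightarrow> (0::complex)) at_infinity"
      proof -
        have "cauchy_transform (nikishin \<sigma> 0 k) = (ct (\<mu> 0) (\<rho> 0 k) :: complex \<Rightarrow> complex)"
          by (rule ext) (rule cauchy_transform_nikishin[OF le0 k])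
        then show ?thesis using tendsto_ct_at_infinity[OF M \<rho>_density[OF le0 k]] by simp
      qed
      have "((\<lambda>z::complex. 1 / z ^ (n ! k + 1 + ?N)) \<longlongrightarrow> 0) at_infinity"
      proof -
        have "(\<lambda>z::complex. 1 / z ^ (n ! k + 1 + ?N)) = (\<lambda>z. inverse z ^ (n ! k + 1 + ?N))"
          by (rule ext) (simp only: power_inverse divide_inverse mult_1)
        then show ?thesis using tendsto_power[OF tendsto_inverse_0, of "n ! k + 1 + ?N"] by simp
      qed
      then have "(G \<longlongrightarrow> 0) at_infinity" by (rule bigo_tendsto_0[OF GO])
      from tendsto_diff[OF s0 this] have "((\<lambda>z. cauchy_transform (nikishin \<sigma> 0 k) z - G z) \<longlongrightarrow> 0) at_infinity" by simp
      then have "((\<lambda>z. poly (P k) z / poly Q z) \<longlongrightarrow> 0) at_infinity"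
      proof (rule Lim_transform_eventually)
        show "\<forall>\<^sub>F z in at_infinity. cauchy_transform (nikishin \<sigma> 0 k) z - G z = poly (P k) z / poly Q z"
          using eventually_outside_compact[OF compact_of_real_Icc[of "a 0" "b 0"]] by eventually_elim (simp flip: EG)
      qed
      from tendsto_Lim[OF trivial_limit_at_infinity this] tendsto_Lim[OF trivial_limit_at_infinity s0]
      have "?err None = 0" by (simp add: sphere_ext_def)
      moreover have "0 \<le> (C\<^sub>0 + 1) * ((L / \<eta>) ^ ?s * \<theta> ^ (2 * ?N - ?s))" using C0 by (intro mult_nonneg_nonneg[OF _ nonneg]) simp
      ultimately show ?thesis using True by (simp only: joukowski_sphere_def mult.assoc) simp
    qed
  qed
qed
qed

end

section \<open>The rate in terms of conformal representations\<close>

lemma nikishin_generators_system: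
  assumes "nikishin_generators m \<Delta> \<sigma>"
  obtains a b e \<mu> where "nikishin_system m \<sigma> a b e \<mu>" "\<And>j. j \<le> m \<Longrightarrow> \<Delta> j = {a j..b j}"
proof -
  define P where "P j \<mu> e a b \<longleftrightarrow> e \<in> {1, -1::real} \<and> a < b \<and> \<Delta> j = {a..b} \<and> nondegenerate_on {a..b} \<mu> \<and>
    (\<forall>A\<in>sets borel. \<sigma> j A = e * measure \<mu> A)" for j \<mu> and e a b :: real
  have "\<forall>j\<in>{..m}. \<exists>\<mu> e a b. P j \<mu> e a b"
  proof
    fix j assume "j \<in> {..m}"
    then have "\<sigma> j \<in> meas_class (\<Delta> j)" using assms by (simp add: nikishin_generators_def)
    then show "\<exists>\<mu> e a b. P j \<mu> e a b"
    proof (rule meas_class_measure)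
      fix \<mu> e and a b :: real
      assume "e \<in> {1, -1::real}" "a < b" "\<Delta> j = {a..b}" "nondegenerate_on {a..b} \<mu>" "\<And>A. A \<in> sets borel \<Longrightarrow> \<sigma> j A = e * measure \<mu> A"
      then have "P j \<mu> e a b" by (simp add: P_def)
      then show ?thesis by blast
    qed
  qed
  from bchoice[OF this] obtain \<mu> where "\<forall>j\<in>{..m}. \<exists>e a b. P j (\<mu> j) e a b" by blast
  from bchoice[OF this] obtain e where "\<forall>j\<in>{..m}. \<exists>a b. P j (\<mu> j) (e j) a b" by blast
  from bchoice[OF this] obtain a where "\<forall>j\<in>{..m}. \<exists>b. P j (\<mu> j) (e j) (a j) b" by blast
  from bchoice[OF this] obtain b where P: "\<forall>j\<in>{..m}. P j (\<mu> j) (e j) (a j) (b j)" by blast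
  then have P': "\<And>j. j \<le> m \<Longrightarrow> P j (\<mu> j) (e j) (a j) (b j)" by simp
  show thesis
  proof (rule that)
    show \<Delta>: "\<Delta> j = {a j..b j}" if "j \<le> m" for j using P'[OF that] by (simp add: P_def)
    show "nikishin_system m \<sigma> a b e \<mu>"
    proof
      show "{a j..b j} \<inter> {a (Suc j)..b (Suc j)} = {}" if "j < m" for j
        using assms that \<Delta>[of j] \<Delta>[of "Suc j"] unfolding nikishin_generators_def by (metis Suc_leI less_imp_le_nat)
    qed (use P'[unfolded P_def] in blast)+
  qed
qed

text \<open>The maximum \<delta> appears as a greatest element of the set of values, so its
  attainment is part of the claim. It follows from the compactness of the preimages of K and of the
  normalization points in the disc.\<close>

theorem corollary1p1:
  fixes m :: nat
    and \<Delta> :: "nat \<Rightarrow> real set"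
    and \<sigma> :: "nat \<Rightarrow> real set \<Rightarrow> real"
    and \<Lambda> :: "nat \<Rightarrow> nat list"
    and c \<kappa> :: real
    and Q :: "nat list \<Rightarrow> complex poly"
    and P :: "nat list \<Rightarrow> nat \<Rightarrow> complex poly"
  assumes nik: "nikishin_generators m \<Delta> \<sigma>"
    and multi_indices: "\<And>i. length (\<Lambda> i) = m + 1"
    and distinct: "inj \<Lambda>"
    and c: "c > 0" and \<kappa>: "\<kappa> < 1"
    and balanced: "\<And>i j. j \<le> m \<Longrightarrow>
      real (\<Lambda> i ! j) \<ge> real (sum_list (\<Lambda> i)) / real (m + 1) - c * real (sum_list (\<Lambda> i)) powr \<kappa>"
    and approx: "\<And>i. type_II_approximant m (nikishin \<sigma> 0) (\<Lambda> i) (Q (\<Lambda> i)) (P (\<Lambda> i))"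
  shows "\<forall>K. compactin riemann_sphere K \<and> K \<subseteq> UNIV - real_embed (\<Delta> 0) \<longrightarrow>
      (\<forall>k\<le>m. uniform_limit K
         (\<lambda>i. sphere_ext (\<lambda>z. poly (P (\<Lambda> i) k) z / poly (Q (\<Lambda> i)) z))
         (sphere_ext (cauchy_transform (nikishin \<sigma> 0 k))) sequentially) \<and>
      (\<forall>\<phi>. K \<noteq> {} \<and>
         (\<forall>t \<in> norm_points m \<Delta>.
            conformal_representation (UNIV - real_embed (\<Delta> 0)) t (\<phi> t)) \<longrightarrow>
         (\<exists>\<delta>. \<delta> \<in> {cmod (\<phi> t z) | z t. z \<in> K \<and> t \<in> norm_points m \<Delta>} \<and>
            (\<forall>x \<in> {cmod (\<phi> t z) | z t. z \<in> K \<and> t \<in> norm_points m \<Delta>}. x \<le> \<delta>) \<and>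
            \<delta> < 1 \<and>
            (\<forall>k\<le>m. limsup (\<lambda>i. ereal (unif_norm K
                (\<lambda>p. sphere_ext (cauchy_transform (nikishin \<sigma> 0 k)) p
                   - sphere_ext (\<lambda>z. poly (P (\<Lambda> i) k) z / poly (Q (\<Lambda> i)) z) p)
                powr (1 / (2 * real (sum_list (\<Lambda> i)))))) \<le> ereal \<delta>)))"
proof -
  obtain a b e \<mu> where sys: "nikishin_system m \<sigma> a b e \<mu>" and \<Delta>: "\<And>j. j \<le> m \<Longrightarrow> \<Delta> j = {a j..b j}"
    using nikishin_generators_system[OF nik] by blast
  interpret nikishin_system m \<sigma> a b e \<mu> by (rule sys)
  let ?N = "\<lambda>i. sum_list (\<Lambda> i)" and ?J = "joukowski_sphere (a 0) (b 0)" and ?NP = "norm_points m \<Delta>"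
  let ?err = "\<lambda>k i p. sphere_ext (cauchy_transform (nikishin \<sigma> 0 k)) p - sphere_ext (\<lambda>z. poly (P (\<Lambda> i) k) z / poly (Q (\<Lambda> i)) z) p"
  have ab0: "a 0 < b 0" by (rule ab) simp
  have N: "filterlim ?N at_top sequentially" by (rule sum_list_at_top[OF distinct multi_indices])
  have NP: "compactin riemann_sphere ?NP" "?NP \<subseteq> UNIV - real_embed {a 0..b 0}"
  proof -
    have "compactin riemann_sphere (Some ` complex_of_real ` {a 1..b 1})"
      unfolding riemann_sphere_def
      by (rule image_compactin[OF _ continuous_map_Some]) (simp add: compact_of_real_Icc)
    then have "compactin riemann_sphere (real_embed {a 1..b 1})" by (simp add: real_embed_def image_image)
    moreover have "compactin riemann_sphere {None}" by (simp add: compactin_sing riemann_sphere_def)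
    ultimately show "compactin riemann_sphere ?NP"
      using \<Delta>[of 1] by (cases "m = 0") (auto simp: norm_points_def intro!: compactin_Un[of _ "real_embed {a 1..b 1}" "{None}", simplified])
    show "?NP \<subseteq> UNIV - real_embed {a 0..b 0}"
    proof (cases "m = 0")
      case False
      then have "{a 0..b 0} \<inter> {a 1..b 1} = {}" "\<Delta> 1 = {a 1..b 1}" using disj[of 0] \<Delta>[of 1] by auto
      then show ?thesis by (auto simp: norm_points_def real_embed_def)
    qed (auto simp: norm_points_def real_embed_def)
  qed
  obtain A where A: "compact A" "A \<subseteq> ball 0 1" and JA: "?J ` A = ?NP"
    using compact_joukowski_sphere_preimage[OF ab0 NP] by blast
  \<comment> \<open>Infinity is a normalization point. It contributes |w| itself to the maximum,
    since the Moebius function of 0 is the identity.\<close>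
  have A0: "0 \<in> A"
  proof -
    have "None \<in> ?J ` A" unfolding JA by (simp add: norm_points_def)
    then show ?thesis by (auto simp: joukowski_sphere_def split: if_splits)
  qed
  have A1: "\<exists>u\<in>A. ?J u = Some (of_real t)" if "m \<noteq> 0" "t \<in> {a 1..b 1}" for t
  proof -
    have "Some (complex_of_real t) \<in> ?J ` A" unfolding JA using that \<Delta>[of 1] by (auto simp: norm_points_def real_embed_def)
    then show ?thesis by force
  qed
  have key: "\<exists>x. (\<forall>i. 0 < x i) \<and> (\<forall>\<^sub>F i in sequentially. \<forall>p\<in>?J ` W. cmod (?err k i p) \<le> x i) \<and>
      (\<lambda>i. x i powr (1 / (2 * real (?N i)))) \<longlonglongrightarrow> \<theta>"
    if k: "k \<le> m" and W: "W \<subseteq> ball 0 1" and \<delta>: "0 \<le> \<delta>" "\<delta> < \<theta>" "\<theta> < 1"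
      and M: "\<And>w u. w \<in> W \<Longrightarrow> u \<in> A \<Longrightarrow> cmod (Moebius_function 0 u w) \<le> \<delta>" for k W \<delta> \<theta>
  proof -
    \<comment> \<open>The rate estimate takes a positive bound, but \<delta> = 0 may occur, for
      instance if K consists of infinity alone and m = 0.\<close>
    define \<delta>' where "\<delta>' = (\<delta> + \<theta>) / 2"
    have \<delta>': "0 < \<delta>'" "\<delta>' < \<theta>" "\<delta> \<le> \<delta>'" using \<delta> by (auto simp: \<delta>'_def)
    have M': "cmod (Moebius_function 0 u w) \<le> \<delta>'" if "w \<in> W" "u \<in> A" for w u using M[OF that] \<delta>'(3) by linarith
    have w: "cmod w \<le> \<delta>'" if "w \<in> W" for w using M'[OF that A0] by (simp add: Moebius_function_simple)
    show ?thesis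
    proof (rule approximation_rate[OF k W A A1 \<delta>'(1,2) \<delta>(3) w M'])
      fix C D :: real
      assume CD: "0 < C" "0 < D"
        and bound: "\<And>n Q P w. type_II_approximant m (nikishin \<sigma> 0) n Q P \<Longrightarrow> length n = m + 1 \<Longrightarrow> 1 \<le> n ! k \<Longrightarrow> w \<in> W \<Longrightarrow>
          cmod (sphere_ext (cauchy_transform (nikishin \<sigma> 0 k)) (?J w) - sphere_ext (\<lambda>z. poly (P k) z / poly Q z) (?J w))
            \<le> C * D ^ deficiency m n k * \<theta> ^ (2 * sum_list n - deficiency m n k)"
      define s where "s i = deficiency m (\<Lambda> i) k" for i
      define x where "x i = C * D ^ s i * \<theta> ^ (2 * ?N i - s i)" for i
      have as: "(\<lambda>i. real (s i) / real (?N i)) \<longlonglongrightarrow> 0" "\<forall>\<^sub>F i in sequentially. 1 \<le> \<Lambda> i ! k"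
        unfolding s_def by (rule balanced_asymptotics[OF N multi_indices c \<kappa> k balanced]; assumption)+
      have sN: "s i \<le> 2 * ?N i" for i using deficiency[OF multi_indices[of i] k] by (simp add: s_def)
      have \<theta>0: "0 < \<theta>" using \<delta> by linarith
      have "\<forall>\<^sub>F i in sequentially. \<forall>p\<in>?J ` W. cmod (?err k i p) \<le> x i"
        using as(2)
      proof eventually_elim
        case (elim i)
        show ?case
        proof
          fix p assume "p \<in> ?J ` W"
          then obtain w where w: "w \<in> W" "p = ?J w" by blast
          show "cmod (?err k i p) \<le> x i" unfolding w(2) x_def s_def
            by (rule bound[OF approx multi_indices elim w(1)])
        qed
      qed
      moreover have "\<forall>i. 0 < x i" using CD \<theta>0 by (simp add: x_def)
      moreover have "(\<lambda>i. x i powr (1 / (2 * real (?N i)))) \<longlonglongrightarrow> \<theta>"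
        unfolding x_def by (rule rate_limit[OF N as(1) sN CD \<theta>0])
      ultimately show ?thesis by blast
    qed
  qed
  show ?thesis
  proof (intro allI impI)
    fix K assume "compactin riemann_sphere K \<and> K \<subseteq> UNIV - real_embed (\<Delta> 0)"
    then have K: "compactin riemann_sphere K" "K \<subseteq> UNIV - real_embed {a 0..b 0}" using \<Delta>[of 0] by auto
    obtain W where W: "compact W" "W \<subseteq> ball 0 1" and JW: "?J ` W = K"
      using compact_joukowski_sphere_preimage[OF ab0 K] by blast
    show "(\<forall>k\<le>m. uniform_limit K
         (\<lambda>i. sphere_ext (\<lambda>z. poly (P (\<Lambda> i) k) z / poly (Q (\<Lambda> i)) z))
         (sphere_ext (cauchy_transform (nikishin \<sigma> 0 k))) sequentially) \<and>
      (\<forall>\<phi>. K \<noteq> {} \<and>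
         (\<forall>t \<in> norm_points m \<Delta>.
            conformal_representation (UNIV - real_embed (\<Delta> 0)) t (\<phi> t)) \<longrightarrow>
         (\<exists>\<delta>. \<delta> \<in> {cmod (\<phi> t z) | z t. z \<in> K \<and> t \<in> norm_points m \<Delta>} \<and>
            (\<forall>x \<in> {cmod (\<phi> t z) | z t. z \<in> K \<and> t \<in> norm_points m \<Delta>}. x \<le> \<delta>) \<and>
            \<delta> < 1 \<and>
            (\<forall>k\<le>m. limsup (\<lambda>i. ereal (unif_norm K (?err k i) powr (1 / (2 * real (?N i))))) \<le> ereal \<delta>)))"
    proof (cases "K = {}")
      case True
      then show ?thesis by (simp add: uniform_limit_iff)
    next
      case False
      then have WA: "W \<times> A \<noteq> {}" using JW A0 by auto
      let ?M = "\<lambda>q. cmod (Moebius_function 0 (snd q) (fst q))"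
      have "continuous_on (W \<times> A) ?M"
        unfolding Moebius_function_simple
      proof (intro continuous_intros ballI)
        fix q assume "q \<in> W \<times> A"
        then have "cmod (snd q) < 1" "cmod (fst q) \<le> 1" using W(2) A(2) by (auto intro: less_imp_le)
        then show "1 - cnj (snd q) * fst q \<noteq> 0" by (rule disc_denominator_nonzero)
      qed
      from continuous_attains_sup[OF compact_Times[OF W(1) A(1)] WA this]
      obtain q where q: "q \<in> W \<times> A" "\<And>q'. q' \<in> W \<times> A \<Longrightarrow> ?M q' \<le> ?M q" by blast
      define w\<^sub>0 where "w\<^sub>0 = fst q"
      define u\<^sub>0 where "u\<^sub>0 = snd q"
      define \<delta> where "\<delta> = cmod (Moebius_function 0 u\<^sub>0 w\<^sub>0)"
      have wu: "w\<^sub>0 \<in> W" "u\<^sub>0 \<in> A" using q(1) by (auto simp: w\<^sub>0_def u\<^sub>0_def)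
      have le: "cmod (Moebius_function 0 u w) \<le> \<delta>" if "w \<in> W" "u \<in> A" for w u
        using q(2)[of "(w, u)"] that by (simp add: \<delta>_def w\<^sub>0_def u\<^sub>0_def)
      have \<delta>: "0 \<le> \<delta>" "\<delta> < 1"
        unfolding \<delta>_def using wu W(2) A(2) by (auto intro!: Moebius_function_norm_lt_1)
      note key = key[OF _ W(2) \<delta>(1) _ _ le, unfolded JW]
      show ?thesis
      proof (intro conjI allI impI)
        fix k assume k: "k \<le> m"
        \<comment> \<open>Any rate strictly between \<delta> and 1 yields uniform
          convergence.\<close>
        define \<theta> where "\<theta> = (\<delta> + 1) / 2"
        have \<theta>: "0 < \<theta>" "\<delta> < \<theta>" "\<theta> < 1" using \<delta> by (auto simp: \<theta>_def)
        from key[OF k \<theta>(2,3)] obtain x where x: "\<And>i. 0 < x i" "\<forall>\<^sub>F i in sequentially. \<forall>p\<in>K. cmod (?err k i p) \<le> x i"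
          "(\<lambda>i. x i powr (1 / (2 * real (?N i)))) \<longlonglongrightarrow> \<theta>" by blast
        have x0: "x \<longlonglongrightarrow> 0" by (rule tendsto_zero_of_root[OF N x(1,3) \<theta>(1,3)])
        show "uniform_limit K (\<lambda>i. sphere_ext (\<lambda>z. poly (P (\<Lambda> i) k) z / poly (Q (\<Lambda> i)) z))
           (sphere_ext (cauchy_transform (nikishin \<sigma> 0 k))) sequentially"
          unfolding uniform_limit_iff
        proof (intro allI impI)
          fix \<epsilon> :: real assume "0 < \<epsilon>"
          from x(2) order_tendstoD(2)[OF x0 this]
          show "\<forall>\<^sub>F i in sequentially. \<forall>p\<in>K. dist (sphere_ext (\<lambda>z. poly (P (\<Lambda> i) k) z / poly (Q (\<Lambda> i)) z) p)
              (sphere_ext (cauchy_transform (nikishin \<sigma> 0 k)) p) < \<epsilon>"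
            by eventually_elim (force simp: dist_norm norm_minus_commute)
        qed
      next
        fix \<phi> assume \<phi>: "K \<noteq> {} \<and> (\<forall>t \<in> ?NP. conformal_representation (UNIV - real_embed (\<Delta> 0)) t (\<phi> t))"
        have mob: "cmod (\<phi> (?J u) (?J w)) = cmod (Moebius_function 0 u w)" if "w \<in> W" "u \<in> A" for w u
        proof (rule conformal_representation_norm[OF ab0])
          have "?J u \<in> ?NP" using that JA by blast
          then show "conformal_representation (UNIV - real_embed {a 0..b 0}) (?J u) (\<phi> (?J u))" using \<phi> \<Delta>[of 0] by simp
        qed (use that W(2) A(2) in auto)
        let ?S = "{cmod (\<phi> t z) | z t. z \<in> K \<and> t \<in> ?NP}"
        have "\<delta> \<in> ?S" unfolding \<delta>_def mob[OF wu, symmetric] using wu JW JA by blast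
        moreover have "x \<le> \<delta>" if "x \<in> ?S" for x
        proof -
          from that obtain z t where zt: "z \<in> K" "t \<in> ?NP" "x = cmod (\<phi> t z)" by blast
          then obtain w u where "w \<in> W" "u \<in> A" "z = ?J w" "t = ?J u" using JW JA by blast
          then show ?thesis using zt(3) mob le by simp
        qed
        \<comment> \<open>The estimates hold for each \<theta> strictly between \<delta> and 1, with
          constants that depend on \<theta>; the bound \<delta> is obtained as the infimum of these
          rates.\<close>
        moreover have "limsup (\<lambda>i. ereal (unif_norm K (?err k i) powr (1 / (2 * real (?N i))))) \<le> ereal \<delta>" if k: "k \<le> m" for k
        proof (rule dense_ge_bounded[of "ereal \<delta>" "ereal 1"])
          show "ereal \<delta> < ereal 1" using \<delta> by simp
          fix r assume r: "ereal \<delta> < r" "r < ereal 1"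
          then obtain \<theta> where \<theta>: "r = ereal \<theta>" by (cases r) auto
          have \<theta>1: "\<delta> < \<theta>" "\<theta> < 1" using r by (auto simp: \<theta>)
          from key[OF k \<theta>1] obtain x where x: "\<And>i. 0 < x i" "\<forall>\<^sub>F i in sequentially. \<forall>p\<in>K. cmod (?err k i p) \<le> x i"
            "(\<lambda>i. x i powr (1 / (2 * real (?N i)))) \<longlonglongrightarrow> \<theta>" by blast
          have "\<forall>\<^sub>F i in sequentially. ereal (unif_norm K (?err k i) powr (1 / (2 * real (?N i)))) \<le> ereal (x i powr (1 / (2 * real (?N i))))"
            using x(2)
          proof eventually_elim
            case (elim i)
            obtain p where p: "p \<in> K" using False by blast
            have "bdd_above ((\<lambda>p. cmod (?err k i p)) ` K)" by (rule bdd_aboveI2[of _ _ "x i"]) (use elim in blast)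
            from cSUP_upper[OF p this] have "0 \<le> unif_norm K (?err k i)"
              unfolding unif_norm_def by (rule order_trans[OF norm_ge_zero])
            moreover have "unif_norm K (?err k i) \<le> x i"
              unfolding unif_norm_def by (rule cSUP_least[OF False]) (use elim in blast)
            ultimately show ?case by (auto intro!: powr_mono2)
          qed
          then have "limsup (\<lambda>i. ereal (unif_norm K (?err k i) powr (1 / (2 * real (?N i))))) \<le> limsup (\<lambda>i. ereal (x i powr (1 / (2 * real (?N i)))))"
            by (rule Limsup_mono)
          also have "\<dots> = ereal \<theta>" by (rule lim_imp_Limsup) (use x(3) in simp_all)
          finally show "limsup (\<lambda>i. ereal (unif_norm K (?err k i) powr (1 / (2 * real (?N i))))) \<le> r" by (simp only: \<theta>)
        qed
        ultimately show "\<exists>\<delta>. \<delta> \<in> ?S \<and> (\<forall>x \<in> ?S. x \<le> \<delta>) \<and> \<delta> < 1 \<and>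
            (\<forall>k\<le>m. limsup (\<lambda>i. ereal (unif_norm K (?err k i) powr (1 / (2 * real (?N i))))) \<le> ereal \<delta>)"
          using \<delta>(2) by (intro exI[of _ \<delta>] conjI ballI allI impI)
      qed
    qed
  qed
qed

end
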